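(* Let $\Gamma$ be a simple graph such that $(\Gamma,1)$ is an intersection graph, and let $\overline\Gamma$ be its complement graph (same vertex set, complementary edge set). Then for every $k=0,1,\dots,|V(\Gamma)|$, $$r_k^{(\overline\Gamma)}(c)=(-1)^{|V(\Gamma)|-k}\, r_k^{(\Gamma)}(c).$$
   Context: Let $\mathfrak{sl}_2=\mathfrak{sl}_2(\mathbb C)$ with basis $x_1=\tfrac12\begin{pmatrix}0&1\\1&0\end{pmatrix}$, $x_2=\tfrac12\begin{pmatrix}0&-i\\ i&0\end{pmatrix}$, $x_3=\tfrac12\begin{pmatrix}1&0\\0&-1\end{pmatrix}$ (orthonormal for $(a,b)=2\operatorname{tr}(ab)$), and let $c=x_1^2+x_2^2+x_3^2\in U(\mathfrak{sl}_2)$ be the Casimir element. A chord diagram with $n$ chords is an oriented circle with $2n$ distinct points partitioned into $n$ pairs (chords), up to orientation-preserving diffeomorphism; two chords intersect if their endpoints alternate along the circle; the intersection graph has the chords as vertices, adjacent iff they intersect. A graph is an intersection graph if it is the intersection graph of some chord diagram. The $\mathfrak{sl}_2$ weight system $w_{\mathfrak{sl}_2}$: cut the circle at a non-endpoint, list the endpoints $p_1,\dots,p_{2n}$ in order, and set $w_{\mathfrak{sl}_2}(D)=\sum_{\varphi}x_{\varphi(p_1)}\cdots x_{\varphi(p_{2n})}$, where $\varphi$ runs over maps from chords to $\{1,2,3\}$ and $\varphi(p)$ is the value on the chord containing $p$; this is independent of the cut and is a polynomial in $c$. It is known that $w_{\mathfrak{sl}_2}(D)$ depends only on the intersection graph of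 $D$, so $w_{\mathfrak{sl}_2}(\Gamma)\in\mathbb C[c]$ is defined for every intersection graph $\Gamma$. The join $(\Gamma_1,\Gamma_2)$ of two graphs is their disjoint union together with all edges joining a vertex of $\Gamma_1$ to a vertex of $\Gamma_2$; $(\Gamma,n)$ denotes the join of $\Gamma$ with the edgeless graph on $n$ vertices. It is known that if $(\Gamma,1)$ is an intersection graph then $(\Gamma,n)$ is an intersection graph for all $n\ge0$, $(\overline\Gamma,1)$ is also an intersection graph, and there are unique polynomials $r_0^{(\Gamma)}(c),\dots,r_{|V(\Gamma)|}^{(\Gamma)}(c)\in\mathbb C[c]$ such that for all $n\ge 0$ $$w_{\mathfrak{sl}_2}((\Gamma,n))=\sum_{k=0}^{|V(\Gamma)|} r_k^{(\Gamma)}(c)\Big(c-\frac{k(k+1)}{2}\Big)^n .$$ *)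

theory Defs
  imports Complex_Main "HOL-Computational_Algebra.Polynomial" "HOL-Library.FuncSet"
begin

text \<open>Elements of the free associative algebra on generators x_1, x_2, x_3
  (indices 1,2,3) are represented as coefficient functions on words.
  The product is the concatenation (Cauchy) product, which is well defined
  for arbitrary coefficient functions since a word has finitely many splittings.\<close>

type_synonym nc = "nat list \<Rightarrow> complex"

definition ncword :: "nat list \<Rightarrow> nc" where
  "ncword u = (\<lambda>w. if w = u then 1 else 0)"

definition ncmul :: "nc \<Rightarrow> nc \<Rightarrow> nc" where
  "ncmul f g = (\<lambda>w. \<Sum>i\<le>length w. f (take i w) * g (drop i w))"

definition ncpow :: "nc \<Rightarrow> nat \<Rightarrow> nc" where
  "ncpow f n = (ncmul f ^^ n) (ncword [])"

definition eps :: "nat \<Rightarrow> nat \<Rightarrow> nat \<Rightarrow> complex" where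
  "eps a b c =
     (if (a,b,c) \<in> {(1,2,3),(2,3,1),(3,1,2)} then 1
      else if (a,b,c) \<in> {(2,1,3),(3,2,1),(1,3,2)} then -1 else 0)"

text \<open>Commutation relation x_a x_b - x_b x_a - [x_a,x_b], where for the given basis
  x_k = sigma_k / 2 one has [x_a,x_b] = i * eps a b c * x_c.\<close>
definition sl2_rel :: "nat \<Rightarrow> nat \<Rightarrow> nc" where
  "sl2_rel a b = (\<lambda>w. ncword [a,b] w - ncword [b,a] w
                    - (\<Sum>c\<in>{1,2,3}. \<i> * eps a b c * ncword [c] w))"

text \<open>The two-sided ideal generated by the relations; U(sl2) = free algebra / ideal.\<close>
inductive U_ideal :: "nc \<Rightarrow> bool" where
  zero: "U_ideal (\<lambda>_. 0)"
| add: "U_ideal f \<Longrightarrow> U_ideal g \<Longrightarrow> U_ideal (\<lambda>w. f w + g w)"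
| smult: "U_ideal f \<Longrightarrow> U_ideal (\<lambda>w. z * f w)"
| gen: "a \<in> {1,2,3} \<Longrightarrow> b \<in> {1,2,3} \<Longrightarrow>
        U_ideal (ncmul (ncword u) (ncmul (sl2_rel a b) (ncword v)))"

definition casimir :: nc where
  "casimir = (\<lambda>w. \<Sum>a\<in>{1,2,3}. ncword [a,a] w)"

definition poly_casimir :: "complex poly \<Rightarrow> nc" where
  "poly_casimir P = (\<lambda>w. \<Sum>i\<le>degree P. coeff P i * ncpow casimir i w)"

text \<open>A chord diagram with n chords, cut at a non-endpoint: the list of the chords
  (labelled 0..n-1) met at the endpoints p_1,...,p_2n in order; every chord occurs
  exactly twice.\<close>
definition chord_diagram :: "nat \<Rightarrow> nat list \<Rightarrow> bool" where
  "chord_diagram n ds \<longleftrightarrow> length ds = 2 * n \<and> set ds \<subseteq> {0..<n}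
     \<and> (\<forall>a<n. card {i. i < length ds \<and> ds ! i = a} = 2)"

definition chords_intersect :: "nat list \<Rightarrow> nat \<Rightarrow> nat \<Rightarrow> bool" where
  "chords_intersect ds a b \<longleftrightarrow> a \<noteq> b \<and>
     (\<exists>i j k l. i < j \<and> j < k \<and> k < l \<and> l < length ds \<and>
        ((ds!i = a \<and> ds!j = b \<and> ds!k = a \<and> ds!l = b) \<or>
         (ds!i = b \<and> ds!j = a \<and> ds!k = b \<and> ds!l = a)))"

text \<open>The sl2 weight system as an element of the free algebra (to be read modulo U_ideal).\<close>
definition w_sl2_word :: "nat \<Rightarrow> nat list \<Rightarrow> nc" where
  "w_sl2_word n ds = (\<lambda>w. \<Sum>\<phi>\<in>PiE {0..<n} (\<lambda>_. {1,2,3::nat}). ncword (map \<phi> ds) w)"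

definition w_sl2_poly :: "nat \<Rightarrow> nat list \<Rightarrow> complex poly" where
  "w_sl2_poly n ds = (THE P. U_ideal (\<lambda>w. w_sl2_word n ds w - poly_casimir P w))"

definition simple_graph :: "nat \<Rightarrow> (nat \<Rightarrow> nat \<Rightarrow> bool) \<Rightarrow> bool" where
  "simple_graph m E \<longleftrightarrow> (\<forall>u<m. \<forall>v<m. E u v \<longleftrightarrow> E v u) \<and> (\<forall>u<m. \<not> E u u)"

definition graph_iso :: "nat \<Rightarrow> (nat \<Rightarrow> nat \<Rightarrow> bool) \<Rightarrow> (nat \<Rightarrow> nat \<Rightarrow> bool) \<Rightarrow> bool" where
  "graph_iso m E F \<longleftrightarrow> (\<exists>f. bij_betw f {0..<m} {0..<m} \<and>
      (\<forall>u<m. \<forall>v<m. E u v \<longleftrightarrow> F (f u) (f v)))"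

definition is_intersection_graph :: "nat \<Rightarrow> (nat \<Rightarrow> nat \<Rightarrow> bool) \<Rightarrow> bool" where
  "is_intersection_graph m E \<longleftrightarrow>
     (\<exists>ds. chord_diagram m ds \<and> graph_iso m E (chords_intersect ds))"

definition w_sl2_graph :: "nat \<Rightarrow> (nat \<Rightarrow> nat \<Rightarrow> bool) \<Rightarrow> complex poly" where
  "w_sl2_graph m E = w_sl2_poly m
     (SOME ds. chord_diagram m ds \<and> graph_iso m E (chords_intersect ds))"

definition join_indep :: "nat \<Rightarrow> (nat \<Rightarrow> nat \<Rightarrow> bool) \<Rightarrow> nat \<Rightarrow> nat \<Rightarrow> nat \<Rightarrow> bool" where
  "join_indep m E n = (\<lambda>u v. (u < m \<and> v < m \<and> E u v)
        \<or> (u < m \<and> m \<le> v \<and> v < m + n) \<or> (v < m \<and> m \<le> u \<and> u < m + n))"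

definition compl_graph :: "nat \<Rightarrow> (nat \<Rightarrow> nat \<Rightarrow> bool) \<Rightarrow> nat \<Rightarrow> nat \<Rightarrow> bool" where
  "compl_graph m E = (\<lambda>u v. u < m \<and> v < m \<and> u \<noteq> v \<and> \<not> E u v)"

definition r_family :: "nat \<Rightarrow> (nat \<Rightarrow> nat \<Rightarrow> bool) \<Rightarrow> (nat \<Rightarrow> complex poly) \<Rightarrow> bool" where
  "r_family m E r \<longleftrightarrow> (\<forall>k>m. r k = 0) \<and>
     (\<forall>n. w_sl2_graph (m + n) (join_indep m E n)
          = (\<Sum>k\<le>m. r k * [:- (of_nat (k * (k + 1)) / 2), 1:] ^ n))"

definition r_coeff :: "nat \<Rightarrow> (nat \<Rightarrow> nat \<Rightarrow> bool) \<Rightarrow> nat \<Rightarrow> complex poly" where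
  "r_coeff m E = (THE r. r_family m E r)"

end

theory Submission
  imports Defs
begin

text \<open>Write the diagram of \<open>(\<Gamma>, n)\<close> as the word \<open>u A u\<^sup>R B\<close>, where \<open>u\<close> lists the \<open>n\<close> added chords, \<open>u\<^sup>R\<close> is
  its reversal and \<open>A\<close>, \<open>B\<close> are permutations of the chords of \<open>\<Gamma>\<close>; the word \<open>u A\<^sup>R u\<^sup>R B\<close> then represents the
  join with the complement. Each added chord applies \<open>T a = \<Sum>\<^sub>i x\<^sub>i a x\<^sub>i\<close> to the enclosed factor, and \<open>T\<close> has eigenvalues
  \<open>c - k(k+1)/2\<close> on the elements of degree at most \<open>m\<close>. The antipode reverses \<open>A\<close> up to \<open>(-1)^m\<close> and acts on the
  \<open>k\<close>-th eigenspace by \<open>(-1)^k\<close>, which gives the sign \<open>(-1)^(m-k)\<close>.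

  That the weight depends on the intersection graph only is proved via mutation: reversing and exchanging the two arcs
  whose ends are those of a set of chords preserves the weight, because the tangle formed by these
  chords commutes with \<open>T\<close>, so that the antipode can be applied to it. Two words with the same interlacement
  are mutants of each other. By induction this reduces to prime words, those with no cut of at most four edges that has two letters on each side. A prime word
  is determined by its interlacement up to rotation and reversal: local complementation at a chord preserves
  primality, and for at least six chords deleting some chord from one of three local complements is again prime.\<close>

subsection \<open>The enveloping algebra as a quotient type\<close>

text \<open>\<open>w_sl2_graph\<close> picks a diagram by \<open>SOME\<close>,
  \<open>w_sl2_poly\<close> and \<open>r_coeff\<close> pick by \<open>THE\<close>. So the facts
  quoted as known have to be proved too: equal interlacement gives equal weight, a polynomial in the
  Casimir element is determined by its image in the enveloping algebra (tested on lowest weight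
  modules where this element takes every complex value), and the c - k(k+1)/2 are distinct. The
  eigenvalues come from \<open>T u = c u - (1/2) Q u\<close>, where \<open>Q\<close> sums the
  squares of the commutators with the generators: \<open>Q\<close> is the Casimir operator of the
  adjoint action, with value k(k+1) on spin k. Hence whatever commutes with brackets and with c
  commutes with \<open>T\<close>, and sums over chord colourings do. Primality is expressed by cuts
  of the four-valent graph traced by the word, because local complementation only chooses another
  Eulerian circuit of that graph and so leaves every cut unchanged. The induction starts at five
  letters: no prime word has exactly four, and on five letters the four-valent graph is complete,
  which leaves a finite check.\<close>

definition fins :: "nc \<Rightarrow> bool" where
  "fins f \<longleftrightarrow> finite {w. f w \<noteq> 0}"

lemma fins_zero: "fins (\<lambda>_. 0)"
  by (simp add: fins_def)

lemma fins_add: "fins f \<Longrightarrow> fins g \<Longrightarrow> fins (\<lambda>w. f w + g w)"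
  unfolding fins_def by (rule finite_subset[of _ "{w. f w \<noteq> 0} \<union> {w. g w \<noteq> 0}"]) auto

lemma fins_smult: "fins f \<Longrightarrow> fins (\<lambda>w. z * f w)"
  unfolding fins_def by (rule finite_subset[of _ "{w. f w \<noteq> 0}"]) auto

lemma fins_uminus: "fins f \<Longrightarrow> fins (\<lambda>w. - f w)"
  unfolding fins_def by simp

lemma fins_diff: "fins f \<Longrightarrow> fins g \<Longrightarrow> fins (\<lambda>w. f w - g w)"
  using fins_add[of f "\<lambda>w. - g w"] fins_uminus[of g] by simp

lemma fins_ncword: "fins (ncword u)"
  unfolding fins_def ncword_def by (rule finite_subset[of _ "{u}"]) auto

lemma fins_sum: "(\<And>i. i \<in> I \<Longrightarrow> fins (f i)) \<Longrightarrow> fins (\<lambda>w. \<Sum>i\<in>I. f i w)"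
  by (induction I rule: infinite_finite_induct) (auto intro: fins_add fins_zero)

lemma fins_ncmul:
  assumes "fins f" "fins g"
  shows "fins (ncmul f g)"
proof -
  have "{w. ncmul f g w \<noteq> 0} \<subseteq> (\<lambda>(u, v). u @ v) ` ({w. f w \<noteq> 0} \<times> {w. g w \<noteq> 0})"
  proof
    fix w assume "w \<in> {w. ncmul f g w \<noteq> 0}"
    then have "(\<Sum>i\<le>length w. f (take i w) * g (drop i w)) \<noteq> 0"
      by (simp add: ncmul_def)
    then obtain i where "f (take i w) * g (drop i w) \<noteq> 0"
      using sum.not_neutral_contains_not_neutral by blast
    then show "w \<in> (\<lambda>(u, v). u @ v) ` ({w. f w \<noteq> 0} \<times> {w. g w \<noteq> 0})"
      by (intro image_eqI[of _ _ "(take i w, drop i w)"]) auto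
  qed
  moreover have "finite ({w. f w \<noteq> 0} \<times> {w. g w \<noteq> 0})"
    using assms by (simp add: fins_def)
  ultimately show ?thesis
    unfolding fins_def using finite_subset by blast
qed

lemma ncmul_add_left: "ncmul (\<lambda>w. f w + g w) h = (\<lambda>w. ncmul f h w + ncmul g h w)"
  by (simp add: ncmul_def fun_eq_iff algebra_simps sum.distrib)

lemma ncmul_add_right: "ncmul h (\<lambda>w. f w + g w) = (\<lambda>w. ncmul h f w + ncmul h g w)"
  by (simp add: ncmul_def fun_eq_iff algebra_simps sum.distrib)

lemma ncmul_diff_left: "ncmul (\<lambda>w. f w - g w) h = (\<lambda>w. ncmul f h w - ncmul g h w)"
  by (simp add: ncmul_def fun_eq_iff algebra_simps sum_subtractf)

lemma ncmul_diff_right: "ncmul h (\<lambda>w. f w - g w) = (\<lambda>w. ncmul h f w - ncmul h g w)"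
  by (simp add: ncmul_def fun_eq_iff algebra_simps sum_subtractf)

lemma ncmul_smult_left: "ncmul (\<lambda>w. z * f w) h = (\<lambda>w. z * ncmul f h w)"
  by (simp add: ncmul_def fun_eq_iff algebra_simps sum_distrib_left)

lemma ncmul_smult_right: "ncmul h (\<lambda>w. z * f w) = (\<lambda>w. z * ncmul h f w)"
  by (simp add: ncmul_def fun_eq_iff algebra_simps sum_distrib_left)

lemma ncmul_zero_left: "ncmul (\<lambda>_. 0) h = (\<lambda>_. 0)"
  by (simp add: ncmul_def)

lemma ncmul_zero_right: "ncmul h (\<lambda>_. 0) = (\<lambda>_. 0)"
  by (simp add: ncmul_def)

text \<open>Bookkeeping for associativity: both sides run over the ways to cut a word of length
  \<open>n\<close> in three; \<open>j\<close> and \<open>i\<close> are the cut positions,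
  \<open>l\<close> is the length of the middle piece.\<close>

lemma sum_triangle_split:
  fixes F :: "nat \<Rightarrow> nat \<Rightarrow> complex"
  shows "(\<Sum>i\<le>n. \<Sum>j\<le>i. F j i) = (\<Sum>j\<le>n. \<Sum>l\<le>n - j. F j (j + l))"
proof -
  have "(\<Sum>i\<le>n. \<Sum>j\<le>i. F j i) = (\<Sum>(i, j)\<in>(SIGMA i:{..n}. {..i}). F j i)"
    by (simp add: sum.Sigma)
  also have "\<dots> = (\<Sum>(j, l)\<in>(SIGMA j:{..n}. {..n - j}). F j (j + l))"
    by (rule sum.reindex_bij_witness[of _ "\<lambda>(j, l). (j + l, j)" "\<lambda>(i, j). (j, i - j)"]) auto
  also have "\<dots> = (\<Sum>j\<le>n. \<Sum>l\<le>n - j. F j (j + l))"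
    by (simp add: sum.Sigma)
  finally show ?thesis .
qed

lemma ncmul_assoc: "ncmul (ncmul f g) h = ncmul f (ncmul g h)"
proof
  fix w :: "nat list"
  let ?n = "length w"
  define F where "F j i = f (take j w) * g (take (i - j) (drop j w)) * h (drop i w)" for j i
  have 1: "ncmul f g (take i w) * h (drop i w) = (\<Sum>j\<le>i. F j i)" if "i \<le> ?n" for i
  proof -
    have "ncmul f g (take i w) = (\<Sum>j\<le>i. f (take j w) * g (take (i - j) (drop j w)))"
      unfolding ncmul_def using that
      by (simp add: min_absorb2) (rule sum.cong, auto simp: min_def drop_take)
    then show ?thesis by (simp add: F_def sum_distrib_right)
  qed
  have 2: "f (take j w) * ncmul g h (drop j w) = (\<Sum>l\<le>?n - j. F j (j + l))" for j
    unfolding ncmul_def F_def by (simp add: sum_distrib_left mult.assoc add.commute)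
  have "ncmul (ncmul f g) h w = (\<Sum>i\<le>?n. \<Sum>j\<le>i. F j i)"
    unfolding ncmul_def[of "ncmul f g"] by (rule sum.cong) (auto simp: 1)
  also have "\<dots> = (\<Sum>j\<le>?n. \<Sum>l\<le>?n - j. F j (j + l))"
    by (rule sum_triangle_split)
  also have "\<dots> = ncmul f (ncmul g h) w"
    unfolding ncmul_def[of f "ncmul g h"] by (rule sum.cong) (auto simp: 2)
  finally show "ncmul (ncmul f g) h w = ncmul f (ncmul g h) w" .
qed

lemma ncmul_sc_left: "ncmul (\<lambda>w. if w = [] then z else 0) f = (\<lambda>w. z * f w)"
proof
  fix w :: "nat list"
  have "ncmul (\<lambda>w. if w = [] then z else 0) f w
      = (\<Sum>i\<le>length w. if i = 0 then z * f w else 0)"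
    unfolding ncmul_def by (intro sum.cong) auto
  then show "ncmul (\<lambda>w. if w = [] then z else 0) f w = z * f w"
    by simp
qed

lemma ncmul_sc_right: "ncmul f (\<lambda>w. if w = [] then z else 0) = (\<lambda>w. z * f w)"
proof
  fix w :: "nat list"
  have "ncmul f (\<lambda>w. if w = [] then z else 0) w
      = (\<Sum>i\<le>length w. if i = length w then z * f w else 0)"
    unfolding ncmul_def by (intro sum.cong) auto
  then show "ncmul f (\<lambda>w. if w = [] then z else 0) w = z * f w"
    by simp
qed

lemma ncmul_ncword_Nil: "ncmul (ncword []) f = f" "ncmul f (ncword []) = f"
  using ncmul_sc_left[of 1 f] ncmul_sc_right[of f 1] by (simp_all add: ncword_def)

lemma ncmul_ncword_ncword: "ncmul (ncword u) (ncword v) = ncword (u @ v)"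
proof
  fix w :: "nat list"
  have *: "ncword u (take i w) * ncword v (drop i w)
      = (if i = length u then ncword (u @ v) w else 0)" if "i \<le> length w" for i
  proof (cases "take i w = u \<and> drop i w = v")
    case True
    then have "w = u @ v"
      using append_take_drop_id[of i w] by simp
    moreover have "i = length u"
      using True length_take[of i w] that by (simp add: min_def)
    ultimately show ?thesis
      by (simp add: ncword_def)
  next
    case False
    then have "\<not> (i = length u \<and> w = u @ v)"
      by auto
    then show ?thesis
      using False by (auto simp: ncword_def)
  qed
  have "ncmul (ncword u) (ncword v) w = (\<Sum>i\<le>length w. if i = length u then ncword (u @ v) w else 0)"
    unfolding ncmul_def by (rule sum.cong) (simp_all add: *)
  also have "\<dots> = ncword (u @ v) w"
    by (cases "w = u @ v") (simp_all add: ncword_def)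
  finally show "ncmul (ncword u) (ncword v) w = ncword (u @ v) w" .
qed

lemma U_ideal_fins: "U_ideal f \<Longrightarrow> fins f"
proof (induction rule: U_ideal.induct)
  case (gen a b u v)
  have "fins (\<lambda>w. \<i> * eps a b c * ncword [c] w)" for c
    by (rule fins_smult[OF fins_ncword])
  then have "fins (\<lambda>w. \<Sum>c\<in>{1,2,3}. \<i> * eps a b c * ncword [c] w)"
    by (rule fins_sum)
  then have "fins (sl2_rel a b)"
    unfolding sl2_rel_def
    by (intro fins_diff[OF fins_diff] fins_ncword)
  then show ?case
    by (rule fins_ncmul[OF fins_ncword fins_ncmul[OF _ fins_ncword]])
next
  case zero
  show ?case by (rule fins_zero)
next
  case (add f g)
  show ?case by (rule fins_add[OF add.IH])
next
  case (smult f z)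
  show ?case by (rule fins_smult[OF smult.IH])
qed

lemma U_ideal_sum: "(\<And>i. i \<in> I \<Longrightarrow> U_ideal (f i)) \<Longrightarrow> U_ideal (\<lambda>w. \<Sum>i\<in>I. f i w)"
proof (induction I rule: infinite_finite_induct)
  case (insert i I)
  have "U_ideal (\<lambda>w. f i w + (\<Sum>i\<in>I. f i w))"
    by (rule U_ideal.add) (use insert in auto)
  then show ?case
    using insert.hyps by simp
qed (simp_all add: U_ideal.zero)

lemma U_ideal_uminus: "U_ideal f \<Longrightarrow> U_ideal (\<lambda>w. - f w)"
  using U_ideal.smult[of f "-1"] by simp

text \<open>The rule \<open>gen\<close> of \<open>U_ideal\<close> admits only words as outer
  factors. Expanding a finitely supported factor into words is what gives closure under
  multiplication by arbitrary ones.\<close>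

lemma ncmul_word_expand_right:
  assumes "fins g"
  shows "ncmul f g = (\<lambda>x. \<Sum>w\<in>{w. g w \<noteq> 0}. g w * ncmul f (ncword w) x)"
proof
  fix x :: "nat list"
  have fin: "finite {w. g w \<noteq> 0}"
    using assms by (simp add: fins_def)
  have "(\<Sum>w\<in>{w. g w \<noteq> 0}. g w * ncmul f (ncword w) x)
      = (\<Sum>i\<le>length x. \<Sum>w\<in>{w. g w \<noteq> 0}. if w = drop i x then f (take i x) * g w else 0)"
    unfolding ncmul_def ncword_def sum_distrib_left
    by (subst sum.swap) (intro sum.cong refl, auto)
  also have "\<dots> = (\<Sum>i\<le>length x. f (take i x) * g (drop i x))"
    using fin by (intro sum.cong refl) auto
  finally show "ncmul f g x = (\<Sum>w\<in>{w. g w \<noteq> 0}. g w * ncmul f (ncword w) x)"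
    by (simp add: ncmul_def)
qed

lemma ncmul_word_expand_left:
  assumes "fins g"
  shows "ncmul g f = (\<lambda>x. \<Sum>w\<in>{w. g w \<noteq> 0}. g w * ncmul (ncword w) f x)"
proof
  fix x :: "nat list"
  have fin: "finite {w. g w \<noteq> 0}"
    using assms by (simp add: fins_def)
  have "(\<Sum>w\<in>{w. g w \<noteq> 0}. g w * ncmul (ncword w) f x)
      = (\<Sum>i\<le>length x. \<Sum>w\<in>{w. g w \<noteq> 0}. if w = take i x then g w * f (drop i x) else 0)"
    unfolding ncmul_def ncword_def sum_distrib_left
    by (subst sum.swap) (intro sum.cong refl, auto)
  also have "\<dots> = (\<Sum>i\<le>length x. g (take i x) * f (drop i x))"
    using fin by (intro sum.cong refl) auto
  finally show "ncmul g f x = (\<Sum>w\<in>{w. g w \<noteq> 0}. g w * ncmul (ncword w) f x)"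
    by (simp add: ncmul_def)
qed

lemma U_ideal_ncmul_right:
  assumes "U_ideal f" "fins g"
  shows "U_ideal (ncmul f g)"
proof -
  have "U_ideal (ncmul f (ncword w))" for w
    using assms(1)
  proof (induction rule: U_ideal.induct)
    case (gen a b u v)
    then show ?case
      using U_ideal.gen[of a b u "v @ w"] by (simp add: ncmul_assoc ncmul_ncword_ncword)
  next
    case (add f g)
    show ?case
      unfolding ncmul_add_left by (rule U_ideal.add[OF add.IH])
  next
    case (smult f z)
    show ?case
      unfolding ncmul_smult_left by (rule U_ideal.smult[OF smult.IH])
  qed (simp only: ncmul_zero_left U_ideal.zero)
  then have "U_ideal (\<lambda>x. g w * ncmul f (ncword w) x)" for w
    by (rule U_ideal.smult)
  then have "U_ideal (\<lambda>x. \<Sum>w\<in>{w. g w \<noteq> 0}. g w * ncmul f (ncword w) x)"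
    by (rule U_ideal_sum)
  then show ?thesis
    by (subst ncmul_word_expand_right[OF assms(2)])
qed

lemma U_ideal_ncmul_left:
  assumes "U_ideal f" "fins g"
  shows "U_ideal (ncmul g f)"
proof -
  have "U_ideal (ncmul (ncword w) f)" for w
    using assms(1)
  proof (induction rule: U_ideal.induct)
    case (gen a b u v)
    then show ?case
      using U_ideal.gen[of a b "w @ u" v]
      by (simp add: ncmul_assoc[symmetric] ncmul_ncword_ncword)
  next
    case (add f g)
    show ?case
      unfolding ncmul_add_right by (rule U_ideal.add[OF add.IH])
  next
    case (smult f z)
    show ?case
      unfolding ncmul_smult_right by (rule U_ideal.smult[OF smult.IH])
  qed (simp only: ncmul_zero_right U_ideal.zero)
  then have "U_ideal (\<lambda>x. g w * ncmul (ncword w) f x)" for w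
    by (rule U_ideal.smult)
  then have "U_ideal (\<lambda>x. \<Sum>w\<in>{w. g w \<noteq> 0}. g w * ncmul (ncword w) f x)"
    by (rule U_ideal_sum)
  then show ?thesis
    by (subst ncmul_word_expand_left[OF assms(2)])
qed

section \<open>The antipode on the free algebra\<close>

definition ncanti :: "nc \<Rightarrow> nc" where
  "ncanti f = (\<lambda>w. (-1) ^ length w * f (rev w))"

lemma fins_ncanti:
  assumes "fins f"
  shows "fins (ncanti f)"
proof -
  have "{w. ncanti f w \<noteq> 0} \<subseteq> rev ` {w. f w \<noteq> 0}"
    by (auto simp: ncanti_def intro: image_eqI[of _ rev "rev _"])
  then show ?thesis
    using assms unfolding fins_def by (meson finite_imageI finite_subset)
qed

lemma ncanti_ncmul: "ncanti (ncmul f g) = ncmul (ncanti g) (ncanti f)"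
proof
  fix w :: "nat list"
  let ?n = "length w"
  have "ncmul (ncanti g) (ncanti f) w
      = (\<Sum>i\<le>?n. (-1) ^ ?n * (g (rev (take i w)) * f (rev (drop i w))))"
    unfolding ncmul_def ncanti_def
    by (intro sum.cong refl) (auto simp: min_def power_add[symmetric] algebra_simps)
  also have "\<dots> = (\<Sum>i\<le>?n. (-1) ^ ?n * (g (rev (take (?n - i) w)) * f (rev (drop (?n - i) w))))"
    by (rule sum.reindex_bij_witness[of _ "\<lambda>i. ?n - i" "\<lambda>i. ?n - i"]) auto
  also have "\<dots> = ncanti (ncmul f g) w"
    unfolding ncmul_def ncanti_def sum_distrib_left
    by (intro sum.cong refl) (auto simp: rev_take rev_drop)
  finally show "ncanti (ncmul f g) w = ncmul (ncanti g) (ncanti f) w" ..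
qed

lemma ncanti_ncword: "ncanti (ncword u) = (\<lambda>w. (-1) ^ length u * ncword (rev u) w)"
  by (auto simp: ncanti_def ncword_def fun_eq_iff)

text \<open>Reversal swaps the two quadratic terms and keeps their signs, while the linear bracket
  term changes sign; so every relation goes to its negative and the ideal is preserved.\<close>

lemma ncanti_sl2_rel:
  assumes "a \<in> {1,2,3}" "b \<in> {1,2,3}"
  shows "ncanti (sl2_rel a b) = (\<lambda>w. - sl2_rel a b w)"
proof
  fix w :: "nat list"
  consider "length w = 1" | "length w = 2" | "length w \<noteq> 1" "length w \<noteq> 2"
    by blast
  then show "ncanti (sl2_rel a b) w = - sl2_rel a b w"
  proof cases
    case 1
    then obtain x where "w = [x]" by (metis One_nat_def length_0_conv length_Suc_conv)
    then show ?thesis by (simp add: ncanti_def sl2_rel_def ncword_def)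
  next
    case 2
    then obtain x y where "w = [x, y]" 
      by (metis One_nat_def Suc_1 length_0_conv length_Suc_conv)
    then show ?thesis by (auto simp: ncanti_def sl2_rel_def ncword_def)
  next
    case 3
    then have "rev w \<noteq> [a,b]" "rev w \<noteq> [b,a]" "w \<noteq> [a,b]" "w \<noteq> [b,a]"
      "\<And>c. rev w \<noteq> [c]" "\<And>c. w \<noteq> [c]"
      by auto
    then show ?thesis by (simp add: ncanti_def sl2_rel_def ncword_def)
  qed
qed

lemma U_ideal_ncanti: "U_ideal f \<Longrightarrow> U_ideal (ncanti f)"
proof (induction rule: U_ideal.induct)
  case zero
  then show ?case by (simp add: ncanti_def U_ideal.zero)
next
  case (add f g)
  then show ?case
    using U_ideal.add[OF add.IH] by (simp add: ncanti_def algebra_simps)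
next
  case (smult f z)
  then show ?case
    using U_ideal.smult[OF smult.IH, of z] by (simp add: ncanti_def algebra_simps)
next
  case (gen a b u v)
  have "ncanti (ncmul (ncword u) (ncmul (sl2_rel a b) (ncword v)))
      = (\<lambda>w. (- ((-1) ^ length u * (-1) ^ length v))
          * ncmul (ncword (rev v)) (ncmul (sl2_rel a b) (ncword (rev u))) w)"
    using ncmul_smult_right[of "ncword (rev v)" "-1" ] ncmul_smult_left[of "-1" ]
    by (simp add: ncanti_ncmul ncanti_ncword ncanti_sl2_rel[OF gen] ncmul_assoc
        ncmul_smult_left ncmul_smult_right ncmul_smult_left[of "-1", simplified] 
        ncmul_smult_right[of _ "-1", simplified] mult.assoc)
  then show ?case
    using gen by (simp only:) (intro U_ideal.smult U_ideal.gen)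
qed

text \<open>A partial equivalence: \<open>nc\<close> contains all coefficient functions, also those
  of infinite support, whereas the enveloping algebra is a quotient of the finitely supported ones.
  All elements of \<open>U_ideal\<close> have finite support.\<close>

definition Urel :: "nc \<Rightarrow> nc \<Rightarrow> bool" where
  "Urel f g \<longleftrightarrow> fins f \<and> fins g \<and> U_ideal (\<lambda>w. f w - g w)"

lemma part_equivp_Urel: "part_equivp Urel"
proof (rule part_equivpI)
  show "\<exists>x. Urel x x"
    by (rule exI[of _ "\<lambda>_. 0"]) (simp add: Urel_def fins_zero U_ideal.zero)
  show "symp Urel"
    by (rule sympI) (use U_ideal_uminus in \<open>fastforce simp: Urel_def\<close>)
  show "transp Urel"
  proof (rule transpI)
    fix f g h assume "Urel f g" "Urel g h"
    then show "Urel f h"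
      using U_ideal.add[of "\<lambda>w. f w - g w" "\<lambda>w. g w - h w"] by (simp add: Urel_def)
  qed
qed

quotient_type usl2 = nc / partial: Urel
  by (rule part_equivp_Urel)

instantiation usl2 :: "{zero, one, plus, minus, uminus, times}"
begin

lift_definition zero_usl2 :: usl2 is "\<lambda>_. 0"
  by (simp add: Urel_def fins_zero U_ideal.zero)

lift_definition one_usl2 :: usl2 is "ncword []"
  by (simp add: Urel_def fins_ncword U_ideal.zero)

lift_definition plus_usl2 :: "usl2 \<Rightarrow> usl2 \<Rightarrow> usl2" is "\<lambda>f g w. f w + g w"
proof -
  fix f f' g g' assume "Urel f f'" "Urel g g'"
  then show "Urel (\<lambda>w. f w + g w) (\<lambda>w. f' w + g' w)"
    using U_ideal.add[of "\<lambda>w. f w - f' w" "\<lambda>w. g w - g' w"]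
    by (simp add: Urel_def fins_add algebra_simps)
qed

lift_definition minus_usl2 :: "usl2 \<Rightarrow> usl2 \<Rightarrow> usl2" is "\<lambda>f g w. f w - g w"
proof -
  fix f f' g g' assume "Urel f f'" "Urel g g'"
  then show "Urel (\<lambda>w. f w - g w) (\<lambda>w. f' w - g' w)"
    using U_ideal.add[of "\<lambda>w. f w - f' w" "\<lambda>w. - (g w - g' w)"]
      U_ideal_uminus[of "\<lambda>w. g w - g' w"]
    by (simp add: Urel_def fins_diff algebra_simps)
qed

lift_definition uminus_usl2 :: "usl2 \<Rightarrow> usl2" is "\<lambda>f w. - f w"
proof -
  fix f f' assume "Urel f f'"
  then show "Urel (\<lambda>w. - f w) (\<lambda>w. - f' w)"
    using U_ideal_uminus[of "\<lambda>w. f w - f' w"] by (simp add: Urel_def fins_uminus)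
qed

lift_definition times_usl2 :: "usl2 \<Rightarrow> usl2 \<Rightarrow> usl2" is ncmul
proof -
  fix f f' g g' assume *: "Urel f f'" "Urel g g'"
  have "U_ideal (\<lambda>w. ncmul (\<lambda>w. f w - f' w) g w + ncmul f' (\<lambda>w. g w - g' w) w)"
    using * unfolding Urel_def
    by (intro U_ideal.add[OF U_ideal_ncmul_right U_ideal_ncmul_left]) auto
  then show "Urel (ncmul f g) (ncmul f' g')"
    using * by (simp add: Urel_def fins_ncmul ncmul_diff_left ncmul_diff_right)
qed

instance ..

end

instance usl2 :: ring
proof
  fix a b c :: usl2
  show "a + b + c = a + (b + c)" 
    by transfer (simp add: Urel_def fins_add U_ideal.zero add.assoc)
  show "a + b = b + a"
    by transfer (simp add: Urel_def fins_add U_ideal.zero add.commute)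
  show "0 + a = a"
    by transfer (simp add: Urel_def)
  show "- a + a = 0"
    by transfer (simp add: Urel_def fins_zero U_ideal.zero)
  show "a - b = a + - b"
    by transfer (simp add: Urel_def fins_diff U_ideal.zero)
  show "a * b * c = a * (b * c)"
    by transfer (simp add: Urel_def fins_ncmul U_ideal.zero ncmul_assoc)
  show "(a + b) * c = a * c + b * c"
    by transfer (simp add: Urel_def fins_ncmul fins_add U_ideal.zero ncmul_add_left)
  show "a * (b + c) = a * b + a * c"
    by transfer (simp add: Urel_def fins_ncmul fins_add U_ideal.zero ncmul_add_right)
qed

instance usl2 :: monoid_mult
proof
  fix a :: usl2
  show "1 * a = a" "a * 1 = a"
    by (transfer, simp add: Urel_def ncmul_ncword_Nil)+
qed

lift_definition sc :: "complex \<Rightarrow> usl2" is "\<lambda>z w. if w = [] then z else 0"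
  by (auto simp: Urel_def fins_def U_ideal.zero)

lift_definition xg :: "nat \<Rightarrow> usl2" is "\<lambda>a. ncword [a]"
  by (simp add: Urel_def fins_ncword U_ideal.zero)

lift_definition antip :: "usl2 \<Rightarrow> usl2" is ncanti
proof -
  fix f g assume *: "Urel f g"
  then have "U_ideal (ncanti (\<lambda>w. f w - g w))"
    by (simp add: Urel_def U_ideal_ncanti)
  then have "U_ideal (\<lambda>w. ncanti f w - ncanti g w)"
    by (simp add: ncanti_def algebra_simps)
  then show "Urel (ncanti f) (ncanti g)"
    using * by (simp add: Urel_def fins_ncanti)
qed

lemma Urel_refl: "fins f \<Longrightarrow> Urel f f"
  by (simp add: Urel_def U_ideal.zero)

lemma fins_sc: "fins (\<lambda>w. if w = [] then z else 0)"
  by (auto simp: fins_def)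

lemma sc_add: "sc (a + b) = sc a + sc b"
proof (transfer)
  fix a b :: complex
  have "(\<lambda>w. if w = [] then a + b else 0) = (\<lambda>w::nat list. (if w = [] then a else 0) + (if w = [] then b else 0))"
    by auto
  then show "Urel (\<lambda>w. if w = [] then a + b else 0)
      (\<lambda>w. (if w = [] then a else 0) + (if w = [] then b else 0))"
    using Urel_refl[OF fins_sc] by metis
qed

lemma sc_mult: "sc (a * b) = sc a * sc b"
proof (transfer)
  fix a b :: complex
  have "(\<lambda>w. if w = [] then a * b else 0) = ncmul (\<lambda>w. if w = [] then a else 0) (\<lambda>w. if w = [] then b else 0)"
    unfolding ncmul_sc_left by auto
  then show "Urel (\<lambda>w. if w = [] then a * b else 0)
      (ncmul (\<lambda>w. if w = [] then a else 0) (\<lambda>w. if w = [] then b else 0))"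
    using Urel_refl[OF fins_sc] by metis
qed

lemma sc_comm: "u * sc z = sc z * u"
  by transfer (simp add: ncmul_sc_left ncmul_sc_right Urel_def fins_smult U_ideal.zero)

lemma sc_0 [simp]: "sc 0 = 0"
  by transfer (simp add: Urel_refl fins_zero)

lemma sc_1 [simp]: "sc 1 = 1"
proof transfer
  have "(\<lambda>w. if w = [] then 1 else 0) = ncword []"
    by (simp add: ncword_def)
  then show "Urel (\<lambda>w. if w = [] then 1 else 0) (ncword [])"
    using Urel_refl[OF fins_ncword] by metis
qed

lemma antip_mult: "antip (u * v) = antip v * antip u"
  by transfer (simp add: ncanti_ncmul Urel_def fins_ncmul fins_ncanti U_ideal.zero)

lemma antip_add: "antip (u + v) = antip u + antip v"
proof transfer
  fix u v
  assume "Urel u u" "Urel v v"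
  moreover have "ncanti (\<lambda>w. u w + v w) = (\<lambda>w. ncanti u w + ncanti v w)"
    by (simp add: ncanti_def algebra_simps)
  ultimately show "Urel (ncanti (\<lambda>w. u w + v w)) (\<lambda>w. ncanti u w + ncanti v w)"
    by (simp add: Urel_def fins_ncanti fins_add U_ideal.zero)
qed

lemma antip_sc: "antip (sc z) = sc z"
proof transfer
  fix z :: complex
  have "ncanti (\<lambda>w. if w = [] then z else 0) = (\<lambda>w. if w = [] then z else 0)"
    by (auto simp: ncanti_def)
  then show "Urel (ncanti (\<lambda>w. if w = [] then z else 0)) (\<lambda>w. if w = [] then z else 0)"
    using Urel_refl[OF fins_sc] by metis
qed

lemma antip_X: "antip (xg a) = - xg a"
  by transfer (simp add: ncanti_ncword Urel_refl fins_uminus fins_ncword)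

lemma X_comm:
  assumes "a \<in> {1,2,3}" "b \<in> {1,2,3}"
  shows "xg a * xg b - xg b * xg a = (\<Sum>c\<in>{1,2,3}. sc (\<i> * eps a b c) * xg c)"
proof -
  have "xg a * xg b - xg b * xg a
     - (sc (\<i> * eps a b 1) * xg 1 + sc (\<i> * eps a b 2) * xg 2 + sc (\<i> * eps a b 3) * xg 3) = 0"
    using assms
  proof (transfer fixing: a b)
    assume ab: "a \<in> {1,2,3}" "b \<in> {1,2,3}"
    have "U_ideal (ncmul (ncword []) (ncmul (sl2_rel a b) (ncword [])))"
      by (rule U_ideal.gen[OF ab])
    then have "U_ideal (sl2_rel a b)"
      by (simp add: ncmul_ncword_Nil)
    then show "Urel (\<lambda>w. ncmul (ncword [a]) (ncword [b]) w - ncmul (ncword [b]) (ncword [a]) w -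
          (ncmul (\<lambda>w. if w = [] then \<i> * eps a b 1 else 0) (ncword [1]) w +
           ncmul (\<lambda>w. if w = [] then \<i> * eps a b 2 else 0) (ncword [2]) w +
           ncmul (\<lambda>w. if w = [] then \<i> * eps a b 3 else 0) (ncword [3]) w)) (\<lambda>_. 0)"
      using U_ideal_fins[of "sl2_rel a b"]
      by (simp add: Urel_def fins_zero ncmul_ncword_ncword ncmul_sc_left sl2_rel_def[abs_def] add.assoc)
  qed
  then show ?thesis by (simp add: add.assoc)
qed

subsection \<open>The degree filtration and the averaging operator\<close>

declare One_nat_def [simp del]

definition I3 :: "nat set" where
  "I3 = {1,2,3}"

lemma I3 [simp]: "1 \<in> I3" "2 \<in> I3" "3 \<in> I3"
  by (simp_all add: I3_def)

lemma I3E: "a \<in> I3 \<Longrightarrow> (a = 1 \<Longrightarrow> P) \<Longrightarrow> (a = 2 \<Longrightarrow> P) \<Longrightarrow> (a = 3 \<Longrightarrow> P) \<Longrightarrow> P"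
  by (auto simp: I3_def)

lemma finite_I3 [simp]: "finite I3"
  by (simp add: I3_def)

lemma antip_0 [simp]: "antip 0 = 0"
  using antip_add[of 0 0] by simp

lemma antip_1 [simp]: "antip 1 = 1"
  using antip_sc[of 1] by simp

lemma antip_uminus: "antip (- u) = - antip u"
  using antip_add[of u "- u"] by (simp add: eq_neg_iff_add_eq_0 add.commute)

lemma antip_diff: "antip (u - v) = antip u - antip v"
  using antip_add[of u "- v"] by (simp add: antip_uminus)

lemma antip_sum: "antip (\<Sum>i\<in>I. f i) = (\<Sum>i\<in>I. antip (f i))"
  by (induction I rule: infinite_finite_induct) (simp_all add: antip_add)

lemma sc_uminus: "sc (- a) = - sc a"
  using sc_add[of a "- a"] by (simp add: eq_neg_iff_add_eq_0 add.commute)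

lemma sc_diff: "sc (a - b) = sc a - sc b"
  using sc_add[of a "- b"] by (simp add: sc_uminus)

lemma sc_comm_left: "u * (sc z * v) = sc z * (u * v)"
  by (simp add: mult.assoc[symmetric] sc_comm[of u z])

lemma X_sc_left: "xg a * (sc z * v) = sc z * (xg a * v)"
  by (rule sc_comm_left)

lemma sc_sc_left: "sc a * (sc b * u) = sc (a * b) * u"
  by (simp add: sc_mult mult.assoc)

section \<open>Casimir element, adjoint action and averaging operator\<close>

definition Cas :: usl2 where
  "Cas = (\<Sum>a\<in>I3. xg a * xg a)"

lemma Cas_sc_left: "Cas * (sc a * u) = sc a * (Cas * u)"
  by (rule sc_comm_left)

definition ad :: "nat \<Rightarrow> usl2 \<Rightarrow> usl2" where
  "ad a u = xg a * u - u * xg a"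

definition TT :: "usl2 \<Rightarrow> usl2" where
  "TT u = (\<Sum>a\<in>I3. xg a * u * xg a)"

text \<open>Half of k(k+1), which is the value on spin \<open>k\<close> of the Casimir operator
  \<open>QQ\<close> of the adjoint action; the factor one half is that of
  \<open>TT_QQ\<close>.\<close>

definition kap :: "nat \<Rightarrow> complex" where
  "kap k = of_nat (k * (k + 1)) / 2"

text \<open>The eigenvalue \<open>Cas - kap k\<close> is itself an element of the algebra that
  commutes with the generators, so the linear algebra below is carried out over polynomials in
  \<open>Cas\<close>.\<close>

definition lam :: "nat \<Rightarrow> usl2 \<Rightarrow> usl2" where
  "lam k u = Cas * u - sc (kap k) * u"

definition eig :: "nat \<Rightarrow> usl2 \<Rightarrow> bool" where
  "eig k u \<longleftrightarrow> TT u = lam k u"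

definition prodX :: "nat list \<Rightarrow> usl2" where
  "prodX ws = prod_list (map xg ws)"

lemma prodX_simps [simp]:
  "prodX [] = 1" "prodX (a # ws) = xg a * prodX ws" "prodX (ws @ vs) = prodX ws * prodX vs"
  by (simp_all add: prodX_def)

lemma sum123: "(\<Sum>a\<in>I3. f a) = f 1 + f 2 + f (3::nat)" for f :: "nat \<Rightarrow> 'a::comm_monoid_add"
  by (simp add: I3_def add.assoc)

lemma ad_X: "a \<in> I3 \<Longrightarrow> b \<in> I3 \<Longrightarrow>
    ad a (xg b) = (\<Sum>c\<in>I3. sc (\<i> * eps a b c) * xg c)"
  using X_comm[of a b] by (simp add: ad_def I3_def)

lemma ad_X_table:
  "ad 1 (xg 1) = 0" "ad 2 (xg 2) = 0" "ad 3 (xg 3) = 0"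
  "ad 1 (xg 2) = sc \<i> * xg 3" "ad 2 (xg 3) = sc \<i> * xg 1" "ad 3 (xg 1) = sc \<i> * xg 2"
  "ad 2 (xg 1) = - (sc \<i> * xg 3)" "ad 3 (xg 2) = - (sc \<i> * xg 1)" "ad 1 (xg 3) = - (sc \<i> * xg 2)"
  using ad_X[of 1 1] ad_X[of 1 2] ad_X[of 1 3] ad_X[of 2 1] ad_X[of 2 2] ad_X[of 2 3]
    ad_X[of 3 1] ad_X[of 3 2] ad_X[of 3 3]
  by (simp_all add: eps_def sc_uminus sum123)

lemma ad_linear:
  "ad a 0 = 0" "ad a (u + v) = ad a u + ad a v" "ad a (- u) = - ad a u"
  "ad a (u - v) = ad a u - ad a v" "ad a (sc z * u) = sc z * ad a u"
  by (simp_all add: ad_def algebra_simps sc_comm_left)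

lemma ad_sum: "ad a (\<Sum>i\<in>I. f i) = (\<Sum>i\<in>I. ad a (f i))"
  by (induction I rule: infinite_finite_induct) (simp_all add: ad_linear)

lemma ad_mult: "ad a (u * v) = ad a u * v + u * ad a v"
  by (simp add: ad_def algebra_simps)

lemma ad_one [simp]: "ad a 1 = 0"
  by (simp add: ad_def)

lemma ad_Cas: "a \<in> I3 \<Longrightarrow> ad a Cas = 0"
  unfolding Cas_def sum123 ad_linear ad_mult
  by (elim I3E; simp only: ad_X_table) (simp_all add: X_sc_left mult.assoc)

lemma ad_Cas_mult: "a \<in> I3 \<Longrightarrow> ad a (Cas * u) = Cas * ad a u"
  by (simp add: ad_mult ad_Cas)

lemma X_Cas: "a \<in> I3 \<Longrightarrow> xg a * Cas = Cas * xg a"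
  using ad_Cas[of a] by (simp add: ad_def)

lemma X_Cas_left: "a \<in> I3 \<Longrightarrow> xg a * (Cas * u) = Cas * (xg a * u)"
  by (simp add: mult.assoc[symmetric] X_Cas)

text \<open>Degrees are shifted by one: \<open>Fil n\<close> is spanned by words of length \<^emph>\<open>less\<close> than \<open>n\<close>,
  so that \<open>Fil 0\<close> is the zero module and the recursion for \<open>-1\<close> needs no special case.\<close>
inductive Fil :: "nat \<Rightarrow> usl2 \<Rightarrow> bool" where
  zero: "Fil n 0"
| word: "length ws < n \<Longrightarrow> set ws \<subseteq> I3 \<Longrightarrow> Fil n (prodX ws)"
| add: "Fil n u \<Longrightarrow> Fil n v \<Longrightarrow> Fil n (u + v)"
| scal: "Fil n u \<Longrightarrow> Fil n (sc z * u)"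
| cas: "Fil n u \<Longrightarrow> Fil n (Cas * u)"

lemma Fil_uminus: "Fil n u \<Longrightarrow> Fil n (- u)"
  using Fil.scal[of n u "-1"] by (simp add: sc_uminus)

lemma Fil_diff: "Fil n u \<Longrightarrow> Fil n v \<Longrightarrow> Fil n (u - v)"
  using Fil.add[of n u "- v"] Fil_uminus by simp

lemma Fil_sum: "(\<And>i. i \<in> I \<Longrightarrow> Fil n (f i)) \<Longrightarrow> Fil n (\<Sum>i\<in>I. f i)"
proof (induction I rule: infinite_finite_induct)
  case (insert i I)
  then show ?case by (simp add: Fil.add)
qed (simp_all add: Fil.zero)

lemma Fil_mono: "Fil n u \<Longrightarrow> n \<le> m \<Longrightarrow> Fil m u"
proof (induction rule: Fil.induct)
  case (word ws n)
  then show ?case using Fil.word[of ws m] by simp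
qed (auto intro: Fil.zero Fil.add Fil.scal Fil.cas)

lemma Fil_0: "Fil 0 u \<Longrightarrow> u = 0"
  by (induction "0::nat" u rule: Fil.induct) simp_all

lemma Fil_X_left: "Fil n u \<Longrightarrow> a \<in> I3 \<Longrightarrow> Fil (Suc n) (xg a * u)"
proof (induction rule: Fil.induct)
  case (word ws n)
  then show ?case using Fil.word[of "a # ws" "Suc n"] by simp
next
  case (add n u v)
  then show ?case by (simp add: distrib_left Fil.add)
next
  case (scal n u z)
  then show ?case by (simp add: sc_comm_left Fil.scal)
next
  case (cas n u)
  then show ?case by (simp only: X_Cas_left) (simp add: Fil.cas)
qed (simp add: Fil.zero)

text \<open>A commutator with a generator replaces the letters one at a time by their brackets,
  which are again linear; the length does not grow.\<close>

lemma Fil_ad_word: "set ws \<subseteq> I3 \<Longrightarrow> length ws < n \<Longrightarrow> a \<in> I3 \<Longrightarrow> Fil n (ad a (prodX ws))"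
proof (induction ws arbitrary: n)
  case Nil
  then show ?case by (simp add: Fil.zero)
next
  case (Cons b ws)
  obtain m where n: "n = Suc m"
    using Cons.prems not0_implies_Suc[of n] by auto
  have "Fil n (sc (\<i> * eps a b c) * (xg c * prodX ws))" if "c \<in> I3" for c
    using Cons.prems that n by (intro Fil.scal) (auto intro!: Fil_X_left Fil.word)
  then have "Fil n (\<Sum>c\<in>I3. sc (\<i> * eps a b c) * (xg c * prodX ws))"
    by (rule Fil_sum)
  moreover have "Fil n (xg b * ad a (prodX ws))"
    unfolding n using Cons n by (intro Fil_X_left) auto
  moreover have "ad a (prodX (b # ws)) = (\<Sum>c\<in>I3. sc (\<i> * eps a b c) * (xg c * prodX ws)) + xg b * ad a (prodX ws)"
    using Cons.prems by (simp only: prodX_simps ad_mult ad_X[of a b] set_simps insert_subset sum_distrib_right mult.assoc)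
  ultimately show ?case
    using Fil.add by simp
qed

lemma Fil_ad: "Fil n u \<Longrightarrow> a \<in> I3 \<Longrightarrow> Fil n (ad a u)"
proof (induction rule: Fil.induct)
  case (word ws n)
  then show ?case using Fil_ad_word by blast
next
  case (cas n u)
  then have "Fil n (ad a u)" by blast
  then show ?case using cas.prems by (simp add: ad_Cas_mult Fil.cas)
qed (simp_all add: ad_linear Fil.zero Fil.add Fil.scal)

lemma Fil_X_right:
  assumes "Fil n u" "a \<in> I3"
  shows "Fil (Suc n) (u * xg a)"
proof -
  have "u * xg a = xg a * u - ad a u"
    by (simp add: ad_def)
  then show ?thesis
    using Fil_diff[OF Fil_X_left[OF assms] Fil_mono[OF Fil_ad[OF assms], of "Suc n"]] by simp
qed

lemma Cas_comm: "Fil n u \<Longrightarrow> u * Cas = Cas * u"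
proof (induction rule: Fil.induct)
  case (word ws n)
  then show ?case
  proof (induction ws arbitrary: n)
    case (Cons b ws)
    then have "prodX ws * Cas = Cas * prodX ws" "b \<in> I3"
      by auto
    then show ?case
      using X_Cas_left[of b "prodX ws"] by (simp only: prodX_simps mult.assoc)
  qed simp
next
  case (scal n u z)
  then show ?case by (simp add: mult.assoc sc_comm_left)
qed (simp_all add: algebra_simps)

lemma Fil_mult_word: "set ws \<subseteq> I3 \<Longrightarrow> Fil n u \<Longrightarrow> Fil (n + length ws) (u * prodX ws)"
proof (induction ws arbitrary: u n)
  case (Cons b ws)
  have "Fil (Suc n) (u * xg b)"
    using Cons.prems by (intro Fil_X_right) auto
  then have "Fil (Suc n + length ws) (u * xg b * prodX ws)"
    using Cons.IH Cons.prems by (simp only: set_simps insert_subset)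
  then show ?case
    by (simp add: mult.assoc)
qed simp

lemma Fil_mult: "Fil m v \<Longrightarrow> Fil n u \<Longrightarrow> Fil (n + m) (u * v)"
proof (induction rule: Fil.induct)
  case (zero m)
  then show ?case by (simp add: Fil.zero)
next
  case (word ws m)
  then show ?case
    using Fil_mono[OF Fil_mult_word[OF word(2) word(3)], of "n + m"] by simp
next
  case (add m v w)
  then have "Fil (n + m) (u * v + u * w)"
    by (intro Fil.add)
  then show ?case by (simp add: distrib_left)
next
  case (scal m v z)
  then show ?case by (simp add: sc_comm_left Fil.scal)
next
  case (cas m v)
  then have "Fil (n + m) (Cas * (u * v))"
    by (intro Fil.cas)
  moreover have "u * (Cas * v) = Cas * (u * v)"
    by (simp add: mult.assoc[symmetric] Cas_comm[OF cas.prems])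
  ultimately show ?case by simp
qed

lemma TT_linear:
  "TT 0 = 0" "TT (u + v) = TT u + TT v" "TT (u - v) = TT u - TT v" "TT (- u) = - TT u"
  "TT (sc z * u) = sc z * TT u"
  unfolding TT_def sum123 by (simp_all add: algebra_simps X_sc_left Cas_sc_left sc_sc_left)

lemma TT_sum: "TT (\<Sum>i\<in>I. f i) = (\<Sum>i\<in>I. TT (f i))"
  by (induction I rule: infinite_finite_induct) (simp_all add: TT_linear)

lemma TT_Cas: "TT (Cas * u) = Cas * TT u"
  unfolding TT_def sum123 by (simp add: distrib_left mult.assoc X_Cas_left)

lemma lam_linear:
  "lam k 0 = 0" "lam k (u + v) = lam k u + lam k v" "lam k (u - v) = lam k u - lam k v"
  "lam k (- u) = - lam k u"
  "lam k (sc z * u) = sc z * lam k u" 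
  by (simp_all add: lam_def algebra_simps X_sc_left Cas_sc_left sc_sc_left)

lemma lam_Cas: "lam k (Cas * u) = Cas * lam k u"
  by (simp add: lam_def algebra_simps X_sc_left Cas_sc_left sc_sc_left)

lemma lam_sum: "lam k (\<Sum>i\<in>I. f i) = (\<Sum>i\<in>I. lam k (f i))"
  by (induction I rule: infinite_finite_induct) (simp_all add: lam_linear)

lemma lam_diff: "lam k u - lam m u = sc (kap m - kap k) * u"
  by (simp add: lam_def sc_diff algebra_simps)

lemma kap_eq_iff: "kap k = kap m \<longleftrightarrow> k = m"
proof
  assume "kap k = kap m"
  then have "of_nat (k * (k + 1)) = (of_nat (m * (m + 1)) :: complex)"
    unfolding kap_def by (metis divide_cancel_right zero_neq_numeral)
  then have eq: "k * (k + 1) = m * (m + 1)"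
    using of_nat_eq_iff by blast
  show "k = m"
  proof (cases k m rule: linorder_cases)
    case less
    then have "k * (k + 1) < m * (m + 1)" by (intro mult_strict_mono) auto
    with eq show ?thesis by simp
  next
    case greater
    then have "m * (m + 1) < k * (k + 1)" by (intro mult_strict_mono) auto
    with eq show ?thesis by simp
  qed
qed simp

section \<open>Leading terms of the adjoint Casimir operator\<close>

definition GG :: "nat \<Rightarrow> usl2 \<Rightarrow> usl2" where
  "GG b u = (\<Sum>a\<in>I3. ad a (xg b) * ad a u)"

text \<open>The Casimir operator of the adjoint action. On \<open>xg b * u\<close> the second-order
  Leibniz rule yields \<open>QQ (xg b) * u\<close>, \<open>xg b * QQ u\<close> and twice the cross
  term \<open>GG b u\<close>.\<close>

definition QQ :: "usl2 \<Rightarrow> usl2" where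
  "QQ u = (\<Sum>a\<in>I3. ad a (ad a u))"

lemma sc_ii: "sc \<i> * (sc \<i> * u) = - u"
  by (simp add: sc_sc_left sc_uminus)

text \<open>Contraction of two epsilon symbols over the common index \<open>a\<close>; the factors i
  of the two brackets turn its sign around.\<close>

lemma GG_X:
  assumes "b \<in> I3" "d \<in> I3"
  shows "(\<Sum>a\<in>I3. ad a (xg b) * ad a (xg d)) = xg d * xg b - (if b = d then Cas else 0)"
  using assms unfolding sum123
  by (elim I3E; simp only: ad_X_table)
     (simp_all add: mult.assoc X_sc_left sc_ii Cas_def sum123 algebra_simps)

lemma Fil_comm_prod:
  assumes "Fil n u" "c \<in> I3" "d \<in> I3"
  shows "Fil (Suc n) (ad c (xg d) * u)"
proof -
  have "Fil (Suc n) (\<Sum>e\<in>I3. sc (\<i> * eps c d e) * (xg e * u))"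
    using assms by (intro Fil_sum Fil.scal Fil_X_left)
  then show ?thesis
    by (simp only: ad_X[OF assms(2,3)] sum_distrib_right mult.assoc)
qed

text \<open>By \<open>GG_X\<close> each letter of the word contributes, up to order of factors, one
  copy of \<open>xg b * prodX ws\<close>. The remaining terms are of lower degree: reordering costs
  commutators, and the Casimir term removes two letters because \<open>Cas\<close> counts as degree
  zero in \<open>Fil\<close>.\<close>

lemma GG_word:
  assumes "set ws \<subseteq> I3" "b \<in> I3"
  shows "Fil (Suc (length ws)) (GG b (prodX ws) - sc (of_nat (length ws)) * (xg b * prodX ws))"
  using assms(1)
proof (induction ws)
  case Nil
  then show ?case by (simp add: GG_def Fil.zero)
next
  case (Cons d ws)
  define u l where "u = prodX ws" and "l = length ws"
  have ul: "Fil (Suc l) u" and d: "d \<in> I3" and ws: "set ws \<subseteq> I3"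
    using Cons.prems by (auto simp: u_def l_def intro: Fil.word)
  have IH: "Fil (Suc l) (GG b u - sc (of_nat l) * (xg b * u))"
    using Cons ws by (simp add: u_def l_def)
  have 1: "GG b (xg d * u) = (xg d * xg b - (if b = d then Cas else 0)) * u
      + (xg d * GG b u - (\<Sum>a\<in>I3. ad d (ad a (xg b)) * ad a u))"
  proof -
    have "ad a (xg b) * ad a (xg d * u) = ad a (xg b) * ad a (xg d) * u
        + (xg d * (ad a (xg b) * ad a u) - ad d (ad a (xg b)) * ad a u)" for a
    proof -
      have "P * (Q * u + xg d * R) = P * Q * u + (xg d * (P * R) - (xg d * P - P * xg d) * R)" for P Q R
        by (simp add: algebra_simps)
      then show ?thesis
        by (simp only: ad_mult ad_def[of d "ad a (xg b)"])
    qed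
    then have "GG b (xg d * u) = (\<Sum>a\<in>I3. ad a (xg b) * ad a (xg d) * u
        + (xg d * (ad a (xg b) * ad a u) - ad d (ad a (xg b)) * ad a u))"
      by (simp add: GG_def)
    also have "\<dots> = (\<Sum>a\<in>I3. ad a (xg b) * ad a (xg d)) * u
        + (xg d * GG b u - (\<Sum>a\<in>I3. ad d (ad a (xg b)) * ad a u))"
      by (simp add: sum.distrib sum_subtractf sum_distrib_left sum_distrib_right GG_def)
    finally show ?thesis
      by (simp only: GG_X[OF assms(2) d])
  qed
  have 2: "Fil (Suc (Suc l)) (\<Sum>a\<in>I3. ad d (ad a (xg b)) * ad a u)"
  proof (rule Fil_sum)
    fix a :: nat assume a: "a \<in> I3"
    have "Fil (Suc (Suc l)) (\<Sum>c\<in>I3. sc (\<i> * eps a b c) * (ad d (xg c) * ad a u))"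
      using ul a d by (intro Fil_sum Fil.scal Fil_comm_prod Fil_ad)
    then show "Fil (Suc (Suc l)) (ad d (ad a (xg b)) * ad a u)"
      by (simp only: ad_X[OF a assms(2)] ad_sum ad_linear sum_distrib_right mult.assoc)
  qed
  have 3: "Fil (Suc (Suc l)) ((if b = d then Cas else 0) * u)"
    using Fil_mono[OF ul, of "Suc (Suc l)"] by (auto intro: Fil.zero Fil.cas)
  have 4: "Fil (Suc (Suc l)) (xg d * (GG b u - sc (of_nat l) * (xg b * u)))"
    using IH d by (rule Fil_X_left)
  have 5: "Fil (Suc (Suc l)) (ad b (xg d) * u)"
    using ul assms(2) d by (rule Fil_comm_prod)
  have "GG b (xg d * u) - sc (of_nat (Suc l)) * (xg b * (xg d * u))
     = xg d * (GG b u - sc (of_nat l) * (xg b * u))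
       - (if b = d then Cas else 0) * u - (\<Sum>a\<in>I3. ad d (ad a (xg b)) * ad a u)
       - sc (of_nat (Suc l)) * (ad b (xg d) * u)"
  proof -
    have "(xg d * xg b - K) * u + (xg d * G - S) - (sc z + 1) * (xg b * (xg d * u))
       = xg d * (G - sc z * (xg b * u)) - K * u - S - (sc z + 1) * ((xg b * xg d - xg d * xg b) * u)" for K G S z
      by (simp add: algebra_simps X_sc_left)
    from this[of _ _ _ "of_nat l"] show ?thesis
      unfolding 1 ad_def[of b "xg d"] by (simp add: sc_add add.commute)
  qed
  then show ?case
    using Fil_diff[OF Fil_diff[OF Fil_diff[OF 4 3] 2] Fil.scal[OF 5]]
    by (simp add: u_def l_def)
qed

lemma QQ_X: "b \<in> I3 \<Longrightarrow> QQ (xg b) = sc 2 * xg b"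
  unfolding QQ_def sum123
  by (elim I3E; simp only: ad_X_table ad_linear)
     (simp_all add: sc_ii sc_add[of 1 1, simplified] distrib_right)

text \<open>The eigenvalue on top degree obeys q(l+1) = 2 + 2 l + q(l): the 2 is the value of
  \<open>QQ\<close> on a generator, the 2 l comes from \<open>GG_word\<close>. The solution is
  l(l+1).\<close>

lemma QQ_word:
  assumes "set ws \<subseteq> I3"
  shows "Fil (length ws) (QQ (prodX ws) - sc (2 * kap (length ws)) * prodX ws)"
  using assms
proof (induction ws)
  case Nil
  then show ?case by (simp add: QQ_def ad_linear Fil.zero kap_def)
next
  case (Cons b ws)
  define u l where "u = prodX ws" and "l = length ws"
  have b: "b \<in> I3" and ws: "set ws \<subseteq> I3"
    using Cons.prems by auto
  have 1: "QQ (xg b * u) = QQ (xg b) * u + sc 2 * GG b u + xg b * QQ u"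
    unfolding QQ_def GG_def sum123 ad_mult ad_linear
    by (simp add: algebra_simps sc_add[of 1 1, simplified])
  have 2: "Fil (Suc l) (xg b * (QQ u - sc (2 * kap l) * u))"
    using Cons.IH[OF ws] b unfolding u_def l_def by (rule Fil_X_left)
  have 3: "Fil (Suc l) (GG b u - sc (of_nat l) * (xg b * u))"
    unfolding u_def l_def by (rule GG_word[OF ws b])
  have kap: "2 * kap (Suc l) = 2 + 2 * of_nat l + 2 * kap l"
    by (simp add: kap_def algebra_simps)
  have "QQ (xg b * u) - sc (2 * kap (Suc l)) * (xg b * u)
      = xg b * (QQ u - sc (2 * kap l) * u) + sc 2 * (GG b u - sc (of_nat l) * (xg b * u))"
    unfolding 1 QQ_X[OF b] kap
    by (simp add: sc_add algebra_simps X_sc_left Cas_sc_left sc_sc_left)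
  then show ?case
    using Fil.add[OF 2 Fil.scal[OF 3, of 2]] by (simp add: u_def l_def)
qed

text \<open>Expanding the double commutators gives \<open>Cas * u + u * Cas - 2 TT u\<close>, and
  \<open>Cas\<close> commutes with elements of finite degree. This reduces commutation with
  \<open>TT\<close> to commutation with \<open>ad\<close> and \<open>Cas\<close>.\<close>

lemma TT_QQ:
  assumes "Fil n u"
  shows "TT u = Cas * u - sc (1/2) * QQ u"
proof -
  have "QQ u = Cas * u + u * Cas - (TT u + TT u)"
    unfolding QQ_def TT_def Cas_def ad_def sum123
    by (simp add: algebra_simps)
  then have "QQ u = (Cas * u - TT u) + (Cas * u - TT u)"
    using Cas_comm[OF assms] by simp
  then have "sc (1/2) * QQ u = (sc (1/2) + sc (1/2)) * (Cas * u - TT u)"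
    by (simp only: distrib_left distrib_right)
  also have "\<dots> = Cas * u - TT u"
    by (simp add: sc_add[symmetric])
  finally show ?thesis by simp
qed

text \<open>Triangularity: in top degree \<open>m\<close> the operator acts by the single eigenvalue
  \<open>Cas - kap m\<close>. Shorter words lie in \<open>Fil m\<close> already and are kept there
  by \<open>QQ\<close> and \<open>Cas\<close>.\<close>

lemma TT_lam:
  assumes "Fil n u" "n = Suc m"
  shows "Fil m (TT u - lam m u)"
  using assms
proof (induction rule: Fil.induct)
  case (word ws n)
  show ?case
  proof (cases "length ws = m")
    case True
    have "TT (prodX ws) - lam m (prodX ws) = sc (- (1/2)) * (QQ (prodX ws) - sc (2 * kap m) * prodX ws)"
      by (simp add: TT_QQ[OF Fil.word[OF word.hyps]] lam_def algebra_simps sc_sc_left sc_uminus)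
    then show ?thesis
      using Fil.scal[OF QQ_word[OF word.hyps(2)]] True by simp
  next
    case False
    then have w: "Fil m (prodX ws)"
      using word by (intro Fil.word) auto
    have "Fil m (QQ (prodX ws))"
      unfolding QQ_def using w by (intro Fil_sum Fil_ad)
    then show ?thesis
      using w unfolding TT_QQ[OF w] lam_def by (intro Fil_diff Fil.scal Fil.cas)
  qed
next
  case (add n u v)
  then have "Fil m (TT u - lam m u + (TT v - lam m v))"
    by (intro Fil.add)
  then show ?case by (simp add: TT_linear lam_linear algebra_simps)
next
  case (scal n u z)
  then have "Fil m (sc z * (TT u - lam m u))"
    by (intro Fil.scal)
  then show ?case by (simp add: TT_linear lam_linear algebra_simps)
next
  case (cas n u)
  then have "Fil m (Cas * (TT u - lam m u))"
    by (intro Fil.cas)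
  then show ?case by (simp add: TT_Cas lam_Cas algebra_simps)
qed (simp add: TT_linear lam_linear Fil.zero)

lemma sc_inverse_cancel: "z \<noteq> 0 \<Longrightarrow> sc (1 / z) * (sc z * u) = u"
  by (simp add: sc_sc_left)

text \<open>On a \<open>k\<close>-eigenvector \<open>TT - lam m\<close> is multiplication by the
  nonzero number \<open>kap m - kap k\<close>, and by \<open>TT_lam\<close> it lowers the degree;
  dividing by the number lowers the degree of \<open>u\<close> itself.\<close>

lemma eig_Fil_step:
  assumes "Fil (Suc m) u" "eig k u" "m \<noteq> k"
  shows "Fil m u"
proof -
  have "Fil m (sc (kap m - kap k) * u)"
    using TT_lam[OF assms(1) refl] assms(2) by (simp add: eig_def lam_diff)
  then have "Fil m (sc (1 / (kap m - kap k)) * (sc (kap m - kap k) * u))"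
    by (rule Fil.scal)
  then show ?thesis
    using assms(3) kap_eq_iff[of m k] by (simp add: sc_inverse_cancel)
qed

lemma eig_Fil_zero: "Fil n u \<Longrightarrow> eig k u \<Longrightarrow> n \<le> k \<Longrightarrow> u = 0"
proof (induction n)
  case 0
  then show ?case by (simp add: Fil_0)
next
  case (Suc m)
  then show ?case using eig_Fil_step[of m u k] by simp
qed

lemma eig_Fil: "Fil n u \<Longrightarrow> eig k u \<Longrightarrow> Fil (Suc k) u"
proof (induction n)
  case 0
  then show ?case using Fil_mono by blast
next
  case (Suc m)
  show ?case
  proof (cases "m = k")
    case False
    then show ?thesis using Suc eig_Fil_step[of m u k] by simp
  qed (use Suc in simp)
qed

section \<open>The antipode on the filtration and on eigenvectors\<close>

lemma antip_Cas [simp]: "antip Cas = Cas"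
  unfolding Cas_def antip_sum by (simp add: antip_mult antip_X)

lemma antip_prodX: "antip (prodX ws) = sc ((-1) ^ length ws) * prodX (rev ws)"
  by (induction ws) (simp_all add: antip_mult antip_X sc_uminus mult.assoc)

lemma Fil_prodX_rev:
  assumes "set ws \<subseteq> I3"
  shows "Fil (length ws) (prodX (rev ws) - prodX ws)"
  using assms
proof (induction ws)
  case (Cons b ws)
  then have b: "b \<in> I3" and ws: "set ws \<subseteq> I3" by auto
  have "prodX (rev (b # ws)) - prodX (b # ws) = (prodX (rev ws) - prodX ws) * xg b - ad b (prodX ws)"
    by (simp add: ad_def algebra_simps)
  then show ?case
    using Fil_diff[OF Fil_X_right[OF Cons.IH[OF ws] b] Fil_ad_word[OF ws _ b]] by simp
qed (simp add: Fil.zero)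

lemma antip_Fil:
  assumes "Fil n u"
  shows "Fil n (antip u)"
  using assms
proof (induction rule: Fil.induct)
  case (word ws n)
  then show ?case
    unfolding antip_prodX by (intro Fil.scal Fil.word) auto
next
  case (add n u v)
  then show ?case by (simp add: antip_add Fil.add)
next
  case (scal n u z)
  then show ?case by (simp add: antip_mult antip_sc sc_comm Fil.scal)
next
  case (cas n u)
  then show ?case by (simp add: antip_mult Cas_comm[OF cas.IH] Fil.cas)
qed (simp add: Fil.zero)

lemma antip_Cas_mult: "Fil n u \<Longrightarrow> antip (Cas * u) = Cas * antip u"
  by (simp add: antip_mult Cas_comm[OF antip_Fil])

lemma antip_sc_mult: "antip (sc z * u) = sc z * antip u"
  by (simp add: antip_mult antip_sc sc_comm)

text \<open>Reversing a word changes it only by commutators, that is by lower degree; what remains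
  of the antipode is one sign per letter.\<close>

lemma antip_sign:
  assumes "Fil n u" "n = Suc m"
  shows "Fil m (antip u - sc ((-1) ^ m) * u)"
  using assms
proof (induction rule: Fil.induct)
  case (word ws n)
  show ?case
  proof (cases "length ws = m")
    case True
    have "antip (prodX ws) - sc ((-1) ^ m) * prodX ws = sc ((-1) ^ m) * (prodX (rev ws) - prodX ws)"
      by (simp add: antip_prodX True algebra_simps)
    then show ?thesis
      using Fil.scal[OF Fil_prodX_rev[OF word.hyps(2)]] True by simp
  next
    case False
    then have w: "Fil m (prodX ws)"
      using word by (intro Fil.word) auto
    then show ?thesis
      by (intro Fil_diff Fil.scal antip_Fil)
  qed
next
  case (add n u v)
  then have "Fil m ((antip u - sc ((-1) ^ m) * u) + (antip v - sc ((-1) ^ m) * v))"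
    by (intro Fil.add)
  then show ?case by (simp add: antip_add algebra_simps)
next
  case (scal n u z)
  then have "Fil m (sc z * (antip u - sc ((-1) ^ m) * u))"
    by (intro Fil.scal)
  then show ?case by (simp add: antip_sc_mult algebra_simps X_sc_left Cas_sc_left sc_sc_left)
next
  case (cas n u)
  then have "Fil m (Cas * (antip u - sc ((-1) ^ m) * u))"
    by (intro Fil.cas)
  then show ?case by (simp add: antip_Cas_mult[OF cas.hyps] algebra_simps X_sc_left Cas_sc_left sc_sc_left)
qed (simp add: Fil.zero)

lemma antip_TT: "antip (TT u) = TT (antip u)"
  unfolding TT_def antip_sum by (simp add: antip_mult antip_X mult.assoc)

lemma eig_linear:
  "eig k 0" "eig k u \<Longrightarrow> eig k v \<Longrightarrow> eig k (u + v)" "eig k u \<Longrightarrow> eig k v \<Longrightarrow> eig k (u - v)"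
  "eig k u \<Longrightarrow> eig k (sc z * u)"
  by (simp_all add: eig_def TT_linear lam_linear)

text \<open>The leading-order statement \<open>antip_sign\<close> becomes exact: the antipode
  commutes with \<open>TT\<close>, so the error is again a \<open>k\<close>-eigenvector, but it lies
  in \<open>Fil k\<close>, where \<open>eig_Fil_zero\<close> leaves only zero.\<close>

lemma eig_antip:
  assumes "Fil n u" "eig k u"
  shows "antip u = sc ((-1) ^ k) * u"
proof -
  have 1: "Fil k (antip u - sc ((-1) ^ k) * u)"
    using antip_sign[OF eig_Fil[OF assms] refl] .
  have "antip (TT u) = antip (lam k u)"
    using assms by (simp add: eig_def)
  then have "eig k (antip u)"
    by (simp add: antip_TT eig_def lam_def antip_diff antip_Cas_mult[OF assms(1)] antip_sc_mult)
  then have "eig k (antip u - sc ((-1) ^ k) * u)"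
    using assms(2) by (intro eig_linear)
  then show ?thesis
    using eig_Fil_zero[OF 1] by simp
qed

text \<open>The spectral projections of \<open>TT\<close> on \<open>Fil n\<close>. The element
  \<open>TT u - lam m u\<close> has lower degree, and its \<open>k\<close>-component is that of
  \<open>u\<close> multiplied by \<open>kap m - kap k\<close>. This gives the components for
  \<open>k < m\<close> by recursion; the rest of \<open>u\<close> is the
  \<open>m\<close>-component.\<close>

fun pr :: "nat \<Rightarrow> nat \<Rightarrow> usl2 \<Rightarrow> usl2" where
  "pr 0 k u = 0"
| "pr (Suc m) k u =
    (if k < m then sc (1 / (kap m - kap k)) * pr m k (TT u - lam m u)
     else if k = m then u - (\<Sum>j<m. sc (1 / (kap m - kap j)) * pr m j (TT u - lam m u))
     else 0)"

lemma pr_sum: "Fil n u \<Longrightarrow> (\<Sum>k<n. pr n k u) = u"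
  by (cases n) (simp_all add: Fil_0)

lemma pr_Fil: "Fil n u \<Longrightarrow> Fil n (pr n k u)"
proof (induction n arbitrary: k u)
  case (Suc m)
  have "Fil (Suc m) (pr m j (TT u - lam m u))" for j
    using Suc.IH[OF TT_lam[OF Suc.prems refl]] by (rule Fil_mono) simp
  then show ?case
    using Suc.prems by (auto intro!: Fil.scal Fil_diff Fil_sum Fil.zero)
qed (simp add: Fil.zero)

lemma eig_pr: "Fil n u \<Longrightarrow> eig k (pr n k u)"
proof (induction n arbitrary: k u)
  case (Suc m)
  define w where "w = TT u - lam m u"
  have w: "Fil m w"
    unfolding w_def by (rule TT_lam[OF Suc.prems refl])
  have IH: "eig j (pr m j w)" for j
    using Suc.IH[OF w] .
  have 1: "TT (pr m j w) - lam m (pr m j w) = sc (kap m - kap j) * pr m j w" for j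
    using IH[of j] by (simp add: eig_def lam_diff)
  have "(\<Sum>j<m. sc (1 / (kap m - kap j)) * (sc (kap m - kap j) * pr m j w)) = (\<Sum>j<m. pr m j w)"
    by (intro sum.cong refl) (simp add: sc_inverse_cancel kap_eq_iff)
  also have "\<dots> = w"
    using pr_sum[OF w] .
  finally have 2: "(\<Sum>j<m. sc (1 / (kap m - kap j)) * (TT (pr m j w) - lam m (pr m j w))) = w"
    by (simp add: 1)
  \<comment> \<open>\<open>S\<close> gathers the components below \<open>m\<close>. The operator
    \<open>TT - lam m\<close> takes both \<open>u\<close> and \<open>S\<close> to \<open>w\<close>,
    hence kills \<open>u - S\<close>.\<close>
  define S where "S = (\<Sum>j<m. sc (1 / (kap m - kap j)) * pr m j w)"
  have "TT S - lam m S = w"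
    using 2 by (simp add: S_def TT_sum lam_sum TT_linear lam_linear sum_subtractf right_diff_distrib)
  moreover have "pr (Suc m) m u = u - S"
    by (simp add: S_def w_def)
  moreover have "TT (u - S) - lam m (u - S) = w - (TT S - lam m S)"
    by (simp add: TT_linear lam_linear w_def)
  ultimately have "TT (pr (Suc m) m u) - lam m (pr (Suc m) m u) = 0"
    by simp
  then have "eig m (pr (Suc m) m u)"
    by (simp add: eig_def)
  moreover have "eig k (pr (Suc m) k u)" if "k < m"
    using that IH[of k] by (simp add: eig_linear w_def[symmetric])
  ultimately show ?case
    using eig_linear(1)[of k] by (cases k m rule: linorder_cases) auto
qed (simp add: eig_linear)

lemma pr_additive: "pr n k (u + v) = pr n k u + pr n k v"
proof (induction n arbitrary: k u v)
  case (Suc m)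
  have "TT (u + v) - lam m (u + v) = (TT u - lam m u) + (TT v - lam m v)"
    by (simp add: TT_linear lam_linear algebra_simps)
  then show ?case
    by (simp only: pr.simps Suc.IH distrib_left sum.distrib) (simp add: algebra_simps)
qed simp

lemma pr_sc: "pr n k (sc z * u) = sc z * pr n k u"
proof (induction n arbitrary: k u)
  case (Suc m)
  have 1: "TT (sc z * u) - lam m (sc z * u) = sc z * (TT u - lam m u)"
    by (simp add: TT_linear lam_linear algebra_simps)
  have 2: "sc c * (sc z * v) = sc z * (sc c * v)" for c v
    by (rule sc_comm_left)
  show ?case
    by (simp only: pr.simps 1 Suc.IH) (simp only: 2 sum_distrib_left[symmetric] right_diff_distrib[symmetric] if_distrib[of "\<lambda>v. sc z * v"] mult_zero_right)
qed simp

text \<open>The tensor summing \<open>xg a\<close> with itself is invariant, so the brackets that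
  fall on the two outer factors cancel and only the one on \<open>u\<close> is left.\<close>

lemma ad_TT: "b \<in> I3 \<Longrightarrow> ad b (TT u) = TT (ad b u)"
proof -
  assume b: "b \<in> I3"
  have "(\<Sum>a\<in>I3. ad b (xg a) * u * xg a + xg a * u * ad b (xg a)) = 0"
    using b unfolding sum123
    by (elim I3E; simp only: ad_X_table) (simp_all add: X_sc_left sc_comm_left[of u] mult.assoc)
  moreover have "ad b (TT u) = TT (ad b u) + (\<Sum>a\<in>I3. ad b (xg a) * u * xg a + xg a * u * ad b (xg a))"
    unfolding TT_def sum123 ad_linear ad_mult by (simp add: algebra_simps)
  ultimately show ?thesis by simp
qed

lemma ad_lam: "b \<in> I3 \<Longrightarrow> ad b (lam k u) = lam k (ad b u)"
  by (simp only: lam_def ad_linear ad_Cas_mult)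

lemma ad_pr: "b \<in> I3 \<Longrightarrow> ad b (pr n k u) = pr n k (ad b u)"
proof (induction n arbitrary: k u)
  case (Suc m)
  have "ad b (TT u - lam m u) = TT (ad b u) - lam m (ad b u)"
    using Suc.prems by (simp only: ad_linear ad_TT ad_lam)
  then show ?case
    using Suc.IH[OF Suc.prems] by (simp add: ad_linear ad_sum)
qed (simp add: ad_linear)

lemma TT_pow_eig:
  assumes "eig k u"
  shows "(TT ^^ n) u = (Cas - sc (kap k)) ^ n * u"
proof (induction n)
  case (Suc n)
  have "TT ((Cas - sc (kap k)) ^ n * u) = (Cas - sc (kap k)) ^ n * TT u" for n
  proof (induction n)
    case (Suc n)
    have "TT ((Cas - sc (kap k)) * v) = (Cas - sc (kap k)) * TT v" for v
      by (simp add: left_diff_distrib TT_linear TT_Cas)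
    then show ?case by (simp add: mult.assoc Suc)
  qed simp
  then show ?case
    using assms Suc by (simp add: eig_def lam_def left_diff_distrib[symmetric] power_Suc2 mult.assoc del: power_Suc)
qed simp

text \<open>An invariant of finite degree is an eigenvector of \<open>TT\<close> for \<open>k = 0\<close>, hence lies in
  degree zero.\<close>

lemma eig_0_invariant:
  assumes "Fil n u" "\<And>a. a \<in> I3 \<Longrightarrow> ad a u = 0"
  shows "eig 0 u"
proof -
  have *: "xg a * u * xg a = xg a * xg a * u" if "a \<in> I3" for a
    using assms(2)[OF that] by (metis ad_def eq_iff_diff_eq_0 mult.assoc)
  have "TT u = (\<Sum>a\<in>I3. xg a * xg a * u)"
    unfolding TT_def by (rule sum.cong[OF refl *])
  then show ?thesis
    by (simp add: eig_def lam_def kap_def Cas_def sum_distrib_right distrib_right)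
qed

section \<open>Polynomials in the Casimir element\<close>

definition evC :: "complex poly \<Rightarrow> usl2" where
  "evC P = fold_coeffs (\<lambda>a u. sc a + Cas * u) P 0"

lemma evC_0 [simp]: "evC 0 = 0"
  by (simp add: evC_def)

lemma evC_pCons [simp]: "evC (pCons a P) = sc a + Cas * evC P"
  by (cases "a = 0 \<and> P = 0") (auto simp: evC_def)

lemma evC_add: "evC (P + Q) = evC P + evC Q"
proof (induction P arbitrary: Q)
  case (pCons a P)
  then show ?case by (cases Q) (simp add: sc_add algebra_simps)
qed simp

lemma evC_smult: "evC (smult z P) = sc z * evC P"
  by (induction P) (simp_all add: sc_mult distrib_left Cas_sc_left)

lemma evC_mult: "evC (P * Q) = evC P * evC Q"
  by (induction P) (simp_all add: evC_add evC_smult distrib_right mult.assoc)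

lemma evC_1 [simp]: "evC 1 = 1"
  by (simp add: one_pCons)

lemma evC_power: "evC (P ^ n) = evC P ^ n"
  by (induction n) (simp_all add: evC_mult)

lemma evC_sum: "evC (\<Sum>i\<in>I. f i) = (\<Sum>i\<in>I. evC (f i))"
  by (induction I rule: infinite_finite_induct) (simp_all add: evC_add)

text \<open>\<open>Fil 1\<close> admits only the empty word, but multiplication by scalars and by
  \<open>Cas\<close> costs no degree.\<close>

lemma Fil_1_evC:
  assumes "Fil n u" "n = 1"
  shows "\<exists>P. u = evC P"
  using assms
proof (induction rule: Fil.induct)
  case (zero n)
  then show ?case by (intro exI[of _ 0]) simp
next
  case (word ws n)
  then show ?case by (intro exI[of _ 1]) simp
next
  case (add n u v)
  then show ?case by (metis evC_add)
next
  case (scal n u z)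
  then show ?case by (metis evC_smult)
next
  case (cas n u)
  then obtain P where "u = evC P" by blast
  then show ?case by (intro exI[of _ "pCons 0 P"]) simp
qed

lemma invariant_evC:
  assumes "Fil n u" "\<And>a. a \<in> I3 \<Longrightarrow> ad a u = 0"
  shows "\<exists>P. u = evC P"
  using Fil_1_evC[OF eig_Fil[OF assms(1) eig_0_invariant[OF assms]]] by simp

subsection \<open>Infinitesimal invariance of chord sums\<close>

definition wd :: "('a \<Rightarrow> nat) \<Rightarrow> 'a list \<Rightarrow> usl2" where
  "wd \<phi> ds = prodX (map \<phi> ds)"

lemma wd_simps [simp]:
  "wd \<phi> [] = 1" "wd \<phi> (h # t) = xg (\<phi> h) * wd \<phi> t" "wd \<phi> (xs @ ys) = wd \<phi> xs * wd \<phi> ys"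
  by (simp_all add: wd_def)

lemma wd_cong: "(\<And>l. l \<in> set ds \<Longrightarrow> \<phi> l = \<psi> l) \<Longrightarrow> wd \<phi> ds = wd \<psi> ds"
  by (simp add: wd_def cong: map_cong)

lemma wd_upd [simp]: "l \<notin> set ds \<Longrightarrow> wd (\<phi>(l := x)) ds = wd \<phi> ds"
  by (rule wd_cong) auto

lemma Fil_wd: "\<phi> ` set ds \<subseteq> I3 \<Longrightarrow> Fil (Suc (length ds)) (wd \<phi> ds)"
  unfolding wd_def by (rule Fil.word) auto

text \<open>The part of the commutator with \<open>xg a\<close> that falls on the ends of the chord
  \<open>l\<close>; summed over all chords it is the whole commutator
  (\<open>ad_wd\<close>).\<close>

primrec dlt :: "nat \<Rightarrow> 'a \<Rightarrow> ('a \<Rightarrow> nat) \<Rightarrow> 'a list \<Rightarrow> usl2" where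
  "dlt a l \<phi> [] = 0"
| "dlt a l \<phi> (h # t) = (if h = l then ad a (xg (\<phi> h)) * wd \<phi> t else 0) + xg (\<phi> h) * dlt a l \<phi> t"

lemma dlt_append [simp]: "dlt a l \<phi> (xs @ ys) = dlt a l \<phi> xs * wd \<phi> ys + wd \<phi> xs * dlt a l \<phi> ys"
  by (induction xs) (simp_all add: algebra_simps)

lemma dlt_notin [simp]: "l \<notin> set ds \<Longrightarrow> dlt a l \<phi> ds = 0"
  by (induction ds) auto

lemma ad_wd:
  assumes "finite S" "set ds \<subseteq> S"
  shows "ad a (wd \<phi> ds) = (\<Sum>l\<in>S. dlt a l \<phi> ds)"
  using assms(2)
proof (induction ds)
  case (Cons h t)
  have "(\<Sum>l\<in>S. if h = l then ad a (xg (\<phi> h)) * wd \<phi> t else 0) = ad a (xg (\<phi> h)) * wd \<phi> t"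
    using Cons.prems assms(1) by simp
  then show ?case
    using Cons by (simp add: ad_mult sum.distrib sum_distrib_left)
qed simp

text \<open>Bilinearity over the complex numbers. The two arguments abstract the places in a larger
  expression where two pieces tied together by chords are inserted.\<close>

definition biadd :: "(usl2 \<Rightarrow> usl2 \<Rightarrow> usl2) \<Rightarrow> bool" where
  "biadd H \<longleftrightarrow> (\<forall>u u' v. H (u + u') v = H u v + H u' v) \<and> (\<forall>u v v'. H u (v + v') = H u v + H u v')
     \<and> (\<forall>z u v. H (sc z * u) v = sc z * H u v) \<and> (\<forall>z u v. H u (sc z * v) = sc z * H u v)"

lemma biaddI:
  assumes "\<And>u u' v. H (u + u') v = H u v + H u' v" "\<And>u v v'. H u (v + v') = H u v + H u v'"
    "\<And>z u v. H (sc z * u) v = sc z * H u v" "\<And>z u v. H u (sc z * v) = sc z * H u v"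
  shows "biadd H"
  using assms by (simp add: biadd_def)

lemma biaddD:
  assumes "biadd H"
  shows "H (u + u') v = H u v + H u' v" "H u (v + v') = H u v + H u v'"
    "H (sc z * u) v = sc z * H u v" "H u (sc z * v) = sc z * H u v"
  using assms by (simp_all add: biadd_def)

lemma biadd_0:
  assumes "biadd H"
  shows "H 0 v = 0" "H u 0 = 0"
  using biaddD(1)[OF assms, of 0 0 v] biaddD(2)[OF assms, of u 0 0] by simp_all

lemma biadd_uminus:
  assumes "biadd H"
  shows "H (- u) v = - H u v" "H u (- v) = - H u v"
  using biaddD(3)[OF assms, of "-1" u v] biaddD(4)[OF assms, of u "-1" v] by (simp_all add: sc_uminus)

lemma biadd_sum:
  assumes "biadd H"
  shows "H (\<Sum>i\<in>I. f i) v = (\<Sum>i\<in>I. H (f i) v)" "H u (\<Sum>i\<in>I. f i) = (\<Sum>i\<in>I. H u (f i))"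
  by (induction I rule: infinite_finite_induct) (simp_all add: biadd_0[OF assms] biaddD[OF assms])

text \<open>Antisymmetry of the structure constants: the term with \<open>b\<close> bracketed into
  \<open>c\<close> in the first slot cancels the one with \<open>c\<close> bracketed into
  \<open>b\<close> in the second.\<close>

lemma pair_cancel:
  assumes H: "biadd H" and "a \<in> I3"
  shows "(\<Sum>b\<in>I3. H (ad a (xg b)) (xg b) + H (xg b) (ad a (xg b))) = 0"
  using assms(2) unfolding sum123
  by (elim I3E; simp only: ad_X_table) (simp_all add: biadd_0[OF H] biadd_uminus[OF H] biaddD[OF H])

lemma count_list_split:
  assumes "count_list xs l = Suc n"
  obtains ys zs where "xs = ys @ l # zs" "l \<notin> set ys" "count_list zs l = n"
proof -
  have "l \<in> set xs"
    using assms by (metis count_list_0_iff Zero_not_Suc)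
  then obtain ys zs where "xs = ys @ l # zs" "l \<notin> set ys"
    using split_list_first by metis
  with assms that show thesis by simp
qed

lemma count_list_1E:
  assumes "count_list xs l = 1"
  obtains ys zs where "xs = ys @ l # zs" "l \<notin> set ys" "l \<notin> set zs"
  using assms by (metis One_nat_def count_list_0_iff count_list_split)

lemma count_list_2E:
  assumes "count_list xs l = 2"
  obtains ys zs ws where "xs = ys @ l # zs @ l # ws" "l \<notin> set ys" "l \<notin> set zs" "l \<notin> set ws"
  using assms by (metis One_nat_def Suc_1 count_list_1E count_list_split)

text \<open>A chord has both ends in \<alpha>, one in each word, or both in \<gamma>. In each case,
  with the other colours fixed, the expression is bilinear in the two end letters and
  \<open>pair_cancel\<close> applies.\<close>

lemma label_cancel:
  assumes \<Psi>: "biadd \<Psi>" and a: "a \<in> I3" and cnt: "count_list (\<alpha> @ \<gamma>) l = 2"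
  shows "(\<Sum>x\<in>I3. \<Psi> (dlt a l (\<phi>(l := x)) \<alpha>) (wd (\<phi>(l := x)) \<gamma>)
             + \<Psi> (wd (\<phi>(l := x)) \<alpha>) (dlt a l (\<phi>(l := x)) \<gamma>)) = 0"
proof -
  consider "count_list \<alpha> l = 2" "count_list \<gamma> l = 0" | "count_list \<alpha> l = 1" "count_list \<gamma> l = 1"
    | "count_list \<alpha> l = 0" "count_list \<gamma> l = 2"
    using cnt by (auto, linarith)
  then show ?thesis
  proof cases
    case 1
    then obtain p q r where \<alpha>: "\<alpha> = p @ l # q @ l # r" "l \<notin> set p" "l \<notin> set q" "l \<notin> set r"
      using count_list_2E by metis
    have \<gamma>: "l \<notin> set \<gamma>"
      using 1 by (simp add: count_list_0_iff)
    have "biadd (\<lambda>u v. \<Psi> (wd \<phi> p * (u * (wd \<phi> q * (v * wd \<phi> r)))) (wd \<phi> \<gamma>))"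
      by (rule biaddI) (simp_all add: distrib_left distrib_right mult.assoc biaddD[OF \<Psi>] sc_comm_left)
    from pair_cancel[OF this a] show ?thesis
      using \<alpha> \<gamma> by (simp add: biadd_0[OF \<Psi>] biaddD[OF \<Psi>] algebra_simps)
  next
    case 2
    then obtain p q r s where \<alpha>: "\<alpha> = p @ l # q" "l \<notin> set p" "l \<notin> set q"
      and \<gamma>: "\<gamma> = r @ l # s" "l \<notin> set r" "l \<notin> set s"
      using count_list_1E by metis
    have "biadd (\<lambda>u v. \<Psi> (wd \<phi> p * (u * wd \<phi> q)) (wd \<phi> r * (v * wd \<phi> s)))"
      by (rule biaddI) (simp_all add: distrib_left distrib_right mult.assoc biaddD[OF \<Psi>] sc_comm_left)
    from pair_cancel[OF this a] show ?thesis
      using \<alpha> \<gamma> by (simp add: biadd_0[OF \<Psi>] biaddD[OF \<Psi>] algebra_simps)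
  next
    case 3
    then obtain p q r where \<gamma>: "\<gamma> = p @ l # q @ l # r" "l \<notin> set p" "l \<notin> set q" "l \<notin> set r"
      using count_list_2E by metis
    have \<alpha>: "l \<notin> set \<alpha>"
      using 3 by (simp add: count_list_0_iff)
    have "biadd (\<lambda>u v. \<Psi> (wd \<phi> \<alpha>) (wd \<phi> p * (u * (wd \<phi> q * (v * wd \<phi> r)))))"
      by (rule biaddI) (simp_all add: distrib_left distrib_right mult.assoc biaddD[OF \<Psi>] sc_comm_left)
    from pair_cancel[OF this a] show ?thesis
      using \<alpha> \<gamma> by (simp add: biadd_0[OF \<Psi>] biaddD[OF \<Psi>] algebra_simps)
  qed
qed

lemma sum_PiE_split:
  assumes "finite S" "l \<in> S"
  shows "(\<Sum>\<phi>\<in>PiE S (\<lambda>_. I3). F \<phi>) = (\<Sum>\<phi>\<in>PiE (S - {l}) (\<lambda>_. I3). \<Sum>x\<in>I3. F (\<phi>(l := x)))"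
proof -
  have S: "S = insert l (S - {l})" using assms by auto
  have "(\<Sum>\<phi>\<in>PiE S (\<lambda>_. I3). F \<phi>) = (\<Sum>p\<in>I3 \<times> PiE (S - {l}) (\<lambda>_. I3). F ((snd p)(l := fst p)))"
    by (subst S, subst PiE_insert_eq, subst sum.reindex)
       (auto intro!: sum.cong inj_combinator[of l "S - {l}" "\<lambda>_. I3", unfolded case_prod_beta'] simp: case_prod_beta')
  also have "\<dots> = (\<Sum>\<phi>\<in>PiE (S - {l}) (\<lambda>_. I3). \<Sum>x\<in>I3. F (\<phi>(l := x)))"
    by (subst sum.swap) (simp add: sum.cartesian_product case_prod_beta')
  finally show ?thesis .
qed

lemma sum_PiE_zero:
  assumes "finite S" "l \<in> S" "\<And>\<phi>. \<phi> \<in> PiE (S - {l}) (\<lambda>_. I3) \<Longrightarrow> (\<Sum>x\<in>I3. F (\<phi>(l := x))) = (0::usl2)"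
  shows "(\<Sum>\<phi>\<in>PiE S (\<lambda>_. I3). F \<phi>) = 0"
  unfolding sum_PiE_split[OF assms(1,2)] using assms(3) by (rule sum.neutral[OF ballI])

text \<open>The commutator is a sum over chords, and after exchanging the sums each chord cancels by
  itself. \<Psi> will be a product around a fixed middle factor for tangles, and a product with a
  spectral projection in the join formula.\<close>

lemma bilinear_invariance:
  assumes \<Psi>: "biadd \<Psi>" and a: "a \<in> I3" and S: "finite S" "set (\<alpha> @ \<gamma>) \<subseteq> S"
    and cnt: "\<And>l. l \<in> S \<Longrightarrow> count_list (\<alpha> @ \<gamma>) l = 2"
  shows "(\<Sum>\<phi>\<in>PiE S (\<lambda>_. I3). \<Psi> (ad a (wd \<phi> \<alpha>)) (wd \<phi> \<gamma>) + \<Psi> (wd \<phi> \<alpha>) (ad a (wd \<phi> \<gamma>))) = 0"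
proof -
  have "(\<Sum>\<phi>\<in>PiE S (\<lambda>_. I3). \<Psi> (ad a (wd \<phi> \<alpha>)) (wd \<phi> \<gamma>) + \<Psi> (wd \<phi> \<alpha>) (ad a (wd \<phi> \<gamma>)))
     = (\<Sum>\<phi>\<in>PiE S (\<lambda>_. I3). \<Sum>l\<in>S. \<Psi> (dlt a l \<phi> \<alpha>) (wd \<phi> \<gamma>) + \<Psi> (wd \<phi> \<alpha>) (dlt a l \<phi> \<gamma>))"
    using S by (simp add: ad_wd[of S] biadd_sum[OF \<Psi>] sum.distrib)
  also have "\<dots> = (\<Sum>l\<in>S. \<Sum>\<phi>\<in>PiE S (\<lambda>_. I3). \<Psi> (dlt a l \<phi> \<alpha>) (wd \<phi> \<gamma>) + \<Psi> (wd \<phi> \<alpha>) (dlt a l \<phi> \<gamma>))"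
    by (rule sum.swap)
  also have "\<dots> = 0"
  proof (rule sum.neutral, rule ballI)
    fix l assume l: "l \<in> S"
    show "(\<Sum>\<phi>\<in>PiE S (\<lambda>_. I3). \<Psi> (dlt a l \<phi> \<alpha>) (wd \<phi> \<gamma>) + \<Psi> (wd \<phi> \<alpha>) (dlt a l \<phi> \<gamma>)) = 0"
      by (rule sum_PiE_zero[OF S(1) l]) (rule label_cancel[OF \<Psi> a cnt[OF l]])
  qed
  finally show ?thesis .
qed

section \<open>Weights of double occurrence words\<close>

definition dow :: "'a list \<Rightarrow> bool" where
  "dow w \<longleftrightarrow> (\<forall>x\<in>set w. count_list w x = 2)"

definition W :: "'a list \<Rightarrow> usl2" where
  "W ds = (\<Sum>\<phi>\<in>PiE (set ds) (\<lambda>_. I3). wd \<phi> ds)"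

lemma ad_self [simp]: "ad a (xg a) = 0"
  by (simp add: ad_def)

lemma dlt_self: "dlt (\<phi> b) b \<phi> ds = 0"
  by (induction ds) auto

text \<open>Moving the first letter to the end costs the commutator of its generator with
  \<open>V\<close>. Chords other than \<open>b\<close> cancel by \<open>label_cancel\<close>; the
  chord \<open>b\<close> itself contributes the bracket of a generator with itself.\<close>

lemma W_rotate1:
  assumes "dow (b # V)"
  shows "W (b # V) = W (V @ [b])"
proof -
  define S where "S = set (b # V)"
  have S: "finite S" "set V \<subseteq> S" "b \<in> S" by (auto simp: S_def)
  have cnt: "count_list (V @ []) l = 2" if "l \<in> S" "l \<noteq> b" for l
    using assms that by (auto simp: dow_def S_def split: if_splits)
  have "(\<Sum>\<phi>\<in>PiE S (\<lambda>_. I3). dlt (\<phi> b) l \<phi> V) = 0" if l: "l \<in> S" for l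
  proof (cases "l = b")
    case True
    then show ?thesis by (simp add: dlt_self)
  next
    case False
    have bi: "biadd (\<lambda>u v. u * v)"
      by (rule biaddI) (simp_all add: algebra_simps sc_comm_left)
    show ?thesis
    proof (rule sum_PiE_zero[OF S(1) l])
      fix \<phi> assume "\<phi> \<in> PiE (S - {l}) (\<lambda>_. I3)"
      then have "\<phi> b \<in> I3"
        using False S(3) by auto
      from label_cancel[OF bi this cnt[OF l False], of \<phi>]
      show "(\<Sum>x\<in>I3. dlt ((\<phi>(l := x)) b) l (\<phi>(l := x)) V) = 0"
        using False by simp
    qed
  qed
  then have "0 = (\<Sum>l\<in>S. \<Sum>\<phi>\<in>PiE S (\<lambda>_. I3). dlt (\<phi> b) l \<phi> V)"
    by simp
  also have "\<dots> = (\<Sum>\<phi>\<in>PiE S (\<lambda>_. I3). ad (\<phi> b) (wd \<phi> V))"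
    by (subst sum.swap) (simp add: ad_wd[OF S(1,2)])
  also have "\<dots> = W (b # V) - W (V @ [b])"
    by (simp add: W_def ad_def sum_subtractf S_def)
  finally show ?thesis by simp
qed

lemma W_rotate: "dow (xs @ ys) \<Longrightarrow> W (xs @ ys) = W (ys @ xs)"
proof (induction xs arbitrary: ys)
  case (Cons b xs)
  have "count_list (xs @ ys @ [b]) x = count_list ((b # xs) @ ys) x" for x
    by simp
  moreover have "set (xs @ ys @ [b]) = set ((b # xs) @ ys)"
    by auto
  ultimately have "dow (xs @ ys @ [b])"
    using Cons.prems unfolding dow_def by metis
  then show ?case
    using Cons.IH[of "ys @ [b]"] W_rotate1[of b "xs @ ys"] Cons.prems by simp
qed simp

lemma finite_PiE_I3: "finite S \<Longrightarrow> finite (PiE S (\<lambda>_. I3))"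
  by (rule finite_PiE) auto

lemma Fil_ex_sum:
  assumes "finite I" "\<And>i. i \<in> I \<Longrightarrow> \<exists>n. Fil n (f i)"
  shows "\<exists>n. Fil n (\<Sum>i\<in>I. f i)"
  using assms
proof (induction I rule: finite_induct)
  case (insert i I)
  then obtain m n where "Fil m (f i)" "Fil n (\<Sum>i\<in>I. f i)"
    by (metis insertI1 insertI2)
  then have "Fil (max m n) (f i + (\<Sum>i\<in>I. f i))"
    by (intro Fil.add) (auto intro: Fil_mono)
  then show ?case
    using insert.hyps by auto
qed (auto intro: Fil.zero)

subsection \<open>Invariance under mutation\<close>

lemma antip_antip: "antip (antip u) = u"
proof transfer
  fix f assume "Urel f f"
  moreover have "ncanti (ncanti f) = f"
    by (simp add: ncanti_def power_add[symmetric] mult.assoc[symmetric])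
  ultimately show "Urel (ncanti (ncanti f)) f" by simp
qed

lemma antip_wd: "antip (wd \<phi> ds) = sc ((-1) ^ length ds) * wd \<phi> (rev ds)"
  by (simp add: wd_def antip_prodX rev_map)

lemma length_even_counts:
  assumes "\<And>l. l \<in> set xs \<Longrightarrow> count_list xs l = 2"
  shows "even (length xs)"
proof -
  have "length xs = (\<Sum>l\<in>set xs. count_list xs l)"
    by (simp add: sum_count_set)
  also have "\<dots> = 2 * card (set xs)"
    using assms by simp
  finally show ?thesis by simp
qed

text \<open>The operator of a tangle: the chords of \<open>S\<close> have their ends on the two arcs
  \<alpha> and \<gamma>, and the operator acts on whatever is enclosed between the arcs.\<close>

definition Phi :: "'a set \<Rightarrow> 'a list \<Rightarrow> 'a list \<Rightarrow> usl2 \<Rightarrow> usl2" where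
  "Phi S \<alpha> \<gamma> u = (\<Sum>\<phi>\<in>PiE S (\<lambda>_. I3). wd \<phi> \<alpha> * u * wd \<phi> \<gamma>)"

lemma Phi_linear:
  "Phi S \<alpha> \<gamma> (u + v) = Phi S \<alpha> \<gamma> u + Phi S \<alpha> \<gamma> v"
  "Phi S \<alpha> \<gamma> (u - v) = Phi S \<alpha> \<gamma> u - Phi S \<alpha> \<gamma> v"
  "Phi S \<alpha> \<gamma> 0 = 0"
  "Phi S \<alpha> \<gamma> (sc z * u) = sc z * Phi S \<alpha> \<gamma> u"
  by (simp_all add: Phi_def algebra_simps sum.distrib sum_subtractf sum_distrib_left)
     (simp add: sc_comm_left)

lemma Phi_sum: "Phi S \<alpha> \<gamma> (\<Sum>i\<in>I. f i) = (\<Sum>i\<in>I. Phi S \<alpha> \<gamma> (f i))"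
  by (induction I rule: infinite_finite_induct) (simp_all add: Phi_linear)

lemma ad_Phi:
  assumes a: "a \<in> I3" and S: "finite S" "set (\<alpha> @ \<gamma>) \<subseteq> S"
    and cnt: "\<And>l. l \<in> S \<Longrightarrow> count_list (\<alpha> @ \<gamma>) l = 2"
  shows "ad a (Phi S \<alpha> \<gamma> u) = Phi S \<alpha> \<gamma> (ad a u)"
proof -
  have bi: "biadd (\<lambda>p q. p * u * q)"
    by (rule biaddI) (simp_all add: algebra_simps sc_comm_left)
  show ?thesis
    using bilinear_invariance[OF bi a S cnt]
    by (simp add: Phi_def ad_sum ad_mult algebra_simps sum.distrib)
qed

lemma Phi_Cas:
  assumes "set (\<alpha> @ \<gamma>) \<subseteq> S"
  shows "Phi S \<alpha> \<gamma> (Cas * u) = Cas * Phi S \<alpha> \<gamma> u"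
proof -
  have "wd \<phi> \<alpha> * (Cas * u) = Cas * (wd \<phi> \<alpha> * u)" if "\<phi> \<in> PiE S (\<lambda>_. I3)" for \<phi>
  proof -
    have "\<phi> ` set \<alpha> \<subseteq> I3"
      using that assms by auto
    then have "wd \<phi> \<alpha> * Cas = Cas * wd \<phi> \<alpha>"
      using Cas_comm Fil_wd by blast
    then show ?thesis by (metis mult.assoc)
  qed
  then have "Phi S \<alpha> \<gamma> (Cas * u) = (\<Sum>\<phi>\<in>PiE S (\<lambda>_. I3). Cas * (wd \<phi> \<alpha> * u) * wd \<phi> \<gamma>)"
    unfolding Phi_def by (intro sum.cong) simp_all
  then show ?thesis
    by (simp add: Phi_def sum_distrib_left mult.assoc)
qed

lemma Fil_Phi:
  assumes "finite S" "set (\<alpha> @ \<gamma>) \<subseteq> S" "Fil n u"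
  shows "\<exists>m. Fil m (Phi S \<alpha> \<gamma> u)"
  unfolding Phi_def
proof (rule Fil_ex_sum)
  fix \<phi> assume "\<phi> \<in> PiE S (\<lambda>_. I3)"
  then have "Fil (Suc (length \<alpha>)) (wd \<phi> \<alpha>)" "Fil (Suc (length \<gamma>)) (wd \<phi> \<gamma>)"
    using assms(2) by (intro Fil_wd; force)+
  then show "\<exists>m. Fil m (wd \<phi> \<alpha> * u * wd \<phi> \<gamma>)"
    using Fil_mult assms(3) by blast
qed (simp add: finite_PiE_I3 assms)

text \<open>\<open>Phi\<close> commutes with \<open>ad\<close> and with \<open>Cas\<close>, hence
  with \<open>QQ\<close>, and therefore with \<open>TT\<close> by \<open>TT_QQ\<close>.\<close>

lemma eig_Phi:
  assumes S: "finite S" "set (\<alpha> @ \<gamma>) \<subseteq> S" and cnt: "\<And>l. l \<in> S \<Longrightarrow> count_list (\<alpha> @ \<gamma>) l = 2"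
    and u: "Fil n u" "eig k u"
  shows "eig k (Phi S \<alpha> \<gamma> u)"
proof -
  obtain m where m: "Fil m (Phi S \<alpha> \<gamma> u)"
    using Fil_Phi[OF S u(1)] by blast
  have "QQ (Phi S \<alpha> \<gamma> u) = Phi S \<alpha> \<gamma> (QQ u)"
    unfolding QQ_def Phi_sum by (intro sum.cong refl) (simp add: ad_Phi[OF _ S cnt])
  then have "TT (Phi S \<alpha> \<gamma> u) = Phi S \<alpha> \<gamma> (TT u)"
    unfolding TT_QQ[OF m] TT_QQ[OF u(1)] by (simp add: Phi_linear Phi_Cas[OF S(2)])
  then show ?thesis
    using u(2) by (simp add: eig_def lam_def Phi_linear Phi_Cas[OF S(2)])
qed

text \<open>The antipode acts on the spin \<open>k\<close> part by \<open>(-1)^k\<close>, and a two-legged tangle of chords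
  preserves the spin decomposition; conjugating by the antipode therefore does nothing.\<close>

lemma Phi_rev:
  assumes S: "finite S" "set (\<alpha> @ \<gamma>) \<subseteq> S" and cnt: "\<And>l. l \<in> S \<Longrightarrow> count_list (\<alpha> @ \<gamma>) l = 2"
    and u: "Fil n u"
  shows "Phi S (rev \<gamma>) (rev \<alpha>) u = Phi S \<alpha> \<gamma> u"
proof -
  have eq: "antip (Phi S \<alpha> \<gamma> (antip (pr n k u))) = Phi S \<alpha> \<gamma> (pr n k u)" for k
  proof -
    have f: "Fil n (pr n k u)" and e: "eig k (pr n k u)"
      using pr_Fil[OF u] eig_pr[OF u] by auto
    obtain m where m: "Fil m (Phi S \<alpha> \<gamma> (pr n k u))"
      using Fil_Phi[OF S f] by blast
    show ?thesis
      by (simp add: eig_antip[OF f e] Phi_linear antip_sc_mult eig_antip[OF m eig_Phi[OF S cnt f e]]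
          sc_sc_left power_add[symmetric] mult_2[symmetric])
  qed
  have "antip (Phi S \<alpha> \<gamma> (antip u)) = (\<Sum>k<n. antip (Phi S \<alpha> \<gamma> (antip (pr n k u))))"
    by (subst pr_sum[OF u, symmetric]) (simp add: antip_sum Phi_sum)
  also have "\<dots> = (\<Sum>k<n. Phi S \<alpha> \<gamma> (pr n k u))"
    by (simp add: eq)
  also have "\<dots> = Phi S \<alpha> \<gamma> u"
    by (subst (2) pr_sum[OF u, symmetric]) (simp add: Phi_sum)
  finally have 1: "antip (Phi S \<alpha> \<gamma> (antip u)) = Phi S \<alpha> \<gamma> u" .
  \<comment> \<open>The antipode produces one sign for each letter of the arcs; every chord has two
    ends there, so the signs multiply to 1.\<close>
  have "even (length (\<alpha> @ \<gamma>))"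
    by (rule length_even_counts) (use S cnt in auto)
  then have sg: "(-1) ^ length \<gamma> * (-1) ^ length \<alpha> = (1::complex)"
    by (simp add: power_add[symmetric] add.commute)
  have "antip (wd \<phi> \<alpha> * antip u * wd \<phi> \<gamma>) = wd \<phi> (rev \<gamma>) * u * wd \<phi> (rev \<alpha>)" for \<phi>
  proof -
    have "antip (wd \<phi> \<alpha> * antip u * wd \<phi> \<gamma>)
        = sc ((-1) ^ length \<gamma>) * (wd \<phi> (rev \<gamma>) * (u * (sc ((-1) ^ length \<alpha>) * wd \<phi> (rev \<alpha>))))"
      by (simp add: antip_mult antip_antip antip_wd mult.assoc)
    also have "\<dots> = sc ((-1) ^ length \<gamma>) * (sc ((-1) ^ length \<alpha>) * (wd \<phi> (rev \<gamma>) * (u * wd \<phi> (rev \<alpha>))))"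
      by (simp only: sc_comm_left[of u] sc_comm_left[of "wd \<phi> (rev \<gamma>)"])
    also have "\<dots> = wd \<phi> (rev \<gamma>) * u * wd \<phi> (rev \<alpha>)"
      by (simp only: sc_sc_left sg sc_1 mult_1_left mult.assoc)
    finally show ?thesis .
  qed
  then have "antip (Phi S \<alpha> \<gamma> (antip u)) = Phi S (rev \<gamma>) (rev \<alpha>) u"
    by (simp add: Phi_def antip_sum)
  with 1 show ?thesis by simp
qed

lemma sum_PiE_Un:
  assumes "S \<inter> T = {}"
  shows "(\<Sum>\<phi>\<in>PiE (S \<union> T) (\<lambda>_. I3). F \<phi>)
    = (\<Sum>\<psi>\<in>PiE T (\<lambda>_. I3). \<Sum>\<phi>\<in>PiE S (\<lambda>_. I3). F (\<lambda>z. if z \<in> S then \<phi> z else \<psi> z))"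
proof -
  have "(\<Sum>\<phi>\<in>PiE (S \<union> T) (\<lambda>_. I3). F \<phi>)
    = (\<Sum>p\<in>PiE T (\<lambda>_. I3) \<times> PiE S (\<lambda>_. I3). F (\<lambda>z. if z \<in> S then snd p z else fst p z))"
  proof (rule sum.reindex_bij_witness[of _ "\<lambda>p z. if z \<in> S then snd p z else fst p z"
        "\<lambda>\<phi>. (restrict \<phi> T, restrict \<phi> S)"])
    fix \<phi> assume \<phi>: "\<phi> \<in> PiE (S \<union> T) (\<lambda>_. I3)"
    have *: "(\<lambda>z. if z \<in> S then restrict \<phi> S z else restrict \<phi> T z) = \<phi>"
    proof
      fix z
      show "(if z \<in> S then restrict \<phi> S z else restrict \<phi> T z) = \<phi> z"
        using PiE_arb[OF \<phi>, of z] by simp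
    qed
    then show "(\<lambda>z. if z \<in> S then snd (restrict \<phi> T, restrict \<phi> S) z else fst (restrict \<phi> T, restrict \<phi> S) z) = \<phi>"
      unfolding fst_conv snd_conv .
    show "F (\<lambda>z. if z \<in> S then snd (restrict \<phi> T, restrict \<phi> S) z else fst (restrict \<phi> T, restrict \<phi> S) z) = F \<phi>"
      unfolding fst_conv snd_conv * ..
    show "(restrict \<phi> T, restrict \<phi> S) \<in> PiE T (\<lambda>_. I3) \<times> PiE S (\<lambda>_. I3)"
      using \<phi> by auto
  next
    fix p assume "p \<in> PiE T (\<lambda>_. I3) \<times> PiE S (\<lambda>_. I3)"
    then obtain g h where p: "p = (g, h)" and g: "g \<in> PiE T (\<lambda>_. I3)" and h: "h \<in> PiE S (\<lambda>_. I3)"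
      by auto
    have "restrict (\<lambda>z. if z \<in> S then h z else g z) T = g"
    proof
      fix z show "restrict (\<lambda>z. if z \<in> S then h z else g z) T z = g z"
        using PiE_arb[OF g, of z] assms by auto
    qed
    moreover have "restrict (\<lambda>z. if z \<in> S then h z else g z) S = h"
    proof
      fix z show "restrict (\<lambda>z. if z \<in> S then h z else g z) S z = h z"
        using PiE_arb[OF h, of z] by auto
    qed
    ultimately show "(restrict (\<lambda>z. if z \<in> S then snd p z else fst p z) T,
        restrict (\<lambda>z. if z \<in> S then snd p z else fst p z) S) = p"
      unfolding p fst_conv snd_conv by simp
    have "(if z \<in> S then h z else g z) \<in> I3" if "z \<in> S \<union> T" for z
      using PiE_mem[OF h, of z] PiE_mem[OF g, of z] that by auto
    moreover have "(if z \<in> S then h z else g z) = undefined" if "z \<notin> S \<union> T" for z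
      using PiE_arb[OF g, of z] that by auto
    ultimately show "(\<lambda>z. if z \<in> S then snd p z else fst p z) \<in> PiE (S \<union> T) (\<lambda>_. I3)"
      unfolding p fst_conv snd_conv by (rule PiE_I)
  qed
  then show ?thesis
    by (simp add: sum.cartesian_product case_prod_beta')
qed

text \<open>With the colours of the chords in \<beta> and \<delta> fixed, the chords of \<alpha> and
  \<gamma> act as a tangle on the finite-degree element read along \<beta>, and
  \<open>Phi_rev\<close> applies to each summand.\<close>

lemma W_conj:
  assumes dis: "set (\<alpha> @ \<gamma>) \<inter> set (\<beta> @ \<delta>) = {}" and dow: "dow (\<alpha> @ \<beta> @ \<gamma> @ \<delta>)"
  shows "W (rev \<gamma> @ \<beta> @ rev \<alpha> @ \<delta>) = W (\<alpha> @ \<beta> @ \<gamma> @ \<delta>)"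
proof -
  define S T where "S = set (\<alpha> @ \<gamma>)" and "T = set (\<beta> @ \<delta>)"
  have S: "finite S" "set (\<alpha> @ \<gamma>) \<subseteq> S" and ST: "S \<inter> T = {}"
    using dis by (auto simp: S_def T_def)
  have cnt: "count_list (\<alpha> @ \<gamma>) l = 2" if "l \<in> S" for l
  proof -
    have "l \<notin> set \<beta>" "l \<notin> set \<delta>"
      using that ST by (auto simp: T_def)
    moreover have "l \<in> set (\<alpha> @ \<beta> @ \<gamma> @ \<delta>)"
      using that by (auto simp: S_def)
    then have "count_list (\<alpha> @ \<beta> @ \<gamma> @ \<delta>) l = 2"
      using dow unfolding dow_def by blast
    ultimately show ?thesis
      by simp
  qed
  have expand: "W (\<alpha>' @ \<beta> @ \<gamma>' @ \<delta>) = (\<Sum>\<psi>\<in>PiE T (\<lambda>_. I3). Phi S \<alpha>' \<gamma>' (wd \<psi> \<beta>) * wd \<psi> \<delta>)"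
    if "set (\<alpha>' @ \<gamma>') = S" for \<alpha>' \<gamma>'
  proof -
    have set: "set (\<alpha>' @ \<beta> @ \<gamma>' @ \<delta>) = S \<union> T"
      using that by (auto simp: T_def)
    have "wd (\<lambda>z. if z \<in> S then \<phi> z else \<psi> z) (\<alpha>' @ \<beta> @ \<gamma>' @ \<delta>)
        = wd \<phi> \<alpha>' * wd \<psi> \<beta> * wd \<phi> \<gamma>' * wd \<psi> \<delta>" for \<phi> \<psi> :: "'a \<Rightarrow> nat"
    proof -
      have "wd (\<lambda>z. if z \<in> S then \<phi> z else \<psi> z) \<alpha>' = wd \<phi> \<alpha>'" "wd (\<lambda>z. if z \<in> S then \<phi> z else \<psi> z) \<gamma>' = wd \<phi> \<gamma>'"
        using that by (auto intro!: wd_cong)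
      moreover have "wd (\<lambda>z. if z \<in> S then \<phi> z else \<psi> z) \<beta> = wd \<psi> \<beta>" "wd (\<lambda>z. if z \<in> S then \<phi> z else \<psi> z) \<delta> = wd \<psi> \<delta>"
        using ST by (auto intro!: wd_cong simp: T_def)
      ultimately show ?thesis by (simp add: mult.assoc)
    qed
    then show ?thesis
      unfolding W_def set sum_PiE_Un[OF ST] Phi_def by (simp add: sum_distrib_right)
  qed
  have "Phi S (rev \<gamma>) (rev \<alpha>) (wd \<psi> \<beta>) = Phi S \<alpha> \<gamma> (wd \<psi> \<beta>)" if "\<psi> \<in> PiE T (\<lambda>_. I3)" for \<psi>
  proof (rule Phi_rev[OF S cnt])
    show "Fil (Suc (length \<beta>)) (wd \<psi> \<beta>)"
      using that by (intro Fil_wd) (auto simp: T_def)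
  qed
  then have "(\<Sum>\<psi>\<in>PiE T (\<lambda>_. I3). Phi S (rev \<gamma>) (rev \<alpha>) (wd \<psi> \<beta>) * wd \<psi> \<delta>)
      = (\<Sum>\<psi>\<in>PiE T (\<lambda>_. I3). Phi S \<alpha> \<gamma> (wd \<psi> \<beta>) * wd \<psi> \<delta>)"
    by simp
  moreover have "set (rev \<gamma> @ rev \<alpha>) = S" "set (\<alpha> @ \<gamma>) = S"
    by (auto simp: S_def)
  ultimately show ?thesis
    using expand[of "rev \<gamma>" "rev \<alpha>"] expand[of \<alpha> \<gamma>] by argo
qed

lemma W_map:
  assumes inj: "inj_on f (set ds)"
  shows "W (map f ds) = W ds"
  unfolding W_def
proof (rule sum.reindex_bij_witness[of _ "\<lambda>\<phi>. restrict (\<phi> \<circ> the_inv_into (set ds) f) (f ` set ds)"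
      "\<lambda>\<phi>. restrict (\<phi> \<circ> f) (set ds)"])
  fix \<phi> assume \<phi>: "\<phi> \<in> PiE (set (map f ds)) (\<lambda>_. I3)"
  show "restrict (restrict (\<phi> \<circ> f) (set ds) \<circ> the_inv_into (set ds) f) (f ` set ds) = \<phi>"
  proof
    fix z
    show "restrict (restrict (\<phi> \<circ> f) (set ds) \<circ> the_inv_into (set ds) f) (f ` set ds) z = \<phi> z"
    proof (cases "z \<in> f ` set ds")
      case True
      then show ?thesis
        using the_inv_into_into[OF inj True subset_refl] f_the_inv_into_f[OF inj True] by simp
    next
      case False
      then show ?thesis using PiE_arb[OF \<phi>, of z] by simp
    qed
  qed
  have "\<phi> (f x) \<in> I3" if "x \<in> set ds" for x
    using PiE_mem[OF \<phi>, of "f x"] that by simp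
  then show "restrict (\<phi> \<circ> f) (set ds) \<in> PiE (set ds) (\<lambda>_. I3)"
    by simp
  have "wd (restrict (\<phi> \<circ> f) (set ds)) ds = wd (\<phi> \<circ> f) ds"
    by (rule wd_cong) simp
  then show "wd (restrict (\<phi> \<circ> f) (set ds)) ds = wd \<phi> (map f ds)"
    by (simp add: wd_def)
next
  fix \<phi> assume \<phi>: "\<phi> \<in> PiE (set ds) (\<lambda>_. I3)"
  show "restrict (restrict (\<phi> \<circ> the_inv_into (set ds) f) (f ` set ds) \<circ> f) (set ds) = \<phi>"
  proof
    fix z
    show "restrict (restrict (\<phi> \<circ> the_inv_into (set ds) f) (f ` set ds) \<circ> f) (set ds) z = \<phi> z"
      using PiE_arb[OF \<phi>, of z] by (cases "z \<in> set ds") (simp_all add: the_inv_into_f_f[OF inj])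
  qed
  have "\<phi> (the_inv_into (set ds) f (f x)) \<in> I3" if "x \<in> set ds" for x
    using PiE_mem[OF \<phi>, of x] that by (simp add: the_inv_into_f_f[OF inj])
  then show "restrict (\<phi> \<circ> the_inv_into (set ds) f) (f ` set ds) \<in> PiE (set (map f ds)) (\<lambda>_. I3)"
    by auto
qed

declare pr.simps [simp del]

subsection \<open>Separating polynomials in the Casimir element\<close>

text \<open>The lowest weight modules: \<open>x_3 = t d/dt - j\<close>, \<open>x_1 \<plusminus> i x_2\<close> act by
  \<open>2 j t - t^2 d/dt\<close> and \<open>d/dt\<close>, so that the Casimir element acts by \<open>j (j + 1)\<close>.\<close>

definition oplus :: "complex \<Rightarrow> complex poly \<Rightarrow> complex poly" where
  "oplus j p = smult (2 * j) (pCons 0 p) - pCons 0 (pCons 0 (pderiv p))"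

definition ozero :: "complex \<Rightarrow> complex poly \<Rightarrow> complex poly" where
  "ozero j p = pCons 0 (pderiv p) - smult j p"

text \<open>The generators \<open>1\<close> and \<open>2\<close> are recovered from the raising and
  lowering operators. Other letters also occur in \<open>nc\<close>; no relation involves them, so
  they may act by zero.\<close>

definition rho :: "complex \<Rightarrow> nat \<Rightarrow> complex poly \<Rightarrow> complex poly" where
  "rho j a p = (if a = 1 then smult (1/2) (oplus j p + pderiv p)
     else if a = 2 then smult (1/(2*\<i>)) (oplus j p - pderiv p)
     else if a = 3 then ozero j p else 0)"

lemma rho_linear:
  "rho j a (p + q) = rho j a p + rho j a q" "rho j a (smult z p) = smult z (rho j a p)"
  "rho j a 0 = 0" "rho j a (p - q) = rho j a p - rho j a q"
  by (simp_all add: rho_def oplus_def ozero_def pderiv_add pderiv_smult pderiv_diff smult_add_right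
      smult_diff_right algebra_simps)

lemma rho_comm:
  assumes "a \<in> {1,2,3}" "b \<in> {1,2,3}"
  shows "rho j a (rho j b p) - rho j b (rho j a p) = (\<Sum>c\<in>{1,2,3}. smult (\<i> * eps a b c) (rho j c p))"
proof -
  have zp: "pderiv (oplus j p) = smult (2*j) (p + pCons 0 (pderiv p))
      - (pCons 0 (pderiv p) + pCons 0 (pderiv p + pCons 0 (pderiv (pderiv p))))"
    by (simp only: oplus_def pderiv_diff pderiv_smult pderiv_pCons)
  have zz: "pderiv (ozero j p) = pderiv p + pCons 0 (pderiv (pderiv p)) - smult j (pderiv p)"
    by (simp add: ozero_def pderiv_diff pderiv_smult pderiv_pCons)
  have two: "coeff (q * 2) n = 2 * coeff q n" "coeff (2 * q) n = 2 * coeff q n" for q :: "complex poly" and n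
    by (simp_all only: mult_2 mult_2_right coeff_add)
  have c1: "oplus j (pderiv p) - pderiv (oplus j p) = smult 2 (ozero j p)"
    by (simp add: zp)
      (simp add: oplus_def ozero_def poly_eq_iff coeff_pCons algebra_simps two split: nat.splits)
  have c2: "ozero j (pderiv p) - pderiv (ozero j p) = - pderiv p"
    by (simp add: zz) (simp add: ozero_def poly_eq_iff coeff_pCons algebra_simps split: nat.splits)
  have c3: "ozero j (oplus j p) - oplus j (ozero j p) = oplus j p"
    unfolding ozero_def[of j "oplus j p"] oplus_def[of j "ozero j p"] zp zz
    by (simp add: oplus_def ozero_def poly_eq_iff coeff_pCons algebra_simps two split: nat.splits)
  have lin: "oplus j (smult z p) = smult z (oplus j p)" "ozero j (smult z p) = smult z (ozero j p)" 
    "oplus j (p + q) = oplus j p + oplus j q" "ozero j (p + q) = ozero j p + ozero j q"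
    "oplus j (p - q) = oplus j p - oplus j q" "ozero j (p - q) = ozero j p - ozero j q" for z p q
    by (simp_all add: oplus_def ozero_def pderiv_add pderiv_smult pderiv_diff smult_add_right
      smult_diff_right algebra_simps)
  note c1' = c1[THEN diff_eq_eq[THEN iffD1]] and c2' = c2[THEN diff_eq_eq[THEN iffD1]] 
    and c3' = c3[THEN diff_eq_eq[THEN iffD1]]
  show ?thesis
    using assms
    by (elim insertE emptyE; simp add: rho_def eps_def lin pderiv_smult pderiv_add pderiv_diff
        smult_add_right smult_diff_right c1' c2' c3')
       (simp_all add: poly_eq_iff field_simps two)
qed

lemma smult_sum_right: "smult z (\<Sum>i\<in>I. f i) = (\<Sum>i\<in>I. smult z (f i))"
  by (induction I rule: infinite_finite_induct) (simp_all add: smult_add_right)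

definition act :: "complex \<Rightarrow> nat list \<Rightarrow> complex poly \<Rightarrow> complex poly" where
  "act j w p = foldr (rho j) w p"

lemma act_append: "act j (u @ v) p = act j u (act j v p)"
  by (simp add: act_def)

lemma act_linear:
  "act j w (p + q) = act j w p + act j w q" "act j w (smult z p) = smult z (act j w p)"
  "act j w 0 = 0" "act j w (p - q) = act j w p - act j w q"
  by (induction w) (simp_all add: act_def rho_linear)

lemma act_sum: "act j w (\<Sum>i\<in>I. f i) = (\<Sum>i\<in>I. act j w (f i))"
  by (induction I rule: infinite_finite_induct) (simp_all add: act_linear)

definition Rf :: "complex \<Rightarrow> nc \<Rightarrow> complex poly \<Rightarrow> complex poly" where
  "Rf j f p = (\<Sum>w\<in>{w. f w \<noteq> 0}. smult (f w) (act j w p))"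

lemma Rf_superset: "finite A \<Longrightarrow> {w. f w \<noteq> 0} \<subseteq> A \<Longrightarrow> Rf j f p = (\<Sum>w\<in>A. smult (f w) (act j w p))"
  unfolding Rf_def by (rule sum.mono_neutral_left) auto

lemma Rf_zero: "Rf j (\<lambda>_. 0) p = 0"
  by (simp add: Rf_def)

lemma Rf_add:
  assumes "fins f" "fins g"
  shows "Rf j (\<lambda>w. f w + g w) p = Rf j f p + Rf j g p"
proof -
  let ?A = "{w. f w \<noteq> 0} \<union> {w. g w \<noteq> 0}"
  have A: "finite ?A" using assms by (simp add: fins_def)
  have "Rf j (\<lambda>w. f w + g w) p = (\<Sum>w\<in>?A. smult (f w + g w) (act j w p))"
    by (rule Rf_superset[OF A]) auto
  also have "\<dots> = (\<Sum>w\<in>?A. smult (f w) (act j w p)) + (\<Sum>w\<in>?A. smult (g w) (act j w p))"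
    by (simp add: smult_add_left sum.distrib)
  also have "(\<Sum>w\<in>?A. smult (f w) (act j w p)) = Rf j f p"
    by (rule Rf_superset[OF A, symmetric]) auto
  also have "(\<Sum>w\<in>?A. smult (g w) (act j w p)) = Rf j g p"
    by (rule Rf_superset[OF A, symmetric]) auto
  finally show ?thesis .
qed

lemma Rf_smult:
  assumes "fins f"
  shows "Rf j (\<lambda>w. z * f w) p = smult z (Rf j f p)"
proof -
  have A: "finite {w. f w \<noteq> 0}" using assms by (simp add: fins_def)
  have "Rf j (\<lambda>w. z * f w) p = (\<Sum>w\<in>{w. f w \<noteq> 0}. smult (z * f w) (act j w p))"
    by (rule Rf_superset[OF A]) auto
  also have "\<dots> = smult z (Rf j f p)"
    by (simp add: Rf_def smult_sum_right)
  finally show ?thesis .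
qed

lemma Rf_diff:
  assumes "fins f" "fins g"
  shows "Rf j (\<lambda>w. f w - g w) p = Rf j f p - Rf j g p"
  using Rf_add[OF assms(1) fins_uminus[OF assms(2)]] Rf_smult[OF assms(2), of j "-1"] by simp

lemma Rf_sum:
  assumes "finite I" "\<And>i. i \<in> I \<Longrightarrow> fins (h i)"
  shows "Rf j (\<lambda>w. \<Sum>i\<in>I. h i w) p = (\<Sum>i\<in>I. Rf j (h i) p)"
  using assms
proof (induction I rule: finite_induct)
  case (insert i I)
  have "fins (h i)" "fins (\<lambda>w. \<Sum>i\<in>I. h i w)"
    using insert.prems by (auto intro: fins_sum)
  then show ?case
    using insert by (simp add: Rf_add)
qed (simp add: Rf_zero)

lemma Rf_word: "Rf j (ncword u) p = act j u p"
  using Rf_superset[of "{u}" "ncword u" j p] by (auto simp: ncword_def)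

lemma Rf_ncmul:
  assumes f: "fins f" and g: "fins g"
  shows "Rf j (ncmul f g) p = Rf j f (Rf j g p)"
proof -
  have fin: "finite {w. f w \<noteq> 0}" "finite {w. g w \<noteq> 0}"
    using f g by (simp_all add: fins_def)
  have 1: "Rf j (ncmul (ncword v) (ncword w)) p = act j v (act j w p)" for v w
    by (simp add: ncmul_ncword_ncword Rf_word act_append)
  have 2: "Rf j (ncmul f (ncword w)) p = Rf j f (act j w p)" for w
  proof -
    have "Rf j (ncmul f (ncword w)) p = Rf j (\<lambda>x. \<Sum>v\<in>{v. f v \<noteq> 0}. f v * ncmul (ncword v) (ncword w) x) p"
      by (subst ncmul_word_expand_left[OF f]) simp
    also have "\<dots> = (\<Sum>v\<in>{v. f v \<noteq> 0}. Rf j (\<lambda>x. f v * ncmul (ncword v) (ncword w) x) p)"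
      by (intro Rf_sum fin fins_smult fins_ncmul fins_ncword)
    also have "\<dots> = (\<Sum>v\<in>{v. f v \<noteq> 0}. smult (f v) (act j v (act j w p)))"
      by (simp only: Rf_smult[OF fins_ncmul[OF fins_ncword fins_ncword]] 1)
    also have "\<dots> = Rf j f (act j w p)"
      by (simp add: Rf_def)
    finally show ?thesis .
  qed
  have "Rf j (ncmul f g) p = Rf j (\<lambda>x. \<Sum>w\<in>{w. g w \<noteq> 0}. g w * ncmul f (ncword w) x) p"
    by (subst ncmul_word_expand_right[OF g]) simp
  also have "\<dots> = (\<Sum>w\<in>{w. g w \<noteq> 0}. Rf j (\<lambda>x. g w * ncmul f (ncword w) x) p)"
    by (intro Rf_sum fin fins_smult fins_ncmul fins_ncword f)
  also have "\<dots> = (\<Sum>w\<in>{w. g w \<noteq> 0}. smult (g w) (Rf j f (act j w p)))"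
    by (simp add: Rf_smult fins_ncmul fins_ncword 2 f)
  also have "\<dots> = Rf j f (Rf j g p)"
    unfolding Rf_def act_sum smult_sum_right act_linear
    by (subst sum.swap) (simp add: mult.commute)
  finally show ?thesis .
qed

lemma Rf_sl2_rel:
  assumes "a \<in> {1,2,3}" "b \<in> {1,2,3}"
  shows "Rf j (sl2_rel a b) p = 0"
proof -
  have "Rf j (sl2_rel a b) p = Rf j (ncword [a,b]) p - Rf j (ncword [b,a]) p
      - (\<Sum>c\<in>{1,2,3}. Rf j (\<lambda>w. \<i> * eps a b c * ncword [c] w) p)"
  proof -
    have f: "fins (\<lambda>w. \<i> * eps a b c * ncword [c] w)" for c
      by (rule fins_smult[OF fins_ncword])
    have s: "fins (\<lambda>w. \<Sum>c\<in>{1,2,3}. \<i> * eps a b c * ncword [c] w)"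
      by (rule fins_sum[OF f])
    show ?thesis
      unfolding sl2_rel_def
      by (subst Rf_diff[OF fins_diff[OF fins_ncword fins_ncword] s],
          subst Rf_diff[OF fins_ncword fins_ncword], subst Rf_sum[OF _ f]) simp_all
  qed
  also have "\<dots> = rho j a (rho j b p) - rho j b (rho j a p) - (\<Sum>c\<in>{1,2,3}. smult (\<i> * eps a b c) (rho j c p))"
    by (simp only: Rf_smult[OF fins_ncword] Rf_word) (simp add: act_def)
  also have "\<dots> = 0"
    by (simp only: rho_comm[OF assms]) simp
  finally show ?thesis .
qed

lemma fins_sl2_rel: "a \<in> {1,2,3} \<Longrightarrow> b \<in> {1,2,3} \<Longrightarrow> fins (sl2_rel a b)"
  using U_ideal_fins[OF U_ideal.gen[of a b "[]" "[]"]] by (simp add: ncmul_ncword_Nil)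

lemma Rf_U_ideal: "U_ideal f \<Longrightarrow> Rf j f p = 0"
proof (induction arbitrary: p rule: U_ideal.induct)
  case zero
  show ?case by (rule Rf_zero)
next
  case (add f g)
  then show ?case by (simp add: Rf_add U_ideal_fins)
next
  case (smult f z)
  then show ?case by (simp add: Rf_smult U_ideal_fins)
next
  case (gen a b u v)
  have f: "fins (sl2_rel a b)"
    using gen by (rule fins_sl2_rel)
  show ?case
    by (subst Rf_ncmul[OF fins_ncword fins_ncmul[OF f fins_ncword]], subst Rf_ncmul[OF f fins_ncword])
       (simp only: Rf_sl2_rel[OF gen] Rf_word act_linear)
qed

lift_definition actU :: "complex \<Rightarrow> usl2 \<Rightarrow> complex poly \<Rightarrow> complex poly" is Rf
proof (rule ext)
  fix j f g p assume "Urel f g"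
  then show "Rf j f p = Rf j g p"
    using Rf_diff[of f g j p] Rf_U_ideal[of "\<lambda>w. f w - g w" j p] by (simp add: Urel_def)
qed

lemma actU_add: "actU j (u + v) p = actU j u p + actU j v p"
  by transfer (simp add: Urel_def Rf_add)

lemma actU_mult: "actU j (u * v) p = actU j u (actU j v p)"
  by transfer (simp add: Urel_def Rf_ncmul)

lemma actU_X: "actU j (xg a) p = rho j a p"
  by transfer (simp add: Rf_word act_def)

lemma actU_sc: "actU j (sc z) p = smult z p"
proof -
  have "(\<lambda>w::nat list. if w = [] then z else 0) = (\<lambda>w. z * ncword [] w)"
    by (auto simp: ncword_def)
  then have "Rf j (\<lambda>w. if w = [] then z else 0) p = smult z p"
    by (simp add: Rf_smult fins_ncword Rf_word act_def)
  then show ?thesis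
    by (simp add: sc.abs_eq actU.abs_eq[OF Urel_refl[OF fins_sc]])
qed

text \<open>Constants are killed by d/dt, so they are lowest weight vectors, and on these the
  Casimir element is computed directly.\<close>

lemma actU_Cas_1: "actU j Cas [:z:] = [: z * (j * (j + 1)) :]"
  unfolding Cas_def sum123 actU_add actU_mult actU_X
  by (simp add: rho_def oplus_def ozero_def pderiv_pCons algebra_simps power2_eq_square[symmetric])

lemma actU_evC: "actU j (evC P) [:1:] = [: poly P (j * (j + 1)) :]"
proof (induction P)
  case 0
  have "actU j 0 [:1:] = 0"
    using actU_sc[of j 0] by simp
  then show ?case by simp
next
  case (pCons a P)
  then show ?case
    by (simp add: actU_add actU_mult actU_sc actU_Cas_1)
qed

text \<open>Every complex \<open>y\<close> has the form j(j+1) for some complex \<open>j\<close>, by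
  solving the quadratic equation; the modules therefore detect the value of a polynomial at every
  point.\<close>

lemma evC_inject:
  assumes "evC P = evC Q"
  shows "P = Q"
proof -
  have "poly P y = poly Q y" for y
  proof -
    define j where "j = (csqrt (1 + 4 * y) - 1) / 2"
    have "2 * j + 1 = csqrt (1 + 4 * y)"
      by (simp add: j_def field_simps)
    then have "(2 * j + 1)^2 = 1 + 4 * y"
      by simp
    then have "4 * (j * (j + 1)) = 4 * y"
      by (simp add: power2_eq_square algebra_simps)
    then have "j * (j + 1) = y"
      by simp
    moreover have "[: poly P (j * (j + 1)) :] = [: poly Q (j * (j + 1)) :]"
      using assms by (simp add: actU_evC[symmetric])
    ultimately show ?thesis by simp
  qed
  then show ?thesis
    by (simp add: poly_eq_poly_eq_iff[symmetric] fun_eq_iff)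
qed

subsection \<open>The weight system as a polynomial\<close>

definition mk :: "nc \<Rightarrow> usl2" where
  "mk f = abs_usl2 f"

lemma mk_add: "fins f \<Longrightarrow> fins g \<Longrightarrow> mk (\<lambda>w. f w + g w) = mk f + mk g"
  by (simp add: mk_def plus_usl2.abs_eq Urel_refl)

lemma mk_diff: "fins f \<Longrightarrow> fins g \<Longrightarrow> mk (\<lambda>w. f w - g w) = mk f - mk g"
  by (simp add: mk_def minus_usl2.abs_eq Urel_refl)

lemma mk_mult: "fins f \<Longrightarrow> fins g \<Longrightarrow> mk (ncmul f g) = mk f * mk g"
  by (simp add: mk_def times_usl2.abs_eq Urel_refl)

lemma mk_zero: "mk (\<lambda>_. 0) = 0"
  by (simp add: mk_def zero_usl2_def)

lemma mk_smult: "fins f \<Longrightarrow> mk (\<lambda>w. z * f w) = sc z * mk f"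
  using mk_mult[OF fins_sc, of f z] by (simp add: ncmul_sc_left mk_def sc.abs_eq)

lemma mk_sum: "(\<And>i. i \<in> I \<Longrightarrow> fins (f i)) \<Longrightarrow> mk (\<lambda>w. \<Sum>i\<in>I. f i w) = (\<Sum>i\<in>I. mk (f i))"
proof (induction I rule: infinite_finite_induct)
  case (insert i I)
  have "fins (f i)" "fins (\<lambda>w. \<Sum>i\<in>I. f i w)"
    using insert.prems by (auto intro: fins_sum)
  then show ?case
    using insert by (simp add: mk_add)
qed (simp_all add: mk_zero)

lemma mk_eq_0_iff: "fins f \<Longrightarrow> mk f = 0 \<longleftrightarrow> U_ideal f"
  unfolding mk_def zero_usl2_def
  using Quotient_rel[OF Quotient_usl2, of f "\<lambda>_. 0"] by (auto simp: Urel_def fins_zero U_ideal.zero)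

lemma mk_word: "mk (ncword ws) = prodX ws"
proof (induction ws)
  case Nil
  then show ?case by (simp add: mk_def one_usl2_def)
next
  case (Cons a ws)
  have "mk (ncword ([a] @ ws)) = mk (ncword [a]) * mk (ncword ws)"
    by (simp only: ncmul_ncword_ncword[symmetric] mk_mult[OF fins_ncword fins_ncword])
  moreover have "mk (ncword [a]) = xg a"
    by (simp add: mk_def xg_def)
  ultimately show ?case using Cons by simp
qed

lemma fins_casimir: "fins casimir"
  unfolding casimir_def by (rule fins_sum[OF fins_ncword])

lemma mk_casimir: "mk casimir = Cas"
  unfolding casimir_def by (subst mk_sum[OF fins_ncword]) (simp add: mk_word Cas_def I3_def)

lemma fins_ncpow: "fins f \<Longrightarrow> fins (ncpow f n)"
  by (induction n) (simp_all add: ncpow_def fins_ncword fins_ncmul)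

lemma mk_ncpow: "fins f \<Longrightarrow> mk (ncpow f n) = mk f ^ n"
proof (induction n)
  case (Suc n)
  then have "mk (ncmul f (ncpow f n)) = mk f * mk f ^ n"
    by (simp add: mk_mult fins_ncpow)
  then show ?case by (simp add: ncpow_def)
qed (simp add: ncpow_def mk_word)

lemma evC_altdef: "evC P = (\<Sum>i\<le>degree P. sc (coeff P i) * Cas ^ i)"
proof -
  have "evC P = evC (\<Sum>i\<le>degree P. monom (coeff P i) i)"
    by (simp add: poly_as_sum_of_monoms)
  also have "\<dots> = (\<Sum>i\<le>degree P. sc (coeff P i) * Cas ^ i)"
  proof -
    have "evC (monom a i) = sc a * Cas ^ i" for a i
      by (induction i) (simp_all add: monom_Suc monom_0 Cas_sc_left mult.assoc)
    then show ?thesis by (simp add: evC_sum)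
  qed
  finally show ?thesis .
qed

lemma fins_poly_casimir: "fins (poly_casimir P)"
  unfolding poly_casimir_def by (rule fins_sum[OF fins_smult[OF fins_ncpow[OF fins_casimir]]])

lemma mk_poly_casimir: "mk (poly_casimir P) = evC P"
  unfolding poly_casimir_def evC_altdef
  by (subst mk_sum[OF fins_smult[OF fins_ncpow[OF fins_casimir]]])
     (simp add: mk_smult fins_ncpow fins_casimir mk_ncpow mk_casimir)

text \<open>Membership of the difference in \<open>U_ideal\<close> is equality in
  \<open>usl2\<close>, and \<open>evC_inject\<close> makes the polynomial selected by
  \<open>THE\<close> unique.\<close>

lemma w_sl2_poly_eq:
  assumes "set ds = {0..<n}" "W ds = evC P"
  shows "w_sl2_poly n ds = P"
proof -
  have f: "fins (w_sl2_word n ds)"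
    unfolding w_sl2_word_def by (rule fins_sum[OF fins_ncword])
  have "mk (w_sl2_word n ds) = W ds"
    unfolding w_sl2_word_def by (subst mk_sum[OF fins_ncword])
      (simp add: mk_word W_def wd_def assms(1) I3_def)
  then have "U_ideal (\<lambda>w. w_sl2_word n ds w - poly_casimir Q w) \<longleftrightarrow> evC P = evC Q" for Q
    using mk_eq_0_iff[OF fins_diff[OF f fins_poly_casimir[of Q]]] assms(2)
    by (simp add: mk_diff f fins_poly_casimir mk_poly_casimir)
  then show ?thesis
    unfolding w_sl2_poly_def using evC_inject by (intro the_equality) auto
qed

subsection \<open>Joining with an edgeless graph\<close>

lemma Phi_nested:
  assumes "distinct us"
  shows "Phi (set us) us (rev us) v = (TT ^^ length us) v"
  using assms
proof (induction us)
  case Nil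
  then show ?case by (simp add: Phi_def)
next
  case (Cons u us)
  have S: "finite (set (u # us))" "u \<in> set (u # us)" by auto
  have eq: "set (u # us) - {u} = set us"
    using Cons.prems by auto
  have "Phi (set (u # us)) (u # us) (rev (u # us)) v
     = (\<Sum>\<phi>\<in>PiE (set us) (\<lambda>_. I3). \<Sum>x\<in>I3. xg x * (wd \<phi> us * v * wd \<phi> (rev us)) * xg x)"
    unfolding Phi_def sum_PiE_split[OF S] eq using Cons.prems by (simp add: mult.assoc)
  also have "\<dots> = TT (Phi (set us) us (rev us) v)"
    by (simp add: TT_def Phi_def TT_sum[unfolded TT_def])
  finally show ?case
    using Cons by simp
qed

lemma W_nested:
  assumes us: "distinct us" "set us \<inter> S = {}" and AB: "set A \<subseteq> S" "set B \<subseteq> S" "S \<subseteq> set A \<union> set B"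
  shows "W (us @ A @ rev us @ B) = (\<Sum>\<phi>\<in>PiE S (\<lambda>_. I3). (TT ^^ length us) (wd \<phi> A) * wd \<phi> B)"
proof -
  have set: "set (us @ A @ rev us @ B) = set us \<union> S"
    using AB by auto
  have "wd (\<lambda>z. if z \<in> set us then \<phi> z else \<psi> z) (us @ A @ rev us @ B)
      = wd \<phi> us * wd \<psi> A * wd \<phi> (rev us) * wd \<psi> B" for \<phi> \<psi> :: "'a \<Rightarrow> nat"
  proof -
    have "wd (\<lambda>z. if z \<in> set us then \<phi> z else \<psi> z) us = wd \<phi> us"
      "wd (\<lambda>z. if z \<in> set us then \<phi> z else \<psi> z) (rev us) = wd \<phi> (rev us)"
      by (auto intro!: wd_cong)
    moreover have "wd (\<lambda>z. if z \<in> set us then \<phi> z else \<psi> z) A = wd \<psi> A"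
      "wd (\<lambda>z. if z \<in> set us then \<phi> z else \<psi> z) B = wd \<psi> B"
      using us(2) AB by (auto intro!: wd_cong simp: disjoint_iff)
    ultimately show ?thesis by (simp add: mult.assoc)
  qed
  then show ?thesis
    unfolding W_def set sum_PiE_Un[OF us(2)] Phi_nested[OF us(1), symmetric] Phi_def
    by (simp add: sum_distrib_right)
qed

lemma evC_uminus: "evC (- P) = - evC P"
  using evC_smult[of "-1" P] by (simp add: sc_uminus)

lemma evC_lin: "evC [:- kap k, 1:] = Cas - sc (kap k)"
  by (simp add: sc_uminus)

lemma distinct_count_list: "distinct xs \<Longrightarrow> count_list xs x = (if x \<in> set xs then 1 else 0)"
  by (induction xs) auto

text \<open>\<open>R k\<close> pairs the \<open>k\<close>-th spectral component of \<open>A\<close>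
  with \<open>B\<close>; projections commute with \<open>ad\<close>, so it is invariant and hence a
  polynomial in \<open>Cas\<close>. Both expansions are obtained together in order to share the same
  \<open>r\<close>.\<close>

lemma join_formula:
  assumes A: "distinct A" "set A = S" and B: "distinct B" "set B = S" and m: "length A = m"
  obtains r where
    "\<forall>us. distinct us \<longrightarrow> set us \<inter> S = {} \<longrightarrow>
      W (us @ A @ rev us @ B) = evC (\<Sum>k\<le>m. r k * [:- kap k, 1:] ^ length us)"
    "\<forall>us. distinct us \<longrightarrow> set us \<inter> S = {} \<longrightarrow>
      W (us @ rev A @ rev us @ B) = evC (\<Sum>k\<le>m. ((-1) ^ (m - k) * r k) * [:- kap k, 1:] ^ length us)"
proof -
  define R where "R k = (\<Sum>\<phi>\<in>PiE S (\<lambda>_. I3). pr (Suc m) k (wd \<phi> A) * wd \<phi> B)" for k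
  have S: "finite S" using A by auto
  have cnt: "count_list (A @ B) l = 2" if "l \<in> S" for l
    using that A B by (simp add: distinct_count_list)
  have FA: "Fil (Suc m) (wd \<phi> A)" "Fil (Suc (length B)) (wd \<phi> B)" if "\<phi> \<in> PiE S (\<lambda>_. I3)" for \<phi>
    using that Fil_wd[of \<phi> A] Fil_wd[of \<phi> B] A(2) B(2) m by auto
  have "\<exists>P. R k = evC P" for k
  proof -
    have "\<exists>n. Fil n (R k)"
      unfolding R_def
    proof (rule Fil_ex_sum)
      fix \<phi> assume "\<phi> \<in> PiE S (\<lambda>_. I3)"
      then show "\<exists>n. Fil n (pr (Suc m) k (wd \<phi> A) * wd \<phi> B)"
        using Fil_mult[OF FA(2) pr_Fil[OF FA(1)]] by blast
    qed (simp add: finite_PiE_I3 S)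
    moreover have "ad a (R k) = 0" if a: "a \<in> I3" for a
    proof -
      have bi: "biadd (\<lambda>u v. pr (Suc m) k u * v)"
        by (rule biaddI) (simp_all only: pr_additive pr_sc distrib_left distrib_right mult.assoc sc_comm_left)
      show ?thesis
        using bilinear_invariance[OF bi a S _ cnt] A(2) B(2)
        by (simp add: R_def ad_sum ad_mult ad_pr[OF a])
    qed
    ultimately show ?thesis
      using invariant_evC by blast
  qed
  then obtain r where r: "R k = evC (r k)" for k by metis
  let ?L = "\<lambda>k. Cas - sc (kap k)"
  have Lcomm: "sc z * ?L k ^ n = ?L k ^ n * sc z" for z k n
    by (rule sc_comm[symmetric])
  have ev: "evC (\<Sum>k\<le>m. q k * r k * [:- kap k, 1:] ^ n) = (\<Sum>k\<le>m. evC (q k) * ?L k ^ n * R k)" for q n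
  proof -
    have "q k * r k * P = q k * P * r k" for k P
      by (simp add: mult_ac)
    then show ?thesis
      by (simp only: evC_sum evC_mult evC_power evC_lin r)
  qed
  have pow: "(TT ^^ n) (pr (Suc m) k (wd \<phi> A)) = ?L k ^ n * pr (Suc m) k (wd \<phi> A)"
    if "\<phi> \<in> PiE S (\<lambda>_. I3)" for \<phi> n k
    by (rule TT_pow_eig[OF eig_pr[OF FA(1)[OF that]]])
  have TTs: "(TT ^^ n) (\<Sum>i\<in>I. f i) = (\<Sum>i\<in>I. (TT ^^ n) (f i))" for n and I :: "nat set" and f
    by (induction n) (simp_all add: TT_sum)
  have TTc: "(TT ^^ n) (sc z * u) = sc z * (TT ^^ n) u" for n z u
    by (induction n) (simp_all add: TT_linear)
  show thesis
  proof (rule that[of r]; intro allI impI)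
    fix us :: "'a list" assume us: "distinct us" "set us \<inter> S = {}"
    let ?n = "length us"
    have "(TT ^^ ?n) (wd \<phi> A) = (\<Sum>k<Suc m. ?L k ^ ?n * pr (Suc m) k (wd \<phi> A))"
      if "\<phi> \<in> PiE S (\<lambda>_. I3)" for \<phi>
      by (subst pr_sum[OF FA(1)[OF that], symmetric]) (simp only: TTs pow[OF that])
    then have "W (us @ A @ rev us @ B)
        = (\<Sum>\<phi>\<in>PiE S (\<lambda>_. I3). (\<Sum>k<Suc m. ?L k ^ ?n * pr (Suc m) k (wd \<phi> A)) * wd \<phi> B)"
      using W_nested[OF us, of A B] A B by simp
    also have "\<dots> = (\<Sum>k<Suc m. ?L k ^ ?n * R k)"
      unfolding R_def sum_distrib_left sum_distrib_right
      by (subst sum.swap) (simp only: mult.assoc)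
    also have "\<dots> = evC (\<Sum>k\<le>m. r k * [:- kap k, 1:] ^ ?n)"
      using ev[of "\<lambda>_. 1" ?n] by (simp only: lessThan_Suc_atMost mult_1_left evC_1)
    finally show "W (us @ A @ rev us @ B) = evC (\<Sum>k\<le>m. r k * [:- kap k, 1:] ^ ?n)" .
  next
    fix us :: "'a list" assume us: "distinct us" "set us \<inter> S = {}"
    let ?n = "length us"
    let ?s = "\<lambda>k. sc ((-1) ^ (m - k))"
    \<comment> \<open>The first sign stems from reversing the \<open>m\<close> letters of
      \<open>A\<close>, the second from the antipode on the \<open>k\<close>-th component;
      \<open>k \<le> m\<close> makes the difference genuine.\<close>
    have sgn: "(-1) ^ m * (-1) ^ k = ((-1) ^ (m - k) :: complex)" if "k < Suc m" for k
    proof -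
      have "(-1) ^ m = ((-1) ^ (m - k) * (-1) ^ k :: complex)"
        using that by (simp add: power_add[symmetric])
      then show ?thesis
        by (simp add: mult.assoc power_mult_distrib[symmetric])
    qed
    have "(TT ^^ ?n) (wd \<phi> (rev A)) = (\<Sum>k<Suc m. ?s k * ?L k ^ ?n * pr (Suc m) k (wd \<phi> A))"
      if \<phi>: "\<phi> \<in> PiE S (\<lambda>_. I3)" for \<phi>
    proof -
      have "wd \<phi> (rev A) = sc ((-1) ^ m) * antip (wd \<phi> A)"
        using antip_wd[of \<phi> A] m by (simp add: sc_sc_left power_add[symmetric] mult_2[symmetric])
      also have "\<dots> = sc ((-1) ^ m) * (\<Sum>k<Suc m. antip (pr (Suc m) k (wd \<phi> A)))"
        by (subst pr_sum[OF FA(1)[OF \<phi>], symmetric]) (simp only: antip_sum)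
      also have "\<dots> = sc ((-1) ^ m) * (\<Sum>k<Suc m. sc ((-1) ^ k) * pr (Suc m) k (wd \<phi> A))"
        by (simp only: eig_antip[OF pr_Fil[OF FA(1)[OF \<phi>]] eig_pr[OF FA(1)[OF \<phi>]]])
      also have "\<dots> = (\<Sum>k<Suc m. ?s k * pr (Suc m) k (wd \<phi> A))"
        unfolding sum_distrib_left by (intro sum.cong refl) (simp only: sc_sc_left sgn lessThan_iff)
      finally have "(TT ^^ ?n) (wd \<phi> (rev A)) = (\<Sum>k<Suc m. ?s k * (?L k ^ ?n * pr (Suc m) k (wd \<phi> A)))"
        by (simp only: TTs TTc pow[OF \<phi>])
      then show ?thesis by (simp only: mult.assoc)
    qed
    then have "W (us @ rev A @ rev us @ B)
        = (\<Sum>\<phi>\<in>PiE S (\<lambda>_. I3). (\<Sum>k<Suc m. ?s k * ?L k ^ ?n * pr (Suc m) k (wd \<phi> A)) * wd \<phi> B)"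
      using W_nested[OF us, of "rev A" B] A B by simp
    also have "\<dots> = (\<Sum>k<Suc m. ?s k * ?L k ^ ?n * R k)"
      unfolding R_def sum_distrib_left sum_distrib_right
      by (subst sum.swap) (simp only: mult.assoc)
    also have "\<dots> = evC (\<Sum>k\<le>m. ((-1) ^ (m - k) * r k) * [:- kap k, 1:] ^ ?n)"
    proof -
      have "evC ((-1) ^ i) = sc ((-1) ^ i)" for i
        by (induction i) (simp_all add: evC_uminus sc_uminus)
      then show ?thesis
        using ev[of "\<lambda>k. (-1) ^ (m - k)" ?n] by (simp only: lessThan_Suc_atMost)
    qed
    finally show "W (us @ rev A @ rev us @ B)
        = evC (\<Sum>k\<le>m. ((-1) ^ (m - k) * r k) * [:- kap k, 1:] ^ ?n)" .
  qed
qed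

text \<open>A Vandermonde argument by Lagrange interpolation: vanishing power sums give vanishing
  sums weighted by any polynomial in the nodes, in particular by one that is zero at all nodes
  except the \<open>k\<close>-th.\<close>

lemma power_sums_zero:
  fixes g \<mu> :: "nat \<Rightarrow> 'a::idom"
  assumes "finite K" "inj_on \<mu> K" "\<And>n. (\<Sum>k\<in>K. g k * \<mu> k ^ n) = 0" "k \<in> K"
  shows "g k = 0"
proof -
  have poly: "(\<Sum>k\<in>K. g k * poly p (\<mu> k)) = 0" for p
  proof -
    have "g k * poly p (\<mu> k) = (\<Sum>i\<le>degree p. coeff p i * (g k * \<mu> k ^ i))" for k
      unfolding poly_altdef sum_distrib_left by (rule sum.cong) (simp_all add: mult.left_commute)
    then have "(\<Sum>k\<in>K. g k * poly p (\<mu> k)) = (\<Sum>k\<in>K. \<Sum>i\<le>degree p. coeff p i * (g k * \<mu> k ^ i))"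
      by simp
    also have "\<dots> = (\<Sum>i\<le>degree p. coeff p i * (\<Sum>k\<in>K. g k * \<mu> k ^ i))"
      unfolding sum_distrib_left by (rule sum.swap)
    finally show ?thesis using assms(3) by simp
  qed
  define p where "p = (\<Prod>l\<in>K - {k}. [:- \<mu> l, 1:])"
  have p: "poly p x = (\<Prod>l\<in>K - {k}. x - \<mu> l)" for x
    by (simp add: p_def poly_prod)
  have z: "poly p (\<mu> l) = 0" if "l \<in> K - {k}" for l
    unfolding p by (rule prod_zero) (use assms(1) that in auto)
  have "(\<Sum>l\<in>K. g l * poly p (\<mu> l)) = g k * poly p (\<mu> k) + (\<Sum>l\<in>K - {k}. g l * poly p (\<mu> l))"
    by (rule sum.remove[OF assms(1,4)])
  also have "(\<Sum>l\<in>K - {k}. g l * poly p (\<mu> l)) = 0"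
    by (rule sum.neutral) (simp add: z)
  finally have "g k * poly p (\<mu> k) = 0"
    by (simp add: poly)
  moreover have "\<mu> k - \<mu> l \<noteq> 0" if "l \<in> K - {k}" for l
    using inj_onD[OF assms(2), of k l] assms(4) that by auto
  then have "poly p (\<mu> k) \<noteq> 0"
    unfolding p using assms(1) by (simp add: prod_zero_iff)
  ultimately show ?thesis
    by simp
qed

lemma r_coeff_eq:
  assumes w: "\<And>n. w_sl2_graph (m + n) (join_indep m E n) = (\<Sum>k\<le>m. r k * [:- kap k, 1:] ^ n)" and "k \<le> m"
  shows "r_coeff m E k = r k"
proof -
  \<comment> \<open>\<open>r_family\<close> demands zero beyond \<open>m\<close>, where
    \<open>r\<close> is arbitrary.\<close>
  define r' where "r' k = (if k \<le> m then r k else 0)" for k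
  have fam: "r_family m E q \<longleftrightarrow> (\<forall>k>m. q k = 0) \<and>
     (\<forall>n. (\<Sum>k\<le>m. r k * [:- kap k, 1:] ^ n) = (\<Sum>k\<le>m. q k * [:- kap k, 1:] ^ n))" for q
    unfolding r_family_def w kap_def ..
  have eq: "(\<Sum>k\<le>m. r k * [:- kap k, 1:] ^ n) = (\<Sum>k\<le>m. r' k * [:- kap k, 1:] ^ n)" for n
    by (rule sum.cong) (simp_all add: r'_def)
  have r': "r_family m E r'"
    unfolding fam using eq by (simp add: r'_def)
  have inj: "inj_on (\<lambda>k. [:- kap k, 1:]) {..m}"
    by (auto simp: inj_on_def kap_eq_iff)
  have uniq: "q = r'" if "r_family m E q" for q
  proof
    fix k
    have q: "q k = 0" if "k > m" for k
      using \<open>r_family m E q\<close> that unfolding fam by blast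
    have "(\<Sum>k\<le>m. r k * [:- kap k, 1:] ^ n) = (\<Sum>k\<le>m. q k * [:- kap k, 1:] ^ n)" for n
      using \<open>r_family m E q\<close> unfolding fam by blast
    then have z: "(\<Sum>k\<le>m. (q k - r' k) * [:- kap k, 1:] ^ n) = 0" for n
      by (simp only: left_diff_distrib sum_subtractf eq[symmetric] diff_self)
    show "q k = r' k"
    proof (cases "k \<le> m")
      case True
      have "q k - r' k = 0"
        by (rule power_sums_zero[OF finite_atMost inj z]) (use True in simp)
      then show ?thesis by simp
    next
      case False
      then show ?thesis
        using q[of k] by (simp add: r'_def)
    qed
  qed
  have "r_coeff m E = r'"
    unfolding r_coeff_def using r' uniq by (rule the_equality)
  then show ?thesis
    using assms(2) by (simp add: r'_def)
qed

declare One_nat_def [simp]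

subsection \<open>Double occurrence words, interlacement and mutation\<close>

text \<open>Interlacement, phrased through the restriction of the word to two letters, so that
  deleting other letters visibly preserves it.\<close>

definition cr :: "'a list \<Rightarrow> 'a \<Rightarrow> 'a \<Rightarrow> bool" where
  "cr w x y \<longleftrightarrow> x \<noteq> y \<and> filter (\<lambda>z. z = x \<or> z = y) w \<in> {[x, y, x, y], [y, x, y, x]}"

definition cyc :: "'a list \<Rightarrow> 'a list \<Rightarrow> bool" where
  "cyc u w \<longleftrightarrow> (\<exists>xs ys. u = xs @ ys \<and> w = ys @ xs)"

text \<open>Equality as unoriented circular words: rotations and reflections of the circle.\<close>

definition dih :: "'a list \<Rightarrow> 'a list \<Rightarrow> bool" where
  "dih u w \<longleftrightarrow> cyc u w \<or> cyc (rev u) w"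

lemma cyc_append: "cyc (xs @ ys) (ys @ xs)"
  by (auto simp: cyc_def)

lemma cyc_refl [simp]: "cyc u u"
  using cyc_append[of u "[]"] by simp

lemma cyc_sym: "cyc u w \<Longrightarrow> cyc w u"
  by (auto simp: cyc_def)

lemma cyc_rotate: "cyc u w \<longleftrightarrow> (\<exists>n. w = rotate n u)"
proof
  assume "cyc u w"
  then obtain xs ys where "u = xs @ ys" "w = ys @ xs"
    by (auto simp: cyc_def)
  then have "w = rotate (length xs) u"
    by (simp add: rotate_append)
  then show "\<exists>n. w = rotate n u" ..
next
  assume "\<exists>n. w = rotate n u"
  then obtain n where "w = rotate n u" ..
  then have "w = drop (n mod length u) u @ take (n mod length u) u"
    by (simp add: rotate_drop_take)
  then show "cyc u w"
    using cyc_append[of "take (n mod length u) u" "drop (n mod length u) u"] by simp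
qed

lemma cyc_trans [trans]: "cyc u v \<Longrightarrow> cyc v w \<Longrightarrow> cyc u w"
  unfolding cyc_rotate by (metis rotate_rotate)

lemma cyc_rev:
  assumes "cyc u w"
  shows "cyc (rev u) (rev w)"
proof -
  obtain xs ys where "u = xs @ ys" "w = ys @ xs"
    using assms by (auto simp: cyc_def)
  then show ?thesis
    using cyc_append[of "rev ys" "rev xs"] by simp
qed

lemma cyc_mset: "cyc u w \<Longrightarrow> mset u = mset w"
  by (auto simp: cyc_def)

lemma cyc_set: "cyc u w \<Longrightarrow> set u = set w"
  by (auto simp: cyc_def)

lemma cyc_filter: "cyc u w \<Longrightarrow> cyc (filter P u) (filter P w)"
  unfolding cyc_def by (metis filter_append)

lemma cyc_map: "cyc u w \<Longrightarrow> cyc (map f u) (map f w)"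
  unfolding cyc_def by (metis map_append)

lemma dih_refl [simp]: "dih u u"
  by (simp add: dih_def)

lemma dih_sym: "dih u w \<Longrightarrow> dih w u"
  unfolding dih_def by (metis cyc_sym cyc_rev rev_rev_ident)

lemma dih_trans [trans]: "dih u v \<Longrightarrow> dih v w \<Longrightarrow> dih u w"
  unfolding dih_def using cyc_trans cyc_rev by (metis rev_rev_ident)

lemma dih_set: "dih u w \<Longrightarrow> set u = set w"
  by (auto simp: dih_def dest: cyc_set)

lemma dow_mset: "mset u = mset w \<Longrightarrow> dow u \<longleftrightarrow> dow w"
  unfolding dow_def by (metis count_mset set_mset_mset)

lemma dow_cyc: "cyc u w \<Longrightarrow> dow u \<longleftrightarrow> dow w"
  using dow_mset cyc_mset by blast

lemma dow_rev [simp]: "dow (rev u) \<longleftrightarrow> dow u"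
  by (rule dow_mset) simp

lemma dow_dih: "dih u w \<Longrightarrow> dow u \<longleftrightarrow> dow w"
  unfolding dih_def using dow_cyc dow_rev by metis

lemma count_list_filter: "count_list (filter P w) x = (if P x then count_list w x else 0)"
  by (induction w) auto

lemma dow_filter: "dow w \<Longrightarrow> dow (filter P w)"
  by (auto simp: dow_def count_list_filter)

lemma cr_sym: "cr w x y \<longleftrightarrow> cr w y x"
  by (auto simp: cr_def disj_commute)

lemma cr_irrefl [simp]: "\<not> cr w x x"
  by (simp add: cr_def)

lemma alt_rotate:
  assumes "A @ B \<in> {[x, y, x, y], [y, x, y, x]}"
  shows "B @ A \<in> {[x, y, x, y], [y, x, y, x]}"
proof -
  have key: "drop n [p, q, p, q] @ take n [p, q, p, q] \<in> {[p, q, p, q], [q, p, q, p]}" for n :: nat and p q :: 'a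
  proof -
    have "n = 0 \<or> n = 1 \<or> n = 2 \<or> n = 3 \<or> n \<ge> 4"
      by linarith
    then show ?thesis
      by (elim disjE) (simp_all add: numeral_2_eq_2 numeral_3_eq_3)
  qed
  have *: "B @ A = drop (length A) (A @ B) @ take (length A) (A @ B)"
    by simp
  consider "A @ B = [x, y, x, y]" | "A @ B = [y, x, y, x]"
    using assms by blast
  then show ?thesis
  proof cases
    case 1
    show ?thesis
      unfolding * 1 by (rule key)
  next
    case 2
    show ?thesis
      unfolding * 2 using key[of "length A" y x] by blast
  qed
qed

lemma cr_cyc:
  assumes "cyc u w"
  shows "cr u x y \<longleftrightarrow> cr w x y"
proof -
  obtain xs ys where "u = xs @ ys" "w = ys @ xs"
    using assms by (auto simp: cyc_def)
  have "A @ B \<in> {[x, y, x, y], [y, x, y, x]} \<longleftrightarrow> B @ A \<in> {[x, y, x, y], [y, x, y, x]}" for A B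
    by (rule iffI) (erule alt_rotate)+
  then show ?thesis
    by (simp only: cr_def filter_append \<open>u = xs @ ys\<close> \<open>w = ys @ xs\<close>)
qed

lemma cr_rev [simp]: "cr (rev w) x y \<longleftrightarrow> cr w x y"
proof -
  have "rev l \<in> {[x, y, x, y], [y, x, y, x]} \<longleftrightarrow> l \<in> {[x, y, x, y], [y, x, y, x]}" for l
    using rev_swap[of l "[x, y, x, y]"] rev_swap[of l "[y, x, y, x]"] by auto
  then show ?thesis
    by (simp only: cr_def rev_filter[symmetric])
qed

lemma cr_filter: "P x \<Longrightarrow> P y \<Longrightarrow> cr (filter P w) x y \<longleftrightarrow> cr w x y"
proof -
  assume "P x" "P y"
  then have "filter (\<lambda>z. z = x \<or> z = y) (filter P w) = filter (\<lambda>z. z = x \<or> z = y) w"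
    by (auto intro: filter_cong)
  then show ?thesis by (simp only: cr_def)
qed

text \<open>\<open>conj\<close> is the move of \<open>W_conj\<close>; its disjointness condition
  says that the arcs \<open>a\<close> and \<open>c\<close> carry both ends of each of their chords.
  Reversal of a whole word is the case where the other three pieces are empty.\<close>

inductive mut :: "'a list \<Rightarrow> 'a list \<Rightarrow> bool" where
  refl: "mut u u"
| trans [trans]: "mut u v \<Longrightarrow> mut v w \<Longrightarrow> mut u w"
| rot: "mut (xs @ ys) (ys @ xs)"
| conj: "set (a @ c) \<inter> set (b @ d) = {} \<Longrightarrow> mut (a @ b @ c @ d) (rev c @ b @ rev a @ d)"

lemma mut_mset: "mut u w \<Longrightarrow> mset u = mset w"
  by (induction rule: mut.induct) simp_all

lemma mut_set: "mut u w \<Longrightarrow> set u = set w"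
  using mut_mset mset_eq_setD by blast

lemma mut_dow: "mut u w \<Longrightarrow> dow u \<longleftrightarrow> dow w"
  using dow_mset mut_mset by blast

lemma mut_sym: "mut u w \<Longrightarrow> mut w u"
proof (induction rule: mut.induct)
  case (conj a c b d)
  then have "mut (rev c @ b @ rev a @ d) (rev (rev a) @ b @ rev (rev c) @ d)"
    by (intro mut.conj) auto
  then show ?case by simp
qed (auto intro: mut.intros)

lemma mut_cyc: "cyc u w \<Longrightarrow> mut u w"
  by (auto simp: cyc_def intro: mut.rot)

lemma mut_rev: "mut u (rev u)"
  using mut.conj[of u "[]" "[]" "[]"] by simp

lemma mut_dih: "dih u w \<Longrightarrow> mut u w"
  unfolding dih_def using mut_cyc mut_rev mut.trans by blast

text \<open>\<open>conj\<close> is applied to the complementary arcs \<open>q\<close> and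
  \<open>r @ p\<close>; a reversal of the whole word then restores these and leaves \<open>a\<close>
  and \<open>c\<close> reversed in place.\<close>

lemma mut_flip:
  assumes "set (a @ c) \<inter> set (p @ q @ r) = {}"
  shows "mut (p @ a @ q @ c @ r) (p @ rev a @ q @ rev c @ r)"
proof -
  have "mut (p @ a @ q @ c @ r) (q @ c @ (r @ p) @ a)"
    using mut.rot[of "p @ a" "q @ c @ r"] by simp
  also have "mut (q @ c @ (r @ p) @ a) (rev (r @ p) @ c @ rev q @ a)"
    using assms by (intro mut.conj) auto
  also have "mut (rev (r @ p) @ c @ rev q @ a) (rev (rev (r @ p) @ c @ rev q @ a))"
    by (rule mut_rev)
  also have "mut (rev (rev (r @ p) @ c @ rev q @ a)) (p @ rev a @ q @ rev c @ r)"
    using mut.rot[of "rev a @ q @ rev c @ r" p] by simp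
  finally show ?thesis .
qed

lemma mut_conj_lin:
  assumes "set (a @ c) \<inter> set (p @ q @ r) = {}"
  shows "mut (p @ a @ q @ c @ r) (p @ rev c @ q @ rev a @ r)"
proof -
  have "mut (p @ a @ q @ c @ r) (a @ q @ c @ (r @ p))"
    using mut.rot[of p "a @ q @ c @ r"] by simp
  also have "mut (a @ q @ c @ (r @ p)) (rev c @ q @ rev a @ (r @ p))"
    using assms by (intro mut.conj) auto
  also have "mut (rev c @ q @ rev a @ (r @ p)) (p @ rev c @ q @ rev a @ r)"
    using mut.rot[of "rev c @ q @ rev a @ r" p] by simp
  finally show ?thesis .
qed

text \<open>The product of the two preceding moves; with the identity the three moves form a Klein
  four-group acting on the pair of arcs.\<close>

lemma mut_swap:
  assumes "set (a @ c) \<inter> set (p @ q @ r) = {}"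
  shows "mut (p @ a @ q @ c @ r) (p @ c @ q @ a @ r)"
proof -
  have "mut (p @ rev c @ q @ rev a @ r) (p @ rev (rev c) @ q @ rev (rev a) @ r)"
    by (rule mut_flip) (use assms in auto)
  then show ?thesis
    using mut_conj_lin[OF assms] mut.trans by fastforce
qed

lemma filter_replicate_count:
  assumes "y \<notin> set w"
  shows "filter (\<lambda>z. z = x \<or> z = y) w = replicate (count_list w x) x"
  using assms by (induction w) auto

lemma cr_blocks:
  assumes "i \<le> 2" "j \<le> 2" "x \<noteq> y"
  shows "replicate i x @ replicate j y @ replicate (2 - i) x @ replicate (2 - j) y \<in> {[x, y, x, y], [y, x, y, x]}
     \<longleftrightarrow> i = 1 \<and> j = 1"
proof -
  have "i = 0 \<or> i = 1 \<or> i = 2" "j = 0 \<or> j = 1 \<or> j = 2"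
    using assms by auto
  then show ?thesis
    using assms(3) by (elim disjE) (simp_all add: numeral_2_eq_2)
qed

text \<open>Only a pair with one chord on the arcs and one off them needs an argument: it crosses
  exactly if each of the two chords has its ends on different arcs, a condition that the move
  respects. Any other pair is at most reversed as a whole.\<close>

lemma mut_cr:
  assumes "mut u w" "dow u"
  shows "cr u x y \<longleftrightarrow> cr w x y"
  using assms
proof (induction rule: mut.induct)
  case (trans u v w)
  then show ?case using mut_dow by blast
next
  case (rot xs ys)
  show ?case by (rule cr_cyc[OF cyc_append])
next
  case (conj a c b d)
  define f where "f = filter (\<lambda>z. z = x \<or> z = y)"
  let ?A = "{[x, y, x, y], [y, x, y, x]}"
  have mixed: "cr (a @ b @ c @ d) x' y' \<longleftrightarrow> cr (rev c @ b @ rev a @ d) x' y'"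
    if x: "x' \<in> set (a @ c)" and y: "y' \<in> set (b @ d)" for x' y'
  proof -
    have n: "y' \<notin> set a" "y' \<notin> set c" "x' \<notin> set b" "x' \<notin> set d"
      using conj.hyps x y by auto
    have "count_list (a @ b @ c @ d) x' = 2" "count_list (a @ b @ c @ d) y' = 2"
      using conj.prems x y unfolding dow_def by (metis UnCI set_append Un_iff)+
    then have cnt: "count_list c x' = 2 - count_list a x'" "count_list a x' \<le> 2"
       "count_list d y' = 2 - count_list b y'" "count_list b y' \<le> 2"
      using n by auto
    have ne: "x' \<noteq> y'" using n x by auto
    have fb: "filter (\<lambda>z. z = x' \<or> z = y') b = replicate (count_list b y') y'"
      "filter (\<lambda>z. z = x' \<or> z = y') d = replicate (count_list d y') y'"
      using filter_replicate_count[of x' b y'] filter_replicate_count[of x' d y'] n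
      by (simp_all add: disj_commute)
    have fa: "filter (\<lambda>z. z = x' \<or> z = y') a = replicate (count_list a x') x'"
      "filter (\<lambda>z. z = x' \<or> z = y') c = replicate (count_list c x') x'"
      using filter_replicate_count[of y' a x'] filter_replicate_count[of y' c x'] n by simp_all
    have 1: "cr (a @ b @ c @ d) x' y' \<longleftrightarrow> count_list a x' = 1 \<and> count_list b y' = 1"
      using cr_blocks[OF cnt(2,4) ne] ne unfolding cr_def filter_append fa fb cnt(1,3) by blast
    have "count_list c x' \<le> 2" "count_list a x' = 2 - count_list c x'"
      using cnt by auto
    then have 2: "cr (rev c @ b @ rev a @ d) x' y' \<longleftrightarrow> count_list c x' = 1 \<and> count_list b y' = 1"
      using cr_blocks[of "count_list c x'" "count_list b y'", OF _ cnt(4) ne] ne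
      unfolding cr_def filter_append rev_filter[symmetric] fa fb cnt(3) rev_replicate by metis
    show ?thesis
      unfolding 1 2 using cnt by auto
  qed
  have nil: "f xs = []" if "x \<notin> set xs" "y \<notin> set xs" for xs
    using that by (auto simp: f_def filter_empty_conv)
  have len: "f xs = [] \<or> set (f xs) \<subseteq> {x, y}" for xs
    by (auto simp: f_def)
  consider "x \<in> set (a @ c)" "y \<in> set (b @ d)" | "y \<in> set (a @ c)" "x \<in> set (b @ d)"
    | "x \<notin> set (b @ d)" "y \<notin> set (b @ d)" | "x \<notin> set (a @ c)" "y \<notin> set (a @ c)"
    using conj.hyps by blast
  then show ?case
  proof cases
    case 1
    then show ?thesis by (rule mixed)
  next
    case 2
    then show ?thesis using mixed cr_sym by metis
  next
    case 3
    then have "f b = []" "f d = []"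
      using nil by auto
    then have "f (a @ b @ c @ d) = f (a @ c)" "f (rev c @ b @ rev a @ d) = f (rev (a @ c))"
      by (auto simp: f_def)
    then have "cr (a @ b @ c @ d) x y \<longleftrightarrow> cr (a @ c) x y"
      "cr (rev c @ b @ rev a @ d) x y \<longleftrightarrow> cr (rev (a @ c)) x y"
      unfolding cr_def f_def by simp_all
    then show ?thesis using cr_rev[of "a @ c" x y] by blast
  next
    case 4
    then have "f a = []" "f c = []"
      using nil by auto
    then have "f (a @ b @ c @ d) = f (rev c @ b @ rev a @ d)"
      by (auto simp: f_def rev_filter[symmetric])
    then show ?thesis
      unfolding cr_def f_def by (simp only:)
  qed
qed simp

lemma mut_W: "mut u w \<Longrightarrow> dow u \<Longrightarrow> W u = W w"
proof (induction rule: mut.induct)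
  case (trans u v w)
  then show ?case using mut_dow by metis
next
  case (conj a c b d)
  then show ?case using W_conj by metis
next
  case (rot xs ys)
  then show ?case by (rule W_rotate)
qed simp

subsection \<open>Substituting a two-legged tangle for a chord\<close>

text \<open>A mutation may exchange the two occurrences of a chord \<open>b\<close>. They are
  therefore tagged by \<open>Inr False\<close> and \<open>Inr True\<close>, so that it stays known
  which one is to be replaced by \<alpha> and which by \<gamma>.\<close>

fun untag :: "'a \<Rightarrow> 'a + bool \<Rightarrow> 'a" where
  "untag b (Inl z) = z"
| "untag b (Inr _) = b"

fun subst_tag :: "'a list \<Rightarrow> 'a list \<Rightarrow> 'a + bool \<Rightarrow> 'a list" where
  "subst_tag \<alpha> \<gamma> (Inl z) = [z]"
| "subst_tag \<alpha> \<gamma> (Inr False) = \<alpha>"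
| "subst_tag \<alpha> \<gamma> (Inr True) = \<gamma>"

definition expand :: "'a list \<Rightarrow> 'a list \<Rightarrow> ('a + bool) list \<Rightarrow> 'a list" where
  "expand \<alpha> \<gamma> w = concat (map (subst_tag \<alpha> \<gamma>) w)"

lemma expand_simps [simp]:
  "expand \<alpha> \<gamma> [] = []" "expand \<alpha> \<gamma> (t # w) = subst_tag \<alpha> \<gamma> t @ expand \<alpha> \<gamma> w"
  "expand \<alpha> \<gamma> (u @ w) = expand \<alpha> \<gamma> u @ expand \<alpha> \<gamma> w"
  by (simp_all add: expand_def)

lemma rev_expand: "rev (expand \<alpha> \<gamma> w) = expand (rev \<alpha>) (rev \<gamma>) (rev w)"
proof (induction w)
  case (Cons t w)
  have "rev (subst_tag \<alpha> \<gamma> t) = subst_tag (rev \<alpha>) (rev \<gamma>) t"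
  proof (cases t)
    case (Inr s)
    then show ?thesis by (cases s) simp_all
  qed simp
  then show ?case using Cons by simp
qed simp

lemma expand_untagged: "Inr False \<notin> set w \<Longrightarrow> Inr True \<notin> set w \<Longrightarrow> expand \<alpha> \<gamma> w = expand \<alpha>' \<gamma>' w"
proof (induction w)
  case (Cons t w)
  then have "subst_tag \<alpha> \<gamma> t = subst_tag \<alpha>' \<gamma>' t"
    by (cases t) (simp, metis (full_types) list.set_intros(1))
  then show ?case using Cons by simp
qed simp

lemma set_expand: "set (expand \<alpha> \<gamma> w) \<subseteq> {z. Inl z \<in> set w} \<union> (if \<exists>t. Inr t \<in> set w then set \<alpha> \<union> set \<gamma> else {})"
proof
  fix z assume "z \<in> set (expand \<alpha> \<gamma> w)"
  then obtain t where t: "t \<in> set w" "z \<in> set (subst_tag \<alpha> \<gamma> t)"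
    by (auto simp: expand_def)
  show "z \<in> {z. Inl z \<in> set w} \<union> (if \<exists>t. Inr t \<in> set w then set \<alpha> \<union> set \<gamma> else {})"
  proof (cases t)
    case (Inl y)
    then show ?thesis using t by auto
  next
    case (Inr c)
    then have "z \<in> set \<alpha> \<union> set \<gamma>" using t by (cases c) auto
    then show ?thesis using t Inr by auto
  qed
qed

lemma expand_memD:
  assumes "z \<in> set (expand \<alpha> \<gamma> w)"
  shows "Inl z \<in> set w \<or> ((\<exists>t. Inr t \<in> set w) \<and> z \<in> set \<alpha> \<union> set \<gamma>)"
  using subsetD[OF set_expand assms] by (cases "\<exists>t. Inr t \<in> set w") simp_all

definition tagged :: "'a \<Rightarrow> ('a + bool) list \<Rightarrow> bool" where
  "tagged b w \<longleftrightarrow> Inl b \<notin> set w \<and> count_list w (Inr False) = 1 \<and> count_list w (Inr True) = 1"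

lemma tagged_mset: "mset u = mset w \<Longrightarrow> tagged b u \<longleftrightarrow> tagged b w"
  unfolding tagged_def by (metis count_mset set_mset_mset)

lemma taggedE:
  assumes "tagged b w"
  obtains p q r where "w = p @ Inr False # q @ Inr True # r"
      "\<And>t. Inr t \<notin> set (p @ q @ r)" "Inl b \<notin> set (p @ q @ r)"
    | p q r where "w = p @ Inr True # q @ Inr False # r"
      "\<And>t. Inr t \<notin> set (p @ q @ r)" "Inl b \<notin> set (p @ q @ r)"
proof -
  from assms have c1: "count_list w (Inr False) = 1" and c2: "count_list w (Inr True) = 1"
    and b: "Inl b \<notin> set w" by (auto simp: tagged_def)
  obtain p s where w: "w = p @ Inr False # s" "Inr False \<notin> set p" "Inr False \<notin> set s"
    using count_list_1E[OF c1] by metis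
  have "count_list p (Inr True) + count_list s (Inr True) = 1"
    using c2 w by simp
  then consider "count_list p (Inr True) = 1" "count_list s (Inr True) = 0"
    | "count_list p (Inr True) = 0" "count_list s (Inr True) = 1"
    by linarith
  then show thesis
  proof cases
    case 1
    obtain p1 p2 where p: "p = p1 @ Inr True # p2" "Inr True \<notin> set p1" "Inr True \<notin> set p2"
      using count_list_1E[OF 1(1)] by metis
    have "Inr t \<notin> set (p1 @ p2 @ s)" for t
      using p w 1(2) by (cases t) (auto simp: count_list_0_iff)
    then show thesis
      using that(2)[of p1 p2 s] p w b by auto
  next
    case 2
    obtain s1 s2 where s: "s = s1 @ Inr True # s2" "Inr True \<notin> set s1" "Inr True \<notin> set s2"
      using count_list_1E[OF 2(2)] by metis
    have "Inr t \<notin> set (p @ s1 @ s2)" for t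
      using s w 2(1) by (cases t) (auto simp: count_list_0_iff)
    then show thesis
      using that(1)[of p s1 s2] s w b by auto
  qed
qed

text \<open>Corrects a \<open>conj\<close> step whose reversed arcs contain the tags: the
  substituted pieces come out reversed, and \<open>mut_flip\<close> turns both back in
  place.\<close>

lemma mut_tag_flip:
  assumes t: "tagged b w" and fresh: "\<And>z. Inl z \<in> set w \<Longrightarrow> z \<notin> set \<alpha> \<union> set \<gamma>"
  shows "mut (expand (rev \<alpha>) (rev \<gamma>) w) (expand \<alpha> \<gamma> w)"
proof -
  have *: "mut (p' @ rev a @ q' @ rev c @ r') (p' @ a @ q' @ c @ r')"
    if "set (a @ c) \<inter> set (p' @ q' @ r') = {}" for a c p' q' r' :: "'a list"
    using mut_flip[of "rev a" "rev c" p' q' r'] that by simp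
  have f: "expand (rev \<alpha>) (rev \<gamma>) x = expand \<alpha> \<gamma> x" "set (expand \<alpha> \<gamma> x) \<subseteq> {z. Inl z \<in> set x}"
    if "\<And>t. Inr t \<notin> set x" for x
    using expand_untagged[of x] set_expand[of \<alpha> \<gamma> x] that by auto
  from t show ?thesis
  proof (cases rule: taggedE)
    case (1 p q r)
    then have n: "\<And>t. Inr t \<notin> set p" "\<And>t. Inr t \<notin> set q" "\<And>t. Inr t \<notin> set r" by auto
    have "mut (expand \<alpha> \<gamma> p @ rev \<alpha> @ expand \<alpha> \<gamma> q @ rev \<gamma> @ expand \<alpha> \<gamma> r)
       (expand \<alpha> \<gamma> p @ \<alpha> @ expand \<alpha> \<gamma> q @ \<gamma> @ expand \<alpha> \<gamma> r)"
      using f(2)[OF n(1)] f(2)[OF n(2)] f(2)[OF n(3)] fresh 1(1) by (intro *) fastforce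
    then show ?thesis
      using f(1)[OF n(1)] f(1)[OF n(2)] f(1)[OF n(3)] 1(1) by simp
  next
    case (2 p q r)
    then have n: "\<And>t. Inr t \<notin> set p" "\<And>t. Inr t \<notin> set q" "\<And>t. Inr t \<notin> set r" by auto
    have "mut (expand \<alpha> \<gamma> p @ rev \<gamma> @ expand \<alpha> \<gamma> q @ rev \<alpha> @ expand \<alpha> \<gamma> r)
       (expand \<alpha> \<gamma> p @ \<gamma> @ expand \<alpha> \<gamma> q @ \<alpha> @ expand \<alpha> \<gamma> r)"
      using f(2)[OF n(1)] f(2)[OF n(2)] f(2)[OF n(3)] fresh 2(1) by (intro *) fastforce
    then show ?thesis
      using f(1)[OF n(1)] f(1)[OF n(2)] f(1)[OF n(3)] 2(1) by simp
  qed
qed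

lemma map_eq_appendE:
  assumes "map f w = xs @ ys"
  obtains u v where "w = u @ v" "map f u = xs" "map f v = ys"
proof (rule that[of "take (length xs) w" "drop (length xs) w"])
  show "map f (take (length xs) w) = xs" "map f (drop (length xs) w) = ys"
    by (simp_all only: take_map[symmetric] drop_map[symmetric] assms) simp_all
qed simp

text \<open>Induction over the moves. In a \<open>conj\<close> step both tags are on the moved arcs
  or both are off them, since they come from one letter; in the first case the reversal of the
  substituted pieces is undone by \<open>mut_tag_flip\<close>.\<close>

lemma mut_lift_tagged:
  assumes "mut P Q" "map (untag b) P' = P" "tagged b P'"
    and fresh: "(set \<alpha> \<union> set \<gamma>) \<inter> (set P - {b}) = {}"
  shows "\<exists>Q'. map (untag b) Q' = Q \<and> mset Q' = mset P' \<and> mut (expand \<alpha> \<gamma> P') (expand \<alpha> \<gamma> Q')"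
  using assms
proof (induction arbitrary: P' rule: mut.induct)
  case (refl u)
  then show ?case using mut.refl by blast
next
  case (trans u v w)
  obtain V' where V: "map (untag b) V' = v" "mset V' = mset P'" "mut (expand \<alpha> \<gamma> P') (expand \<alpha> \<gamma> V')"
    using trans.IH(1)[OF trans.prems] by blast
  moreover have "set v = set u"
    using mut_set[OF trans.hyps(1)] by simp
  moreover have "tagged b V'"
    using trans.prems(2) tagged_mset[OF V(2)] by simp
  ultimately obtain W' where "map (untag b) W' = w" "mset W' = mset V'" "mut (expand \<alpha> \<gamma> V') (expand \<alpha> \<gamma> W')"
    using trans.IH(2)[of V'] trans.prems(3) by auto
  then show ?case
    using V(2) mut.trans[OF V(3)] by auto
next
  case (rot xs ys)
  then obtain x' y' where "P' = x' @ y'" "map (untag b) x' = xs" "map (untag b) y' = ys"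
    using map_eq_appendE by metis
  then show ?case
    using mut.rot[of "expand \<alpha> \<gamma> x'" "expand \<alpha> \<gamma> y'"]
    by (intro exI[of _ "y' @ x'"]) simp
next
  case (conj a c b0 d)
  obtain a' b' c' d' where P': "P' = a' @ b' @ c' @ d'" "map (untag b) a' = a" "map (untag b) b' = b0"
      "map (untag b) c' = c" "map (untag b) d' = d"
  proof -
    from conj.prems(1) obtain a' x where 1: "P' = a' @ x" "map (untag b) a' = a" "map (untag b) x = b0 @ c @ d"
      by (rule map_eq_appendE)
    from 1(3) obtain b' y where 2: "x = b' @ y" "map (untag b) b' = b0" "map (untag b) y = c @ d"
      by (rule map_eq_appendE)
    from 2(3) obtain c' d' where 3: "y = c' @ d'" "map (untag b) c' = c" "map (untag b) d' = d"
      by (rule map_eq_appendE)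
    have "P' = a' @ b' @ c' @ d'"
      unfolding 1(1) 2(1) 3(1) by simp
    then show thesis
      using 1(2) 2(2) 3(2,3) by (rule that)
  qed
  let ?X = "a' @ c'" and ?Y = "b' @ d'"
  have X: "set (a @ c) = untag b ` set ?X" and Y: "set (b0 @ d) = untag b ` set ?Y"
    using P' by auto
  have nb: "Inl b \<notin> set P'"
    using conj.prems(2) by (simp add: tagged_def)
  have fr: "z \<notin> set \<alpha> \<union> set \<gamma>" if "Inl z \<in> set P'" for z
  proof -
    have "z \<in> set (a @ b0 @ c @ d) - {b}"
    proof -
      have "z \<in> untag b ` set P'"
        using image_eqI[of z "untag b" "Inl z" "set P'"] that by simp
      then have "z \<in> set (a @ b0 @ c @ d)"
        unfolding conj.prems(1)[symmetric] by simp
      moreover have "z \<noteq> b"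
        using that nb by auto
      ultimately show ?thesis by simp
    qed
    then show ?thesis
      using conj.prems(3) by blast
  qed
  have tagXY: "\<not> (Inr s \<in> set ?X \<and> Inr t \<in> set ?Y)" for s t
  proof
    assume "Inr s \<in> set ?X \<and> Inr t \<in> set ?Y"
    then have "untag b (Inr s) \<in> set (a @ c)" "untag b (Inr t) \<in> set (b0 @ d)"
      unfolding X Y by (blast intro: imageI)+
    then have "b \<in> set (a @ c)" "b \<in> set (b0 @ d)"
      by simp_all
    then show False using conj.hyps by blast
  qed
  have dis: "set (expand \<alpha> \<gamma> a' @ expand \<alpha> \<gamma> c') \<inter> set (expand \<alpha> \<gamma> b' @ expand \<alpha> \<gamma> d') = {}"
  proof (rule ccontr)
    assume "\<not> ?thesis"
    then obtain z where "z \<in> set (expand \<alpha> \<gamma> ?X)" "z \<in> set (expand \<alpha> \<gamma> ?Y)"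
      by auto
    then have zX: "Inl z \<in> set ?X \<or> ((\<exists>t. Inr t \<in> set ?X) \<and> z \<in> set \<alpha> \<union> set \<gamma>)"
      and zY: "Inl z \<in> set ?Y \<or> ((\<exists>t. Inr t \<in> set ?Y) \<and> z \<in> set \<alpha> \<union> set \<gamma>)"
      by (simp_all only: expand_memD)
    have inP: "Inl z \<in> set P'" if "Inl z \<in> set ?X \<or> Inl z \<in> set ?Y"
      using that P'(1) by auto
    have nxy: "\<not> (Inl z \<in> set ?X \<and> Inl z \<in> set ?Y)"
    proof
      assume "Inl z \<in> set ?X \<and> Inl z \<in> set ?Y"
      then have "untag b (Inl z) \<in> set (a @ c)" "untag b (Inl z) \<in> set (b0 @ d)"
        unfolding X Y by (blast intro: imageI)+
      then show False
        using conj.hyps by blast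
    qed
    show False
    proof (cases "Inl z \<in> set ?X \<or> Inl z \<in> set ?Y")
      case True
      then have "z \<notin> set \<alpha> \<union> set \<gamma>"
        using fr inP by simp
      then show False
        using zX zY nxy by argo
    next
      case False
      then have "\<exists>s. Inr s \<in> set ?X" "\<exists>t. Inr t \<in> set ?Y"
        using zX zY by argo+
      then obtain s t where "Inr s \<in> set ?X" "Inr t \<in> set ?Y"
        by (elim exE)
      then show False
        using tagXY[of s t] by simp
    qed
  qed
  let ?Q = "rev c' @ b' @ rev a' @ d'"
  have ms: "mset ?Q = mset P'"
    by (simp add: P'(1))
  have tQ: "tagged b ?Q"
    using conj.prems(2) tagged_mset[OF ms] by simp
  have 1: "mut (expand \<alpha> \<gamma> P') (rev (expand \<alpha> \<gamma> c') @ expand \<alpha> \<gamma> b' @ rev (expand \<alpha> \<gamma> a') @ expand \<alpha> \<gamma> d')"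
    using mut.conj[OF dis] by (simp add: P'(1))
  have "mut (rev (expand \<alpha> \<gamma> c') @ expand \<alpha> \<gamma> b' @ rev (expand \<alpha> \<gamma> a') @ expand \<alpha> \<gamma> d') (expand \<alpha> \<gamma> ?Q)"
  proof (cases "\<exists>t. Inr t \<in> set ?X")
    case True
    then have "Inr t \<notin> set b'" "Inr t \<notin> set d'" for t
      using tagXY by auto
    then have "expand \<alpha> \<gamma> b' = expand (rev \<alpha>) (rev \<gamma>) b'" "expand \<alpha> \<gamma> d' = expand (rev \<alpha>) (rev \<gamma>) d'"
      using expand_untagged by metis+
    then have "rev (expand \<alpha> \<gamma> c') @ expand \<alpha> \<gamma> b' @ rev (expand \<alpha> \<gamma> a') @ expand \<alpha> \<gamma> d'
        = expand (rev \<alpha>) (rev \<gamma>) ?Q"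
      by (simp add: rev_expand)
    moreover have "mut (expand (rev \<alpha>) (rev \<gamma>) ?Q) (expand \<alpha> \<gamma> ?Q)"
    proof (rule mut_tag_flip[OF tQ])
      fix z assume "Inl z \<in> set ?Q"
      then have "Inl z \<in> set P'" by (auto simp: P'(1))
      then show "z \<notin> set \<alpha> \<union> set \<gamma>" by (rule fr)
    qed
    ultimately show ?thesis by simp
  next
    case False
    then have "Inr t \<notin> set (rev a')" "Inr t \<notin> set (rev c')" for t
      by auto
    then have "expand (rev \<alpha>) (rev \<gamma>) (rev a') = expand \<alpha> \<gamma> (rev a')"
      "expand (rev \<alpha>) (rev \<gamma>) (rev c') = expand \<alpha> \<gamma> (rev c')"
      using expand_untagged by metis+
    then show ?thesis
      by (simp add: rev_expand mut.refl)
  qed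
  then have "mut (expand \<alpha> \<gamma> P') (expand \<alpha> \<gamma> ?Q)"
    using 1 mut.trans by blast
  moreover have "map (untag b) ?Q = rev c @ b0 @ rev a @ d"
    using P' by (simp add: rev_map[symmetric])
  ultimately show ?case
    using ms by blast
qed

lemma untag_map_Inl: "map (untag b) (map Inl p) = p"
  by (induction p) auto

lemma expand_map_Inl: "expand \<alpha> \<gamma> (map Inl p) = p"
  by (induction p) auto

lemma split_unique:
  assumes "p @ b # q = p' @ b # q'" "b \<notin> set p" "b \<notin> set p'"
  shows "p = p' \<and> q = q'"
  using assms by (auto simp: append_eq_append_conv2 Cons_eq_append_conv append_eq_Cons_conv)

lemma untag_expand:
  assumes "map (untag b) p = q" "\<And>t. Inr t \<notin> set p"
  shows "expand \<alpha> \<gamma> p = q"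
  using assms
proof (induction p arbitrary: q)
  case (Cons t p)
  then obtain z where "t = Inl z"
    by (cases t) auto
  then show ?case using Cons by auto
qed simp

text \<open>A tangle with two arcs may replace a chord throughout a mutation. If the two tags end up
  exchanged, \<open>mut_swap\<close> puts the arcs in the desired order.\<close>

lemma mut_lift:
  assumes mut: "mut (p1 @ b # p2 @ b # p3) (q1 @ b # q2 @ b # q3)"
    and b: "b \<notin> set (p1 @ p2 @ p3)"
    and fresh: "(set \<alpha> \<union> set \<gamma>) \<inter> set (p1 @ p2 @ p3) = {}"
  shows "mut (p1 @ \<alpha> @ p2 @ \<gamma> @ p3) (q1 @ \<alpha> @ q2 @ \<gamma> @ q3)"
proof -
  have bq: "b \<notin> set (q1 @ q2 @ q3)"
  proof -
    have "mset (p1 @ b # p2 @ b # p3) = mset (q1 @ b # q2 @ b # q3)"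
      using mut by (rule mut_mset)
    then have "mset (p1 @ p2 @ p3) = mset (q1 @ q2 @ q3)"
      by simp
    then show ?thesis
      using b mset_eq_setD by metis
  qed
  have sets: "set (q1 @ q2 @ q3) = set (p1 @ p2 @ p3)"
  proof -
    have "insert b (set (q1 @ q2 @ q3)) = insert b (set (p1 @ p2 @ p3))"
      using mut_set[OF mut] by auto
    then show ?thesis using b bq by (metis insert_ident)
  qed
  let ?P = "map Inl p1 @ Inr False # map Inl p2 @ Inr True # map Inl p3"
  have 1: "map (untag b) ?P = p1 @ b # p2 @ b # p3"
    by (simp add: untag_map_Inl del: map_map)
  have ninr: "Inr t \<notin> set (map Inl p :: ('a + bool) list)" for t p
    by auto
  have 2: "tagged b ?P"
    using b by (auto simp: tagged_def count_list_0_iff)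
  have 3: "(set \<alpha> \<union> set \<gamma>) \<inter> (set (p1 @ b # p2 @ b # p3) - {b}) = {}"
    using fresh by auto
  obtain Q' where Q': "map (untag b) Q' = q1 @ b # q2 @ b # q3" "mset Q' = mset ?P"
      "mut (expand \<alpha> \<gamma> ?P) (expand \<alpha> \<gamma> Q')"
    using mut_lift_tagged[OF mut 1 2 3] by blast
  have m: "mut (p1 @ \<alpha> @ p2 @ \<gamma> @ p3) (expand \<alpha> \<gamma> Q')"
    using Q'(3) by (simp add: expand_map_Inl)
  have split: "map (untag b) p = q1 \<and> map (untag b) q = q2 \<and> map (untag b) r = q3"
    if "Q' = p @ Inr s # q @ Inr t # r" "Inl b \<notin> set (p @ q @ r)" "\<And>t. Inr t \<notin> set (p @ q @ r)" for p q r s t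
  proof -
    have nb: "b \<notin> set (map (untag b) x)" if "Inl b \<notin> set x" "\<And>t. Inr t \<notin> set x" for x :: "('a + bool) list"
    proof
      assume "b \<in> set (map (untag b) x)"
      then obtain y where y: "y \<in> set x" "untag b y = b" by auto
      show False
      proof (cases y)
        case (Inl z)
        then show False using y that(1) by simp
      next
        case (Inr s)
        then show False using y that(2) by simp
      qed
    qed
    have "map (untag b) p @ b # (map (untag b) q @ b # map (untag b) r) = q1 @ b # (q2 @ b # q3)"
      using Q'(1) that(1) by simp
    then have "map (untag b) p = q1" "map (untag b) q @ b # map (untag b) r = q2 @ b # q3"
      using split_unique[of _ b] bq nb[of p] that by (metis Un_iff set_append)+
    then show ?thesis
      using split_unique[of "map (untag b) q" b] bq nb[of q] that by (metis Un_iff set_append)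
  qed
  have "tagged b Q'"
    using 2 tagged_mset[OF Q'(2)] by simp
  then show ?thesis
  proof (cases rule: taggedE)
    case (1 p q r)
    then have e: "expand \<alpha> \<gamma> p = q1" "expand \<alpha> \<gamma> q = q2" "expand \<alpha> \<gamma> r = q3"
      using split[OF 1(1,3,2)] untag_expand[of b p] untag_expand[of b q] untag_expand[of b r] by auto
    show ?thesis
      using m e 1(1) by simp
  next
    case (2 p q r)
    then have e: "expand \<alpha> \<gamma> p = q1" "expand \<alpha> \<gamma> q = q2" "expand \<alpha> \<gamma> r = q3"
      using split[OF 2(1,3,2)] untag_expand[of b p] untag_expand[of b q] untag_expand[of b r] by auto
    have "mut (p1 @ \<alpha> @ p2 @ \<gamma> @ p3) (q1 @ \<gamma> @ q2 @ \<alpha> @ q3)"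
      using m e 2(1) by simp
    also have "mut (q1 @ \<gamma> @ q2 @ \<alpha> @ q3) (q1 @ \<alpha> @ q2 @ \<gamma> @ q3)"
      using fresh sets by (intro mut_swap) auto
    finally show ?thesis .
  qed
qed

subsection \<open>Cuts of a circular word\<close>

fun ps :: "('a \<Rightarrow> 'a \<Rightarrow> nat) \<Rightarrow> 'a list \<Rightarrow> nat" where
  "ps f (a # b # xs) = f a b + ps f (b # xs)"
| "ps f xs = 0"

text \<open>Cut sizes, degrees and edge multiplicities of the four-valent graph are all sums of this
  kind over the steps of the closed circuit.\<close>

definition cs :: "('a \<Rightarrow> 'a \<Rightarrow> nat) \<Rightarrow> 'a list \<Rightarrow> nat" where
  "cs f w = (if w = [] then 0 else ps f (w @ [hd w]))"

lemma ps_append: "ps f (xs @ a # ys) = ps f (xs @ [a]) + ps f (a # ys)"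
proof (induction xs)
  case (Cons x xs)
  then show ?case by (cases xs) auto
qed simp

lemma ps_append2: "xs \<noteq> [] \<Longrightarrow> ys \<noteq> [] \<Longrightarrow> ps f (xs @ ys) = ps f xs + f (last xs) (hd ys) + ps f ys"
proof (induction xs)
  case (Cons x xs)
  then show ?case by (cases xs; cases ys) auto
qed simp

lemma cs_rot: "cs f (xs @ ys) = cs f (ys @ xs)"
proof (cases "xs = [] \<or> ys = []")
  case False
  then obtain a x b y where "xs = a # x" "ys = b # y"
    by (meson neq_Nil_conv)
  then show ?thesis
    using ps_append[of f "a # x" b "y @ [a]"] ps_append[of f "b # y" a "x @ [b]"] by (simp add: cs_def)
qed auto

lemma cs_cyc: "cyc u w \<Longrightarrow> cs f u = cs f w"
  by (auto simp: cyc_def cs_rot)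

lemma ps_rev:
  assumes "\<And>a b. f a b = f b a"
  shows "ps f (rev xs) = ps f xs"
proof (induction xs rule: induct_list012)
  case (3 a b xs)
  then show ?case
    using ps_append[of f "rev xs" b "[a]"] assms[of a b] by simp
qed auto

lemma cs_rev:
  assumes "\<And>a b. f a b = f b a"
  shows "cs f (rev w) = cs f w"
proof (cases w rule: rev_cases)
  case (snoc xs x)
  show ?thesis
  proof (cases xs)
    case (Cons y ys)
    have "cs f (rev w) = cs f (rev ys @ [y] @ [x])"
      using snoc Cons cs_rot[of f "[x]" "rev ys @ [y]"] by simp
    also have "\<dots> = cs f ([y] @ [x] @ rev ys)"
      by (metis append_assoc cs_rot)
    also have "\<dots> = ps f (rev (y # ys @ [x, y]))"
      by (simp add: cs_def)
    also have "\<dots> = ps f (y # ys @ [x, y])"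
      by (rule ps_rev[OF assms])
    also have "\<dots> = cs f w"
      using snoc Cons by (simp add: cs_def)
    finally show ?thesis .
  qed (simp add: snoc)
qed simp

lemma cs_dih: "(\<And>a b. f a b = f b a) \<Longrightarrow> dih u w \<Longrightarrow> cs f u = cs f w"
  unfolding dih_def using cs_cyc cs_rev by metis

lemma ps_sum: "ps (\<lambda>a b. f a b + g a b) w = ps f w + ps g w"
  by (induction f w rule: ps.induct) auto

lemma cs_sum: "cs (\<lambda>a b. f a b + g a b) w = cs f w + cs g w"
  by (simp add: cs_def ps_sum)

lemma ps_cong: "(\<And>a b. a \<in> set w \<Longrightarrow> b \<in> set w \<Longrightarrow> f a b = g a b) \<Longrightarrow> ps f w = ps g w"
  by (induction f w rule: ps.induct) auto

lemma cs_cong: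
  assumes "\<And>a b. a \<in> set w \<Longrightarrow> b \<in> set w \<Longrightarrow> f a b = g a b"
  shows "cs f w = cs g w"
  unfolding cs_def using assms by (cases w) (auto intro!: ps_cong)

lemma ps_mono: "(\<And>a b. a \<in> set w \<Longrightarrow> b \<in> set w \<Longrightarrow> f a b \<le> g a b) \<Longrightarrow> ps f w \<le> ps g w"
  by (induction f w rule: ps.induct) (auto intro: add_mono)

lemma cs_mono:
  assumes "\<And>a b. a \<in> set w \<Longrightarrow> b \<in> set w \<Longrightarrow> f a b \<le> g a b"
  shows "cs f w \<le> cs g w"
  unfolding cs_def using assms by (cases w) (auto intro!: ps_mono)

lemma ps_fst: "ps (\<lambda>a b. of_bool (a = v)) (w @ [h]) = count_list w v"
proof (induction w)
  case (Cons x w)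
  then show ?case by (cases w) auto
qed simp

lemma ps_snd: "ps (\<lambda>a b. of_bool (b = v)) (h # w) = count_list w v"
  by (induction w arbitrary: h) auto

text \<open>Each of the two visits to \<open>v\<close> leaves it once and enters it once; a loop is
  counted twice.\<close>

lemma cs_degree:
  assumes "dow w" "v \<in> set w"
  shows "cs (\<lambda>a b. of_bool (a = v) + of_bool (b = v)) w = 4"
proof -
  have w: "w \<noteq> []" "count_list w v = 2"
    using assms by (auto simp: dow_def)
  then obtain h t where ht: "w = h # t"
    by (meson neq_Nil_conv)
  have "count_list (t @ [h]) v = count_list w v"
    by (simp add: ht)
  moreover have "ps (\<lambda>a b. of_bool (b = v)) (w @ [h]) = count_list (t @ [h]) v"
    unfolding ht append_Cons by (rule ps_snd)
  ultimately have "ps (\<lambda>a b. of_bool (b = v)) (w @ [h]) = 2"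
    using w(2) by simp
  then show ?thesis
    using w ps_fst[of v w h] unfolding cs_def ps_sum by (simp add: ht)
qed

text \<open>Reversing the arc between the two visits to \<open>v\<close> runs through the same edges
  backwards.\<close>

lemma cs_lc:
  assumes "\<And>a b. f a b = f b a"
  shows "cs f (v # rev A @ v # B) = cs f (v # A @ v # B)"
proof -
  have "cs f (v # X @ v # B) = ps f (v # X @ [v]) + ps f (v # B @ [v])" for X
    using ps_append[of f "v # X" v "B @ [v]"] by (simp add: cs_def)
  moreover have "ps f (v # rev A @ [v]) = ps f (v # A @ [v])"
    using ps_rev[of f "v # A @ [v]"] assms by simp
  ultimately show ?thesis by simp
qed

text \<open>Deleting \<open>v\<close> merges its four edges in pairs into the two edges that bridge
  the gaps. The balance is kept additive because subtraction on naturals truncates.\<close>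

lemma cs_delete:
  assumes "A \<noteq> []" "B \<noteq> []"
  shows "cs f (v # A @ v # B) + f (last A) (hd B) + f (last B) (hd A)
    = cs f (A @ B) + f v (hd A) + f (last A) v + f v (hd B) + f (last B) v"
proof -
  have "cs f (v # A @ v # B) = ps f (v # A @ [v]) + ps f (v # B @ [v])"
    using ps_append[of f "v # A" v "B @ [v]"] by (simp add: cs_def)
  moreover have "ps f (v # X @ [v]) = f v (hd X) + ps f X + f (last X) v" if "X \<noteq> []" for X
    using ps_append2[of "[v]" "X @ [v]" f] ps_append2[of X "[v]" f] that by simp
  moreover have "cs f (A @ B) = ps f A + f (last A) (hd B) + ps f B + f (last B) (hd A)"
    using ps_append2[of "A @ B" "[hd A]" f] ps_append2[of A B f] assms by (simp add: cs_def)
  ultimately show ?thesis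
    using assms by simp
qed

section \<open>Edge cuts and sets of chords with all ends on two arcs\<close>

definition sep :: "'a set \<Rightarrow> 'a \<Rightarrow> 'a \<Rightarrow> nat" where
  "sep X a b = of_bool ((a \<in> X) \<noteq> (b \<in> X))"

text \<open>A double occurrence word is an Eulerian circuit of a four-valent graph on its letters; \<open>wcut w X\<close> is the size
  of the edge cut between \<open>X\<close> and its complement.\<close>

definition wcut :: "'a list \<Rightarrow> 'a set \<Rightarrow> nat" where
  "wcut w X = cs (sep X) w"

lemma sep_sym: "sep X a b = sep X b a"
  by (auto simp: sep_def)

lemma cut_cyc: "cyc u w \<Longrightarrow> wcut u X = wcut w X"
  by (simp add: wcut_def cs_cyc)

lemma cut_dih: "dih u w \<Longrightarrow> wcut u X = wcut w X"
  unfolding wcut_def using cs_dih[OF sep_sym] .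

lemma cut_compl: "set w \<subseteq> V \<Longrightarrow> wcut w (V - X) = wcut w X"
  unfolding wcut_def by (rule cs_cong) (auto simp: sep_def)

lemma ps_sep_parity: "w \<noteq> [] \<Longrightarrow> odd (ps (sep X) w) \<longleftrightarrow> (hd w \<in> X) \<noteq> (last w \<in> X)"
proof (induction w)
  case (Cons a w)
  then show ?case by (cases w) (auto simp: sep_def)
qed simp

text \<open>A closed circuit crosses the boundary of \<open>X\<close> equally often in both
  directions; so a cut exceeding four has at least six edges.\<close>

lemma even_cut: "even (wcut w X)"
proof (cases w)
  case (Cons a v)
  then show ?thesis
    using ps_sep_parity[of "w @ [hd w]" X] by (auto simp: wcut_def cs_def)
qed (simp add: wcut_def cs_def)

lemma ps_sep_mono: "(\<forall>x\<in>set w. x \<in> X) \<or> (\<forall>x\<in>set w. x \<notin> X) \<Longrightarrow> ps (sep X) w = 0"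
  by (induction "sep X" w rule: ps.induct) (auto simp: sep_def)

lemma ps_sep_append_le: "ps (sep X) (u @ w) \<le> ps (sep X) u + 1 + ps (sep X) w"
proof (cases "u = [] \<or> w = []")
  case False
  then have "ps (sep X) (u @ w) = ps (sep X) u + sep X (last u) (hd w) + ps (sep X) w"
    by (intro ps_append2) auto
  then show ?thesis by (simp add: sep_def)
qed auto

lemma cut_share_le:
  assumes "cyc w (S1 @ S2 @ S3 @ S4)" "set (S1 @ S3) \<subseteq> X" "set (S2 @ S4) \<inter> X = {}"
  shows "wcut w X \<le> 4"
proof -
  have z: "ps (sep X) S1 = 0" "ps (sep X) S2 = 0" "ps (sep X) S3 = 0" "ps (sep X) S4 = 0"
    using assms by (auto intro!: ps_sep_mono)
  have "ps (sep X) (S1 @ S2 @ S3 @ S4 @ [h]) \<le> 4" for h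
    using ps_sep_append_le[of X S1 "S2 @ S3 @ S4 @ [h]"] ps_sep_append_le[of X S2 "S3 @ S4 @ [h]"]
      ps_sep_append_le[of X S3 "S4 @ [h]"] ps_sep_append_le[of X S4 "[h]"] z by simp
  then show ?thesis
    unfolding cut_cyc[OF assms(1)] by (simp add: wcut_def cs_def)
qed

lemma first_run:
  assumes "w \<noteq> []"
  obtains u v where "w = u @ v" "\<And>x. x \<in> set u \<Longrightarrow> x \<in> X \<longleftrightarrow> hd w \<in> X"
    "v = [] \<or> ((hd v \<in> X) \<noteq> (hd w \<in> X) \<and> ps (sep X) w = 1 + ps (sep X) v)"
proof -
  let ?P = "\<lambda>x. x \<in> X \<longleftrightarrow> hd w \<in> X"
  let ?u = "takeWhile ?P w" and ?v = "dropWhile ?P w"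
  have w: "w = ?u @ ?v" by simp
  have u: "?u \<noteq> []"
    using assms by (cases w) auto
  have mono: "x \<in> X \<longleftrightarrow> hd w \<in> X" if "x \<in> set ?u" for x
    using that set_takeWhileD by fastforce
  have "?v = [] \<or> ((hd ?v \<in> X) \<noteq> (hd w \<in> X) \<and> ps (sep X) w = 1 + ps (sep X) ?v)"
  proof (cases "?v = []")
    case False
    then have h: "(hd ?v \<in> X) \<noteq> (hd w \<in> X)"
      using hd_dropWhile[of ?P w] by auto
    have "ps (sep X) ?u = 0"
      using mono by (intro ps_sep_mono) blast
    moreover have "sep X (last ?u) (hd ?v) = 1"
      using mono[OF last_in_set[OF u]] h by (simp add: sep_def)
    ultimately have "ps (sep X) w = 1 + ps (sep X) ?v"
      using ps_append2[OF u False, of "sep X"] w by simp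
    then show ?thesis using h by simp
  qed simp
  then show thesis
    using that[of ?u ?v] w mono by blast
qed

text \<open>At most four changes of side around the circle leave at most two runs inside
  \<open>X\<close> and two outside. The runs are peeled off one after the other.\<close>

lemma cut_share:
  assumes "wcut w X \<le> 4"
  obtains S1 S2 S3 S4 where "cyc w (S1 @ S2 @ S3 @ S4)" "set (S1 @ S3) \<subseteq> X" "set (S2 @ S4) \<inter> X = {}"
proof (cases "\<exists>x\<in>set w. x \<in> X")
  case False
  then show thesis
    using that[of "[]" w "[]" "[]"] by auto
next
  case True
  then obtain x p q where x: "x \<in> X" "w = p @ x # q"
    using split_list by metis
  define u where "u = x # q @ p"
  have wu: "cyc w u"
    using cyc_append[of p "x # q"] x(2) by (simp add: u_def)
  show thesis
  proof (cases "\<exists>y\<in>set u. y \<notin> X")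
    case False
    then show thesis
      using that[of u "[]" "[]" "[]"] wu by auto
  next
    case True
    then obtain r y s where y: "u = r @ y # s" "y \<notin> X" "\<forall>z\<in>set s. z \<in> X"
      using split_list_last_prop[of u "\<lambda>y. y \<notin> X"] by auto
    \<comment> \<open>This rotation begins inside \<open>X\<close> and ends outside, so no run wraps
      around. The closing step uses up one of the four changes and leaves three.\<close>
    define w0 where "w0 = s @ r @ [y]"
    have c0: "cyc w w0"
      using wu cyc_append[of "r @ [y]" s] y(1) cyc_trans by (fastforce simp: w0_def)
    have ne: "w0 \<noteq> []" by (simp add: w0_def)
    have r: "r \<noteq> []" "hd r = x"
      using y(1,2) x(1) by (auto simp: u_def Cons_eq_append_conv)
    have hd0: "hd w0 \<in> X"
      using y(3) x(1) r by (cases s) (auto simp: w0_def)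
    have last0: "last w0 \<notin> X"
      using y(2) by (simp add: w0_def)
    have "wcut w0 X = ps (sep X) w0 + sep X (last w0) (hd w0)"
      using ps_append2[OF ne, of "[hd w0]" "sep X"] ne by (simp add: wcut_def cs_def)
    then have le: "ps (sep X) w0 \<le> 3"
      using assms cut_cyc[OF c0, of X] hd0 last0 by (simp add: sep_def)
    obtain S1 v1 where 1: "w0 = S1 @ v1" "\<And>x. x \<in> set S1 \<Longrightarrow> x \<in> X"
      "v1 = [] \<or> (hd v1 \<notin> X \<and> ps (sep X) w0 = 1 + ps (sep X) v1)"
      using first_run[OF ne, of X] hd0 by metis
    have v1: "v1 \<noteq> []"
      using 1(1,2) last0 ne last_in_set by fastforce
    obtain S2 v2 where 2: "v1 = S2 @ v2" "\<And>x. x \<in> set S2 \<Longrightarrow> x \<notin> X"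
      "v2 = [] \<or> (hd v2 \<in> X \<and> ps (sep X) v1 = 1 + ps (sep X) v2)"
      using first_run[OF v1, of X] 1(3) v1 by metis
    show thesis
    proof (cases "v2 = []")
      case True
      then show thesis
        using that[of S1 S2 "[]" "[]"] c0 1 2 by auto
    next
      case v2: False
      obtain S3 v3 where 3: "v2 = S3 @ v3" "\<And>x. x \<in> set S3 \<Longrightarrow> x \<in> X"
        "v3 = [] \<or> (hd v3 \<notin> X \<and> ps (sep X) v2 = 1 + ps (sep X) v3)"
        using first_run[OF v2, of X] 2(3) v2 by metis
      show thesis
      proof (cases "v3 = []")
        case True
        then show thesis
          using that[of S1 S2 S3 "[]"] c0 1 2 3 by auto
      next
        case v3: False
        obtain S4 v4 where 4: "v3 = S4 @ v4" "\<And>x. x \<in> set S4 \<Longrightarrow> x \<notin> X"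
          "v4 = [] \<or> (hd v4 \<in> X \<and> ps (sep X) v3 = 1 + ps (sep X) v4)"
          using first_run[OF v3, of X] 3(3) v3 by metis
        \<comment> \<open>After three changes a fifth run would have to stay inside \<open>X\<close>
          to the end, but the word ends outside.\<close>
        have "v4 = []"
        proof (rule ccontr)
          assume v4: "v4 \<noteq> []"
          then have "hd v4 \<in> X" "ps (sep X) v4 = 0"
            using 1(3) 2(3) 3(3) 4(3) v1 v2 v3 le by auto
          moreover have "last v4 \<notin> X"
            using last0 1(1) 2(1) 3(1) 4(1) v4 by simp
          ultimately show False
            using ps_sep_parity[OF v4, of X] by simp
        qed
        then show thesis
          using that[of S1 S2 S3 S4] c0 1 2 3 4 by auto
      qed
    qed
  qed
qed

text \<open>Sides with a single letter are exempt, since the edges at one letter always form a cut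
  of at most four.\<close>

definition prime_word :: "'a list \<Rightarrow> bool" where
  "prime_word w \<longleftrightarrow> dow w \<and> (\<forall>Z\<subseteq>set w. 2 \<le> card Z \<longrightarrow> 2 \<le> card (set w - Z) \<longrightarrow> 4 < wcut w Z)"

lemma prime_wordD:
  "prime_word w \<Longrightarrow> Z \<subseteq> set w \<Longrightarrow> 2 \<le> card Z \<Longrightarrow> 2 \<le> card (set w - Z) \<Longrightarrow> 6 \<le> wcut w Z"
proof -
  assume "prime_word w" "Z \<subseteq> set w" "2 \<le> card Z" "2 \<le> card (set w - Z)"
  then have "4 < wcut w Z"
    by (simp add: prime_word_def)
  then show "6 \<le> wcut w Z"
    using even_cut[of w Z] by (cases "wcut w Z = 5") auto
qed

lemma prime_word_dih: "dih u w \<Longrightarrow> prime_word u \<longleftrightarrow> prime_word w"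
  by (simp add: prime_word_def dow_dih dih_set cut_dih)

lemma dih_cyc: "cyc u w \<Longrightarrow> dih u w"
  by (simp add: dih_def)

subsection \<open>Inserting a chord\<close>

lemma dowD: "dow w \<Longrightarrow> x \<in> set w \<Longrightarrow> count_list w x = 2"
  by (simp add: dow_def)

lemma dow_split:
  assumes "dow w" "v \<in> set w"
  obtains A B where "cyc w (v # A @ v # B)" "v \<notin> set A" "v \<notin> set B"
proof -
  have "count_list w v = 2"
    using assms by (simp add: dow_def)
  then obtain p q r where "w = p @ v # q @ v # r" "v \<notin> set p" "v \<notin> set q" "v \<notin> set r"
    by (rule count_list_2E)
  then show thesis
    using that[of q "r @ p"] cyc_append[of p "v # q @ v # r"] by simp
qed

lemma dow_notin:
  assumes "dow (v # A @ v # B)"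
  shows "v \<notin> set A" "v \<notin> set B"
proof -
  have "count_list (v # A @ v # B) v = 2"
    using assms unfolding dow_def by simp
  then show "v \<notin> set A" "v \<notin> set B"
    by (auto simp: count_list_0_iff)
qed

lemma cr_head:
  assumes "dow (v # A @ v # B)"
  shows "cr (v # A @ v # B) v y \<longleftrightarrow> y \<noteq> v \<and> count_list A y = 1"
proof (cases "y = v")
  case False
  have n: "v \<notin> set A" "v \<notin> set B"
    using dow_notin[OF assms] by auto
  have f: "filter (\<lambda>z. z = v \<or> z = y) A = replicate (count_list A y) y"
    "filter (\<lambda>z. z = v \<or> z = y) B = replicate (count_list B y) y"
    using filter_replicate_count[OF n(1), of y] filter_replicate_count[OF n(2), of y]
    by (simp_all add: disj_commute)
  show ?thesis
  proof (cases "y \<in> set (A @ B)")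
    case True
    then have "count_list (v # A @ v # B) y = 2"
      using assms unfolding dow_def by auto
    then have "count_list A y + count_list B y = 2"
      using False by simp
    then consider "count_list A y = 0" "count_list B y = 2" | "count_list A y = 1" "count_list B y = 1"
      | "count_list A y = 2" "count_list B y = 0"
      by linarith
    then show ?thesis
      using False by cases (simp_all add: cr_def f numeral_2_eq_2)
  next
    case notin: False
    then have "count_list A y = 0" "count_list B y = 0"
      by (simp_all add: count_list_0_iff)
    then show ?thesis
      using False by (simp add: cr_def f)
  qed
qed simp

text \<open>\<open>v\<close> is inserted at two points of one and the same circle in each of the two
  words. The arcs \<open>P1\<close> to \<open>P4\<close> lie between the four insertion points; the
  cases are whether the two pairs of points are unseparated or alternate.\<close>

lemma insert_geometry:
  assumes "cyc (A @ B) (A' @ B')"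
  obtains P1 P2 P3 P4 where "cyc (v # A @ v # B) (v # P1 @ v # P2 @ P3 @ P4)"
      "cyc (v # A' @ v # B') (P1 @ P2 @ v # P3 @ v # P4)"
    | P1 P2 P3 P4 where "cyc (v # A @ v # B) (v # P1 @ P2 @ v # P3 @ P4)"
      "cyc (v # A' @ v # B') (P1 @ v # P2 @ P3 @ v # P4)"
proof -
  obtain xs ys where "A @ B = xs @ ys" and 0: "A' @ B' = ys @ xs"
    using assms by (auto simp: cyc_def)
  then consider (le) P where "A @ P = xs" "B = P @ ys" | (gt) K where "A = xs @ K" "K @ B = ys"
    by (auto simp: append_eq_append_conv2)
  then show thesis
  proof cases
    case (le P)
    from 0 consider Q where "A' @ Q = ys" "B' = Q @ xs" | Z where "A' = ys @ Z" "Z @ B' = xs"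
      by (auto simp: append_eq_append_conv2)
    then show thesis
    proof cases
      case (1 Q)
      then show thesis
        using le that(1)[of A P A' Q] cyc_append[of "v # A' @ v # Q" "A @ P"] by auto
    next
      case (2 Z)
      have "A @ P = Z @ B'"
        using le 2 by simp
      then consider K where "A = Z @ K" "K @ P = B'" | K where "A @ K = Z" "P = K @ B'"
        by (auto simp: append_eq_append_conv2)
      then show thesis
      proof cases
        case (1 K)
        then show thesis
          using le 2 that(2)[of Z K P ys] cyc_append[of "v # ys" "Z @ v # K @ P"] by auto
      next
        case K: (2 K)
        then show thesis
          using le 2 that(1)[of A K B' ys] cyc_append[of "v # ys" "A @ K @ v # B'"] by auto
      qed
    qed
  next
    case (gt K)
    from 0 consider Q where "A' @ Q = ys" "B' = Q @ xs" | Z where "A' = ys @ Z" "Z @ B' = xs"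
      by (auto simp: append_eq_append_conv2)
    then show thesis
    proof cases
      case (1 Q)
      have "K @ B = A' @ Q"
        using gt 1 by simp
      then consider L where "K = A' @ L" "L @ B = Q" | L where "K @ L = A'" "B = L @ Q"
        by (auto simp: append_eq_append_conv2)
      then show thesis
      proof cases
        case L: (1 L)
        then show thesis
          using gt 1 that(1)[of B xs A' L] cyc_append[of "v # xs @ A' @ L" "v # B"]
            cyc_append[of "v # A' @ v # L" "B @ xs"] by auto
      next
        case L: (2 L)
        then show thesis
          using gt 1 that(2)[of xs K L Q] cyc_append[of "v # K @ L @ v # Q" xs] by auto
      qed
    next
      case (2 Z)
      then show thesis
        using gt that(1)[of B Z B' K] cyc_append[of "v # Z @ B' @ K" "v # B"]
          cyc_append[of "v # K" "B @ Z @ v # B'"] by auto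
    qed
  qed
qed

text \<open>A chord with one end on \<open>P1\<close> or \<open>P3\<close> and the other on
  \<open>P2\<close> or \<open>P4\<close> would cross \<open>v\<close> in exactly one of the two
  words. Hence \<open>P1\<close> and \<open>P3\<close> carry both ends of each of their
  chords.\<close>

lemma insert_closed:
  assumes dow: "dow D" "dow D'" and v: "v \<in> set D" and f: "cyc (filter (\<lambda>z. z \<noteq> v) D) (filter (\<lambda>z. z \<noteq> v) D')"
    and cr: "\<And>y. cr D v y \<longleftrightarrow> cr D' v y" and v': "v \<in> set D'"
  obtains P1 P2 P3 P4 where "cyc D (v # P1 @ v # P2 @ P3 @ P4)" "cyc D' (P1 @ P2 @ v # P3 @ v # P4)"
      "set (P1 @ P3) \<inter> set (P2 @ P4) = {}" "v \<notin> set (P1 @ P2 @ P3 @ P4)"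
    | P1 P2 P3 P4 where "cyc D (v # P1 @ P2 @ v # P3 @ P4)" "cyc D' (P1 @ v # P2 @ P3 @ v # P4)"
      "set (P1 @ P3) \<inter> set (P2 @ P4) = {}" "v \<notin> set (P1 @ P2 @ P3 @ P4)"
proof -
  obtain A B where AB: "cyc D (v # A @ v # B)" "v \<notin> set A" "v \<notin> set B"
    using dow_split[OF dow(1) v] .
  obtain A' B' where AB': "cyc D' (v # A' @ v # B')" "v \<notin> set A'" "v \<notin> set B'"
    using dow_split[OF dow(2) v'] .
  have fil: "filter (\<lambda>z. z \<noteq> v) X = X" if "v \<notin> set X" for X
    using that by (induction X) auto
  have "cyc (A @ B) (A' @ B')"
    using cyc_filter[OF AB(1), of "\<lambda>z. z \<noteq> v"] cyc_filter[OF AB'(1), of "\<lambda>z. z \<noteq> v"] f AB AB' fil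
    by (simp add: fil) (metis cyc_sym cyc_trans)
  then show thesis
  proof (cases rule: insert_geometry[where v = v])
    case (1 P1 P2 P3 P4)
    have c: "cyc D (v # P1 @ v # P2 @ P3 @ P4)" and c': "cyc D' (P1 @ P2 @ v # P3 @ v # P4)"
      using AB(1) AB'(1) 1 cyc_trans by blast+
    have c'': "cyc D' (v # P3 @ v # P4 @ P1 @ P2)"
      using c' cyc_append[of "P1 @ P2" "v # P3 @ v # P4"] cyc_trans by fastforce
    have d: "dow (v # P1 @ v # P2 @ P3 @ P4)" "dow (v # P3 @ v # P4 @ P1 @ P2)"
      using dow c c'' dow_cyc by blast+
    have n: "v \<notin> set (P1 @ P2 @ P3 @ P4)"
      using dow_notin[OF d(1)] by auto
    have "\<not> (y \<in> set (P1 @ P3) \<and> y \<in> set (P2 @ P4))" for y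
    proof
      assume y: "y \<in> set (P1 @ P3) \<and> y \<in> set (P2 @ P4)"
      then have yv: "y \<noteq> v" using n by auto
      have "count_list (v # P1 @ v # P2 @ P3 @ P4) y = 2"
        by (rule dowD[OF d(1)]) (use y in auto)
      then have s: "count_list P1 y + count_list P2 y + count_list P3 y + count_list P4 y = 2"
        using yv by simp
      have "count_list P1 y = 1 \<longleftrightarrow> count_list P3 y = 1"
        using cr_head[OF d(1), of y] cr_head[OF d(2), of y] cr cr_cyc[OF c] cr_cyc[OF c''] yv by blast
      moreover have "count_list P1 y + count_list P3 y \<noteq> 0" "count_list P2 y + count_list P4 y \<noteq> 0"
        using y by (auto simp: count_list_0_iff)
      ultimately show False
        using s by presburger
    qed
    then show thesis
      using that(1) c c' n by blast
  next
    case (2 P1 P2 P3 P4)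
    have c: "cyc D (v # P1 @ P2 @ v # P3 @ P4)" and c': "cyc D' (P1 @ v # P2 @ P3 @ v # P4)"
      using AB(1) AB'(1) 2 cyc_trans by blast+
    have c'': "cyc D' (v # (P2 @ P3) @ v # P4 @ P1)"
      using c' cyc_append[of P1 "v # P2 @ P3 @ v # P4"] cyc_trans by fastforce
    have d: "dow (v # (P1 @ P2) @ v # P3 @ P4)" "dow (v # (P2 @ P3) @ v # P4 @ P1)"
      using dow c c'' dow_cyc by fastforce+
    have n: "v \<notin> set (P1 @ P2 @ P3 @ P4)"
      using dow_notin[OF d(1)] by auto
    have "\<not> (y \<in> set (P1 @ P3) \<and> y \<in> set (P2 @ P4))" for y
    proof
      assume y: "y \<in> set (P1 @ P3) \<and> y \<in> set (P2 @ P4)"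
      then have yv: "y \<noteq> v" using n by auto
      have "count_list (v # (P1 @ P2) @ v # P3 @ P4) y = 2"
        by (rule dowD[OF d(1)]) (use y in auto)
      then have s: "count_list P1 y + count_list P2 y + count_list P3 y + count_list P4 y = 2"
        using yv by simp
      have "count_list (P1 @ P2) y = 1 \<longleftrightarrow> count_list (P2 @ P3) y = 1"
        using cr_head[OF d(1), of y] cr_head[OF d(2), of y] cr cr_cyc[OF c] cr_cyc[OF c''] yv by auto
      moreover have "count_list P1 y + count_list P3 y \<noteq> 0" "count_list P2 y + count_list P4 y \<noteq> 0"
        using y by (auto simp: count_list_0_iff)
      ultimately show False
        using s by (simp only: count_list_append) presburger
    qed
    then show thesis
      using that(2) c c' n by blast
  qed
qed

text \<open>With \<open>P1\<close> and \<open>P3\<close> closed, two exchanges of arcs transport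
  \<open>v\<close> when the pairs of insertion points are unseparated, and two flips do so when they
  alternate; \<open>v\<close> belongs to the moved arcs in one of the two moves.\<close>

lemma insert_mut:
  assumes dow: "dow D" "dow D'" and v: "v \<in> set D" "v \<in> set D'"
    and f: "cyc (filter (\<lambda>z. z \<noteq> v) D) (filter (\<lambda>z. z \<noteq> v) D')"
    and cr: "\<And>y. cr D v y \<longleftrightarrow> cr D' v y"
  shows "mut D D'"
  using dow v(1) f cr v(2)
proof (cases rule: insert_closed)
  case (1 P1 P2 P3 P4)
  have "mut D ((v # P1 @ [v]) @ P2 @ P3 @ P4)"
    using mut_cyc[OF 1(1)] by simp
  also have "mut ((v # P1 @ [v]) @ P2 @ P3 @ P4) (P3 @ P2 @ (v # P1 @ [v]) @ P4)"
    using mut_swap[of "v # P1 @ [v]" P3 "[]" P2 P4] 1 by auto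
  also have "mut (P3 @ P2 @ (v # P1 @ [v]) @ P4) (P1 @ (P2 @ [v]) @ P3 @ (v # P4))"
    using mut_swap[of P3 P1 "[]" "P2 @ [v]" "v # P4"] 1 by auto
  also have "mut (P1 @ (P2 @ [v]) @ P3 @ (v # P4)) D'"
    using mut_cyc[OF cyc_sym[OF 1(2)]] by simp
  finally show ?thesis .
next
  case (2 P1 P2 P3 P4)
  have "mut D ((v # P1) @ P2 @ (v # P3) @ P4)"
    using mut_cyc[OF 2(1)] by simp
  also have "mut ((v # P1) @ P2 @ (v # P3) @ P4) (rev (v # P1) @ P2 @ rev (v # P3) @ P4)"
    using mut_flip[of "v # P1" "v # P3" "[]" P2 P4] 2 by auto
  also have "mut (rev (v # P1) @ P2 @ rev (v # P3) @ P4) (P1 @ v # P2 @ P3 @ v # P4)"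
    using mut_flip[of "rev P1" "rev P3" "[]" "v # P2" "v # P4"] 2 by auto
  also have "mut (P1 @ v # P2 @ P3 @ v # P4) D'"
    using mut_cyc[OF cyc_sym[OF 2(2)]] .
  finally show ?thesis .
qed

text \<open>Together with the next letter \<open>z\<close> a loop at \<open>v\<close> would fill two
  arcs, namely \<open>v v z\<close> and the other \<open>z\<close>, which is a cut of at most four
  edges.\<close>

lemma prime_no_loop:
  assumes p: "prime_word D" and card: "4 \<le> card (set D)" and c: "cyc D (v # v # R)"
  shows False
proof -
  have d: "dow (v # v # R)"
    using p c dow_cyc by (auto simp: prime_word_def)
  have s: "set D = set (v # v # R)"
    using cyc_set[OF c] .
  have "R \<noteq> []"
  proof
    assume "R = []"
    then have "set D = {v}" using s by simp
    then show False using card by simp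
  qed
  then obtain z R' where R: "R = z # R'" by (meson neq_Nil_conv)
  have "v \<notin> set R"
    using dow_notin[of v "[]" R] d by simp
  then have zv: "z \<noteq> v" using R by auto
  have "count_list (v # v # R) z = 2"
    using d R unfolding dow_def by auto
  then have "count_list R' z = 1"
    using R zv by auto
  then obtain R1 R2 where R': "R' = R1 @ z # R2" "z \<notin> set R1" "z \<notin> set R2"
    by (rule count_list_1E)
  have "wcut D {v, z} \<le> 4"
    by (rule cut_share_le[of D "[v, v, z]" R1 "[z]" R2])
       (use c R R' \<open>v \<notin> set R\<close> in auto)
  moreover have "card {v, z} = 2"
    using zv by simp
  moreover have "card (set D - {v, z}) = card (set D) - 2"
    using zv s R by (subst card_Diff_subset) auto
  ultimately have "2 \<le> card (set D - {v, z})" "2 \<le> card {v, z}" "\<not> 6 \<le> wcut D {v, z}"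
    using card by linarith+
  moreover have "{v, z} \<subseteq> set D"
    using s R by auto
  ultimately show False
    using prime_wordD[OF p] by blast
qed

text \<open>The chords on \<open>P1\<close> and \<open>P3\<close> have a small cut both with and
  without \<open>v\<close>. So \<open>v\<close> can be given to whichever side is short of letters,
  and with four letters in all one of the two cuts has two letters on each side.\<close>

lemma prime_share_trivial:
  assumes p: "prime_word D" and card: "4 \<le> card (set D)"
    and c: "cyc D (v # P1 @ v # P2 @ P3 @ P4) \<or> cyc D (v # P1 @ P2 @ v # P3 @ P4)"
    and dis: "set (P1 @ P3) \<inter> set (P2 @ P4) = {}" and v: "v \<notin> set (P1 @ P2 @ P3 @ P4)"
  shows "(P1 = [] \<and> P3 = []) \<or> (P2 = [] \<and> P4 = [])"
proof (rule ccontr)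
  assume n: "\<not> ?thesis"
  let ?M = "set (P1 @ P3)" and ?Y = "set (P2 @ P4)"
  have ne: "?M \<noteq> {}" "?Y \<noteq> {}"
    using n by auto
  have s: "set D = insert v (?M \<union> ?Y)"
    using c cyc_set by fastforce
  have le1: "wcut D ?M \<le> 4"
    using c
  proof
    assume "cyc D (v # P1 @ v # P2 @ P3 @ P4)"
    then have "cyc D (P1 @ (v # P2) @ P3 @ (P4 @ [v]))"
      using cyc_append[of "[v]" "P1 @ v # P2 @ P3 @ P4"] cyc_trans by fastforce
    then show ?thesis
      by (rule cut_share_le) (use dis v in auto)
  next
    assume "cyc D (v # P1 @ P2 @ v # P3 @ P4)"
    then have "cyc D (P1 @ (P2 @ [v]) @ P3 @ (P4 @ [v]))"
      using cyc_append[of "[v]" "P1 @ P2 @ v # P3 @ P4"] cyc_trans by fastforce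
    then show ?thesis
      by (rule cut_share_le) (use dis v in auto)
  qed
  have le2: "wcut D (insert v ?M) \<le> 4"
    using c
  proof
    assume "cyc D (v # P1 @ v # P2 @ P3 @ P4)"
    then have "cyc D ((v # P1 @ [v]) @ P2 @ P3 @ P4)"
      by simp
    then show ?thesis
      by (rule cut_share_le) (use dis v in auto)
  next
    assume "cyc D (v # P1 @ P2 @ v # P3 @ P4)"
    then have "cyc D ((v # P1) @ P2 @ (v # P3) @ P4)"
      by simp
    then show ?thesis
      by (rule cut_share_le) (use dis v in auto)
  qed
  have vM: "v \<notin> ?M" "v \<notin> ?Y" using v by auto
  have "set D - ?M = insert v ?Y" "set D - insert v ?M = ?Y"
    using s dis vM by auto
  moreover have "card (insert v ?Y) = Suc (card ?Y)" "card (insert v ?M) = Suc (card ?M)"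
    using vM by simp_all
  moreover have "card ?M > 0" "card ?Y > 0"
    using ne by (simp_all add: card_gt_0_iff)
  moreover have "card (set D) = Suc (card ?M + card ?Y)"
    unfolding s using vM card_Un_disjoint[OF _ _ dis] by simp
  ultimately have "\<not> (2 \<le> card ?M)" "\<not> (2 \<le> card ?Y)"
    using prime_wordD[OF p, of ?M] prime_wordD[OF p, of "insert v ?M"] le1 le2 s by auto
  then show False
    using card \<open>card (set D) = Suc (card ?M + card ?Y)\<close> by linarith
qed

text \<open>Primality empties one pair of arcs. Then the insertion points coincide as a set, or else
  \<open>v\<close> would form a loop.\<close>

lemma insert_prime:
  assumes p: "prime_word D" and card: "4 \<le> card (set D)" and dow': "dow D'" and v: "v \<in> set D" "v \<in> set D'"
    and f: "cyc (filter (\<lambda>z. z \<noteq> v) D) (filter (\<lambda>z. z \<noteq> v) D')"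
    and cr: "\<And>y. cr D v y \<longleftrightarrow> cr D' v y"
  shows "cyc D D'"
proof -
  have "dow D" using p by (simp add: prime_word_def)
  from this dow' v(1) f cr v(2) show ?thesis
  proof (cases rule: insert_closed)
    case (1 P1 P2 P3 P4)
    from prime_share_trivial[OF p card disjI1[OF 1(1)] 1(3,4)] show ?thesis
    proof
      assume "P1 = [] \<and> P3 = []"
      then show ?thesis
        using prime_no_loop[OF p card, of v "P2 @ P4"] 1(1) by simp
    next
      assume e: "P2 = [] \<and> P4 = []"
      then have "cyc D' (P1 @ v # P3 @ [v])" "cyc D (v # P1 @ v # P3)"
        using 1 by simp_all
      then show ?thesis
        using cyc_append[of "[v]" "P1 @ v # P3"] by (simp, meson cyc_sym cyc_trans)
    qed
  next
    case (2 P1 P2 P3 P4)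
    from prime_share_trivial[OF p card disjI2[OF 2(1)] 2(3,4)] show ?thesis
    proof
      assume "P1 = [] \<and> P3 = []"
      then show ?thesis
        using 2(1,2) by (simp, meson cyc_sym cyc_trans)
    next
      assume e: "P2 = [] \<and> P4 = []"
      then have "cyc D' (P1 @ v # P3 @ [v])" "cyc D (v # P1 @ v # P3)"
        using 2 by simp_all
      then show ?thesis
        using cyc_append[of "[v]" "P1 @ v # P3"] by (simp, meson cyc_sym cyc_trans)
    qed
  qed
qed

subsection \<open>Local complementation\<close>

text \<open>Reversing one arc at \<open>v\<close> complements the neighbourhood of \<open>v\<close>
  in the interlacement graph (\<open>lcr_cr\<close>). It is a relation because the result is fixed
  only up to rotation and the choice of arc.\<close>

definition lcr :: "'a \<Rightarrow> 'a list \<Rightarrow> 'a list \<Rightarrow> bool" where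
  "lcr v D E \<longleftrightarrow> (\<exists>A B. cyc D (v # A @ v # B) \<and> cyc E (v # rev A @ v # B))"

lemma lcr_exists:
  assumes "dow D" "v \<in> set D"
  shows "\<exists>E. lcr v D E"
proof -
  obtain A B where "cyc D (v # A @ v # B)" "v \<notin> set A" "v \<notin> set B"
    by (rule dow_split[OF assms])
  then show ?thesis
    unfolding lcr_def using cyc_refl by blast
qed

lemma lcr_mset:
  assumes "lcr v D E"
  shows "mset D = mset E"
proof -
  obtain A B where "cyc D (v # A @ v # B)" "cyc E (v # rev A @ v # B)"
    using assms by (auto simp: lcr_def)
  then have "mset D = mset (v # A @ v # B)" "mset E = mset (v # rev A @ v # B)"
    by (simp_all only: cyc_mset)
  then show ?thesis by simp
qed

lemma lcr_set: "lcr v D E \<Longrightarrow> set D = set E"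
  using lcr_mset mset_eq_setD by metis

lemma lcr_dow: "lcr v D E \<Longrightarrow> dow D \<longleftrightarrow> dow E"
  using lcr_mset dow_mset by metis

lemma lcr_cut:
  assumes "lcr v D E"
  shows "wcut E Z = wcut D Z"
proof -
  obtain A B where "cyc D (v # A @ v # B)" "cyc E (v # rev A @ v # B)"
    using assms by (auto simp: lcr_def)
  then show ?thesis
    using cs_lc[of "sep Z", OF sep_sym, of v A B] by (simp only: cut_cyc) (simp only: wcut_def)
qed

lemma lcr_prime:
  assumes "lcr v D E"
  shows "prime_word D \<longleftrightarrow> prime_word E"
  unfolding prime_word_def lcr_dow[OF assms] lcr_set[OF assms] lcr_cut[OF assms] ..

lemma cr_in_set:
  assumes "cr w x y"
  shows "x \<in> set w" "y \<in> set w"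
proof -
  have "set (filter (\<lambda>z. z = x \<or> z = y) w) = {x, y}"
    using assms unfolding cr_def by fastforce
  then show "x \<in> set w" "y \<in> set w" by auto
qed

lemma alt_rev_prefix:
  assumes "a @ b \<in> {[x, y, x, y], [y, x, y, x]}" "\<not> (count_list a x = 1 \<and> count_list a y = 1)" "x \<noteq> y"
  shows "rev a @ b \<in> {[x, y, x, y], [y, x, y, x]}"
proof -
  have key: "rev (take n [p, q, p, q]) @ drop n [p, q, p, q] \<in> {[p, q, p, q], [q, p, q, p]}
      \<or> (count_list (take n [p, q, p, q]) p = 1 \<and> count_list (take n [p, q, p, q]) q = 1)"
    if "p \<noteq> q" for n :: nat and p q :: 'a
  proof -
    have "n = 0 \<or> n = 1 \<or> n = 2 \<or> n = 3 \<or> n \<ge> 4"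
      by linarith
    then show ?thesis
      using that by (elim disjE) (simp_all add: numeral_2_eq_2 numeral_3_eq_3)
  qed
  have *: "rev a @ b = rev (take (length a) (a @ b)) @ drop (length a) (a @ b)"
    "count_list a z = count_list (take (length a) (a @ b)) z" for z
    by simp_all
  consider "a @ b = [x, y, x, y]" | "a @ b = [y, x, y, x]"
    using assms(1) by blast
  then show ?thesis
  proof cases
    case 1
    have "\<not> (count_list (take (length a) [x, y, x, y]) x = 1 \<and> count_list (take (length a) [x, y, x, y]) y = 1)"
      using assms(2) unfolding * 1 .
    then show ?thesis
      unfolding * 1 using key[OF assms(3), of "length a"] by blast
  next
    case 2
    have "\<not> (count_list (take (length a) [y, x, y, x]) x = 1 \<and> count_list (take (length a) [y, x, y, x]) y = 1)"
      using assms(2) unfolding * 2 .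
    then show ?thesis
      unfolding * 2 using key[OF assms(3)[symmetric], of "length a"] by blast
  qed
qed

lemma two_letter_list:
  assumes "set a \<subseteq> {x, y}" "count_list a x = 1" "count_list a y = 1" "x \<noteq> y"
  shows "a = [x, y] \<or> a = [y, x]"
proof -
  obtain p q where a: "a = p @ x # q" "x \<notin> set p" "x \<notin> set q"
    using assms(2) by (rule count_list_1E)
  have p: "set p \<subseteq> {y}" "set q \<subseteq> {y}"
    using a assms(1) by auto
  have "count_list r y = length r" if "set r \<subseteq> {y}" for r
    using that by (induction r) auto
  then have "length p + length q = 1"
    using assms(3,4) p by (simp add: a(1))
  then have "(p = [] \<and> length q = 1) \<or> (q = [] \<and> length p = 1)"
    by (cases p; cases q) simp_all
  then show ?thesis
  proof
    assume *: "p = [] \<and> length q = 1"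
    then obtain z where "q = [z]"
      by (metis One_nat_def length_0_conv length_Suc_conv)
    then show ?thesis using * a(1) p by simp
  next
    assume *: "q = [] \<and> length p = 1"
    then obtain z where "p = [z]"
      by (metis One_nat_def length_0_conv length_Suc_conv)
    then show ?thesis using * a(1) p by simp
  qed
qed

text \<open>If both letters have one occurrence in the reversed part, reversal interchanges the
  alternating and the nested pattern; otherwise it maps alternating patterns to alternating
  ones.\<close>

lemma alt_toggle:
  assumes "set (a @ b) \<subseteq> {x, y}" "count_list (a @ b) x = 2" "count_list (a @ b) y = 2" "x \<noteq> y"
  shows "rev a @ b \<in> {[x, y, x, y], [y, x, y, x]}
     \<longleftrightarrow> (a @ b \<in> {[x, y, x, y], [y, x, y, x]}) \<noteq> (count_list a x = 1 \<and> count_list a y = 1)"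
proof (cases "count_list a x = 1 \<and> count_list a y = 1")
  case True
  then have "count_list b x = 1" "count_list b y = 1"
    using assms by simp_all
  then have "b = [x, y] \<or> b = [y, x]" "a = [x, y] \<or> a = [y, x]"
    using two_letter_list[of b x y] two_letter_list[of a x y] True assms by simp_all
  then show ?thesis
    using True assms(4) by auto
next
  case False
  then have "\<not> (count_list (rev a) x = 1 \<and> count_list (rev a) y = 1)"
    by simp
  then show ?thesis
    using alt_rev_prefix[of a b x y] alt_rev_prefix[of "rev a" b x y] False assms(4)
    unfolding rev_rev_ident by argo
qed

lemma lcr_cr:
  assumes l: "lcr v D E" and dow: "dow D"
  shows "cr E x y \<longleftrightarrow> x \<noteq> y \<and> (cr D x y \<noteq> (cr D v x \<and> cr D v y))"
proof -
  obtain A B where D: "cyc D (v # A @ v # B)" and E: "cyc E (v # rev A @ v # B)"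
    using l by (auto simp: lcr_def)
  let ?D = "v # A @ v # B" and ?E = "v # rev A @ v # B"
  have dD: "dow ?D" and dE: "dow ?E"
    using dow dow_cyc[OF D] dow_cyc[OF E] lcr_dow[OF l] by auto
  have v: "cr ?E v z \<longleftrightarrow> cr ?D v z" for z
    unfolding cr_head[OF dD] cr_head[OF dE] by simp
  have "cr ?E x y \<longleftrightarrow> x \<noteq> y \<and> (cr ?D x y \<noteq> (cr ?D v x \<and> cr ?D v y))"
  proof (cases "x = y \<or> x = v \<or> y = v")
    case True
    then show ?thesis
      using v cr_sym[of ?E] cr_sym[of ?D] by (metis cr_irrefl)
  next
    case False
    then have ne: "x \<noteq> y" "x \<noteq> v" "y \<noteq> v" by auto
    show ?thesis
    proof (cases "x \<in> set ?D \<and> y \<in> set ?D")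
      case True
      define f where "f = filter (\<lambda>z. z = x \<or> z = y)"
      have cf: "count_list (f w) x = count_list w x" "count_list (f w) y = count_list w y" for w
        by (simp_all add: f_def count_list_filter)
      have "count_list ?D x = 2" "count_list ?D y = 2"
        using dowD[OF dD] True by auto
      then have c: "count_list (f A @ f B) x = 2" "count_list (f A @ f B) y = 2"
        using ne by (simp_all add: cf)
      have s: "set (f A @ f B) \<subseteq> {x, y}"
        by (auto simp: f_def)
      have fD: "f ?D = f A @ f B" "f ?E = rev (f A) @ f B"
        using ne by (auto simp: f_def rev_filter)
      have "cr ?D x y \<longleftrightarrow> f A @ f B \<in> {[x, y, x, y], [y, x, y, x]}"
        "cr ?E x y \<longleftrightarrow> rev (f A) @ f B \<in> {[x, y, x, y], [y, x, y, x]}"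
        using ne(1) unfolding cr_def f_def[symmetric] fD by blast+
      then show ?thesis
        using alt_toggle[OF s c ne(1)] ne cr_head[OF dD] by (simp only: cf simp_thms)
    next
      case F: False
      have s: "set ?E = set ?D" by simp
      have "\<not> cr ?E x y" "\<not> cr ?D x y" "\<not> (cr ?D v x \<and> cr ?D v y)"
        using F cr_in_set s by metis+
      then show ?thesis by simp
    qed
  qed
  then show ?thesis
    using cr_cyc[OF D] cr_cyc[OF E] by simp
qed

lemma cyc_align:
  assumes "cyc (v # A @ v # B) (v # A' @ v # B')" "v \<notin> set A" "v \<notin> set B" "v \<notin> set A'" "v \<notin> set B'"
  shows "(A' = A \<and> B' = B) \<or> (A' = B \<and> B' = A)"
proof -
  obtain xs ys where 1: "v # A @ v # B = xs @ ys" "v # A' @ v # B' = ys @ xs"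
    using assms(1) by (auto simp: cyc_def)
  show ?thesis
  proof (cases "xs = [] \<or> ys = []")
    case True
    then have "A @ v # B = A' @ v # B'"
      using 1 by auto
    then show ?thesis
      using split_unique assms by metis
  next
    case False
    then obtain x' y' where xy: "xs = v # x'" "ys = v # y'"
      using 1 by (metis append_eq_Cons_conv)
    then have "A @ v # B = x' @ v # y'" "A' @ v # B' = y' @ v # x'"
      using 1 by auto
    moreover have "v \<notin> set x'"
    proof
      assume "v \<in> set x'"
      then have "count_list x' v \<noteq> 0"
        by (simp add: count_list_0_iff)
      moreover have "count_list (A @ v # B) v = 1"
        using assms by (simp add: count_list_0_iff)
      ultimately show False
        using \<open>A @ v # B = x' @ v # y'\<close> by simp
    qed
    ultimately have "A = x' \<and> B = y'"
      using split_unique assms by metis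
    then show ?thesis
      using split_unique[of A' v B' y' x'] assms \<open>A' @ v # B' = y' @ v # x'\<close> by metis
  qed
qed

lemma dih_align:
  assumes "dih (v # A @ v # B) (v # A' @ v # B')" "v \<notin> set A" "v \<notin> set B" "v \<notin> set A'" "v \<notin> set B'"
  shows "(A' = A \<and> B' = B) \<or> (A' = B \<and> B' = A) \<or> (A' = rev A \<and> B' = rev B) \<or> (A' = rev B \<and> B' = rev A)"
  using assms(1) unfolding dih_def
proof
  assume "cyc (v # A @ v # B) (v # A' @ v # B')"
  then show ?thesis
    using cyc_align assms by metis
next
  assume "cyc (rev (v # A @ v # B)) (v # A' @ v # B')"
  moreover have "cyc (v # rev B @ v # rev A) (rev (v # A @ v # B))"
    using cyc_append[of "[v]" "rev B @ v # rev A"] by simp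
  ultimately have "cyc (v # rev B @ v # rev A) (v # A' @ v # B')"
    using cyc_trans by blast
  then have "(A' = rev B \<and> B' = rev A) \<or> (A' = rev A \<and> B' = rev B)"
    by (rule cyc_align) (use assms in auto)
  then show ?thesis by blast
qed

lemma dih_arcs:
  "dih (v # A @ v # B) (v # B @ v # A)" "dih (v # A @ v # B) (v # rev A @ v # rev B)"
  "dih (v # A @ v # B) (v # rev B @ v # rev A)"
proof -
  show 1: "dih (v # A @ v # B) (v # B @ v # A)" for A B
    using cyc_append[of "v # A" "v # B"] by (simp add: dih_def)
  have "cyc (rev (v # A @ v # B)) (v # rev B @ v # rev A)"
    using cyc_sym[OF cyc_append[of "[v]" "rev B @ v # rev A"]] by simp
  then show 2: "dih (v # A @ v # B) (v # rev B @ v # rev A)"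
    by (simp add: dih_def)
  show "dih (v # A @ v # B) (v # rev A @ v # rev B)"
    using dih_trans[OF 2 1] .
qed

text \<open>Two aligned words on the arcs at \<open>v\<close> can differ in four ways by
  \<open>dih_align\<close>, and these four are permuted when one arc is reversed; so the operation
  loses no information.\<close>

lemma lcr_dih:
  assumes l: "lcr v D E" "lcr v D' E'" and dow: "dow D" "dow D'" and dih: "dih E E'"
  shows "dih D D'"
proof -
  obtain A B where D: "cyc D (v # A @ v # B)" and E: "cyc E (v # rev A @ v # B)"
    using l(1) by (auto simp: lcr_def)
  obtain A' B' where D': "cyc D' (v # A' @ v # B')" and E': "cyc E' (v # rev A' @ v # B')"
    using l(2) by (auto simp: lcr_def)
  have "dow (v # A @ v # B)" "dow (v # A' @ v # B')"
    using dow_cyc[OF D] dow_cyc[OF D'] dow by simp_all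
  then have "v \<notin> set A" "v \<notin> set B" "v \<notin> set A'" "v \<notin> set B'"
    by (simp_all add: dow_notin)
  moreover have "dih (v # rev A @ v # B) (v # rev A' @ v # B')"
    using dih_trans[OF dih_trans[OF dih_cyc[OF cyc_sym[OF E]] dih] dih_cyc[OF E']] .
  ultimately have "(rev A' = rev A \<and> B' = B) \<or> (rev A' = B \<and> B' = rev A)
      \<or> (rev A' = rev (rev A) \<and> B' = rev B) \<or> (rev A' = rev B \<and> B' = rev (rev A))"
    by (intro dih_align) auto
  then have "(A' = A \<and> B' = B) \<or> (A' = rev B \<and> B' = rev A) \<or> (A' = rev A \<and> B' = rev B) \<or> (A' = B \<and> B' = A)"
    by (metis rev_rev_ident)
  then have "dih (v # A @ v # B) (v # A' @ v # B')"
    using dih_arcs[of v A B] by auto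
  then show ?thesis
    using dih_trans[OF dih_trans[OF dih_cyc[OF D]] dih_cyc[OF cyc_sym[OF D']]] by blast
qed

subsection \<open>Edges of the four-valent graph\<close>

definition eb :: "'a \<Rightarrow> 'a \<Rightarrow> 'a \<Rightarrow> 'a \<Rightarrow> nat" where
  "eb x y a b = of_bool (a = x \<and> b = y) + of_bool (a = y \<and> b = x)"

definition ed :: "'a list \<Rightarrow> 'a \<Rightarrow> 'a \<Rightarrow> nat" where
  "ed w x y = cs (eb x y) w"

lemma ed_sym: "ed w x y = ed w y x"
proof -
  have "eb x y = eb y x"
    by (auto simp: eb_def fun_eq_iff)
  then show ?thesis by (simp add: ed_def)
qed

lemma ps_zero: "(\<And>a b. a \<in> set w \<Longrightarrow> b \<in> set w \<Longrightarrow> f a b = 0) \<Longrightarrow> ps f w = 0"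
  by (induction f w rule: ps.induct) auto

lemma cs_star:
  assumes "\<And>a b. a \<noteq> v \<Longrightarrow> b \<noteq> v \<Longrightarrow> f a b = 0" "v \<notin> set A" "v \<notin> set B" "A \<noteq> []" "B \<noteq> []"
  shows "cs f (v # A @ v # B) = f v (hd A) + f (last A) v + f v (hd B) + f (last B) v"
proof -
  have "cs f (v # A @ v # B) = ps f (v # A @ [v]) + ps f (v # B @ [v])"
    using ps_append[of f "v # A" v "B @ [v]"] by (simp add: cs_def)
  moreover have "ps f (v # X @ [v]) = f v (hd X) + f (last X) v" if "X \<noteq> []" "v \<notin> set X" for X
  proof -
    have "ps f X = 0"
      by (rule ps_zero) (use assms(1) that(2) in metis)
    then show ?thesis
      using ps_append2[of "[v]" "X @ [v]" f] ps_append2[of X "[v]" f] that by simp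
  qed
  ultimately show ?thesis
    using assms by simp
qed

lemma ed_star:
  assumes "cyc D (v # A @ v # B)" "v \<notin> set A" "v \<notin> set B" "A \<noteq> []" "B \<noteq> []" "x \<noteq> v"
  shows "ed D v x = of_bool (hd A = x) + of_bool (last A = x) + of_bool (hd B = x) + of_bool (last B = x)"
proof -
  have "ed D v x = cs (eb v x) (v # A @ v # B)"
    unfolding ed_def by (rule cs_cyc[OF assms(1)])
  also have "\<dots> = eb v x v (hd A) + eb v x (last A) v + eb v x v (hd B) + eb v x (last B) v"
    by (rule cs_star) (use assms in \<open>auto simp: eb_def\<close>)
  finally show ?thesis
    using assms(6) by (simp add: eb_def conj_commute)
qed

text \<open>If \<open>i\<close> of the four edges at \<open>v\<close> end in \<open>U\<close>, then
  moving \<open>v\<close> into \<open>U\<close> removes these from the cut and adds the other 4 - i.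
  The second equation is \<open>cs_delete\<close> for this cut.\<close>

lemma cut_insert:
  assumes D: "cyc D (v # A @ v # B)" and AB: "v \<notin> set A" "v \<notin> set B" "A \<noteq> []" "B \<noteq> []" and v: "v \<notin> U"
  shows "wcut D (insert v U) + 2 * (of_bool (hd A \<in> U) + of_bool (last A \<in> U) + of_bool (hd B \<in> U) + of_bool (last B \<in> U))
     = wcut D U + 4"
    "wcut D U + sep U (last A) (hd B) + sep U (last B) (hd A)
      = wcut (A @ B) U + (of_bool (hd A \<in> U) + of_bool (last A \<in> U) + of_bool (hd B \<in> U) + of_bool (last B \<in> U))"
proof -
  have n: "hd A \<noteq> v" "last A \<noteq> v" "hd B \<noteq> v" "last B \<noteq> v"
    using AB by (metis hd_in_set last_in_set)+
  have e: "wcut D Z = cs (sep Z) (v # A @ v # B)" for Z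
    unfolding wcut_def by (rule cs_cyc[OF D])
  have s1: "wcut (A @ B) (insert v U) = wcut (A @ B) U"
    unfolding wcut_def by (rule cs_cong) (use AB in \<open>auto simp: sep_def\<close>)
  have s2: "sep (insert v U) (last A) (hd B) = sep U (last A) (hd B)"
    "sep (insert v U) (last B) (hd A) = sep U (last B) (hd A)"
    using n by (simp_all add: sep_def)
  have 1: "sep U v z = of_bool (z \<in> U)" "sep U z v = of_bool (z \<in> U)" for z
    using v by (auto simp: sep_def)
  have 2: "sep (insert v U) v z + of_bool (z \<in> U) = 1" "sep (insert v U) z v + of_bool (z \<in> U) = 1" if "z \<noteq> v" for z
    using that by (auto simp: sep_def)
  show u: "wcut D U + sep U (last A) (hd B) + sep U (last B) (hd A)
      = wcut (A @ B) U + (of_bool (hd A \<in> U) + of_bool (last A \<in> U) + of_bool (hd B \<in> U) + of_bool (last B \<in> U))"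
    using cs_delete[OF AB(3,4), of "sep U" v] unfolding e[symmetric] wcut_def[of "A @ B", symmetric] 1 by linarith
  have "wcut D (insert v U) + sep U (last A) (hd B) + sep U (last B) (hd A) = wcut (A @ B) U
     + sep (insert v U) v (hd A) + sep (insert v U) (last A) v + sep (insert v U) v (hd B) + sep (insert v U) (last B) v"
    using cs_delete[OF AB(3,4), of "sep (insert v U)" v]
    unfolding e[symmetric] s2 wcut_def[of "A @ B", symmetric] s1 .
  from this show "wcut D (insert v U) + 2 * (of_bool (hd A \<in> U) + of_bool (last A \<in> U) + of_bool (hd B \<in> U) + of_bool (last B \<in> U))
     = wcut D U + 4"
  proof -
    have "c' + 2 * (x + y + z + t) = c + 4"
      if "c' + s + s' = ab + p + q + r + r'" "c + s + s' = ab + (x + y + z + t)"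
        "p + x = 1" "q + y = 1" "r + z = 1" "r' + t = 1"
      for c c' s s' ab p q r r' x y z t :: nat
    proof -
      have "(p + q + r + r') + (x + y + z + t) = 4"
        using that(3-6) by simp
      then show ?thesis
        using that(1,2) by simp
    qed
    from this[OF \<open>wcut D (insert v U) + _ + _ = _\<close> u 2(1)[OF n(1)] 2(2)[OF n(2)] 2(1)[OF n(3)] 2(2)[OF n(4)]]
    show ?thesis .
  qed
qed

lemma cut_submodular: "wcut w (P \<inter> Q) + wcut w (P \<union> Q) \<le> wcut w P + wcut w Q"
  unfolding wcut_def cs_sum[symmetric] by (rule cs_mono) (auto simp: sep_def)

text \<open>The two degrees add up to eight and count every edge within the pair twice, every cut
  edge once.\<close>

lemma cut_pair:
  assumes "dow D" "p \<in> set D" "q \<in> set D" "p \<noteq> q"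
  shows "wcut D {p, q} + 2 * ed D p q + 2 * cs (\<lambda>a b. of_bool (a = p \<and> b = p)) D
     + 2 * cs (\<lambda>a b. of_bool (a = q \<and> b = q)) D = 8"
proof -
  let ?p = "\<lambda>a b. of_bool (a = p \<and> b = p) :: nat" and ?q = "\<lambda>a b. of_bool (a = q \<and> b = q) :: nat"
  have "cs (\<lambda>a b. sep {p, q} a b + (eb p q a b + (eb p q a b + (?p a b + (?p a b + (?q a b + ?q a b)))))) D
     = cs (\<lambda>a b. (of_bool (a = p) + of_bool (b = p)) + (of_bool (a = q) + of_bool (b = q))) D"
    by (rule cs_cong) (use assms(4) in \<open>auto simp: sep_def eb_def\<close>)
  also have "\<dots> = cs (\<lambda>a b. of_bool (a = p) + of_bool (b = p)) D + cs (\<lambda>a b. of_bool (a = q) + of_bool (b = q)) D"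
    by (rule cs_sum)
  also have "\<dots> = 8"
    by (simp only: cs_degree[OF assms(1,2)] cs_degree[OF assms(1,3)])
  finally have "wcut D {p, q} + (ed D p q + (ed D p q + (cs ?p D + (cs ?p D + (cs ?q D + cs ?q D))))) = 8"
    unfolding wcut_def ed_def cs_sum .
  then show ?thesis by linarith
qed

lemma prime_arcs:
  assumes p: "prime_word D" and card: "4 \<le> card (set D)" and c: "cyc D (v # A @ v # B)"
  shows "A \<noteq> []" "B \<noteq> []" "v \<notin> set A" "v \<notin> set B" "set D = insert v (set (A @ B))"
    "cs (\<lambda>a b. of_bool (a = v \<and> b = v)) D = 0"
proof -
  have "dow (v # A @ v # B)"
    using p dow_cyc[OF c] by (simp add: prime_word_def)
  then show n: "v \<notin> set A" "v \<notin> set B"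
    by (auto dest: dow_notin)
  show A: "A \<noteq> []"
    using prime_no_loop[OF p card, of v B] c by auto
  show B: "B \<noteq> []"
  proof
    assume "B = []"
    then have "cyc D (v # v # A)"
      using c cyc_append[of "v # A" "[v]"] cyc_trans by fastforce
    then show False
      using prime_no_loop[OF p card] by blast
  qed
  show "set D = insert v (set (A @ B))"
    using cyc_set[OF c] by auto
  have "hd A \<noteq> v" "last A \<noteq> v" "hd B \<noteq> v" "last B \<noteq> v"
    using A B n by (metis hd_in_set last_in_set)+
  then show "cs (\<lambda>a b. of_bool (a = v \<and> b = v)) D = 0"
    unfolding cs_cyc[OF c] by (subst cs_star) (use A B n in auto)
qed

lemma prime_loopless:
  assumes p: "prime_word D" and card: "4 \<le> card (set D)" and v: "v \<in> set D"
  shows "cs (\<lambda>a b. of_bool (a = v \<and> b = v)) D = 0"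
proof -
  have "dow D" using p by (simp add: prime_word_def)
  then obtain A B where "cyc D (v # A @ v # B)" "v \<notin> set A" "v \<notin> set B"
    using v by (rule dow_split)
  then show ?thesis
    using prime_arcs[OF p card] by blast
qed

lemma prime_cut_pair:
  assumes p: "prime_word D" and card: "4 \<le> card (set D)" and pq: "p \<in> set D" "q \<in> set D" "p \<noteq> q"
  shows "wcut D {p, q} + 2 * ed D p q = 8"
  using cut_pair[of D p q] prime_loopless[OF p card] p pq by (simp add: prime_word_def)

text \<open>Let \<open>i\<close> be the number of edge ends of \<open>v\<close> in a small cut
  \<open>Z\<close> of the shorter word. Comparing the cuts of \<open>Z\<close> and
  \<open>insert v Z\<close> in \<open>D\<close>, both at least six, leaves only i = 2, both cuts
  equal to six, and the two bridging edges uncut. Hence \<open>v\<close> sees the ends of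
  \<open>Z\<close> in adjacent pairs.\<close>

lemma bad_cut:
  assumes p: "prime_word D" and card: "4 \<le> card (set D)" and c: "cyc D (v # A @ v # B)"
    and bad: "\<not> prime_word (A @ B)"
  shows "\<exists>Z. Z \<subseteq> set D - {v} \<and> wcut D Z = 6 \<and> {hd A, last B} \<subseteq> Z \<and> {last A, hd B} \<inter> Z = {}"
proof -
  note AB = prime_arcs[OF p card c]
  have "dow (v # A @ v # B)"
    using p dow_cyc[OF c] by (simp add: prime_word_def)
  then have "dow (filter (\<lambda>z. z \<noteq> v) (v # A @ v # B))"
    by (rule dow_filter)
  moreover have "filter (\<lambda>z. z \<noteq> v) (v # A @ v # B) = A @ B"
  proof -
    have "filter (\<lambda>z. z \<noteq> v) A = A" "filter (\<lambda>z. z \<noteq> v) B = B"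
      using AB(3,4) by (auto intro!: filter_True)
    then show ?thesis by simp
  qed
  ultimately have "dow (A @ B)" by simp
  with bad obtain Z where Z: "Z \<subseteq> set (A @ B)" "2 \<le> card Z" "2 \<le> card (set (A @ B) - Z)" "wcut (A @ B) Z \<le> 4"
    by (auto simp: prime_word_def not_less)
  have vZ: "v \<notin> Z" using Z(1) AB(3,4) by auto
  have sD: "set D - {v} = set (A @ B)"
    using AB by auto
  note ci = cut_insert[OF c AB(3,4,1,2) vZ]
  let ?i = "of_bool (hd A \<in> Z) + of_bool (last A \<in> Z) + of_bool (hd B \<in> Z) + of_bool (last B \<in> Z) :: nat"
  have c1: "6 \<le> wcut D Z"
  proof (rule prime_wordD[OF p])
    have "set (A @ B) - Z \<subseteq> set D - Z" using AB(5) by auto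
    then show "2 \<le> card (set D - Z)"
      using Z(3) card_mono[of "set D - Z" "set (A @ B) - Z"] by simp
  qed (use Z AB(5) in auto)
  have c2: "6 \<le> wcut D (insert v Z)"
  proof (rule prime_wordD[OF p])
    have "finite Z" using Z(1) finite_subset by blast
    then show "2 \<le> card (insert v Z)"
      using Z(2) vZ by simp
    have "set D - insert v Z = set (A @ B) - Z" using sD by auto
    then show "2 \<le> card (set D - insert v Z)"
      using Z(3) by simp
  qed (use Z AB(5) in auto)
  have i: "?i = 2 \<and> sep Z (last A) (hd B) = 0 \<and> sep Z (last B) (hd A) = 0 \<and> wcut D Z = 6 \<and> wcut D (insert v Z) = 6"
  proof -
    have "i = 2 \<and> s = 0 \<and> s' = 0 \<and> c = 6 \<and> c' = 6"
      if "c' + 2 * i = c + 4" "c + s + s' = ab + i" "6 \<le> c" "6 \<le> c'" "ab \<le> 4" for c c' s s' ab i :: nat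
    proof -
      have "s + s' = 0" "c = 6" "c' = 6"
        using that by linarith+
      then show ?thesis
        using that by simp
    qed
    from this[OF ci c1 c2 Z(4)] show ?thesis .
  qed
  then have eq: "last A \<in> Z \<longleftrightarrow> hd B \<in> Z" "last B \<in> Z \<longleftrightarrow> hd A \<in> Z"
    by (auto simp: sep_def)
  then consider "hd A \<in> Z" "last B \<in> Z" "last A \<notin> Z" "hd B \<notin> Z"
    | "hd A \<notin> Z" "last B \<notin> Z" "last A \<in> Z" "hd B \<in> Z"
    using i by (cases "hd A \<in> Z"; cases "last A \<in> Z") auto
  then show ?thesis
  proof cases
    case 1
    then show ?thesis
      using i Z(1) sD by (intro exI[of _ Z]) auto
  next
    case 2
    \<comment> \<open>Here \<open>Z\<close> contains the other two ends; its complement without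
      \<open>v\<close> has them on the required sides.\<close>
    have "wcut D (set D - insert v Z) = 6"
      using cut_compl[of D "set D" "insert v Z"] i by simp
    moreover have "hd A \<in> set D - insert v Z" "last B \<in> set D - insert v Z"
      using 2 AB by auto
    ultimately show ?thesis
      using 2 by (intro exI[of _ "set D - insert v Z"]) auto
  qed
qed

subsection \<open>Prime minors of prime words\<close>

text \<open>The obstruction produced by \<open>bad_cut\<close>: a cut of six edges on which the
  neighbours of \<open>v\<close> in \<open>S\<close> and in \<open>T\<close> lie on opposite
  sides.\<close>

definition sepr :: "'a list \<Rightarrow> 'a \<Rightarrow> 'a set \<Rightarrow> 'a set \<Rightarrow> bool" where
  "sepr D v S T \<longleftrightarrow> (\<exists>P\<subseteq>set D - {v}. wcut D P = 6 \<and> S \<subseteq> P \<and> T \<inter> P = {})"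

text \<open>\<open>v\<close> has four different neighbours. The cut condition repeats
  \<open>cut_insert\<close> in terms of the set of neighbours, which makes the notion symmetric in
  all four.\<close>

definition star :: "'a list \<Rightarrow> 'a \<Rightarrow> 'a \<Rightarrow> 'a \<Rightarrow> 'a \<Rightarrow> 'a \<Rightarrow> bool" where
  "star D v a b c d \<longleftrightarrow> v \<in> set D \<and> {a, b, c, d} \<subseteq> set D - {v} \<and> distinct [a, b, c, d] \<and>
     (\<forall>U. v \<notin> U \<longrightarrow> wcut D (insert v U)
       + 2 * (\<Sum>x\<in>{a, b, c, d}. of_bool (x \<in> U)) = wcut D U + 4) \<and>
     (\<forall>x. x \<noteq> v \<longrightarrow> (ed D v x \<ge> 1 \<longleftrightarrow> x \<in> {a, b, c, d}))"

lemma star_perm: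
  assumes "star D v a b c d" "{a', b', c', d'} = {a, b, c, d}" "distinct [a', b', c', d']"
  shows "star D v a' b' c' d'"
  using assms(1,3) unfolding star_def assms(2) by blast

lemma star_cut:
  assumes "star D v a b c d" "v \<notin> U"
  shows "wcut D (insert v U)
    + 2 * (of_bool (a \<in> U) + of_bool (b \<in> U) + of_bool (c \<in> U) + of_bool (d \<in> U)) = wcut D U + 4"
proof -
  have "distinct [a, b, c, d]"
    using assms(1) by (simp add: star_def)
  then have "(\<Sum>x\<in>{a, b, c, d}. of_bool (x \<in> U)) =
      (of_bool (a \<in> U) + of_bool (b \<in> U) + of_bool (c \<in> U) + of_bool (d \<in> U) :: nat)"
    by simp
  then show ?thesis
    using assms unfolding star_def by metis
qed

text \<open>\<open>v\<close> has two edges to each side, so it may change sides without altering the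
  cut; then the complement is taken.\<close>

lemma sepr_sym:
  assumes s: "star D v a b c d" and "sepr D v {a, b} {c, d}"
  shows "sepr D v {c, d} {a, b}"
proof -
  obtain P where P: "P \<subseteq> set D - {v}" "wcut D P = 6" "{a, b} \<subseteq> P" "{c, d} \<inter> P = {}"
    using assms(2) by (auto simp: sepr_def)
  have v: "v \<notin> P" using P(1) by auto
  have "wcut D (insert v P) + 2 * 2 = wcut D P + 4"
    using star_cut[OF s v] P(3,4) by auto
  then have "wcut D (insert v P) = 6"
    using P(2) by simp
  then have "wcut D (set D - insert v P) = 6"
    using cut_compl[of D "set D" "insert v P"] by simp
  moreover have "{c, d} \<subseteq> set D - insert v P"
    using s P(4) unfolding star_def by auto
  ultimately show ?thesis
    unfolding sepr_def using P by (intro exI[of _ "set D - insert v P"]) auto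
qed

text \<open>Uncrossing: three neighbours of \<open>v\<close> lie in \<open>P \<union> Q\<close>, so
  adding \<open>v\<close> there lowers the cut by two. By submodularity the cuts of
  \<open>P \<inter> Q\<close> and \<open>insert v (P \<union> Q)\<close> add up to at most 10,
  whereas primality would require 6 + 6 if neither corner were a single letter.\<close>

lemma cross_cut:
  assumes p: "prime_word D" and s: "star D v a b c d"
    and P: "P \<subseteq> set D - {v}" "wcut D P = 6" "a \<in> P" "b \<in> P" "c \<notin> P" "d \<notin> P"
    and Q: "Q \<subseteq> set D - {v}" "wcut D Q = 6" "a \<in> Q" "c \<in> Q" "b \<notin> Q" "d \<notin> Q"
  shows "P \<inter> Q = {a} \<or> set D - {v} - (P \<union> Q) = {d}"
proof (rule ccontr)
  assume n: "\<not> ?thesis"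
  have st: "v \<in> set D" "d \<in> set D - {v}" "b \<in> set D"
    using s by (auto simp: star_def)
  have fin: "finite P" "finite Q"
    using P(1) Q(1) finite_subset by blast+
  have big: "2 \<le> card S" if S: "finite S" "x \<in> S" "S \<noteq> {x}" for S and x :: 'a
  proof -
    obtain y where "y \<in> S" "y \<noteq> x" using S(2,3) by blast
    then have "card {x, y} \<le> card S"
      using S by (intro card_mono) auto
    then show ?thesis using \<open>y \<noteq> x\<close> by simp
  qed
  have v: "v \<notin> P \<union> Q" using P(1) Q(1) by auto
  have "wcut D (insert v (P \<union> Q)) + 2 * 3 = wcut D (P \<union> Q) + 4"
    using star_cut[OF s v] P(3-6) Q(3-6) by auto
  then have le: "wcut D (P \<inter> Q) + wcut D (insert v (P \<union> Q)) \<le> 10"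
    using cut_submodular[of D P Q] P(2) Q(2) by linarith
  have n1: "P \<inter> Q \<noteq> {a}" and n2: "set D - insert v (P \<union> Q) \<noteq> {d}"
    using n by (simp_all add: set_diff_eq)
  have "6 \<le> wcut D (P \<inter> Q)"
  proof (rule prime_wordD[OF p])
    show "2 \<le> card (P \<inter> Q)"
      by (rule big[OF _ _ n1]) (use P(3) Q(3) fin in simp_all)
    have "v \<in> set D - P \<inter> Q" "b \<in> set D - P \<inter> Q" "b \<noteq> v"
      using st v P(4) Q(5) by blast+
    then show "2 \<le> card (set D - P \<inter> Q)"
      by (intro big[of _ v]) auto
  qed (use P(1) in blast)
  moreover have "6 \<le> wcut D (insert v (P \<union> Q))"
  proof (rule prime_wordD[OF p])
    have "a \<in> insert v (P \<union> Q)" "a \<noteq> v"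
      using P(3) v by blast+
    then show "2 \<le> card (insert v (P \<union> Q))"
      using fin by (intro big[of _ v]) auto
    show "2 \<le> card (set D - insert v (P \<union> Q))"
      by (rule big[OF _ _ n2]) (use st P(6) Q(6) in simp_all)
  qed (use P(1) Q(1) st in blast)
  ultimately show False using le by linarith
qed

text \<open>The two sets divide \<open>V\<close> into four corners. One corner of each diagonal is a
  single letter, and two such corners are adjacent, so they fill one side of one of the
  cuts.\<close>

lemma block_cases:
  assumes "P \<subseteq> V" "Q \<subseteq> V"
    and 1: "P \<inter> Q = {a} \<or> V - (P \<union> Q) = {d}" and 2: "P \<inter> (V - Q) = {b} \<or> V - (P \<union> (V - Q)) = {c}"
  shows "P = {a, b} \<or> Q = {a, c} \<or> V - Q = {b, d} \<or> V - P = {c, d}"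
proof -
  have e: "P \<inter> Q \<union> P \<inter> (V - Q) = P" "P \<inter> Q \<union> (V - (P \<union> (V - Q))) = Q"
    "P \<inter> (V - Q) \<union> (V - (P \<union> Q)) = V - Q" "(V - (P \<union> (V - Q))) \<union> (V - (P \<union> Q)) = V - P"
    using assms(1,2) by blast+
  have u: "{x, y} = {x} \<union> {y}" for x y :: 'a by (rule insert_is_Un)
  from 1 show ?thesis
  proof
    assume a: "P \<inter> Q = {a}"
    from 2 show ?thesis
    proof
      assume "P \<inter> (V - Q) = {b}"
      then show ?thesis using e(1) unfolding u a by simp
    next
      assume "V - (P \<union> (V - Q)) = {c}"
      then show ?thesis using e(2) unfolding u a by simp
    qed
  next
    assume d: "V - (P \<union> Q) = {d}"
    from 2 show ?thesis
    proof
      assume "P \<inter> (V - Q) = {b}"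
      then show ?thesis using e(3) unfolding u d by simp
    next
      assume "V - (P \<union> (V - Q)) = {c}"
      then show ?thesis using e(4) unfolding u d by simp
    qed
  qed
qed

text \<open>\<open>cross_cut\<close> is applied to \<open>Q\<close> and to its complement in
  \<open>set D - {v}\<close>; \<open>block_cases\<close> then finds a side that consists of two
  neighbours only.\<close>

lemma small_block:
  assumes p: "prime_word D" and s: "star D v a b c d"
    and "sepr D v {a, b} {c, d}" "sepr D v {a, c} {b, d}"
  shows "wcut D {a, b} = 6 \<or> wcut D {a, c} = 6 \<or> wcut D {b, d} = 6 \<or> wcut D {c, d} = 6"
proof -
  obtain P where P: "P \<subseteq> set D - {v}" "wcut D P = 6" "a \<in> P" "b \<in> P" "c \<notin> P" "d \<notin> P"
    using assms(3) by (auto simp: sepr_def)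
  obtain Q where Q: "Q \<subseteq> set D - {v}" "wcut D Q = 6" "a \<in> Q" "c \<in> Q" "b \<notin> Q" "d \<notin> Q"
    using assms(4) by (auto simp: sepr_def)
  let ?V = "set D - {v}"
  have st: "{a, b, c, d} \<subseteq> set D - {v}" "distinct [a, b, c, d]"
    using s by (auto simp: star_def)
  have co: "wcut D (?V - R) = 6"
    if "v \<notin> R" "wcut D R = 6" "of_bool (a \<in> R) + of_bool (b \<in> R) + of_bool (c \<in> R) + of_bool (d \<in> R) = (2::nat)" for R
  proof -
    have "wcut D (insert v R) + 2 * 2 = wcut D R + 4"
      using star_cut[OF s that(1)] that(3) by simp
    then have "wcut D (set D - insert v R) = 6"
      using cut_compl[of D "set D" "insert v R"] that(2) by simp
    moreover have "set D - insert v R = ?V - R" by blast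
    ultimately show ?thesis by (simp only:)
  qed
  have vPQ: "v \<notin> P" "v \<notin> Q"
    using P(1) Q(1) by blast+
  have Q': "wcut D (?V - Q) = 6"
    by (rule co[OF vPQ(2) Q(2)]) (simp add: Q(3-6))
  have P': "wcut D (?V - P) = 6"
    by (rule co[OF vPQ(1) P(2)]) (simp add: P(3-6))
  have 1: "P \<inter> Q = {a} \<or> ?V - (P \<union> Q) = {d}"
    by (rule cross_cut[OF p s P Q])
  have s': "star D v b a d c"
    by (rule star_perm[OF s]) (simp add: insert_commute, use st(2) in simp, metis)
  have 2: "P \<inter> (?V - Q) = {b} \<or> ?V - (P \<union> (?V - Q)) = {c}"
  proof (rule cross_cut[OF p s' P(1,2,4,3,6,5) _ Q'])
    show "?V - Q \<subseteq> ?V" by blast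
    show "b \<in> ?V - Q" "d \<in> ?V - Q" "a \<notin> ?V - Q" "c \<notin> ?V - Q"
      using st(1) Q(3-6) by simp_all
  qed
  show ?thesis
    using block_cases[OF P(1) Q(1) 1 2] P(2) Q(2) P' Q' by (elim disjE) simp_all
qed

text \<open>At least three of the four edges at \<open>a\<close> leave \<open>P\<close>, towards
  \<open>b\<close>, \<open>c\<close> and \<open>v\<close>; taking \<open>a\<close> out lowers the
  cut from six to at most four. Primality then forces \<open>P = {a, d}\<close>, and a pair with cut
  six is joined by an edge.\<close>

lemma third_edge:
  assumes p: "prime_word D" and card: "4 \<le> card (set D)" and s: "star D v a b c d"
    and ab: "ed D a b \<ge> 1" and ac: "ed D a c \<ge> 1" and sp: "sepr D v {a, d} {b, c}"
  shows "ed D a d \<ge> 1"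
proof -
  obtain P where P: "P \<subseteq> set D - {v}" "wcut D P = 6" "a \<in> P" "d \<in> P" "b \<notin> P" "c \<notin> P"
    using sp by (auto simp: sepr_def)
  have st: "{a, b, c, d} \<subseteq> set D - {v}" "distinct [a, b, c, d]" "v \<in> set D" "ed D v a \<ge> 1"
    using s by (auto simp: star_def)
  have dow: "dow D" using p by (simp add: prime_word_def)
  have "cs (\<lambda>a' b'. sep (P - {a}) a' b' + (eb a b a' b' + eb a b a' b') + (eb a c a' b' + eb a c a' b')
      + (eb a v a' b' + eb a v a' b')) D \<le> cs (\<lambda>a' b'. sep P a' b' + (of_bool (a' = a) + of_bool (b' = a))) D"
    by (rule cs_mono) (use P st in \<open>auto simp: sep_def eb_def\<close>)
  then have "wcut D (P - {a}) + 2 * ed D a b + 2 * ed D a c + 2 * ed D a v \<le> wcut D P + 4"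
    unfolding cs_sum wcut_def[symmetric] ed_def[symmetric] using cs_degree[OF dow, of a, unfolded cs_sum] st(1) by simp
  then have le: "wcut D (P - {a}) \<le> 4"
    using ab ac st(4) P(2) ed_sym[of D a v] by linarith
  have fin: "finite P" using P(1) finite_subset by blast
  have "P - {a} = {d}"
  proof (rule ccontr)
    assume n: "P - {a} \<noteq> {d}"
    obtain y where "y \<in> P - {a}" "y \<noteq> d"
      using n P(4) st(2) by auto
    then have "card {d, y} \<le> card (P - {a})"
      using P(4) st(2) fin by (intro card_mono) auto
    then have 1: "2 \<le> card (P - {a})"
      using \<open>y \<noteq> d\<close> by simp
    have "card {b, c} \<le> card (set D - (P - {a}))"
      using P(5,6) st by (intro card_mono) auto
    then have 2: "2 \<le> card (set D - (P - {a}))"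
      using st(2) by simp
    show False
      using prime_wordD[OF p _ 1 2] P(1) le by auto
  qed
  then have "P = {a, d}"
    using P(3) by auto
  then have "wcut D {a, d} = 6"
    using P(2) by simp
  then show ?thesis
    using prime_cut_pair[OF p card, of a d] st(1,2) by auto
qed

text \<open>Any two of the separations yield an edge on a four-cycle of the neighbours
  (\<open>small_block\<close>), and a neighbour joined to two others is joined to the third
  (\<open>third_edge\<close>). A graph on four vertices with these properties has a vertex joined to
  all others.\<close>

lemma mate:
  assumes p: "prime_word D" and card: "4 \<le> card (set D)" and s: "star D v a b c d"
    and s1: "sepr D v {a, b} {c, d}" and s2: "sepr D v {a, c} {b, d}" and s3: "sepr D v {a, d} {b, c}"
  shows "\<exists>x\<in>{a, b, c, d}. \<forall>y\<in>{a, b, c, d} - {x}. ed D x y \<ge> 1"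
proof -
  have st: "{a, b, c, d} \<subseteq> set D - {v}" "distinct [a, b, c, d]"
    using s by (auto simp: star_def)
  have edge: "ed D x y \<ge> 1" if "wcut D {x, y} = 6" "x \<in> {a, b, c, d}" "y \<in> {a, b, c, d}" "x \<noteq> y" for x y
    using prime_cut_pair[OF p card, of x y] that st(1) by auto
  have S: "star D v a b c d" "star D v a b d c" "star D v a c b d" "star D v a c d b" "star D v a d b c" "star D v a d c b"
    "star D v b a c d" "star D v b a d c" "star D v b c a d" "star D v b c d a" "star D v b d a c" "star D v b d c a"
    "star D v c a b d" "star D v c a d b" "star D v c b a d" "star D v c b d a" "star D v c d a b" "star D v c d b a"
    "star D v d a b c" "star D v d a c b" "star D v d b a c" "star D v d b c a" "star D v d c a b" "star D v d c b a"
    using st(2) by (auto intro!: star_perm[OF s])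
  have t1: "sepr D v {c, d} {a, b}" and t2: "sepr D v {b, d} {a, c}" and t3: "sepr D v {b, c} {a, d}"
    using sepr_sym[OF S(1) s1] sepr_sym[OF S(3) s2] sepr_sym[OF S(5) s3] .
  note ic = insert_commute[of _ _ "{}"]
  have c1: "wcut D {a, b} = 6 \<or> wcut D {a, c} = 6 \<or> wcut D {b, d} = 6 \<or> wcut D {c, d} = 6"
    by (rule small_block[OF p S(1) s1 s2])
  have c2: "wcut D {a, b} = 6 \<or> wcut D {a, d} = 6 \<or> wcut D {b, c} = 6 \<or> wcut D {d, c} = 6"
    by (rule small_block[OF p S(2)]) (use s1 s3 in \<open>simp_all add: ic\<close>)
  have c3: "wcut D {a, c} = 6 \<or> wcut D {a, d} = 6 \<or> wcut D {c, b} = 6 \<or> wcut D {d, b} = 6"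
    by (rule small_block[OF p S(4)]) (use s2 s3 in \<open>simp_all add: ic\<close>)
  define m where "m x y \<longleftrightarrow> ed D x y \<ge> 1" for x y
  have msym: "m x y \<longleftrightarrow> m y x" for x y
    by (simp add: m_def ed_sym)
  have e1: "m a b \<or> m a c \<or> m b d \<or> m c d"
    using c1 edge[of a b] edge[of a c] edge[of b d] edge[of c d] st(2) unfolding m_def by auto
  have e2: "m a b \<or> m a d \<or> m b c \<or> m d c"
    using c2 edge[of a b] edge[of a d] edge[of b c] edge[of d c] st(2) unfolding m_def by auto
  have e3: "m a c \<or> m a d \<or> m c b \<or> m d b"
    using c3 edge[of a c] edge[of a d] edge[of c b] edge[of d b] st(2) unfolding m_def by auto
  have T: "m x w" if "star D v x y z w" "sepr D v {x, w} {y, z}" "m x y" "m x z" for x y z w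
    using third_edge[OF p card that(1)] that(2-4) by (simp add: m_def)
  have u1: "sepr D v {b, a} {c, d}" "sepr D v {d, c} {a, b}"
    and u2: "sepr D v {c, a} {b, d}" "sepr D v {d, b} {a, c}"
    and u3: "sepr D v {d, a} {b, c}" "sepr D v {c, b} {a, d}"
    using s1 t1 s2 t2 s3 t3 by (simp_all add: ic)
  have Ta: "m a b \<Longrightarrow> m a c \<Longrightarrow> m a d" "m a b \<Longrightarrow> m a d \<Longrightarrow> m a c" "m a c \<Longrightarrow> m a d \<Longrightarrow> m a b"
    by (rule T[OF S(1) s3] T[OF S(2) s2] T[OF S(4) s1]; assumption)+
  have Tb: "m b a \<Longrightarrow> m b c \<Longrightarrow> m b d" "m b a \<Longrightarrow> m b d \<Longrightarrow> m b c" "m b c \<Longrightarrow> m b d \<Longrightarrow> m b a"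
    by (rule T[OF S(7) t2] T[OF S(8) t3] T[OF S(10) u1(1)]; assumption)+
  have Tc: "m c a \<Longrightarrow> m c b \<Longrightarrow> m c d" "m c a \<Longrightarrow> m c d \<Longrightarrow> m c b" "m c b \<Longrightarrow> m c d \<Longrightarrow> m c a"
    by (rule T[OF S(13) t1] T[OF S(14) u3(2)] T[OF S(16) u2(1)]; assumption)+
  have Td: "m d a \<Longrightarrow> m d b \<Longrightarrow> m d c" "m d a \<Longrightarrow> m d c \<Longrightarrow> m d b" "m d b \<Longrightarrow> m d c \<Longrightarrow> m d a"
    by (rule T[OF S(19) u1(2)] T[OF S(20) u2(2)] T[OF S(22) u3(1)]; assumption)+
  have "(m a b \<and> m a c \<and> m a d) \<or> (m b a \<and> m b c \<and> m b d) \<or> (m c a \<and> m c b \<and> m c d) \<or> (m d a \<and> m d b \<and> m d c)"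
    using e1 e2 e3 Ta Tb Tc Td msym[of a b] msym[of a c] msym[of a d] msym[of b c] msym[of b d] msym[of c d] by argo
  then show ?thesis
    unfolding m_def[symmetric] by blast
qed

text \<open>Of the total degree 16 the six inner edges use 12, which leaves a cut of at most four
  edges.\<close>

lemma prime_no_K4:
  assumes p: "prime_word D" and card: "6 \<le> card (set D)" and K: "{v, a, b, c} \<subseteq> set D" "distinct [v, a, b, c]"
    and e: "ed D v a \<ge> 1" "ed D v b \<ge> 1" "ed D v c \<ge> 1" "ed D a b \<ge> 1" "ed D a c \<ge> 1" "ed D b c \<ge> 1"
  shows False
proof -
  have dow: "dow D" using p by (simp add: prime_word_def)
  let ?dg = "\<lambda>x a' b'. of_bool (a' = x) + of_bool (b' = x) :: nat"
  have ineq: "cs (\<lambda>x y. sep {v, a, b, c} x y + (eb v a x y + eb v a x y) + (eb v b x y + eb v b x y) + (eb v c x y + eb v c x y)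
     + (eb a b x y + eb a b x y) + (eb a c x y + eb a c x y) + (eb b c x y + eb b c x y)) D
    \<le> cs (\<lambda>x y. ?dg v x y + ?dg a x y + ?dg b x y + ?dg c x y) D"
    by (rule cs_mono) (use K(2) in \<open>auto simp: sep_def eb_def\<close>)
  have deg: "cs (?dg x) D = 4" if "x \<in> {v, a, b, c}" for x
    using cs_degree[OF dow, of x] K(1) that by blast
  have deg': "cs (?dg v) D = 4" "cs (?dg a) D = 4" "cs (?dg b) D = 4" "cs (?dg c) D = 4"
    by (rule deg, simp)+
  have "wcut D {v, a, b, c} + 2 * ed D v a + 2 * ed D v b + 2 * ed D v c + 2 * ed D a b + 2 * ed D a c
     + 2 * ed D b c \<le> 16"
    using ineq[unfolded cs_sum] deg'[unfolded cs_sum] unfolding wcut_def ed_def by linarith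
  then have "wcut D {v, a, b, c} \<le> 4"
    using e by linarith
  moreover have "card {v, a, b, c} = 4"
    using K(2) by simp
  moreover have "card (set D - {v, a, b, c}) = card (set D) - 4"
    using K by (subst card_Diff_subset) auto
  ultimately have "2 \<le> card (set D - {v, a, b, c})" "2 \<le> card {v, a, b, c}" "\<not> 6 \<le> wcut D {v, a, b, c}"
    using card by linarith+
  then show False
    using prime_wordD[OF p K(1)] by blast
qed

text \<open>Deleting \<open>v\<close> from these words gives the minors of \<open>D\<close> at \<open>v\<close>; the last disjunct is the case of the pivot on \<open>v w\<close>.\<close>

definition lc2 :: "'a \<Rightarrow> 'a list \<Rightarrow> 'a list \<Rightarrow> bool" where
  "lc2 v D E \<longleftrightarrow> E = D \<or> lcr v D E \<or> (\<exists>w F. lcr w D F \<and> lcr v F E)"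

definition stuck :: "'a list \<Rightarrow> 'a \<Rightarrow> bool" where
  "stuck D v \<longleftrightarrow> (\<forall>E A B. lc2 v D E \<longrightarrow> cyc E (v # A @ v # B) \<longrightarrow> \<not> prime_word (A @ B))"

lemma bad_cut_sepr:
  assumes "prime_word D" "4 \<le> card (set D)" "cyc D (v # A @ v # B)" "\<not> prime_word (A @ B)"
  shows "sepr D v {hd A, last B} {last A, hd B}"
  using bad_cut[OF assms] unfolding sepr_def by blast

text \<open>Supplies the chord \<open>w\<close> for the pivot at \<open>v\<close>.\<close>

lemma prime_crossing:
  assumes p: "prime_word D" and card: "4 \<le> card (set D)" and c: "cyc D (v # A @ v # B)"
  shows "\<exists>w. w \<in> set A \<inter> set B"
proof (rule ccontr)
  assume "\<not> ?thesis"
  then have "set (A @ []) \<inter> set (B @ []) = {}" by auto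
  then have "(A = [] \<and> [] = ([]::'a list)) \<or> (B = [] \<and> [] = ([]::'a list))"
    by (rule prime_share_trivial[OF p card, of v, rotated]) (use c prime_arcs[OF p card c] in auto)
  then show False
    using prime_arcs[OF p card c] by blast
qed

text \<open>The three minors join the four edges at \<open>v\<close> in the three possible pairings.
  Their parent words are circuits of the same four-valent graph, so the cuts found for them are cuts
  of \<open>D\<close>.\<close>

lemma stuck_sepr:
  assumes p: "prime_word D" and card: "4 \<le> card (set D)" and c: "cyc D (v # A @ v # B)" and s: "stuck D v"
  shows "sepr D v {hd A, last B} {last A, hd B}" "sepr D v {last A, last B} {hd A, hd B}"
    "sepr D v {last B, hd B} {last A, hd A}"
proof -
  note AB = prime_arcs[OF p card c]
  have dow: "dow D" using p by (simp add: prime_word_def)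
  have np: "\<not> prime_word (P @ Q)" if "lc2 v D E" "cyc E (v # P @ v # Q)" for E P Q
    using s that unfolding stuck_def by blast
  show "sepr D v {hd A, last B} {last A, hd B}"
    by (rule bad_cut_sepr[OF p card c np[OF _ c]]) (simp add: lc2_def)
  have tr: "sepr D v S T" if "sepr E v S T" "set E = set D" "\<And>Z. wcut E Z = wcut D Z" for E S T
    using that unfolding sepr_def by simp
  define E where "E = v # rev A @ v # B"
  have l: "lcr v D E"
    unfolding lcr_def E_def using c cyc_refl by blast
  have "sepr E v {hd (rev A), last B} {last (rev A), hd B}"
  proof (rule bad_cut_sepr)
    show "prime_word E" "4 \<le> card (set E)" "cyc E (v # rev A @ v # B)"
      using p card lcr_prime[OF l] lcr_set[OF l] by (simp_all add: E_def)
    show "\<not> prime_word (rev A @ B)"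
      by (rule np[of E]) (use l in \<open>simp_all add: lc2_def E_def\<close>)
  qed
  then show "sepr D v {last A, last B} {hd A, hd B}"
    using tr[OF _ lcr_set[OF l, symmetric] lcr_cut[OF l]] AB(1) by (simp add: hd_rev last_rev)
  obtain w where w: "w \<in> set A" "w \<in> set B"
    using prime_crossing[OF p card c] by blast
  obtain A1 A2 where A: "A = A1 @ w # A2"
    using w(1) by (meson split_list)
  obtain B1 B2 where B: "B = B1 @ w # B2"
    using w(2) by (meson split_list)
  \<comment> \<open>\<open>F\<close> is \<open>D\<close> complemented at \<open>w\<close>, and
    \<open>G\<close> is \<open>F\<close> complemented at \<open>v\<close>. In \<open>G\<close> the
    arcs at \<open>v\<close> run from \<open>last B\<close> to \<open>last A\<close> and from
    \<open>hd A\<close> to \<open>hd B\<close>, the pairing that \<open>D\<close> and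
    \<open>E\<close> do not show.\<close>
  define F where "F = w # rev (A2 @ v # B1) @ w # (B2 @ v # A1)"
  define G where "G = v # rev (rev A2 @ w # B2) @ v # (A1 @ w # rev B1)"
  have "cyc (v # A @ v # B) (w # (A2 @ v # B1) @ w # (B2 @ v # A1))"
    using cyc_append[of "v # A1" "w # A2 @ v # B1 @ w # B2"] by (simp add: A B)
  then have f: "lcr w D F"
    unfolding lcr_def F_def using cyc_trans[OF c] cyc_refl by blast
  have "cyc F (v # (rev A2 @ w # B2) @ v # (A1 @ w # rev B1))"
    using cyc_append[of "w # rev B1" "v # rev A2 @ w # B2 @ v # A1"] by (simp add: F_def)
  then have g: "lcr v F G"
    unfolding lcr_def G_def using cyc_refl by blast
  have sG: "set G = set D"
    using lcr_set[OF f] lcr_set[OF g] by simp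
  have cG: "wcut G Z = wcut D Z" for Z
    using lcr_cut[OF f] lcr_cut[OF g] by simp
  have "sepr G v {hd (rev (rev A2 @ w # B2)), last (A1 @ w # rev B1)} {last (rev (rev A2 @ w # B2)), hd (A1 @ w # rev B1)}"
  proof (rule bad_cut_sepr)
    show "prime_word G" "4 \<le> card (set G)"
      using p card lcr_prime[OF f] lcr_prime[OF g] sG by simp_all
    show "cyc G (v # rev (rev A2 @ w # B2) @ v # (A1 @ w # rev B1))"
      by (simp add: G_def)
    then show "\<not> prime_word (rev (rev A2 @ w # B2) @ A1 @ w # rev B1)"
      by (rule np[of G, rotated]) (use f g in \<open>auto simp: lc2_def\<close>)
  qed
  moreover have "hd (rev (rev A2 @ w # B2)) = last B" "last (A1 @ w # rev B1) = hd B"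
    "last (rev (rev A2 @ w # B2)) = last A" "hd (A1 @ w # rev B1) = hd A"
    unfolding A B by (simp_all add: hd_append last_rev hd_rev)
  ultimately show "sepr D v {last B, hd B} {last A, hd A}"
    using tr[OF _ sG cG] by metis
qed

text \<open>Any two of the four arc ends are on opposite sides of one of the three separations,
  hence distinct. The order of the neighbours is then chosen to put the one found by
  \<open>mate\<close> first.\<close>

lemma stuck_mate:
  assumes p: "prime_word D" and card: "4 \<le> card (set D)" and v: "v \<in> set D" and s: "stuck D v"
  shows "\<exists>a b c d. star D v a b c d \<and> ed D a b \<ge> 1 \<and> ed D a c \<ge> 1 \<and> ed D a d \<ge> 1"
proof -
  have "dow D" using p by (simp add: prime_word_def)
  then obtain A B where c: "cyc D (v # A @ v # B)"
    using v by (rule dow_split)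
  note AB = prime_arcs[OF p card c] and S = stuck_sepr[OF p card c s]
  define a b c' d where abcd: "a = hd A" "b = last A" "c' = hd B" "d = last B"
  note S' = S[folded abcd]
  have "a \<noteq> b" "a \<noteq> c'" "d \<noteq> b" "d \<noteq> c'" "b \<noteq> c'" "d \<noteq> a"
    using S' unfolding sepr_def by blast+
  then have dist: "distinct [a, b, c', d]" by auto
  have mem: "{a, b, c', d} \<subseteq> set D - {v}"
    using AB hd_in_set[of A] last_in_set[of A] hd_in_set[of B] last_in_set[of B] unfolding abcd by auto
  have st: "star D v a b c' d"
    unfolding star_def
  proof (intro conjI allI impI)
    fix U assume U: "v \<notin> U"
    have "(\<Sum>x\<in>{a, b, c', d}. of_bool (x \<in> U)) =
        (of_bool (a \<in> U) + of_bool (b \<in> U) + of_bool (c' \<in> U) + of_bool (d \<in> U) :: nat)"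
      using dist by simp
    then show "wcut D (insert v U) + 2 * (\<Sum>x\<in>{a, b, c', d}. of_bool (x \<in> U)) = wcut D U + 4"
      using cut_insert(1)[OF c AB(3,4,1,2) U] unfolding abcd by simp
  next
    fix x assume "x \<noteq> v"
    then show "(ed D v x \<ge> 1) \<longleftrightarrow> x \<in> {a, b, c', d}"
      using ed_star[OF c AB(3,4,1,2), of x, folded abcd] by auto
  qed (use dist mem v in auto)
  have st2: "star D v d c' b a" "star D v b d a c'"
    by (rule star_perm[OF st], blast, use dist in auto)+
  have s1: "sepr D v {a, b} {c', d}"
    using sepr_sym[OF st2(1) S'(3)] by (simp add: insert_commute)
  have s2: "sepr D v {a, c'} {b, d}"
    using sepr_sym[OF st2(2) S'(2)] by (simp add: insert_commute)
  obtain x where x: "x \<in> {a, b, c', d}" "\<forall>y\<in>{a, b, c', d} - {x}. ed D x y \<ge> 1"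
    using mate[OF p card st s1 s2 S'(1)] by blast
  have "\<exists>p q r. {x, p, q, r} = {a, b, c', d} \<and> distinct [x, p, q, r]"
    using x(1)
  proof (elim insertE emptyE)
    assume "x = a" then show ?thesis
      using dist by (intro exI[of _ b] exI[of _ c'] exI[of _ d]) auto
  next
    assume "x = b" then show ?thesis
      using dist by (intro exI[of _ a] exI[of _ c'] exI[of _ d]) auto
  next
    assume "x = c'" then show ?thesis
      using dist by (intro exI[of _ a] exI[of _ b] exI[of _ d]) auto
  next
    assume "x = d" then show ?thesis
      using dist by (intro exI[of _ a] exI[of _ b] exI[of _ c']) auto
  qed
  then obtain p q r where pqr: "{x, p, q, r} = {a, b, c', d}" "distinct [x, p, q, r]" by blast
  have "star D v x p q r"
    by (rule star_perm[OF st pqr])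
  moreover have "ed D x p \<ge> 1" "ed D x q \<ge> 1" "ed D x r \<ge> 1"
    using x(2)[folded pqr(1)] pqr(2) by auto
  ultimately show ?thesis by blast
qed

lemma starD:
  assumes "star D v a b c d"
  shows "a \<in> set D" "b \<in> set D" "c \<in> set D" "d \<in> set D" "v \<in> set D" "distinct [v, a, b, c, d]"
    "x \<noteq> v \<Longrightarrow> ed D v x \<ge> 1 \<Longrightarrow> x \<in> {a, b, c, d}" "x \<in> {a, b, c, d} \<Longrightarrow> ed D v x \<ge> 1"
proof -
  show "a \<in> set D" "b \<in> set D" "c \<in> set D" "d \<in> set D" "v \<in> set D" "distinct [v, a, b, c, d]"
    using assms unfolding star_def by auto
  show "x \<noteq> v \<Longrightarrow> ed D v x \<ge> 1 \<Longrightarrow> x \<in> {a, b, c, d}"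
    using assms unfolding star_def by blast
  assume "x \<in> {a, b, c, d}"
  moreover from this have "x \<noteq> v" using assms unfolding star_def by blast
  ultimately show "ed D v x \<ge> 1"
    using assms unfolding star_def by blast
qed

text \<open>\<open>stuck_mate\<close> holds at every letter. Applied at \<open>v\<close>, at the
  special neighbour \<open>a\<close> and at a further neighbour \<open>b\<close>, it produces four
  mutually adjacent letters, against \<open>prime_no_K4\<close>.\<close>

lemma not_all_stuck:
  assumes p: "prime_word D" and card: "6 \<le> card (set D)" and s: "\<And>v. v \<in> set D \<Longrightarrow> stuck D v"
  shows False
proof -
  have card4: "4 \<le> card (set D)" using card by simp
  have mate: "\<exists>a b c d. star D v a b c d \<and> ed D a b \<ge> 1 \<and> ed D a c \<ge> 1 \<and> ed D a d \<ge> 1" if "v \<in> set D" for v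
    by (rule stuck_mate[OF p card4 that s[OF that]])
  have "D \<noteq> []" using card by auto
  then obtain v where "v \<in> set D" using hd_in_set by metis
  then obtain a b c d where v: "star D v a b c d" and e: "ed D a b \<ge> 1" "ed D a c \<ge> 1" "ed D a d \<ge> 1"
    using mate by metis
  note V = starD[OF v]
  have ev: "ed D v a \<ge> 1" "ed D v b \<ge> 1" "ed D v c \<ge> 1" "ed D v d \<ge> 1"
    by (rule V(8), simp)+
  \<comment> \<open>\<open>a\<close> too has exactly four neighbours, and four of them are already
    known.\<close>
  have Na: "x \<in> {v, b, c, d}" if x: "x \<noteq> a" "ed D a x \<ge> 1" for x
  proof -
    obtain a' b' c' d' where "star D a a' b' c' d'"
      using mate[OF V(1)] by blast
    note A = starD[OF this]
    have "v \<in> {a', b', c', d'}" "b \<in> {a', b', c', d'}" "c \<in> {a', b', c', d'}" "d \<in> {a', b', c', d'}"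
      using A(7)[of v] A(7)[of b] A(7)[of c] A(7)[of d] e ev(1) V(6) ed_sym[of D v a] by auto
    then have "{v, b, c, d} \<subseteq> {a', b', c', d'}" by blast
    moreover have "card {v, b, c, d} = 4" "card {a', b', c', d'} = 4"
      using V(6) A(6) by auto
    ultimately have "{v, b, c, d} = {a', b', c', d'}"
      by (intro card_subset_eq) auto
    then show ?thesis
      using A(7)[OF x] by simp
  qed
  obtain x p' q r where b: "star D b x p' q r" and f: "ed D x p' \<ge> 1" "ed D x q \<ge> 1" "ed D x r \<ge> 1"
    using mate[OF V(2)] by blast
  note B = starD[OF b]
  have vB: "v \<in> {x, p', q, r}" and aB: "a \<in> {x, p', q, r}"
    using B(7)[of v] B(7)[of a] ev(2) e(1) V(6) ed_sym[of D v b] ed_sym[of D a b] by auto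
  have f': "ed D x y \<ge> 1" if "y \<in> {x, p', q, r}" "y \<noteq> x" for y
    using that f by blast
  \<comment> \<open>If the special neighbour \<open>x\<close> of \<open>b\<close> is neither
    \<open>v\<close> nor \<open>a\<close>, it is joined to both. Otherwise a third neighbour
    \<open>y\<close> of \<open>b\<close> is joined to \<open>x\<close>, and the known neighbourhoods
    of \<open>v\<close> and \<open>a\<close> make it \<open>c\<close> or \<open>d\<close>.\<close>
  have "\<exists>y. y \<in> {x, p', q, r} \<and> y \<noteq> v \<and> y \<noteq> a \<and> ed D v y \<ge> 1 \<and> ed D a y \<ge> 1"
  proof (cases "x = v \<or> x = a")
    case False
    then show ?thesis
      using f'[OF vB] f'[OF aB] ed_sym[of D x v] ed_sym[of D x a] by auto
  next
    case True
    have "card {x, p', q, r} = 4"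
      using B(6) by auto
    moreover have "card {v, a} \<le> 2" by (simp add: card_insert_if)
    ultimately have "\<not> {x, p', q, r} \<subseteq> {v, a}"
      using card_mono[of "{v, a}" "{x, p', q, r}"] by auto
    then obtain y where y: "y \<in> {x, p', q, r}" "y \<noteq> v" "y \<noteq> a" by blast
    have yb: "y \<noteq> b"
      using y(1) B(6) by auto
    have "y \<noteq> x" using y True by auto
    note xy = f'[OF y(1) this]
    have "y \<in> {c, d}"
      using True
    proof
      assume "x = v"
      then show ?thesis using V(7)[of y] xy y yb by auto
    next
      assume "x = a"
      then show ?thesis using Na[of y] xy y yb by auto
    qed
    then show ?thesis
      using y ev e by auto
  qed
  then obtain y where y: "y \<in> {x, p', q, r}" "y \<noteq> v" "y \<noteq> a" "ed D v y \<ge> 1" "ed D a y \<ge> 1" by blast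
  have bz: "ed D b y \<ge> 1" "y \<noteq> b" "y \<in> set D"
    using B(8)[OF y(1)] y(1) B(1-6) by auto
  show False
    by (rule prime_no_K4[OF p card, of v a b y]) (use V bz y e ev in auto)
qed

lemma chain:
  assumes "prime_word D" "6 \<le> card (set D)"
  obtains v E A B where "v \<in> set D" "lc2 v D E" "cyc E (v # A @ v # B)" "prime_word (A @ B)"
  using not_all_stuck[OF assms] unfolding stuck_def by blast

section \<open>Words determined by their interlacement\<close>

definition determined :: "'a list \<Rightarrow> bool" where
  "determined D \<longleftrightarrow> (\<forall>D'. dow D' \<longrightarrow> set D' = set D \<longrightarrow> (\<forall>x y. cr D' x y \<longleftrightarrow> cr D x y) \<longrightarrow> dih D D')"

text \<open>Both words are complemented at \<open>v\<close>: by \<open>lcr_cr\<close> the results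
  again have equal interlacement, and \<open>lcr_dih\<close> carries their equivalence back.\<close>

lemma determined_lcr:
  assumes dow: "dow D" and l: "lcr v D E" and v: "v \<in> set D" and E: "determined E"
  shows "determined D"
  unfolding determined_def
proof (intro allI impI)
  fix D' assume D': "dow D'" "set D' = set D" "\<forall>x y. cr D' x y \<longleftrightarrow> cr D x y"
  obtain E' where l': "lcr v D' E'"
    using lcr_exists[OF D'(1)] D'(2) v by blast
  have "dih E E'"
    using E unfolding determined_def
  proof (elim allE impE)
    show "dow E'" using lcr_dow[OF l'] D' by simp
    show "set E' = set E" using lcr_set[OF l'] lcr_set[OF l] D' by simp
    show "\<forall>x y. cr E' x y \<longleftrightarrow> cr E x y"
      using lcr_cr[OF l dow] lcr_cr[OF l' D'(1)] D'(3) by simp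
  qed
  then show "dih D D'"
    by (rule lcr_dih[OF l l' dow D'(1)])
qed

lemma lcr_in_set: "lcr v D E \<Longrightarrow> v \<in> set D"
  unfolding lcr_def by (auto dest: cyc_set)

lemma determined_lc2:
  assumes "dow D" "lc2 v D E" "determined E"
  shows "determined D"
  using assms(2) unfolding lc2_def
proof (elim disjE exE conjE)
  assume "E = D" then show ?thesis using assms by simp
next
  assume l: "lcr v D E"
  then show ?thesis
    using determined_lcr[OF assms(1) l lcr_in_set[OF l]] assms(3) by simp
next
  fix w F assume l: "lcr w D F" "lcr v F E"
  have "dow F" using lcr_dow[OF l(1)] assms(1) by simp
  then have "determined F"
    using determined_lcr[OF _ l(2) lcr_in_set[OF l(2)] assms(3)] by simp
  then show ?thesis
    using determined_lcr[OF assms(1) l(1) lcr_in_set[OF l(1)]] by simp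
qed

text \<open>Without \<open>v\<close> the two words agree up to rotation and reversal; after passing
  to the reverse of \<open>D'\<close> if necessary, \<open>insert_prime\<close> leaves only one
  place for \<open>v\<close>.\<close>

lemma determined_insert:
  assumes p: "prime_word E" and card: "4 \<le> card (set E)" and c: "cyc E (v # A @ v # B)"
    and AB: "determined (A @ B)"
  shows "determined E"
  unfolding determined_def
proof (intro allI impI)
  fix D' assume D': "dow D'" "set D' = set E" "\<forall>x y. cr D' x y \<longleftrightarrow> cr E x y"
  let ?f = "filter (\<lambda>z. z \<noteq> v)"
  note arcs = prime_arcs[OF p card c]
  have "?f A = A" "?f B = B"
    using arcs(3,4) by (auto intro!: filter_True)
  then have "?f (v # A @ v # B) = A @ B" by simp
  then have fE: "cyc (?f E) (A @ B)"
    using cyc_filter[OF c, of "\<lambda>z. z \<noteq> v"] by simp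
  have cr: "cr (?f w) x y \<longleftrightarrow> x \<noteq> v \<and> y \<noteq> v \<and> cr w x y" for w :: "'a list" and x y
  proof (cases "x \<noteq> v \<and> y \<noteq> v")
    case True
    then show ?thesis by (simp add: cr_filter)
  next
    case False
    then show ?thesis using cr_in_set[of "?f w" x y] by auto
  qed
  have "dih (A @ B) (?f D')"
    using AB unfolding determined_def
  proof (elim allE impE)
    show "dow (?f D')" using D'(1) by (rule dow_filter)
    show "set (?f D') = set (A @ B)"
      using D'(2) cyc_set[OF fE] by auto
    show "\<forall>x y. cr (?f D') x y \<longleftrightarrow> cr (A @ B) x y"
      using cr_cyc[OF fE, symmetric] D'(3) by (simp add: cr)
  qed
  then have "dih (?f E) (?f D')"
    using dih_trans[OF dih_cyc[OF fE]] by simp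
  then have "dih (?f D') (?f E)" by (rule dih_sym)
  then have "cyc (?f D') (?f E) \<or> cyc (?f (rev D')) (?f E)"
    unfolding dih_def by (simp add: rev_filter)
  then have "cyc (?f E) (?f D') \<or> cyc (?f E) (?f (rev D'))"
    using cyc_sym by blast
  moreover have v: "v \<in> set E" "v \<in> set D'"
    using arcs(5) D'(2) by auto
  ultimately have "cyc E D' \<or> cyc E (rev D')"
    using insert_prime[OF p card _ v(1), of D'] insert_prime[OF p card _ v(1), of "rev D'"] D' by auto
  then show "dih E D'"
    unfolding dih_def using cyc_rev[of E "rev D'"] by auto
qed

subsection \<open>Words on four letters\<close>

datatype letter = L0 | L1 | L2 | L3 | L4

function (sequential) arrangements :: "'a list \<Rightarrow> 'a list list" where
  "arrangements [] = [[]]"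
| "arrangements (x # xs) =
     concat (map (\<lambda>y. map ((#) y) (arrangements (remove1 y (x # xs)))) (remdups (x # xs)))"
  by pat_completeness auto
termination
  by (relation "measure length") (auto simp: length_remove1 split: if_splits dest: length_pos_if_in_set)

definition crossing_table :: "letter list \<Rightarrow> bool list" where
  "crossing_table w = map (\<lambda>(x, y). let u = filter (\<lambda>z. z = x \<or> z = y) w in u = [x, y, x, y] \<or> u = [y, x, y, x])
     [(L0, L1), (L0, L2), (L0, L3), (L1, L2), (L1, L3), (L2, L3)]"

text \<open>Words on four letters have eight positions, hence eight rotations.\<close>

definition same_circle :: "letter list \<Rightarrow> letter list \<Rightarrow> bool" where
  "same_circle u w \<longleftrightarrow> list_ex (\<lambda>n. w = rotate n u \<or> w = rotate n (rev u)) [0, 1, 2, 3, 4, 5, 6, 7]"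

text \<open>Found by enumeration: up to rotation and reversal these are the words left after deleting a letter from a prime word
  on five letters, each with its crossing table.\<close>

definition four_words :: "(letter list \<times> bool list) list" where
  "four_words = [
  ([L0, L1, L2, L0, L3, L1, L2, L3], [True, True, False, True, True, True]),
  ([L0, L1, L2, L0, L3, L2, L1, L3], [True, True, False, False, True, True]),
  ([L0, L1, L2, L3, L1, L2, L0, L3], [False, False, True, True, True, True]),
  ([L0, L1, L2, L1, L3, L0, L2, L3], [False, True, True, True, False, True]),
  ([L0, L1, L3, L0, L2, L1, L2, L3], [True, False, True, True, True, False]),
  ([L0, L1, L2, L1, L3, L2, L0, L3], [False, False, True, True, False, True]),
  ([L0, L1, L3, L2, L1, L2, L0, L3], [False, False, True, True, True, False]),
  ([L0, L2, L1, L3, L0, L1, L2, L3], [True, True, True, False, True, True]),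
  ([L0, L3, L1, L2, L0, L1, L2, L3], [True, True, True, True, False, False]),
  ([L0, L3, L1, L2, L1, L0, L2, L3], [False, True, True, True, False, False]),
  ([L0, L3, L1, L0, L2, L1, L2, L3], [True, False, True, True, False, False])]"

text \<open>Every word is rotated to begin with \<open>L0\<close>, so the list to be arranged holds
  the seven other occurrences.\<close>

lemma four_words_unique:
  "list_all (\<lambda>w. let t = crossing_table (L0 # w) in
     list_all (\<lambda>(c, t'). if t = t' then same_circle c (L0 # w) else True) four_words)
   (arrangements [L1, L1, L2, L2, L3, L3, L0])"
  by code_simp

text \<open>The word starts at \<open>L4\<close>, and \<open>L0\<close> to \<open>L3\<close> name
  the ends of its two arcs. The four remaining occurrences \<open>p\<close> are split after position
  \<open>n\<close> between the interiors of the arcs. The test on \<open>ed\<close> says that the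
  circuit traces the complete graph on five vertices.\<close>

lemma five_words:
  "list_all (\<lambda>p. list_all (\<lambda>n. let w = L4 # L0 # take n p @ L1 # L4 # L2 # drop n p @ [L3] in
     if list_all (\<lambda>(x, y). ed w x y = 1)
       [(L0, L1), (L0, L2), (L0, L3), (L0, L4), (L1, L2), (L1, L3), (L1, L4), (L2, L3), (L2, L4), (L3, L4)]
     then (let u = L0 # take n p @ L1 # L2 # drop n p @ [L3] in
       list_ex (\<lambda>(c, t). crossing_table u = t \<and> same_circle c u) four_words)
     else True) [0, 1, 2, 3, 4])
   (arrangements [L0, L1, L2, L3])"
  by code_simp

lemma mset_in_arrangements: "mset w = mset xs \<Longrightarrow> w \<in> set (arrangements xs)"
proof (induction w arbitrary: xs)
  case Nil
  then have "xs = []" by simp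
  then show ?case by simp
next
  case (Cons y w)
  have y: "y \<in> set xs"
    using mset_eq_setD[OF Cons.prems] by auto
  have "mset w = mset (remove1 y xs)"
    unfolding mset_remove1 Cons.prems[symmetric] by simp
  then have w: "w \<in> set (arrangements (remove1 y xs))"
    by (rule Cons.IH)
  show ?case
  proof (cases xs)
    case (Cons z zs)
    have "set (arrangements xs) = (\<Union>y\<in>set xs. (#) y ` set (arrangements (remove1 y xs)))"
      unfolding Cons by (subst arrangements.simps(2)) (simp only: set_concat set_map set_remdups image_image)
    then show ?thesis
      using w y by blast
  qed (use y in simp)
qed

lemma crossing_table_cr: "crossing_table w = map (\<lambda>(x, y). cr w x y)
    [(L0, L1), (L0, L2), (L0, L3), (L1, L2), (L1, L3), (L2, L3)]"
  by (simp add: crossing_table_def cr_def Let_def)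

lemma same_circle_dih: "same_circle u w \<Longrightarrow> dih u w"
  unfolding same_circle_def dih_def cyc_rotate list_ex_iff by blast

lemma cr_map_inj:
  assumes "inj f"
  shows "cr (map f w) (f x) (f y) \<longleftrightarrow> cr w x y"
proof -
  have "filter (\<lambda>z. z = f x \<or> z = f y) (map f w) = map f (filter (\<lambda>z. z = x \<or> z = y) w)"
    by (simp add: filter_map o_def inj_eq[OF assms])
  moreover have "map f u = [f p, f q, f p, f q] \<longleftrightarrow> u = [p, q, p, q]" for u p q
    using inj_map_eq_map[OF assms, of u "[p, q, p, q]"] by simp
  ultimately show ?thesis
    unfolding cr_def using inj_eq[OF assms] by simp
qed

lemma count_map_inj: "inj f \<Longrightarrow> count_list (map f w) (f x) = count_list w x"
  by (induction w) (auto simp: inj_eq)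

lemma ed_map_inj:
  assumes "inj f"
  shows "ed (map f w) (f x) (f y) = ed w x y"
proof -
  have p: "ps g (map f u) = ps (\<lambda>a b. g (f a) (f b)) u" for g u
    by (induction "\<lambda>a b. g (f a) (f b)" u rule: ps.induct) simp_all
  have "cs g (map f u) = cs (\<lambda>a b. g (f a) (f b)) u" for g u
    using p[of g "u @ [hd u]"] by (cases u) (simp_all add: cs_def)
  moreover have "(\<lambda>a b. eb (f x) (f y) (f a) (f b)) = eb x y"
    by (simp add: eb_def inj_eq[OF assms] fun_eq_iff)
  ultimately show ?thesis
    by (simp add: ed_def)
qed

lemma UNIV_letter: "UNIV = {L0, L1, L2, L3, L4}"
  using letter.exhaust by blast

text \<open>The competing word is pulled back along \<open>f\<close> and rotated to begin with
  \<open>L0\<close>; its crossing table singles out the entry \<open>c\<close>, and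
  \<open>four_words_unique\<close> identifies the circles.\<close>

lemma four_words_determined:
  fixes f :: "letter \<Rightarrow> 'a"
  assumes f: "inj f" and U: "(c, crossing_table U) \<in> set four_words" "dih c U" and set: "set U = {L0, L1, L2, L3}"
  shows "determined (map f U)"
  unfolding determined_def
proof (intro allI impI)
  fix D' assume D': "dow D'" "set D' = set (map f U)" "\<forall>x y. cr D' x y \<longleftrightarrow> cr (map f U) x y"
  have "\<exists>w. D' = map f w"
    unfolding ex_map_conv using D'(2) by auto
  then obtain w where w: "D' = map f w" by blast
  have ws: "set w = {L0, L1, L2, L3}"
    using D'(2) unfolding w set_map inj_image_eq_iff[OF f] set .
  have cw: "count_list w x = 2" if "x \<in> {L0, L1, L2, L3}" for x
  proof -
    have "x \<in> set w"
      unfolding ws by (rule that)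
    then have "f x \<in> set D'"
      unfolding w by simp
    then have "count_list (map f w) (f x) = 2"
      using dowD[OF D'(1)] unfolding w by blast
    then show ?thesis by (simp add: count_map_inj[OF f])
  qed
  have crU: "cr w x y \<longleftrightarrow> cr U x y" for x y
    using D'(3) cr_map_inj[OF f, of w x y] cr_map_inj[OF f, of U x y] unfolding w by simp
  obtain p r where pr: "w = p @ L0 # r"
    using ws split_list[of L0 w] by auto
  then have cyc: "cyc w (L0 # r @ p)"
    using cyc_append[of p "L0 # r"] by simp
  have "mset (r @ p) = mset [L1, L1, L2, L2, L3, L3, L0]"
  proof (rule multiset_eqI)
    fix x
    have "count (mset (L0 # r @ p)) x = count_list w x"
      unfolding cyc_mset[OF cyc, symmetric] by (simp add: count_mset)
    moreover have "count_list w L4 = 0"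
      using ws by (simp add: count_list_0_iff)
    ultimately show "count (mset (r @ p)) x = count (mset [L1, L1, L2, L2, L3, L3, L0]) x"
      using cw[of x] by (cases x) simp_all
  qed
  then have mem: "r @ p \<in> set (arrangements [L1, L1, L2, L2, L3, L3, L0])"
    by (rule mset_in_arrangements)
  have tab': "crossing_table (L0 # r @ p) = crossing_table U"
    unfolding crossing_table_cr by (simp add: crU flip: cr_cyc[OF cyc])
  have ball: "\<forall>ct\<in>set four_words. case ct of (c, t') \<Rightarrow>
      if crossing_table (L0 # r @ p) = t' then same_circle c (L0 # r @ p) else True"
    using four_words_unique[unfolded list_all_iff, rule_format, OF mem, unfolded Let_def] by simp
  have "same_circle c (L0 # r @ p)"
    using bspec[OF ball U(1)] tab' by simp
  then have "dih c w"
    using same_circle_dih dih_trans dih_cyc[OF cyc_sym[OF cyc]] by blast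
  then have "dih U w"
    using dih_trans[OF dih_sym[OF U(2)]] by blast
  then show "dih (map f U) D'"
    unfolding w dih_def rev_map by (auto intro: cyc_map)
qed

section \<open>Prime words on five letters\<close>

lemma prime5_ends:
  assumes p: "prime_word D" and card: "card (set D) = 5" and c: "cyc D (v # A @ v # B)"
  shows "distinct [hd A, last A, hd B, last B]" "{hd A, last A, hd B, last B} = set D - {v}"
proof -
  have card4: "4 \<le> card (set D)" using card by simp
  note AB = prime_arcs[OF p card4 c]
  have e: "ed D v x \<le> 1" if x: "x \<in> set D" "x \<noteq> v" for x
  proof -
    have v: "v \<in> set D" using AB(5) by simp
    have "card (set D - {v, x}) = 3"
      using card x v by (subst card_Diff_subset) auto
    moreover have "card {v, x} = 2" using x by simp
    ultimately have "6 \<le> wcut D {v, x}"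
      using x v by (intro prime_wordD[OF p]) auto
    moreover have "wcut D {v, x} + 2 * ed D v x = 8"
      using prime_cut_pair[OF p card4 v x(1)] x(2) by simp
    ultimately show ?thesis by linarith
  qed
  have mem: "{hd A, last A, hd B, last B} \<subseteq> set D - {v}"
    using AB hd_in_set[of A] last_in_set[of A] hd_in_set[of B] last_in_set[of B] by auto
  have o: "of_bool (hd A = x) + of_bool (last A = x) + of_bool (hd B = x) + of_bool (last B = x) \<le> (1::nat)"
    if "x \<in> {hd A, last A, hd B, last B}" for x
    using e[of x] ed_star[OF c AB(3,4,1,2), of x] mem that by auto
  show d: "distinct [hd A, last A, hd B, last B]"
    using o[of "hd A"] o[of "last A"] o[of "hd B"] o[of "last B"] by (auto split: if_splits simp: of_bool_def)
  have "v \<in> set D" using AB(5) by simp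
  then have "card (set D - {v}) = 4"
    using card by simp
  moreover have "card {hd A, last A, hd B, last B} = 4"
    using d by auto
  ultimately show "{hd A, last A, hd B, last B} = set D - {v}"
    using mem by (intro card_subset_eq) auto
qed

text \<open>A pair of letters faces three others, so its cut is at least six and admits no double
  edge; the four edges at a letter then reach the four other letters.\<close>

lemma prime5_ed:
  assumes p: "prime_word D" and card: "card (set D) = 5" and x: "x \<in> set D" "y \<in> set D" "x \<noteq> y"
  shows "ed D x y = 1"
proof -
  have card4: "4 \<le> card (set D)" using card by simp
  have "dow D" using p by (simp add: prime_word_def)
  then obtain A B where c: "cyc D (x # A @ x # B)"
    using x(1) by (rule dow_split)
  note AB = prime_arcs[OF p card4 c] and E = prime5_ends[OF p card c]
  have "y \<in> {hd A, last A, hd B, last B}"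
    using E(2) x by simp
  then show ?thesis
    using ed_star[OF c AB(3,4,1,2) x(3)[symmetric]] E(1) by auto
qed

lemma hd_tl_last: "hd A \<noteq> last A \<Longrightarrow> A \<noteq> [] \<Longrightarrow> \<exists>A'. A = hd A # A' @ [last A]"
  by (cases A; cases "tl A" rule: rev_cases) auto

text \<open>The word \<open>A @ B\<close> left after deleting \<open>v\<close> has four letters and
  is never prime, so it is looked up in the table; \<open>determined_insert\<close> puts
  \<open>v\<close> back.\<close>

lemma determined_prime5:
  assumes p: "prime_word D" and card: "card (set D) = 5"
  shows "determined D"
proof -
  have card4: "4 \<le> card (set D)" using card by simp
  have dow: "dow D" using p by (simp add: prime_word_def)
  have "D \<noteq> []" using card by auto
  then obtain v where "v \<in> set D" using hd_in_set by metis
  then obtain A B where c: "cyc D (v # A @ v # B)"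
    using dow dow_split by metis
  note AB = prime_arcs[OF p card4 c] and E = prime5_ends[OF p card c]
  define f where "f = case_letter (hd A) (last A) (hd B) (last B) v"
  have f: "f L0 = hd A" "f L1 = last A" "f L2 = hd B" "f L3 = last B" "f L4 = v"
    by (simp_all add: f_def)
  have inj: "inj f"
  proof (rule injI)
    fix x y assume "f x = f y"
    moreover have "v \<notin> {hd A, last A, hd B, last B}"
      unfolding E(2) by simp
    ultimately show "x = y"
      using E(1) by (cases x; cases y) (simp_all add: f)
  qed
  have range: "range f = set D"
    unfolding UNIV_letter using E(2) AB(5) by (auto simp: f)
  obtain A' B' where A': "A = hd A # A' @ [last A]" and B': "B = hd B # B' @ [last B]"
    using hd_tl_last[of A] hd_tl_last[of B] E(1) AB(1,2) by auto
  have "set A' \<subseteq> set A" "set B' \<subseteq> set B"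
    using set_subset_Cons A' B' by (metis set_append Un_subset_iff set_ConsD subsetI UnI1 list.set_intros(2))+
  then have "set A' \<subseteq> range f" "set B' \<subseteq> range f"
    using AB(5) range by auto
  then have "\<exists>a. A' = map f a" "\<exists>b. B' = map f b"
    unfolding ex_map_conv by auto
  then obtain a b where a: "A' = map f a" and b: "B' = map f b" by blast
  define w where "w = L4 # L0 # a @ L1 # L4 # L2 # b @ [L3]"
  have Aw: "A = map f (L0 # a @ [L1])" and Bw: "B = map f (L2 # b @ [L3])"
    using A' B' a b f by simp_all
  have cw: "cyc D (map f w)"
    using c unfolding Aw Bw w_def by (simp add: f)
  have cnt: "count_list w x = 2" for x
  proof -
    have "f x \<in> set (map f w)"
      using cyc_set[OF cw] range by auto
    then have "count_list (map f w) (f x) = 2"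
      using dow dow_cyc[OF cw] dowD[of "map f w" "f x"] by simp
    then show ?thesis by (simp add: count_map_inj[OF inj])
  qed
  have "mset (a @ b) = mset [L0, L1, L2, L3]"
  proof (rule multiset_eqI)
    fix x
    have "count_list w x = 2" by (rule cnt)
    then show "count (mset (a @ b)) x = count (mset [L0, L1, L2, L3]) x"
      by (cases x) (simp_all add: w_def count_mset)
  qed
  note ms = this
  have ab: "a @ b \<in> set (arrangements [L0, L1, L2, L3])"
    by (rule mset_in_arrangements[OF ms])
  have len: "length (a @ b) = 4"
    using mset_eq_length[OF ms] by simp
  have sab: "set (a @ b) = {L0, L1, L2, L3}"
    using mset_eq_setD[OF ms] by simp
  have "length a \<le> 4"
    using len by simp
  then have "length a = 0 \<or> length a = 1 \<or> length a = 2 \<or> length a = 3 \<or> length a = 4"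
    by linarith
  then have n: "length a \<in> set [0, 1, 2, 3, 4]" by simp
  have ed: "ed w x y = 1" if "x \<noteq> y" for x y
  proof -
    have "ed w x y = ed (map f w) (f x) (f y)"
      by (simp add: ed_map_inj[OF inj])
    also have "\<dots> = ed D (f x) (f y)"
      using cs_cyc[OF cw] by (simp add: ed_def)
    also have "\<dots> = 1"
      by (rule prime5_ed[OF p card]) (use range that inj in \<open>auto simp: inj_eq\<close>)
    finally show ?thesis .
  qed
  let ?u = "L0 # a @ L1 # L2 # b @ [L3]"
  have ta: "take (length a) (a @ b) = a" "drop (length a) (a @ b) = b" by simp_all
  have "list_ex (\<lambda>(c, t). crossing_table ?u = t \<and> same_circle c ?u) four_words"
  proof -
    note F = five_words[unfolded list_all_iff, rule_format, OF ab, rule_format, OF n, unfolded Let_def ta, folded w_def]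
    have "\<forall>xy\<in>set [(L0, L1), (L0, L2), (L0, L3), (L0, L4), (L1, L2), (L1, L3), (L1, L4), (L2, L3), (L2, L4), (L3, L4)].
        case xy of (x, y) \<Rightarrow> ed w x y = 1"
      by (simp add: ed)
    then show ?thesis
      using F by (simp only: if_True)
  qed
  then obtain c where c4: "(c, crossing_table ?u) \<in> set four_words" "same_circle c ?u"
    unfolding list_ex_iff by auto
  have "set ?u = {L0, L1, L2, L3}"
    using sab by auto
  then have "determined (map f ?u)"
    using four_words_determined[OF inj c4(1) same_circle_dih[OF c4(2)]] by blast
  moreover have "map f ?u = A @ B"
    unfolding Aw Bw by simp
  ultimately have "determined (A @ B)" by simp
  then show ?thesis
    by (rule determined_insert[OF p card4 c])
qed

theorem determined_prime:
  assumes "prime_word D" "5 \<le> card (set D)"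
  shows "determined D"
  using assms
proof (induction "card (set D)" arbitrary: D rule: less_induct)
  case less
  show ?case
  proof (cases "card (set D) = 5")
    case True
    then show ?thesis using determined_prime5 less.prems by blast
  next
    case False
    then have 6: "6 \<le> card (set D)" using less.prems by simp
    obtain v E A B where v: "v \<in> set D" and E: "lc2 v D E" "cyc E (v # A @ v # B)" "prime_word (A @ B)"
      by (rule chain[OF less.prems(1) 6])
    have EP: "set E = set D \<and> prime_word E"
      using E(1) unfolding lc2_def
    proof (elim disjE exE conjE)
      assume "E = D" then show ?thesis using less.prems(1) by simp
    next
      assume l: "lcr v D E"
      show ?thesis using lcr_set[OF l] lcr_prime[OF l] less.prems(1) by simp
    next
      fix w F assume l: "lcr w D F" "lcr v F E"
      show ?thesis
        using lcr_set[OF l(1)] lcr_prime[OF l(1)] lcr_set[OF l(2)] lcr_prime[OF l(2)] less.prems(1) by simp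
    qed
    then have card: "4 \<le> card (set E)" using 6 by simp
    note arcs = prime_arcs[OF conjunct2[OF EP] card E(2)]
    have "card (set (A @ B)) + 1 = card (set D)"
      using arcs(3-5) EP by simp
    then have "determined (A @ B)"
      using less.hyps[of "A @ B"] E(3) 6 by simp
    then have "determined E"
      by (rule determined_insert[OF conjunct2[OF EP] card E(2)])
    show ?thesis
      by (rule determined_lc2[OF _ E(1) \<open>determined E\<close>]) (use less.prems(1) in \<open>simp add: prime_word_def\<close>)
  qed
qed

subsection \<open>Non-crossing blocks\<close>

definition same_graph :: "'a list \<Rightarrow> 'a list \<Rightarrow> bool" where
  "same_graph u w \<longleftrightarrow> dow u \<and> dow w \<and> set u = set w \<and> (\<forall>x y. cr u x y \<longleftrightarrow> cr w x y)"

text \<open>The delicate case is a rotation of \<open>R\<close> alone: the block \<open>S\<close> is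
  exchanged past \<open>xs\<close>, after which the whole circle can be rotated.\<close>

lemma mut_prefix:
  assumes "mut R R'" "set S \<inter> set R = {}"
  shows "mut (S @ R) (S @ R')"
  using assms
proof (induction rule: mut.induct)
  case (trans u v w)
  then show ?case
    using mut_set[OF trans.hyps(1)] mut.trans[of "S @ u" "S @ v" "S @ w"] by simp
next
  case (rot xs ys)
  have "mut ([] @ S @ xs @ [] @ ys) ([] @ [] @ xs @ S @ ys)"
    by (rule mut_swap) (use rot in auto)
  moreover have "mut (xs @ (S @ ys)) ((S @ ys) @ xs)"
    by (rule mut.rot)
  ultimately show ?case
    using mut.trans by fastforce
next
  case (conj a c b d)
  have "mut (S @ a @ b @ c @ d) (S @ rev c @ b @ rev a @ d)"
    by (rule mut_conj_lin) (use conj in auto)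
  then show ?case .
qed (rule mut.refl)

lemma cr_disjoint_blocks:
  assumes "dow (R @ T)" "set R \<inter> set T = {}" "x \<in> set R" "y \<in> set T"
  shows "\<not> cr (R @ T) x y"
proof -
  have n: "y \<notin> set R" "x \<notin> set T" "x \<noteq> y"
    using assms(2-4) by auto
  have "count_list (R @ T) x = 2" "count_list (R @ T) y = 2"
    using dowD[OF assms(1)] assms(3,4) by simp_all
  moreover have "count_list T x = 0" "count_list R y = 0"
    using n by (simp_all add: count_list_0_iff)
  ultimately have c: "count_list R x = 2" "count_list T y = 2"
    by simp_all
  have "filter (\<lambda>z. z = x \<or> z = y) T = replicate (count_list T y) y"
    using filter_replicate_count[OF n(2), of y] by (simp add: disj_commute)
  then have "filter (\<lambda>z. z = x \<or> z = y) (R @ T)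
      = replicate 2 x @ replicate 2 y @ replicate (2 - 2) x @ replicate (2 - 2) y"
    using filter_replicate_count[OF n(1), of x] c by simp
  then show ?thesis
    using cr_blocks[of 2 2 x y] n(3) unfolding cr_def by simp
qed

text \<open>For sets of letters of the word: a union of connected components of the interlacement
  graph.\<close>

definition closed_in :: "'a list \<Rightarrow> 'a set \<Rightarrow> bool" where
  "closed_in w X \<longleftrightarrow> (\<forall>x\<in>X. \<forall>y. y \<notin> X \<longrightarrow> \<not> cr w x y)"

lemma run_split: "\<exists>R T. M = R @ T \<and> (\<forall>z\<in>set R. P z) \<and> (T = [] \<or> \<not> P (hd T))"
proof (intro exI conjI)
  show "M = takeWhile P M @ dropWhile P M" by simp
  show "\<forall>z\<in>set (takeWhile P M). P z"
    using set_takeWhileD by fast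
  show "dropWhile P M = [] \<or> \<not> P (hd (dropWhile P M))"
    using hd_dropWhile by blast
qed

text \<open>Innermost argument. \<open>encl c M\<close> says that \<open>M\<close> lies between the
  ends of \<open>c\<close> and contains a letter from the other side of \<open>X\<close>. In a
  shortest such \<open>M\<close>, take a maximal run from the other side: a chord leaving this run
  would cross \<open>c\<close> or enclose a shorter stretch. If there is no such \<open>M\<close>,
  the first run of the word serves.\<close>

lemma closed_run:
  assumes dow: "dow D" and cl: "closed_in D X" and ne: "D \<noteq> []"
  shows "\<exists>p R q. D = p @ R @ q \<and> R \<noteq> [] \<and> set R \<inter> set (p @ q) = {} \<and> (set R \<subseteq> X \<or> set R \<inter> X = {})"
proof -
  define encl where "encl c M \<longleftrightarrow> (\<exists>p q. D = p @ c # M @ c # q \<and> (\<exists>m\<in>set M. (m \<in> X) \<noteq> (c \<in> X)))" for c M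
  have ncr: "\<not> cr D x y" if "(x \<in> X) \<noteq> (y \<in> X)" for x y
    using that cl cr_sym[of D] unfolding closed_in_def by metis
  have memcl: "set R \<subseteq> X \<or> set R \<inter> X = {}" if "\<And>z. z \<in> set R \<Longrightarrow> (z \<in> X) \<longleftrightarrow> b" for R and b
    using that by (cases b) auto
  show ?thesis
  proof (cases "\<exists>c M. encl c M")
    case False
    obtain R T where RT: "D = R @ T" "\<And>z. z \<in> set R \<Longrightarrow> (z \<in> X) \<longleftrightarrow> (hd D \<in> X)" "T = [] \<or> \<not> ((hd T \<in> X) \<longleftrightarrow> (hd D \<in> X))"
      using run_split[of D "\<lambda>z. (z \<in> X) \<longleftrightarrow> (hd D \<in> X)"] by auto
    have "R \<noteq> []"
      using RT(1,3) ne by auto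
    moreover have "set R \<inter> set T = {}"
    proof (rule ccontr)
      assume "set R \<inter> set T \<noteq> {}"
      then obtain c where c: "c \<in> set R" "c \<in> set T" by blast
      obtain R1 R2 where R: "R = R1 @ c # R2"
        using c(1) by (meson split_list)
      obtain T1 T2 where T: "T = T1 @ c # T2"
        using c(2) by (meson split_list)
      have "hd T \<noteq> c"
        using RT(2)[OF c(1)] RT(3) c(2) by auto
      then have "T1 \<noteq> [] \<and> hd T1 = hd T"
        unfolding T by (cases T1) auto
      then have "hd T \<in> set (R2 @ T1)" "(hd T \<in> X) \<noteq> (c \<in> X)"
        using RT(2)[OF c(1)] RT(3) c(2) hd_in_set[of T1] by auto
      moreover have "D = R1 @ c # (R2 @ T1) @ c # T2"
        unfolding RT(1) R T by simp
      ultimately have "encl c (R2 @ T1)"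
        unfolding encl_def by blast
      then show False using False by blast
    qed
    ultimately show ?thesis
      using RT(1) memcl[OF RT(2)] by (intro exI[of _ "[]"] exI[of _ R] exI[of _ T]) simp
  next
    case True
    then have "\<exists>n c M. encl c M \<and> length M = n" by blast
    then obtain n where n: "\<exists>c M. encl c M \<and> length M = n"
      and least: "\<And>m. m < n \<Longrightarrow> \<not> (\<exists>c M. encl c M \<and> length M = m)"
      using exists_least_iff[of "\<lambda>n. \<exists>c M. encl c M \<and> length M = n"] by blast
    obtain c M where e: "encl c M" and len: "length M = n"
      using n by blast
    have small: "\<not> encl c' M'" if "length M' < length M" for c' M'
      using least that len by blast
    obtain p q where D: "D = p @ c # M @ c # q" and m: "\<exists>m\<in>set M. (m \<in> X) \<noteq> (c \<in> X)"
      using e unfolding encl_def by blast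
    obtain M1 M' where M1: "M = M1 @ M'" "\<And>z. z \<in> set M1 \<Longrightarrow> (z \<in> X) \<longleftrightarrow> (c \<in> X)"
      "M' = [] \<or> \<not> ((hd M' \<in> X) \<longleftrightarrow> (c \<in> X))"
      using run_split[of M "\<lambda>z. (z \<in> X) \<longleftrightarrow> (c \<in> X)"] by auto
    have M': "M' \<noteq> []"
      using m M1(1,2) by auto
    obtain R M2 where R: "M' = R @ M2" "\<And>z. z \<in> set R \<Longrightarrow> (z \<in> X) \<longleftrightarrow> (c \<notin> X)"
      "M2 = [] \<or> \<not> ((hd M2 \<in> X) \<longleftrightarrow> (c \<notin> X))"
      using run_split[of M' "\<lambda>z. (z \<in> X) \<longleftrightarrow> (c \<notin> X)"] by auto
    have Rne: "R \<noteq> []"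
      using M' M1(3) R(1,3) by auto
    have cyc: "cyc D (c # M @ c # (q @ p))"
      using cyc_append[of p "c # M @ c # q"] unfolding D by simp
    have "set R \<inter> set ((p @ c # M1) @ (M2 @ c # q)) = {}"
    proof (rule ccontr)
      assume "set R \<inter> set ((p @ c # M1) @ (M2 @ c # q)) \<noteq> {}"
      then obtain d where d: "d \<in> set R" "d \<in> set ((p @ c # M1) @ (M2 @ c # q))" by blast
      have dX: "(d \<in> X) \<longleftrightarrow> (c \<notin> X)" by (rule R(2)[OF d(1)])
      have dc: "d \<noteq> c" "d \<notin> set M1"
        using dX M1(2) by auto
      have "\<not> cr (c # M @ c # (q @ p)) c d"
        using ncr[of c d] dX unfolding cr_cyc[OF cyc] by blast
      then have "count_list M d \<noteq> 1"
        using cr_head[of c M "q @ p" d] dow dow_cyc[OF cyc] dc(1) by simp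
      moreover have "count_list M d \<noteq> 0"
        using d(1) by (simp add: M1(1) R(1) count_list_0_iff)
      moreover have "count_list D d = 2"
        by (rule dowD[OF dow]) (use d(1) in \<open>simp add: D M1(1) R(1)\<close>)
      moreover have "count_list D d = count_list M d + count_list p d + count_list q d"
        using dc(1) by (simp add: D)
      ultimately have "count_list p d = 0" "count_list q d = 0"
        by linarith+
      then have "d \<in> set M2"
        using d(2) dc by (auto simp: count_list_0_iff)
      then obtain M3 M4 where M2: "M2 = M3 @ d # M4"
        by (meson split_list)
      obtain R1 R2 where R12: "R = R1 @ d # R2"
        using d(1) by (meson split_list)
      have "hd M2 \<noteq> d"
        using R(3) dX M2 by auto
      then have h: "M3 \<noteq> []" "hd M3 = hd M2"
        unfolding M2 by (cases M3; simp)+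
      then have "hd M2 \<in> set (R2 @ M3)" "(hd M2 \<in> X) \<noteq> (d \<in> X)"
        using R(3) dX M2 hd_in_set[of M3] by auto
      moreover have "D = (p @ c # M1 @ R1) @ d # (R2 @ M3) @ d # (M4 @ c # q)"
        unfolding D M1(1) R(1) R12 M2 by simp
      ultimately have "encl d (R2 @ M3)"
        unfolding encl_def by blast
      moreover have "length (R2 @ M3) < length M"
        unfolding M1(1) R(1) R12 M2 by simp
      ultimately show False
        using small by blast
    qed
    moreover have "D = (p @ c # M1) @ R @ (M2 @ c # q)"
      unfolding D M1(1) R(1) by simp
    ultimately show ?thesis
      using Rne memcl[OF R(2)] by blast
  qed
qed

text \<open>The block found by \<open>closed_run\<close> is set aside, the rest is sorted by
  induction, and the block is then moved to the half where it belongs.\<close>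

lemma split_blocks:
  assumes "dow D" "closed_in D X"
  shows "\<exists>A B. mut D (A @ B) \<and> set A \<subseteq> X \<and> set B \<inter> X = {}"
  using assms
proof (induction "length D" arbitrary: D rule: less_induct)
  case less
  show ?case
  proof (cases "D = []")
    case True
    then show ?thesis
      by (intro exI[of _ "[]"]) (simp add: mut.refl)
  next
    case False
    then obtain p R q where D: "D = p @ R @ q" and R: "R \<noteq> []" "set R \<inter> set (p @ q) = {}"
      and RX: "set R \<subseteq> X \<or> set R \<inter> X = {}"
      using closed_run[OF less.prems] by blast
    have cyc: "cyc D (R @ (q @ p))"
      using cyc_append[of p "R @ q"] unfolding D by simp
    let ?f = "filter (\<lambda>z. z \<notin> set R)"
    have "?f R = []" by (simp add: filter_empty_conv)
    moreover have "?f (q @ p) = q @ p"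
      by (rule filter_True) (use R(2) in auto)
    ultimately have f: "?f (R @ (q @ p)) = q @ p"
      by (simp only: filter_append append_Nil)
    have dRqp: "dow (R @ (q @ p))"
      using dow_cyc[OF cyc] less.prems(1) by simp
    then have dqp: "dow (q @ p)"
      using dow_filter[of "R @ (q @ p)" "\<lambda>z. z \<notin> set R"] unfolding f by simp
    have "closed_in (q @ p) X"
      unfolding closed_in_def
    proof (intro ballI allI impI notI)
      fix x y assume xy: "x \<in> X" "y \<notin> X" "cr (q @ p) x y"
      then have "x \<notin> set R" "y \<notin> set R"
        using cr_in_set[OF xy(3)] R(2) by auto
      then have "cr D x y"
        using xy(3) cr_filter[of "\<lambda>z. z \<notin> set R" x y "R @ (q @ p)"] unfolding f cr_cyc[OF cyc] by simp
      then show False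
        using xy less.prems(2) unfolding closed_in_def by blast
    qed
    then obtain A B where AB: "mut (q @ p) (A @ B)" "set A \<subseteq> X" "set B \<inter> X = {}"
      using less.hyps[OF _ dqp] R(1) unfolding D by fastforce
    have s: "set R \<inter> set (A @ B) = {}"
      using mut_set[OF AB(1)] R(2) by auto
    have m: "mut D (R @ (A @ B))"
      using mut.trans[OF mut_cyc[OF cyc] mut_prefix[OF AB(1)]] R(2) by auto
    show ?thesis
      using RX
    proof
      assume "set R \<subseteq> X"
      then show ?thesis
        using m AB by (intro exI[of _ "R @ A"] exI[of _ B]) simp
    next
      assume RX: "set R \<inter> X = {}"
      have "mut ([] @ R @ [] @ A @ B) ([] @ A @ [] @ R @ B)"
        by (rule mut_swap) (use s AB(2,3) in auto)
      then have "mut D (A @ (R @ B))"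
        using mut.trans[OF m] by simp
      then show ?thesis
        using AB RX by (intro exI[of _ A] exI[of _ "R @ B"]) auto
    qed
  qed
qed

lemma same_graph_filter: "same_graph u w \<Longrightarrow> same_graph (filter P u) (filter P w)"
  unfolding same_graph_def
proof (elim conjE, intro conjI allI)
  fix x y assume s: "set u = set w" "\<forall>x y. cr u x y \<longleftrightarrow> cr w x y"
  show "cr (filter P u) x y \<longleftrightarrow> cr (filter P w) x y"
  proof (cases "P x \<and> P y")
    case True
    then show ?thesis using s by (simp add: cr_filter)
  next
    case False
    then show ?thesis
      using cr_in_set[of "filter P u" x y] cr_in_set[of "filter P w" x y] by auto
  qed
qed (auto intro: dow_filter)

lemma same_graph_cyc: "same_graph u w \<Longrightarrow> cyc u u' \<Longrightarrow> cyc w w' \<Longrightarrow> same_graph u' w'"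
  unfolding same_graph_def using dow_cyc[of u u'] dow_cyc[of w w'] cyc_set[of u u'] cyc_set[of w w'] cr_cyc[of u u'] cr_cyc[of w w'] by simp

lemma same_graph_mut: "same_graph u w \<Longrightarrow> mut u u' \<Longrightarrow> mut w w' \<Longrightarrow> same_graph u' w'"
  unfolding same_graph_def using mut_dow[of u u'] mut_dow[of w w'] mut_set[of u u'] mut_set[of w w']
    mut_cr[of u u'] mut_cr[of w w'] by simp

text \<open>Both words are sorted into a part in \<open>X\<close> and a part outside; each part has
  fewer letters and is compared by induction.\<close>

lemma mut_disconnected:
  fixes D D' :: "'a list"
  assumes s: "same_graph D D'" and cl: "closed_in D X" and X: "X \<subseteq> set D" "X \<noteq> {}" "X \<noteq> set D"
    and IH: "\<And>u w :: 'a list. card (set u) < card (set D) \<Longrightarrow> same_graph u w \<Longrightarrow> mut u w"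
  shows "mut D D'"
proof -
  have cl': "closed_in D' X"
    using cl s unfolding closed_in_def same_graph_def by simp
  have dow: "dow D" "dow D'" and set: "set D' = set D"
    using s unfolding same_graph_def by auto
  obtain A B where AB: "mut D (A @ B)" "set A \<subseteq> X" "set B \<inter> X = {}"
    using split_blocks[OF dow(1) cl] by blast
  obtain A' B' where AB': "mut D' (A' @ B')" "set A' \<subseteq> X" "set B' \<inter> X = {}"
    using split_blocks[OF dow(2) cl'] by blast
  have sg: "same_graph (A @ B) (A' @ B')"
    by (rule same_graph_mut[OF s AB(1) AB'(1)])
  have f: "filter (\<lambda>z. z \<in> X) (P @ Q) = P" "filter (\<lambda>z. z \<notin> X) (P @ Q) = Q"
    if "set P \<subseteq> X" "set Q \<inter> X = {}" for P Q
  proof -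
    have "filter (\<lambda>z. z \<in> X) P = P" "filter (\<lambda>z. z \<in> X) Q = []" "filter (\<lambda>z. z \<notin> X) P = []" "filter (\<lambda>z. z \<notin> X) Q = Q"
      using that by (auto intro!: filter_True simp: filter_empty_conv)
    then show "filter (\<lambda>z. z \<in> X) (P @ Q) = P" "filter (\<lambda>z. z \<notin> X) (P @ Q) = Q" by simp_all
  qed
  have sA: "same_graph A A'" and sB: "same_graph B B'"
    using same_graph_filter[OF sg, of "\<lambda>z. z \<in> X"] same_graph_filter[OF sg, of "\<lambda>z. z \<notin> X"]
    unfolding f[OF AB(2,3)] f[OF AB'(2,3)] by simp_all
  have un: "set D = set A \<union> set B"
    using mut_set[OF AB(1)] by simp
  have "set A \<subset> set D" "set B \<subset> set D"
    using un X AB(2,3) by auto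
  then have "card (set A) < card (set D)" "card (set B) < card (set D)"
    by (simp_all add: psubset_card_mono)
  note c = this
  have m: "mut A A'" "mut B B'"
    using IH[OF c(1) sA] IH[OF c(2) sB] .
  have "mut (A @ B) (A @ B')"
    by (rule mut_prefix[OF m(2)]) (use AB in auto)
  also have "mut (A @ B') (B' @ A)" by (rule mut.rot)
  also have "mut (B' @ A) (B' @ A')"
    by (rule mut_prefix[OF m(1)]) (use AB AB' in auto)
  also have "mut (B' @ A') (A' @ B')" by (rule mut.rot)
  finally have "mut (A @ B) (A' @ B')" .
  then show ?thesis
    using mut.trans[OF AB(1)] mut.trans mut_sym[OF AB'(1)] by blast
qed

subsection \<open>Blocks meeting a prime word in two arcs\<close>

lemma cr_share:
  assumes dow: "dow (\<alpha> @ \<beta> @ \<gamma> @ \<delta>)" and dis: "set (\<alpha> @ \<gamma>) \<inter> set (\<beta> @ \<delta>) = {}"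
    and x: "x \<in> set (\<alpha> @ \<gamma>)" and z: "z \<in> set (\<beta> @ \<delta>)"
  shows "cr (\<alpha> @ \<beta> @ \<gamma> @ \<delta>) x z \<longleftrightarrow> count_list \<alpha> x = 1 \<and> count_list \<beta> z = 1"
proof -
  have n: "x \<notin> set \<beta>" "x \<notin> set \<delta>" "z \<notin> set \<alpha>" "z \<notin> set \<gamma>" "x \<noteq> z"
    using dis x z by auto
  have "count_list (\<alpha> @ \<beta> @ \<gamma> @ \<delta>) x = 2" "count_list (\<alpha> @ \<beta> @ \<gamma> @ \<delta>) z = 2"
    using dowD[OF dow, of x] dowD[OF dow, of z] x z by (auto simp del: count_list_append)
  moreover have "count_list \<beta> x = 0" "count_list \<delta> x = 0" "count_list \<alpha> z = 0" "count_list \<gamma> z = 0"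
    using n by (simp_all add: count_list_0_iff)
  ultimately have c: "count_list \<alpha> x \<le> 2" "count_list \<beta> z \<le> 2"
    "count_list \<gamma> x = 2 - count_list \<alpha> x" "count_list \<delta> z = 2 - count_list \<beta> z"
    by simp_all
  have f: "filter (\<lambda>y. y = x \<or> y = z) \<alpha> = replicate (count_list \<alpha> x) x"
    "filter (\<lambda>y. y = x \<or> y = z) \<gamma> = replicate (count_list \<gamma> x) x"
    "filter (\<lambda>y. y = x \<or> y = z) \<beta> = replicate (count_list \<beta> z) z"
    "filter (\<lambda>y. y = x \<or> y = z) \<delta> = replicate (count_list \<delta> z) z"
    using filter_replicate_count[OF n(3), of x] filter_replicate_count[OF n(4), of x]
      filter_replicate_count[OF n(1), of z] filter_replicate_count[OF n(2), of z] by (simp_all add: disj_commute)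
  show ?thesis
    unfolding cr_def filter_append f c(3,4) using cr_blocks[OF c(1,2) n(5)] n(5) by simp
qed

text \<open>\<open>v\<close> may be counted on either side, and since \<open>X\<close> has three
  letters one of the two choices leaves two letters on both sides, against primality.\<close>

lemma thin_cut:
  assumes p: "prime_word E" and E: "set E = insert v X" "v \<notin> X" "3 \<le> card X"
    and Z: "Z \<subseteq> X" "Z \<noteq> {}" "Z \<noteq> X" and c: "wcut E Z \<le> 4" "wcut E (insert v Z) \<le> 4"
  shows False
proof -
  have fin: "finite X"
    using E(3) by (intro card_ge_0_finite) simp
  have fin': "finite Z"
    by (rule finite_subset[OF Z(1) fin])
  have vZ: "v \<notin> Z" using Z(1) E(2) by blast
  have cXZ: "card (X - Z) = card X - card Z"
    using fin fin' Z(1) by (simp add: card_Diff_subset)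
  have pos: "1 \<le> card Z" "1 \<le> card (X - Z)"
    using fin fin' Z by (simp_all add: Suc_le_eq card_gt_0_iff)
  show False
  proof (cases "2 \<le> card Z")
    case True
    have "set E - Z = insert v (X - Z)"
      using E(1) vZ by blast
    then have "card (set E - Z) = card (X - Z) + 1"
      using E(2) fin fin' by simp
    then have "6 \<le> wcut E Z"
      using pos True by (intro prime_wordD[OF p]) (use E(1) Z(1) in auto)
    then show False using c by simp
  next
    case False
    have "set E - insert v Z = X - Z"
      using E(1,2) by blast
    moreover have "2 \<le> card (X - Z)"
      using cXZ False E(3) by simp
    moreover have "card (insert v Z) = card Z + 1"
      using fin fin' vZ by simp
    ultimately have "6 \<le> wcut E (insert v Z)"
      using pos by (intro prime_wordD[OF p]) (use E(1) Z(1) in auto)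
    then show False using c by simp
  qed
qed

text \<open>A foreign chord \<open>z\<close> with both ends on one arc at \<open>v\<close> divides
  it into \<open>g1\<close>, \<open>g2\<close>, \<open>g3\<close>. If \<open>z\<close> crosses
  \<open>X\<close> as \<open>v\<close> does, the letters of \<open>g1\<close> and \<open>g3\<close>
  do not occur in \<open>g2\<close> or \<open>a\<close>; if it crosses nothing in \<open>X\<close>,
  those of \<open>g2\<close> occur nowhere else. Either way a cut is too small, or a loop
  appears.\<close>

lemma inner_gap_same_arc:
  assumes p: "prime_word E" and E: "set E = insert v X" "v \<notin> X" "3 \<le> card X"
    and e: "E = v # (g1 @ g2 @ g3) @ v # a" and v: "v \<notin> set (g1 @ g2 @ g3 @ a)"
    and ne: "g2 \<noteq> []" "g1 @ g3 \<noteq> []"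
    and zc: "(\<forall>x\<in>X. count_list g2 x = 1 \<longleftrightarrow> count_list (g1 @ g2 @ g3) x = 1) \<or> (\<forall>x\<in>X. count_list g2 x \<noteq> 1)"
  shows False
proof -
  have X: "X = set (g1 @ g2 @ g3 @ a)"
    using E(1,2) v unfolding e by auto
  have dow: "dow E" using p by (simp add: prime_word_def)
  have tot: "count_list g1 x + count_list g2 x + count_list g3 x + count_list a x = 2" if "x \<in> X" for x
  proof -
    have "x \<in> set E" "x \<noteq> v" using that E(1,2) by auto
    then show ?thesis
      using dowD[OF dow, of x] by (simp add: e)
  qed
  have mem: "x \<in> set l \<longleftrightarrow> count_list l x \<noteq> 0" for x and l :: "'a list"
    by (simp add: count_list_0_iff)
  from zc show False
  proof
    assume zc: "\<forall>x\<in>X. count_list g2 x = 1 \<longleftrightarrow> count_list (g1 @ g2 @ g3) x = 1"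
    have dis: "set (g1 @ g3) \<inter> set (g2 @ a) = {}"
    proof (rule ccontr)
      assume "set (g1 @ g3) \<inter> set (g2 @ a) \<noteq> {}"
      then obtain x where x: "x \<in> set (g1 @ g3)" "x \<in> set (g2 @ a)" by blast
      then have xX: "x \<in> X" unfolding X by auto
      have "count_list g1 x + count_list g3 x \<noteq> 0" "count_list g2 x + count_list a x \<noteq> 0"
        using x unfolding mem by simp_all
      moreover have "count_list g2 x = 1 \<longleftrightarrow> count_list g1 x + count_list g2 x + count_list g3 x = 1"
        using zc xX by (simp add: add.assoc)
      ultimately show False
        using tot[OF xX] by presburger
    qed
    show False
    proof (rule thin_cut[OF p E, of "set (g1 @ g3)"])
      show "set (g1 @ g3) \<subseteq> X" "set (g1 @ g3) \<noteq> {}"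
        using ne unfolding X by auto
      have "hd g2 \<in> X" "hd g2 \<notin> set (g1 @ g3)"
        using hd_in_set[OF ne(1)] dis unfolding X by auto
      then show "set (g1 @ g3) \<noteq> X" by blast
      show "wcut E (set (g1 @ g3)) \<le> 4"
      proof (rule cut_share_le)
        show "cyc E (g1 @ g2 @ g3 @ (v # a @ [v]))"
          unfolding e using cyc_append[of "[v]" "g1 @ g2 @ g3 @ v # a"] by simp
      qed (use dis v in auto)
      show "wcut E (insert v (set (g1 @ g3))) \<le> 4"
      proof (rule cut_share_le)
        show "cyc E ((v # g1) @ g2 @ (g3 @ [v]) @ a)"
          unfolding e by simp
      qed (use dis v in auto)
    qed
  next
    assume zc: "\<forall>x\<in>X. count_list g2 x \<noteq> 1"
    have dis: "set g2 \<inter> set (g1 @ g3 @ a) = {}"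
    proof (rule ccontr)
      assume "set g2 \<inter> set (g1 @ g3 @ a) \<noteq> {}"
      then obtain x where x: "x \<in> set g2" "x \<in> set (g1 @ g3 @ a)" by blast
      then have xX: "x \<in> X" unfolding X by auto
      have "count_list g2 x \<noteq> 0" "count_list g1 x + count_list g3 x + count_list a x \<noteq> 0"
        using x unfolding mem by simp_all
      then show False
        using tot[OF xX] bspec[OF zc xX] by linarith
    qed
    have cyc: "cyc E (g2 @ (g3 @ v # a @ v # g1))"
      unfolding e using cyc_append[of "v # g1" "g2 @ g3 @ v # a"] by simp
    obtain x t where g2: "g2 = x # t"
      using ne(1) by (cases g2) auto
    have cE: "4 \<le> card (set E)"
    proof -
      have "finite X" unfolding X by simp
      then show ?thesis using E by simp
    qed
    show False
    proof (cases "set g2 = {x}")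
      case True
      have "x \<in> X" unfolding X g2 by simp
      have "count_list (g1 @ g3 @ a) x = 0"
        using dis unfolding g2 by (simp add: count_list_0_iff)
      then have "count_list g2 x = 2"
        using tot[OF \<open>x \<in> X\<close>] by simp
      then have "t \<noteq> []" unfolding g2 by auto
      then have "t = hd t # tl t" "hd t \<in> set g2"
        unfolding g2 by simp_all
      then have "t = x # tl t"
        unfolding True by simp
      then have "g2 = x # x # tl t" unfolding g2 by simp
      then have "g2 @ (g3 @ v # a @ v # g1) = x # x # (tl t @ g3 @ v # a @ v # g1)" by simp
      then have "cyc E (x # x # (tl t @ g3 @ v # a @ v # g1))"
        using cyc by (simp only:)
      then show False
        by (rule prime_no_loop[OF p cE])
    next
      case False
      then obtain y where y: "y \<in> set g2" "y \<noteq> x"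
        unfolding g2 by auto
      have "card {x, y} \<le> card (set g2)"
        by (rule card_mono) (use y g2 in auto)
      then have 1: "2 \<le> card (set g2)" using y(2) by simp
      let ?w = "hd (g1 @ g3)"
      have w: "?w \<in> set (g1 @ g3)" by (rule hd_in_set[OF ne(2)])
      then have "?w \<noteq> v" "?w \<notin> set g2" "?w \<in> set E"
        using v dis unfolding e by auto
      then have "card {v, ?w} \<le> card (set E - set g2)"
        by (intro card_mono) (use v in \<open>auto simp: e\<close>)
      then have 2: "2 \<le> card (set E - set g2)" using \<open>?w \<noteq> v\<close> by simp
      have "wcut E (set g2) \<le> 4"
      proof (rule cut_share_le)
        show "cyc E (g2 @ (g3 @ v # a @ v # g1) @ [] @ [])"
          using cyc by simp
      qed (use dis v in auto)
      then show False
        using prime_wordD[OF p _ 1 2] unfolding e by fastforce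
    qed
  qed
qed

text \<open>Now \<open>z\<close> has one end on each arc at \<open>v\<close>. If it crosses
  \<open>X\<close> as \<open>v\<close> does, \<open>g1\<close> and \<open>a1\<close> share no letter
  with \<open>g2\<close> and \<open>a2\<close>; if it crosses nothing in \<open>X\<close>, then
  \<open>g2\<close> and \<open>a1\<close> share none with \<open>g1\<close> and
  \<open>a2\<close>.\<close>

lemma inner_gap_both_arcs:
  assumes p: "prime_word E" and E: "set E = insert v X" "v \<notin> X" "3 \<le> card X"
    and e: "E = v # (g1 @ g2) @ v # (a1 @ a2)" and v: "v \<notin> set (g1 @ g2 @ a1 @ a2)"
    and ne: "g1 \<noteq> []" "g2 \<noteq> []"
    and zc: "(\<forall>x\<in>X. count_list (g2 @ a1) x = 1 \<longleftrightarrow> count_list (g1 @ g2) x = 1) \<or> (\<forall>x\<in>X. count_list (g2 @ a1) x \<noteq> 1)"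
  shows False
proof -
  have X: "X = set (g1 @ g2 @ a1 @ a2)"
    using E(1,2) v unfolding e by auto
  have dow: "dow E" using p by (simp add: prime_word_def)
  have tot: "count_list g1 x + count_list g2 x + count_list a1 x + count_list a2 x = 2" if "x \<in> X" for x
  proof -
    have "x \<in> set E" "x \<noteq> v" using that E(1,2) by auto
    then show ?thesis
      using dowD[OF dow, of x] by (simp add: e)
  qed
  have mem: "x \<in> set l \<longleftrightarrow> count_list l x \<noteq> 0" for x and l :: "'a list"
    by (simp add: count_list_0_iff)
  from zc show False
  proof
    assume zc: "\<forall>x\<in>X. count_list (g2 @ a1) x = 1 \<longleftrightarrow> count_list (g1 @ g2) x = 1"
    have dis: "set (g1 @ a1) \<inter> set (g2 @ a2) = {}"
    proof (rule ccontr)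
      assume "set (g1 @ a1) \<inter> set (g2 @ a2) \<noteq> {}"
      then obtain x where x: "x \<in> set (g1 @ a1)" "x \<in> set (g2 @ a2)" by blast
      then have xX: "x \<in> X" unfolding X by auto
      have "count_list g1 x + count_list a1 x \<noteq> 0" "count_list g2 x + count_list a2 x \<noteq> 0"
        using x unfolding mem by simp_all
      moreover have "count_list g2 x + count_list a1 x = 1 \<longleftrightarrow> count_list g1 x + count_list g2 x = 1"
        using zc xX by simp
      moreover have False if "p + r \<noteq> 0" "q + s \<noteq> 0" "q + r = 1 \<longleftrightarrow> p + q = 1" "p + q + r + s = 2"
        for p q r s :: nat
      proof -
        have "p + r = 1" "q + s = 1" using that(1,2,4) by linarith+
        then have "(p = 0 \<and> r = 1) \<or> (p = 1 \<and> r = 0)" "(q = 0 \<and> s = 1) \<or> (q = 1 \<and> s = 0)" by linarith+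
        then show False using that(3) by (elim disjE) simp_all
      qed
      ultimately show False
        using tot[OF xX] by blast
    qed
    show False
    proof (rule thin_cut[OF p E, of "set (g1 @ a1)"])
      show "set (g1 @ a1) \<subseteq> X" "set (g1 @ a1) \<noteq> {}"
        using ne unfolding X by auto
      have "hd g2 \<in> X" "hd g2 \<notin> set (g1 @ a1)"
        using hd_in_set[OF ne(2)] dis unfolding X by auto
      then show "set (g1 @ a1) \<noteq> X" by blast
      show "wcut E (set (g1 @ a1)) \<le> 4"
      proof (rule cut_share_le)
        show "cyc E (g1 @ (g2 @ [v]) @ a1 @ (a2 @ [v]))"
          unfolding e using cyc_append[of "[v]" "g1 @ g2 @ v # a1 @ a2"] by simp
      qed (use dis v in auto)
      show "wcut E (insert v (set (g1 @ a1))) \<le> 4"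
      proof (rule cut_share_le)
        show "cyc E ((v # g1) @ g2 @ (v # a1) @ a2)"
          unfolding e by simp
      qed (use dis v in auto)
    qed
  next
    assume zc: "\<forall>x\<in>X. count_list (g2 @ a1) x \<noteq> 1"
    have dis: "set (g2 @ a1) \<inter> set (g1 @ a2) = {}"
    proof (rule ccontr)
      assume "set (g2 @ a1) \<inter> set (g1 @ a2) \<noteq> {}"
      then obtain x where x: "x \<in> set (g2 @ a1)" "x \<in> set (g1 @ a2)" by blast
      then have xX: "x \<in> X" unfolding X by auto
      have "count_list g2 x + count_list a1 x \<noteq> 0" "count_list g1 x + count_list a2 x \<noteq> 0"
        using x unfolding mem by simp_all
      moreover have "count_list g2 x + count_list a1 x \<noteq> 1"
        using zc xX by simp
      ultimately show False
        using tot[OF xX] by linarith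
    qed
    show False
    proof (rule thin_cut[OF p E, of "set (g2 @ a1)"])
      show "set (g2 @ a1) \<subseteq> X" "set (g2 @ a1) \<noteq> {}"
        using ne unfolding X by auto
      have "hd g1 \<in> X" "hd g1 \<notin> set (g2 @ a1)"
        using hd_in_set[OF ne(1)] dis unfolding X by auto
      then show "set (g2 @ a1) \<noteq> X" by blast
      show "wcut E (set (g2 @ a1)) \<le> 4"
      proof (rule cut_share_le)
        show "cyc E (g2 @ [v] @ a1 @ (a2 @ v # g1))"
          unfolding e using cyc_append[of "v # g1" "g2 @ v # a1 @ a2"] by simp
      qed (use dis v in auto)
      show "wcut E (insert v (set (g2 @ a1))) \<le> 4"
      proof (rule cut_share_le)
        show "cyc E ((g2 @ v # a1) @ a2 @ [v] @ g1)"
          unfolding e using cyc_append[of "v # g1" "g2 @ v # a1 @ a2"] by simp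
      qed (use dis v in auto)
    qed
  qed
qed

text \<open>A gap between letters of \<open>X\<close> on the arc \<open>P\<close> is filled with
  foreign letters. The two preceding lemmas forbid each of them to have its other end outside the
  gap, so the gap is a closed block, against connectedness.\<close>

lemma arc_contiguous:
  fixes X :: "'a set"
  defines "f \<equiv> filter (\<lambda>z. z \<in> X)"
  assumes dow: "dow D'" and c: "cyc D' (v # P @ v # Q)" and prime: "prime_word (v # f P @ v # f Q)"
    and X: "X \<subseteq> set D'" "v \<notin> X" "3 \<le> card X"
    and zc: "\<And>z. z \<in> set D' \<Longrightarrow> z \<notin> X \<Longrightarrow> z \<noteq> v \<Longrightarrow>
      (\<forall>x\<in>X. cr D' z x \<longleftrightarrow> cr D' v x) \<or> (\<forall>x\<in>X. \<not> cr D' z x)"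
    and conn: "\<And>Z. Z \<subseteq> set D' \<Longrightarrow> Z \<noteq> {} \<Longrightarrow> Z \<noteq> set D' \<Longrightarrow> \<not> closed_in D' Z"
  shows "\<exists>P0 M P1. P = P0 @ M @ P1 \<and> set M \<subseteq> X \<and> set (P0 @ P1) \<inter> X = {}"
proof -
  have dc: "dow (v # P @ v # Q)"
    using dow dow_cyc[OF c] by simp
  note vPQ = dow_notin[OF dc]
  have sD: "set D' = insert v (set P \<union> set Q)"
    using cyc_set[OF c] by auto
  have cv: "cr D' v x \<longleftrightarrow> count_list (f P) x = 1" if "x \<in> X" for x
    using cr_head[OF dc, of x] cr_cyc[OF c] that X(2) by (auto simp: f_def count_list_filter)
  have sE: "set (v # f P @ v # f Q) = insert v X"
    using sD X by (auto simp: f_def)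
  have cf: "count_list (f l) x = count_list l x" if "x \<in> X" for x l
    using that by (simp add: f_def count_list_filter)
  have fv: "v \<notin> set (f l)" for l
    using X(2) by (simp add: f_def)
  \<comment> \<open>Excludes a foreign letter with both ends on \<open>P\<close> and letters of
    \<open>X\<close> both between and beside these ends on \<open>P\<close>.\<close>
  have A: False if P: "P = L1 @ z # L2 @ z # L3" and z: "z \<notin> X" and ne: "f L2 \<noteq> []" "f (L1 @ L3) \<noteq> []" for z L1 L2 L3
  proof -
    have zv: "z \<noteq> v" "z \<in> set D'"
      using vPQ(1) sD unfolding P by auto
    have cz: "cyc D' (z # L2 @ z # (L3 @ v # Q @ v # L1))"
      using cyc_trans[OF c] cyc_append[of "v # L1" "z # L2 @ z # L3 @ v # Q"] unfolding P by simp
    have dz: "dow (z # L2 @ z # (L3 @ v # Q @ v # L1))"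
      using dow dow_cyc[OF cz] by simp
    have "cr D' z x \<longleftrightarrow> count_list (f L2) x = 1" if x: "x \<in> X" for x
    proof -
      have "x \<noteq> z" using x z by auto
      then show ?thesis
        using cr_head[OF dz, of x] cr_cyc[OF cz] by (simp add: cf[OF x])
    qed
    moreover have fP: "f P = f L1 @ f L2 @ f L3"
      using z unfolding P f_def by simp
    ultimately have zc': "(\<forall>x\<in>X. count_list (f L2) x = 1 \<longleftrightarrow> count_list (f L1 @ f L2 @ f L3) x = 1)
        \<or> (\<forall>x\<in>X. count_list (f L2) x \<noteq> 1)"
      using zc[OF zv(2) z zv(1)] cv by simp
    have ne': "f L1 @ f L3 \<noteq> []"
      using ne(2) by (simp add: f_def)
    show False
      by (rule inner_gap_same_arc[OF prime sE X(2,3) _ _ ne(1) ne' zc', of "f Q"]) (use fv fP in simp_all)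
  qed
  \<comment> \<open>Excludes a foreign letter with one end on each arc and letters of
    \<open>X\<close> on both sides of its end on \<open>P\<close>.\<close>
  have C: False if P: "P = L1 @ z # L2" and Q: "Q = Q1 @ z # Q2" and z: "z \<notin> X" and ne: "f L1 \<noteq> []" "f L2 \<noteq> []"
    for z L1 L2 Q1 Q2
  proof -
    have zv: "z \<noteq> v" "z \<in> set D'"
      using vPQ(1) sD unfolding P by auto
    have cz: "cyc D' (z # (L2 @ v # Q1) @ z # (Q2 @ v # L1))"
      using cyc_trans[OF c] cyc_append[of "v # L1" "z # L2 @ v # Q1 @ z # Q2"] unfolding P Q by simp
    have dz: "dow (z # (L2 @ v # Q1) @ z # (Q2 @ v # L1))"
      using dow dow_cyc[OF cz] by simp
    have "cr D' z x \<longleftrightarrow> count_list (f L2 @ f Q1) x = 1" if x: "x \<in> X" for x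
    proof -
      have "x \<noteq> z" "v \<noteq> x" using x z X(2) by auto
      then show ?thesis
        using cr_head[OF dz, of x] cr_cyc[OF cz] by (simp add: cf[OF x])
    qed
    moreover have fP: "f P = f L1 @ f L2" "f Q = f Q1 @ f Q2"
      using z unfolding P Q f_def by simp_all
    ultimately have zc': "(\<forall>x\<in>X. count_list (f L2 @ f Q1) x = 1 \<longleftrightarrow> count_list (f L1 @ f L2) x = 1)
        \<or> (\<forall>x\<in>X. count_list (f L2 @ f Q1) x \<noteq> 1)"
      using zc[OF zv(2) z zv(1)] cv by simp
    show False
      by (rule inner_gap_both_arcs[OF prime sE X(2,3) _ _ ne zc', of "f Q2"]) (use fv fP in simp_all)
  qed
  have fne: "f l \<noteq> []" if "x \<in> set l" "x \<in> X" for x l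
    using that by (auto simp: f_def filter_empty_conv)
  have inner: False if P: "P = L @ R @ K" and R: "R \<noteq> []" "set R \<inter> X = {}"
    and L: "L \<noteq> []" "last L \<in> X" and K: "K \<noteq> []" "hd K \<in> X" for L R K
  proof -
    have RD: "count_list (K @ v # Q @ v # L) z = 0" if z: "z \<in> set R" for z
    proof -
      have zX: "z \<notin> X" using z R(2) by blast
      have zv: "z \<noteq> v" using z vPQ(1) unfolding P by auto
      obtain R1 R2 where R12: "R = R1 @ z # R2"
        using z by (meson split_list)
      have "z \<notin> set L"
      proof
        assume "z \<in> set L"
        then obtain L1 L2 where L12: "L = L1 @ z # L2"
          by (meson split_list)
        have "L2 \<noteq> []" "last L2 = last L"
          using L(2) zX unfolding L12 by (auto split: if_splits)
        then have "f (L2 @ R1) \<noteq> []"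
          using fne[of "last L" "L2 @ R1"] L(2) last_in_set[of L2] by auto
        moreover have "f (L1 @ (R2 @ K)) \<noteq> []"
          using fne[of "hd K" "L1 @ (R2 @ K)"] K by simp
        ultimately show False
          using A[of L1 z "L2 @ R1" "R2 @ K"] zX unfolding P R12 L12 by simp
      qed
      moreover have "z \<notin> set K"
      proof
        assume "z \<in> set K"
        then obtain K1 K2 where K12: "K = K1 @ z # K2"
          by (meson split_list)
        have "K1 \<noteq> []" "hd K1 = hd K"
          using K(2) zX unfolding K12 by (cases K1; simp)+
        then have "f (R2 @ K1) \<noteq> []"
          using fne[of "hd K" "R2 @ K1"] K(2) hd_in_set[of K1] by auto
        moreover have "f ((L @ R1) @ K2) \<noteq> []"
          using fne[of "last L" "(L @ R1) @ K2"] L by simp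
        ultimately show False
          using A[of "L @ R1" z "R2 @ K1" K2] zX unfolding P R12 K12 by simp
      qed
      moreover have "z \<notin> set Q"
      proof
        assume "z \<in> set Q"
        then obtain Q1 Q2 where Q12: "Q = Q1 @ z # Q2"
          by (meson split_list)
        have "f (L @ R1) \<noteq> []" "f (R2 @ K) \<noteq> []"
          using fne[of "last L" "L @ R1"] fne[of "hd K" "R2 @ K"] L K by simp_all
        then show False
          using C[of "L @ R1" z "R2 @ K" Q1 Q2] zX unfolding P R12 Q12 by simp
      qed
      ultimately show ?thesis
        using zv by (simp add: count_list_0_iff)
    qed
    then have dis: "set R \<inter> set (K @ v # Q @ v # L) = {}"
      unfolding count_list_0_iff by blast
    have cR: "cyc D' (R @ (K @ v # Q @ v # L))"
      using cyc_trans[OF c] cyc_append[of "v # L" "R @ K @ v # Q"] unfolding P by simp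
    then have dR: "dow (R @ (K @ v # Q @ v # L))"
      using dow dow_cyc[OF cR] by simp
    have "closed_in D' (set R)"
      unfolding closed_in_def
    proof (intro ballI allI impI notI)
      fix x y assume xy: "x \<in> set R" "y \<notin> set R" "cr D' x y"
      then have "y \<in> set (K @ v # Q @ v # L)"
        using cr_in_set(2)[OF xy(3)] cyc_set[OF cR] by auto
      then show False
        using cr_disjoint_blocks[OF dR dis xy(1)] xy(3) cr_cyc[OF cR] by simp
    qed
    moreover have "v \<in> set D'" "v \<notin> set R" "set R \<subseteq> set D'"
      using sD vPQ unfolding P by auto
    ultimately show False
      using conn[of "set R"] R(1) by auto
  qed
  \<comment> \<open>Foreign letters are stripped from both ends of \<open>P\<close>, so that the
    middle part \<open>rev S\<close>, if nonempty, begins and ends in \<open>X\<close>.\<close>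
  obtain P0 T where P0: "P = P0 @ T" "\<forall>z\<in>set P0. z \<notin> X" "T = [] \<or> \<not> (hd T \<notin> X)"
    using run_split[of P "\<lambda>z. z \<notin> X"] by auto
  obtain S' S where S: "rev T = S' @ S" "\<forall>z\<in>set S'. z \<notin> X" "S = [] \<or> \<not> (hd S \<notin> X)"
    using run_split[of "rev T" "\<lambda>z. z \<notin> X"] by auto
  have T: "T = rev S @ rev S'"
    using S(1) by (metis rev_append rev_rev_ident)
  have "set (rev S) \<subseteq> X"
  proof (rule ccontr)
    assume "\<not> ?thesis"
    then obtain y where y: "y \<in> set (rev S)" "y \<notin> X" by blast
    then have Sne: "S \<noteq> []" by auto
    obtain M1 M2 where M: "rev S = M1 @ y # M2"
      using y(1) by (meson split_list)
    have hX: "hd (rev S) \<in> X"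
      using P0(3) Sne unfolding T by simp
    have lX: "last (rev S) \<in> X"
      using S(3) Sne by (simp add: last_rev)
    have M1: "M1 \<noteq> []" "hd M1 \<in> X"
      using hX y(2) unfolding M by (cases M1; simp)+
    have M2: "M2 \<noteq> []" "last M2 \<in> X"
      using lX y(2) unfolding M by (auto split: if_splits)
    obtain Ra S1 where S1: "rev M1 = Ra @ S1" "\<forall>z\<in>set Ra. z \<notin> X" "S1 = [] \<or> \<not> (hd S1 \<notin> X)"
      using run_split[of "rev M1" "\<lambda>z. z \<notin> X"] by auto
    have M1': "M1 = rev S1 @ rev Ra"
      using S1(1) by (metis rev_append rev_rev_ident)
    have S1ne: "S1 \<noteq> []"
    proof
      assume "S1 = []"
      then have "set M1 = set Ra" using M1' by simp
      then show False using M1 S1(2) hd_in_set[of M1] by blast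
    qed
    obtain Rb S2 where S2: "M2 = Rb @ S2" "\<forall>z\<in>set Rb. z \<notin> X" "S2 = [] \<or> \<not> (hd S2 \<notin> X)"
      using run_split[of M2 "\<lambda>z. z \<notin> X"] by auto
    have S2ne: "S2 \<noteq> []"
    proof
      assume "S2 = []"
      then have "set M2 = set Rb" using S2 by simp
      then show False using M2 S2(2) last_in_set[of M2] by blast
    qed
    show False
    proof (rule inner)
      show "P = (P0 @ rev S1) @ (rev Ra @ y # Rb) @ (S2 @ rev S')"
        unfolding P0(1) T M M1' S2(1) by simp
      show "set (rev Ra @ y # Rb) \<inter> X = {}"
        using S1(2) S2(2) y(2) by auto
      show "last (P0 @ rev S1) \<in> X" "hd (S2 @ rev S') \<in> X"
        using S1(3) S1ne S2(3) S2ne by (simp_all add: last_rev)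
    qed (use S1ne S2ne in simp_all)
  qed
  moreover have "P = P0 @ rev S @ rev S'"
    unfolding P0(1) T ..
  moreover have "set (P0 @ rev S') \<inter> X = {}"
    using P0(2) S(2) by auto
  ultimately show ?thesis by blast
qed

subsection \<open>Words with equal interlacement are mutants\<close>

text \<open>Pigeonhole: four edges from \<open>v\<close> to at most three other letters include a
  double edge, and by \<open>cut_pair\<close> this leaves at most 8 - 4 cut edges.\<close>

lemma crowded_pair:
  assumes dow: "dow D" and c: "cyc D (v # A @ v # B)" and AB: "A \<noteq> []" "B \<noteq> []" and card: "card (set D) \<le> 4"
  shows "\<exists>x\<in>set D. x \<noteq> v \<and> wcut D {v, x} \<le> 4"
proof -
  have dc: "dow (v # A @ v # B)"
    using dow dow_cyc[OF c] by simp
  note n = dow_notin[OF dc]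
  have sD: "set D = insert v (set A \<union> set B)"
    using cyc_set[OF c] by auto
  have mem: "{hd A, last A, hd B, last B} \<subseteq> set D - {v}"
    using sD n AB hd_in_set[of A] last_in_set[of A] hd_in_set[of B] last_in_set[of B] by auto
  have "v \<in> set D" using sD by simp
  then have "card (set D - {v}) \<le> 3"
    using card by simp
  then have "card {hd A, last A, hd B, last B} \<le> 3"
    using card_mono[OF _ mem] by simp
  then have "\<not> distinct [hd A, last A, hd B, last B]"
  proof (intro notI)
    assume "distinct [hd A, last A, hd B, last B]"
    then have "card {hd A, last A, hd B, last B} = 4" by simp
    with \<open>card {hd A, last A, hd B, last B} \<le> 3\<close> show False by linarith
  qed
  then have "\<exists>x\<in>{hd A, last A, hd B, last B}.
      2 \<le> of_bool (hd A = x) + of_bool (last A = x) + of_bool (hd B = x) + (of_bool (last B = x) :: nat)"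
    by auto
  then obtain x where x: "x \<in> {hd A, last A, hd B, last B}"
    "2 \<le> of_bool (hd A = x) + of_bool (last A = x) + of_bool (hd B = x) + (of_bool (last B = x) :: nat)" by blast
  have xD: "x \<in> set D" "x \<noteq> v"
    using x(1) mem by auto
  have "2 \<le> ed D v x"
    unfolding ed_star[OF c n AB xD(2)] by (rule x(2))
  moreover have "wcut D {v, x} + 2 * ed D v x \<le> 8"
    using cut_pair[OF dow, of v x] xD sD by simp
  ultimately have "wcut D {v, x} \<le> 4" by linarith
  then show ?thesis using xD by blast
qed

text \<open>For a set \<open>Z\<close> that avoids them, the arcs \<beta> and \<delta> look like
  single letters; contracting them to the two ends of \<open>v\<close> changes no cut of this
  kind.\<close>

lemma cut_subst:
  assumes "\<alpha> \<noteq> []" "\<beta> \<noteq> []" "\<gamma> \<noteq> []" "\<delta> \<noteq> []" and n: "set \<beta> \<inter> Z = {}" "set \<delta> \<inter> Z = {}" "v \<notin> Z"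
  shows "wcut (\<alpha> @ \<beta> @ \<gamma> @ \<delta>) Z = wcut (\<alpha> @ [v] @ \<gamma> @ [v]) Z"
proof -
  have g: "wcut (\<alpha> @ B @ \<gamma> @ C) Z = ps (sep Z) \<alpha> + of_bool (last \<alpha> \<in> Z) + of_bool (hd \<gamma> \<in> Z) + ps (sep Z) \<gamma>
     + of_bool (last \<gamma> \<in> Z) + of_bool (hd \<alpha> \<in> Z)"
    if B: "B \<noteq> []" "set B \<inter> Z = {}" and C: "C \<noteq> []" "set C \<inter> Z = {}" for B C
  proof -
    have "hd B \<notin> Z" "last B \<notin> Z" "hd C \<notin> Z" "last C \<notin> Z"
      using B C hd_in_set[of B] last_in_set[of B] hd_in_set[of C] last_in_set[of C] by blast+
    moreover have "ps (sep Z) B = 0" "ps (sep Z) C = 0"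
      by (rule ps_sep_mono, use B C in blast)+
    ultimately show ?thesis
      using assms(1,3) B(1) C(1) by (simp add: wcut_def cs_def ps_append2 sep_def)
  qed
  show ?thesis
    using g[of \<beta> \<delta>] g[of "[v]" "[v]"] assms by simp
qed

lemma two_letter_crossing:
  assumes "dow w" "set w \<subseteq> {a, b}" "a \<in> set w" "b \<in> set w" "cr w a b"
  shows "w \<in> {[a, b, a, b], [b, a, b, a]}"
proof -
  have "filter (\<lambda>z. z = a \<or> z = b) w = w"
    by (rule filter_True) (use assms(2) in auto)
  then show ?thesis
    using assms(5) unfolding cr_def by simp
qed

text \<open>Without \<open>a\<close> the words are mutants. \<open>mut_lift\<close> then substitutes
  for \<open>b\<close> the two arcs occupied by the pair in \<open>D\<close>, and what remains is
  the place of \<open>a\<close>, settled by \<open>insert_mut\<close>.\<close>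

lemma mut_pair:
  assumes s: "same_graph D D'" and ab: "a \<in> set D" "b \<in> set D" "a \<noteq> b"
    and c: "cyc D (S1 @ S2 @ S3 @ S4)" "set (S1 @ S3) \<subseteq> {a, b}" "set (S2 @ S4) \<inter> {a, b} = {}"
    and b1: "count_list S1 b = 1"
    and IH: "mut (filter (\<lambda>z. z \<noteq> a) D) (filter (\<lambda>z. z \<noteq> a) D')"
  shows "mut D D'"
proof -
  let ?f = "filter (\<lambda>z. z \<noteq> a)"
  have dow: "dow D" "dow D'" and set: "set D' = set D"
    using s unfolding same_graph_def by auto
  have "count_list (S1 @ S2 @ S3 @ S4) b = 2"
    using dowD[of "S1 @ S2 @ S3 @ S4" b] dow_cyc[OF c(1)] cyc_set[OF c(1)] dow(1) ab(2) by simp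
  moreover have "count_list S2 b = 0" "count_list S4 b = 0"
    using c(3) by (auto simp: count_list_0_iff)
  ultimately have b3: "count_list S3 b = 1"
    using b1 by simp
  have fS: "?f S = [b]" if S: "set S \<subseteq> {a, b}" "count_list S b = 1" for S
  proof -
    have "?f S = filter (\<lambda>z. z = b) S"
      by (rule filter_cong) (use S(1) ab(3) in auto)
    also have "\<dots> = replicate (count_list S b) b"
      using S(1) by (induction S) auto
    finally show ?thesis using S(2) by simp
  qed
  have f2: "?f S2 = S2" "?f S4 = S4"
    by (rule filter_True, use c(3) in auto)+
  have "?f S1 = [b]" "?f S3 = [b]"
    using fS b1 b3 c(2) by auto
  then have fD: "cyc (?f D) (b # S2 @ b # S4)"
    using cyc_filter[OF c(1), of "\<lambda>z. z \<noteq> a"] f2 by simp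
  have "b \<in> set (?f D')"
    using set ab by simp
  then obtain Q1 Q2 where fD': "cyc (?f D') (b # Q1 @ b # Q2)"
    by (rule dow_split[OF dow_filter[OF dow(2)]])
  have m: "mut (b # S2 @ b # S4) (b # Q1 @ b # Q2)"
    using mut.trans[OF mut.trans[OF mut_sym[OF mut_cyc[OF fD]] IH] mut_cyc[OF fD']] .
  have bn: "b \<notin> set ([] @ S2 @ S4)" using c(3) by auto
  have "(set S1 \<union> set S3) \<inter> set ([] @ S2 @ S4) = {}"
    using c(2,3) by auto
  then have "mut ([] @ S1 @ S2 @ S3 @ S4) ([] @ S1 @ Q1 @ S3 @ Q2)"
    by (intro mut_lift[where b = b] bn) (simp_all add: m)
  then have mD: "mut D (S1 @ Q1 @ S3 @ Q2)"
    using mut.trans[OF mut_cyc[OF c(1)]] by simp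
  let ?E = "S1 @ Q1 @ S3 @ Q2"
  have "a \<notin> set (b # Q1 @ b # Q2)"
    unfolding cyc_set[OF fD', symmetric] by simp
  then have "?f Q1 = Q1" "?f Q2 = Q2"
    by (auto intro!: filter_True)
  then have fE: "?f ?E = b # Q1 @ b # Q2"
    using \<open>?f S1 = [b]\<close> \<open>?f S3 = [b]\<close> by simp
  have "mut ?E D'"
  proof (rule insert_mut[OF _ dow(2), of _ a])
    show "dow ?E" using mut_dow[OF mD] dow(1) by simp
    show "a \<in> set ?E" using mut_set[OF mD] ab(1) by simp
    show "a \<in> set D'" using set ab(1) by simp
    show "cyc (?f ?E) (?f D')"
      unfolding fE by (rule cyc_sym[OF fD'])
    show "cr ?E a y \<longleftrightarrow> cr D' a y" for y
      using mut_cr[OF mD dow(1)] s unfolding same_graph_def by simp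
  qed
  then show ?thesis
    by (rule mut.trans[OF mD])
qed

text \<open>\<open>arc_contiguous\<close>, applied to both arcs at \<open>v\<close>, shows that
  \<open>X\<close> occupies the same arcs \<alpha> and \<gamma> in \<open>D'\<close> as in
  \<open>D\<close>. Contracting \<open>X\<close> to its chord \<open>u\<close> gives smaller words
  that are mutants, and \<open>mut_lift\<close> puts the tangle back.\<close>

lemma mut_share:
  assumes s: "same_graph D D'" and conn: "\<And>Z. Z \<subseteq> set D \<Longrightarrow> Z \<noteq> {} \<Longrightarrow> Z \<noteq> set D \<Longrightarrow> \<not> closed_in D Z"
    and X: "3 \<le> card X" and dis: "set (\<alpha> @ \<gamma>) = X" "set (\<beta> @ \<delta>) \<inter> X = {}"
    and c: "cyc D (\<alpha> @ \<beta> @ \<gamma> @ \<delta>)" and u: "u \<in> X" "count_list \<alpha> u = 1" and v: "v \<in> set (\<beta> @ \<delta>)" "count_list \<beta> v = 1"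
    and c': "cyc D' (v # P @ v # Q)" and P: "filter (\<lambda>z. z \<in> X) P = \<gamma>" and Q: "filter (\<lambda>z. z \<in> X) Q = \<alpha>"
    and prime: "prime_word (v # \<gamma> @ v # \<alpha>)"
    and IH: "mut (filter (\<lambda>z. z \<notin> X \<or> z = u) D) (filter (\<lambda>z. z \<notin> X \<or> z = u) D')"
  shows "mut D D'"
proof -
  let ?g = "filter (\<lambda>z. z \<notin> X \<or> z = u)"
  have dow: "dow D" "dow D'" and set: "set D' = set D"
    using s unfolding same_graph_def by auto
  have sc: "cr D x y \<longleftrightarrow> cr D' x y" for x y
    using s unfolding same_graph_def by simp
  have dc: "dow (\<alpha> @ \<beta> @ \<gamma> @ \<delta>)"
    using dow dow_cyc[OF c] by simp
  have sD: "set D = X \<union> set (\<beta> @ \<delta>)"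
    using cyc_set[OF c] dis(1) by auto
  have vX: "v \<notin> X" and XD: "X \<subseteq> set D'"
    using v(1) dis(2) sD set by auto
  have conn': "\<not> closed_in D' Z" if "Z \<subseteq> set D'" "Z \<noteq> {}" "Z \<noteq> set D'" for Z
    using conn[of Z] that set unfolding closed_in_def sc by simp
  have crxz: "cr D' z x \<longleftrightarrow> count_list \<alpha> x = 1 \<and> count_list \<beta> z = 1" if "x \<in> X" "z \<in> set (\<beta> @ \<delta>)" for x z
    using cr_share[OF dc _ _ that(2), of x] that(1) dis cr_cyc[OF c] sc cr_sym[of D'] by auto
  have zc: "(\<forall>x\<in>X. cr D' z x \<longleftrightarrow> cr D' v x) \<or> (\<forall>x\<in>X. \<not> cr D' z x)" if "z \<in> set D'" "z \<notin> X" "z \<noteq> v" for z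
  proof -
    have "z \<in> set (\<beta> @ \<delta>)" using that sD set by auto
    then show ?thesis
      using crxz v by (cases "count_list \<beta> z = 1") simp_all
  qed
  have c'': "cyc D' (v # Q @ v # P)"
    using cyc_trans[OF c'] cyc_append[of "v # P" "v # Q"] by simp
  have prime': "prime_word (v # \<alpha> @ v # \<gamma>)"
    using prime prime_word_dih[OF dih_cyc[OF cyc_append[of "v # \<gamma>" "v # \<alpha>"]]] by simp
  obtain P0 M P1 where PM: "P = P0 @ M @ P1" "set M \<subseteq> X" "set (P0 @ P1) \<inter> X = {}"
    using arc_contiguous[OF dow(2) c' _ XD vX X zc conn'] prime unfolding P Q by blast
  obtain Q0 N Q1 where QN: "Q = Q0 @ N @ Q1" "set N \<subseteq> X" "set (Q0 @ Q1) \<inter> X = {}"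
    using arc_contiguous[OF dow(2) c'' _ XD vX X zc conn'] prime' unfolding P Q by blast
  have f: "filter (\<lambda>z. z \<in> X) (L @ M @ K) = M" if "set M \<subseteq> X" "set (L @ K) \<inter> X = {}" for L M K
  proof -
    have "filter (\<lambda>z. z \<in> X) M = M" "filter (\<lambda>z. z \<in> X) L = []" "filter (\<lambda>z. z \<in> X) K = []"
      using that by (auto intro!: filter_True simp: filter_empty_conv)
    then show ?thesis by simp
  qed
  have MN: "M = \<gamma>" "N = \<alpha>"
    using P Q f[OF PM(2,3)] f[OF QN(2,3)] unfolding PM(1) QN(1) by simp_all
  let ?b = "Q1 @ v # P0" and ?d = "P1 @ v # Q0"
  have cD': "cyc D' (\<alpha> @ ?b @ \<gamma> @ ?d)"
    using cyc_trans[OF c'] cyc_append[of "v # P0 @ \<gamma> @ P1 @ v # Q0" "\<alpha> @ Q1"] unfolding PM(1) QN(1) MN by simp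
  have dis': "set (?b @ ?d) \<inter> X = {}"
    using PM(3) QN(3) vX by auto
  have u2: "count_list \<gamma> u = 1"
  proof -
    have "count_list (\<alpha> @ \<beta> @ \<gamma> @ \<delta>) u = 2"
      using dowD[OF dc, of u] u(1) dis(1) by auto
    moreover have "count_list \<beta> u = 0" "count_list \<delta> u = 0"
      using u(1) dis(2) by (auto simp: count_list_0_iff)
    ultimately show ?thesis using u(2) by simp
  qed
  have gS: "?g S = [u]" if S: "set S \<subseteq> X" "count_list S u = 1" for S
  proof -
    have "?g S = filter (\<lambda>z. z = u) S"
      by (rule filter_cong) (use S(1) in auto)
    also have "\<dots> = replicate (count_list S u) u"
      by (induction S) auto
    finally show ?thesis using S(2) by simp
  qed
  have gu: "?g \<alpha> = [u]" "?g \<gamma> = [u]"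
    using gS[of \<alpha>] gS[of \<gamma>] u u2 dis(1) by auto
  have gn: "?g S = S" if "set S \<inter> X = {}" for S
    by (rule filter_True) (use that in auto)
  have "cyc (?g D) (?g (\<alpha> @ \<beta> @ \<gamma> @ \<delta>))" "cyc (?g D') (?g (\<alpha> @ ?b @ \<gamma> @ ?d))"
    using cyc_filter[OF c] cyc_filter[OF cD'] by blast+
  moreover have "?g \<beta> = \<beta>" "?g \<delta> = \<delta>" "?g ?b = ?b" "?g ?d = ?d"
    using gn[of \<beta>] gn[of \<delta>] gn[of ?b] gn[of ?d] dis(2) dis' by (auto simp del: filter_append filter.simps)
  ultimately have g: "cyc (?g D) (u # \<beta> @ u # \<delta>)" "cyc (?g D') (u # ?b @ u # ?d)"
    using gu by (simp_all only: filter_append append_Cons append_Nil)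
  have m: "mut (u # \<beta> @ u # \<delta>) (u # ?b @ u # ?d)"
    using mut.trans[OF mut.trans[OF mut_sym[OF mut_cyc[OF g(1)]] IH] mut_cyc[OF g(2)]] .
  have "mut ([] @ \<alpha> @ \<beta> @ \<gamma> @ \<delta>) ([] @ \<alpha> @ ?b @ \<gamma> @ ?d)"
  proof (rule mut_lift[where b = u])
    show "mut ([] @ u # \<beta> @ u # \<delta>) ([] @ u # ?b @ u # ?d)" using m by simp
    show "u \<notin> set ([] @ \<beta> @ \<delta>)" "(set \<alpha> \<union> set \<gamma>) \<inter> set ([] @ \<beta> @ \<delta>) = {}"
      using u(1) dis by auto
  qed
  then show ?thesis
    using mut.trans[OF mut.trans[OF mut_cyc[OF c]] mut_cyc[OF cyc_sym[OF cD']]] by simp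
qed

lemma no_isolated_arc:
  assumes dow: "dow D" and c: "cyc D (v # A @ v # B)" and ncl: "\<not> closed_in D {v}"
  shows "A \<noteq> []" "B \<noteq> []"
proof -
  have *: False if "cyc D (v # [] @ v # R)" for R
  proof -
    have "dow (v # [] @ v # R)"
      using dow dow_cyc[OF that] by simp
    then have "\<not> cr D v y" for y
      unfolding cr_cyc[OF that] by (simp only: cr_head count_list.simps) simp
    then show False
      using ncl unfolding closed_in_def by simp
  qed
  show "A \<noteq> []"
    using * c by auto
  show "B \<noteq> []"
  proof
    assume "B = []"
    then have "cyc D (v # [] @ v # A)"
      using cyc_trans[OF c] cyc_append[of "v # A" "[v]"] by simp
    then show False by (rule *)
  qed
qed

lemma same_graph_rev: "same_graph D D' \<Longrightarrow> same_graph D (rev D')"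
  by (simp add: same_graph_def)

text \<open>Among the small cuts one with fewest letters in \<open>X\<close> is chosen. Pairs being
  excluded, it has at least three, and minimality makes all its proper subsets with two or more
  letters thick.\<close>

lemma minimal_share:
  assumes dow: "dow D" and np: "\<not> prime_word D"
    and pair: "\<And>a b. a \<in> set D \<Longrightarrow> b \<in> set D \<Longrightarrow> a \<noteq> b \<Longrightarrow> \<not> wcut D {a, b} \<le> 4"
  obtains X where "X \<subseteq> set D" "3 \<le> card X" "2 \<le> card (set D - X)" "wcut D X \<le> 4"
    "\<forall>Z. Z \<subset> X \<longrightarrow> 2 \<le> card Z \<longrightarrow> 6 \<le> wcut D Z"
proof -
  define bad where "bad n \<longleftrightarrow> (\<exists>X\<subseteq>set D. card X = n \<and> 2 \<le> card X \<and> 2 \<le> card (set D - X) \<and> wcut D X \<le> 4)" for n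
  have "\<exists>n. bad n"
    using dow np unfolding prime_word_def bad_def by (auto simp: not_less)
  then obtain n where n: "bad n" "\<And>m. m < n \<Longrightarrow> \<not> bad m"
    using exists_least_iff[of bad] by blast
  obtain X where X: "X \<subseteq> set D" "card X = n" "2 \<le> card X" "2 \<le> card (set D - X)" "wcut D X \<le> 4"
    using n(1) unfolding bad_def by blast
  have fin: "finite X" using X(1) finite_subset by blast
  have "card X \<noteq> 2"
  proof
    assume "card X = 2"
    then obtain a b where ab: "X = {a, b}" "a \<noteq> b"
      by (meson card_2_iff)
    then show False
      using pair[of a b] X(1,5) by auto
  qed
  then have "3 \<le> card X" using X(3) by linarith
  moreover have "6 \<le> wcut D Z" if Z: "Z \<subset> X" "2 \<le> card Z" for Z
  proof -
    have "card Z < n"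
      using psubset_card_mono[OF fin Z(1)] X(2) by simp
    then have "\<not> bad (card Z)" by (rule n(2))
    moreover have "card (set D - X) \<le> card (set D - Z)"
      by (rule card_mono) (use Z(1) in auto)
    ultimately have "\<not> wcut D Z \<le> 4"
      using X(1,4) Z unfolding bad_def by fastforce
    then show ?thesis
      using even_cut[of D Z] by presburger
  qed
  ultimately show thesis
    using that X by blast
qed

theorem mut_complete: "same_graph D D' \<Longrightarrow> mut D D'"
proof (induction "card (set D)" arbitrary: D D' rule: less_induct)
  case less
  note s = less.prems
  have IH: "mut u w" if "card (set u) < card (set D)" "same_graph u w" for u w :: "'a list"
    by (rule less.hyps[OF that])
  have dow: "dow D" "dow D'" and set: "set D' = set D" and sc: "\<And>x y. cr D x y \<longleftrightarrow> cr D' x y"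
    using s unfolding same_graph_def by auto
  show ?case
  proof (cases "\<exists>Z. Z \<subseteq> set D \<and> Z \<noteq> {} \<and> Z \<noteq> set D \<and> closed_in D Z")
    case True
    then obtain Z where Z: "Z \<subseteq> set D" "Z \<noteq> {}" "Z \<noteq> set D" "closed_in D Z" by blast
    show ?thesis
      by (rule mut_disconnected[OF s Z(4,1,2,3) IH])
  next
    case False
    then have conn: "\<not> closed_in D Z" if "Z \<subseteq> set D" "Z \<noteq> {}" "Z \<noteq> set D" for Z
      using that by blast
    have crossing: "\<exists>x\<in>Z. \<exists>y\<in>set D - Z. cr D x y" if "Z \<subseteq> set D" "Z \<noteq> {}" "Z \<noteq> set D" for Z
      using conn[OF that] cr_in_set(2)[of D] unfolding closed_in_def by fast
    consider "card (set D) = 0" | "card (set D) = 1" | "card (set D) = 2" | "3 \<le> card (set D)"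
      by linarith
    then show ?thesis
    proof cases
      case 1
      then have "D = []" "D' = []" using set by auto
      then show ?thesis by (simp add: mut.refl)
    next
      case 2
      then obtain a where a: "set D = {a}"
        by (meson card_1_singletonE)
      have "w = replicate (count_list w a) a" if "set w \<subseteq> {a}" for w
        using that by (induction w) auto
      moreover have "count_list D a = 2" "count_list D' a = 2"
        using dowD[OF dow(1)] dowD[OF dow(2)] a set by simp_all
      ultimately have "D = D'"
        using a set by (metis order_refl)
      then show ?thesis by (simp add: mut.refl)
    next
      case 3
      then obtain a b where ab: "set D = {a, b}" "a \<noteq> b"
        by (meson card_2_iff)
      have "cr D a b"
        using crossing[of "{a}"] ab by auto
      then have "D \<in> {[a, b, a, b], [b, a, b, a]}" "D' \<in> {[a, b, a, b], [b, a, b, a]}"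
        using two_letter_crossing[of D a b] two_letter_crossing[of D' a b] dow sc ab set by simp_all
      moreover have "cyc [a, b, a, b] [b, a, b, a]" "cyc [b, a, b, a] [a, b, a, b]"
        using cyc_append[of "[a]" "[b, a, b]"] cyc_append[of "[b]" "[a, b, a]"] by simp_all
      ultimately show ?thesis
        using mut_cyc mut.refl by blast
    next
      case 4
      show ?thesis
      proof (cases "\<exists>a\<in>set D. \<exists>b\<in>set D. a \<noteq> b \<and> wcut D {a, b} \<le> 4")
        case True
        then obtain a b where ab: "a \<in> set D" "b \<in> set D" "a \<noteq> b" "wcut D {a, b} \<le> 4" by blast
        obtain S1 S2 S3 S4 where S: "cyc D (S1 @ S2 @ S3 @ S4)" "set (S1 @ S3) \<subseteq> {a, b}" "set (S2 @ S4) \<inter> {a, b} = {}"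
          by (rule cut_share[OF ab(4)])
        have "card {a, b} = 2" using ab(3) by simp
        then have "{a, b} \<noteq> set D" using 4 by auto
        then obtain x y where xy: "x \<in> {a, b}" "y \<in> set D" "y \<notin> {a, b}" "cr D x y"
          using crossing[of "{a, b}"] ab by auto
        have dS: "dow (S1 @ S2 @ S3 @ S4)"
          using dow_cyc[OF S(1)] dow(1) by simp
        have sD: "set D = set (S1 @ S3) \<union> set (S2 @ S4)"
          using cyc_set[OF S(1)] by auto
        have dis: "set (S1 @ S3) \<inter> set (S2 @ S4) = {}"
          using S(2,3) by blast
        have xD: "x \<in> set D" using xy(1) ab by blast
        have "x \<in> set (S1 @ S3)" "y \<in> set (S2 @ S4)"
          using xD xy(1-3) sD S(2,3) by blast+
        then have x1: "count_list S1 x = 1"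
          using cr_share[OF dS dis] xy(4) cr_cyc[OF S(1)] by simp
        \<comment> \<open>\<open>x\<close> crosses a chord outside the pair, hence has an end on
          each arc and can represent the pair; \<open>z\<close> is the letter deleted and
          reinserted.\<close>
        obtain z where z: "z \<in> set D" "z \<noteq> x" "{z, x} = {a, b}"
          using xy(1) ab by auto
        have "same_graph (filter (\<lambda>y. y \<noteq> z) D) (filter (\<lambda>y. y \<noteq> z) D')"
          by (rule same_graph_filter[OF s])
        moreover have "card (set (filter (\<lambda>y. y \<noteq> z) D)) < card (set D)"
          by (rule psubset_card_mono) (use z(1) in auto)
        ultimately have "mut (filter (\<lambda>y. y \<noteq> z) D) (filter (\<lambda>y. y \<noteq> z) D')"
          by (intro IH)
        then show ?thesis
          using mut_pair[OF s z(1) xD z(2) S(1)] S(2,3) x1 z(3) by simp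
      next
        case False
        then have pair: "\<not> wcut D {a, b} \<le> 4" if "a \<in> set D" "b \<in> set D" "a \<noteq> b" for a b
          using that by blast
        have "D \<noteq> []" using 4 by auto
        then have hD: "hd D \<in> set D" by simp
        then obtain A B where AB: "cyc D (hd D # A @ hd D # B)"
          by (rule dow_split[OF dow(1)])
        have "{hd D} \<noteq> set D"
        proof
          assume "{hd D} = set D"
          then have "card (set D) = card {hd D}" by simp
          then show False using 4 by simp
        qed
        then have ne: "A \<noteq> []" "B \<noteq> []"
          using no_isolated_arc[OF dow(1) AB] conn[of "{hd D}"] hD by blast+
        have 5: "5 \<le> card (set D)"
        proof (rule ccontr)
          assume "\<not> ?thesis"
          then have "card (set D) \<le> 4" by simp
          then show False
            using crowded_pair[OF dow(1) AB ne] pair[OF hD] by blast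
        qed
        show ?thesis
        proof (cases "prime_word D")
          case True
          then have "determined D" using 5 by (rule determined_prime)
          then have "dih D D'"
            using dow(2) set sc unfolding determined_def by simp
          then show ?thesis by (rule mut_dih)
        next
          case False
          obtain X where X: "X \<subseteq> set D" "3 \<le> card X" "2 \<le> card (set D - X)" "wcut D X \<le> 4"
            and min: "\<forall>Z. Z \<subset> X \<longrightarrow> 2 \<le> card Z \<longrightarrow> 6 \<le> wcut D Z"
            by (rule minimal_share[OF dow(1) False pair])
          have fin: "finite X" using X(1) finite_subset by blast
          obtain \<alpha> \<beta> \<gamma> \<delta> where c: "cyc D (\<alpha> @ \<beta> @ \<gamma> @ \<delta>)" "set (\<alpha> @ \<gamma>) \<subseteq> X" "set (\<beta> @ \<delta>) \<inter> X = {}"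
            by (rule cut_share[OF X(4)])
          have sD: "set D = set (\<alpha> @ \<gamma>) \<union> set (\<beta> @ \<delta>)"
            using cyc_set[OF c(1)] by auto
          have aX: "set (\<alpha> @ \<gamma>) = X"
            using sD X(1) c(2,3) by blast
          have dc: "dow (\<alpha> @ \<beta> @ \<gamma> @ \<delta>)"
            using dow_cyc[OF c(1)] dow(1) by simp
          have "X \<noteq> {}" "X \<noteq> set D"
            using X(2,3) by auto
          \<comment> \<open>Connectedness supplies a crossing over the boundary of \<open>X\<close>:
            \<open>u\<close> will stand for all of \<open>X\<close>, and \<open>v\<close> for
            everything outside.\<close>
          then obtain u v where uv: "u \<in> X" "v \<in> set D - X" "cr D u v"
            using crossing[OF X(1)] by blast
          have vY: "v \<in> set (\<beta> @ \<delta>)" using uv(2) sD aX by blast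
          have cnt: "count_list \<alpha> u = 1" "count_list \<beta> v = 1"
            using cr_share[OF dc, of u v] uv(1,3) vY aX c(3) cr_cyc[OF c(1)] by auto
          have two: "count_list \<gamma> u = 1" "count_list \<delta> v = 1"
          proof -
            have "count_list (\<alpha> @ \<beta> @ \<gamma> @ \<delta>) u = 2" "count_list (\<alpha> @ \<beta> @ \<gamma> @ \<delta>) v = 2"
              using dowD[OF dc, of u] dowD[OF dc, of v] uv(1) vY aX by auto
            moreover have "count_list \<beta> u = 0" "count_list \<delta> u = 0" "count_list \<alpha> v = 0" "count_list \<gamma> v = 0"
              using uv(1,2) aX c(3) by (auto simp: count_list_0_iff)
            ultimately show "count_list \<gamma> u = 1" "count_list \<delta> v = 1" using cnt by simp_all
          qed
          have ne4: "\<alpha> \<noteq> []" "\<beta> \<noteq> []" "\<gamma> \<noteq> []" "\<delta> \<noteq> []"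
            using cnt two by auto
          have vX: "v \<notin> X" using uv(2) by blast
          \<comment> \<open>The outside arcs contracted to the two ends of \<open>v\<close>.
            Minimality of \<open>X\<close> makes this word prime, so its circle is
            determined.\<close>
          let ?E = "v # \<gamma> @ v # \<alpha>" and ?p = "\<lambda>z. z \<in> X \<or> z = v"
          have fv: "filter ?p S = replicate (count_list S v) v" if "set S \<inter> X = {}" for S
            using that by (induction S) auto
          have fX: "filter ?p S = S" if "set S \<subseteq> X" for S
            by (rule filter_True) (use that in auto)
          have "filter ?p (\<alpha> @ \<beta> @ \<gamma> @ \<delta>) = \<alpha> @ [v] @ \<gamma> @ [v]"
            using fv[of \<beta>] fv[of \<delta>] fX[of \<alpha>] fX[of \<gamma>] cnt(2) two(2) c(2,3) by (auto simp: Int_Un_distrib2)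
          then have "cyc (filter ?p D) (\<alpha> @ [v] @ \<gamma> @ [v])"
            using cyc_filter[OF c(1), of ?p] by simp
          moreover have cE: "cyc (\<alpha> @ [v] @ \<gamma> @ [v]) ?E"
            using cyc_append[of \<alpha> "[v] @ \<gamma> @ [v]"] by simp
          ultimately have fE: "cyc (filter ?p D) ?E"
            by (rule cyc_trans)
          have dE: "dow ?E"
            using dow_cyc[OF fE] dow_filter[OF dow(1)] by blast
          have sE: "set ?E = insert v X"
            using aX by auto
          have cardE: "card (set ?E) = card X + 1"
            unfolding sE using fin vX by simp
          have thick: "6 \<le> wcut ?E Z" if Z: "Z \<subset> X" "2 \<le> card Z" for Z
          proof -
            have "wcut ?E Z = wcut (\<alpha> @ [v] @ \<gamma> @ [v]) Z"
              using cut_cyc[OF cE] by simp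
            also have "\<dots> = wcut (\<alpha> @ \<beta> @ \<gamma> @ \<delta>) Z"
              by (rule cut_subst[OF ne4, symmetric]) (use Z(1) c(3) vX in auto)
            also have "\<dots> = wcut D Z"
              using cut_cyc[OF c(1)] by simp
            finally show ?thesis using min Z by simp
          qed
          have pE: "prime_word ?E"
            unfolding prime_word_def
          proof (intro conjI allI impI dE)
            fix Z assume Z: "Z \<subseteq> set ?E" "2 \<le> card Z" "2 \<le> card (set ?E - Z)"
            show "4 < wcut ?E Z"
            proof (cases "v \<in> Z")
              case False
              have "Z \<subseteq> X" using Z(1) False unfolding sE by blast
              moreover have "Z \<noteq> X"
              proof
                assume "Z = X"
                then have "set ?E - Z = {v}" unfolding sE using vX by blast
                then show False using Z(3) by simp
              qed
              ultimately have "Z \<subset> X" by (rule psubsetI)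
              then show ?thesis using thick[of Z] Z(2) by simp
            next
              case True
              \<comment> \<open>A cut equals that of the complement, so the side without
                \<open>v\<close> is considered.\<close>
              let ?Z = "set ?E - Z"
              have "?Z \<subseteq> X" using True unfolding sE by blast
              moreover have "?Z \<noteq> X"
              proof
                assume e: "?Z = X"
                have "Z \<subseteq> insert v X" using Z(1) unfolding sE .
                then have "Z \<subseteq> {v}" using e by blast
                then have "card Z \<le> 1" using card_mono[of "{v}" Z] by simp
                then show False using Z(2) by simp
              qed
              ultimately have "?Z \<subset> X" by (rule psubsetI)
              then have "6 \<le> wcut ?E ?Z" using Z(3) by (rule thick)
              then show ?thesis
                using cut_compl[of ?E "set ?E" Z] by simp
            qed
          qed
          have 5: "5 \<le> card (set ?E)"
          proof (rule ccontr)
            assume "\<not> ?thesis"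
            then have 4: "card (set ?E) = 4"
              using cardE X(2) by simp
            obtain x where x: "x \<in> set ?E" "x \<noteq> v" "wcut ?E {v, x} \<le> 4"
              using crowded_pair[OF dE cyc_refl ne4(3,1)] 4 by auto
            have "card {v, x} = 2" using x(2) by simp
            moreover have "card (set ?E - {v, x}) = 2"
              using 4 x(1,2) by (subst card_Diff_subset) auto
            ultimately show False
              using prime_wordD[OF pE, of "{v, x}"] x by auto
          qed
          have det: "determined ?E" using pE 5 by (rule determined_prime)
          have vD': "v \<in> set D'" using uv(2) set by blast
          obtain P Q where PQ: "cyc D' (v # P @ v # Q)" "v \<notin> set P" "v \<notin> set Q"
            by (rule dow_split[OF dow(2) vD'])
          let ?f = "filter (\<lambda>z. z \<in> X)"
          have fpf: "filter ?p S = ?f S" if "v \<notin> set S" for S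
            by (rule filter_cong) (use that in auto)
          have fE': "cyc (filter ?p D') (v # ?f P @ v # ?f Q)"
            using cyc_filter[OF PQ(1), of ?p] fpf[OF PQ(2)] fpf[OF PQ(3)] by simp
          have "same_graph ?E (v # ?f P @ v # ?f Q)"
            by (rule same_graph_cyc[OF same_graph_filter[OF s] fE fE'])
          then have "dih ?E (v # ?f P @ v # ?f Q)"
            using det unfolding same_graph_def determined_def by simp
          then have cases: "(?f P = \<gamma> \<and> ?f Q = \<alpha>) \<or> (?f P = \<alpha> \<and> ?f Q = \<gamma>)
              \<or> (?f P = rev \<gamma> \<and> ?f Q = rev \<alpha>) \<or> (?f P = rev \<alpha> \<and> ?f Q = rev \<gamma>)"
            by (rule dih_align) (use vX aX in auto)
          \<comment> \<open>The alignment in which the arcs at \<open>v\<close> show \<gamma> and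
            \<alpha>; the three others are brought to it by exchanging the arcs at \<open>v\<close>,
            by reversing \<open>D'\<close>, or both.\<close>
          have fin: "mut D D''" if s': "same_graph D D''" and c'': "cyc D'' (v # P' @ v # Q')"
            and f: "?f P' = \<gamma>" "?f Q' = \<alpha>" for D'' P' Q'
          proof -
            let ?g = "filter (\<lambda>z. z \<notin> X \<or> z = u)"
            have "\<exists>x\<in>X. x \<noteq> u"
            proof (rule ccontr)
              assume "\<not> ?thesis"
              then have "X \<subseteq> {u}" by blast
              then have "card X \<le> 1" using card_mono[of "{u}" X] by simp
              then show False using X(2) by simp
            qed
            then have "card (set (?g D)) < card (set D)"
              using X(1) by (intro psubset_card_mono) auto
            then have m: "mut (?g D) (?g D'')"
              by (rule IH[OF _ same_graph_filter[OF s']])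
            show ?thesis
              by (rule mut_share[OF s' conn X(2) aX c(3,1) uv(1) cnt(1) vY cnt(2) c'' f pE m])
          qed
          have rc: "cyc (rev D') (v # rev Q @ v # rev P)"
            using cyc_trans[OF cyc_rev[OF PQ(1)]] cyc_sym[OF cyc_append[of "[v]" "rev Q @ v # rev P"]] by simp
          have turn: "cyc w (v # T @ v # S)" if "cyc w (v # S @ v # T)" for w S T
            using cyc_trans[OF that] cyc_append[of "v # S" "v # T"] by simp
          have fr: "?f (rev S) = rev (?f S)" for S by (simp add: rev_filter)
          have undo: "mut D D'" if "mut D (rev D')"
            using mut.trans[OF that mut_rev[of "rev D'"]] by simp
          note sr = same_graph_rev[OF s]
          from cases show ?thesis
          proof (elim disjE conjE)
            assume "?f P = \<gamma>" "?f Q = \<alpha>"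
            then show ?thesis by (rule fin[OF s PQ(1)])
          next
            assume "?f P = \<alpha>" "?f Q = \<gamma>"
            then show ?thesis by (intro fin[OF s turn[OF PQ(1)]])
          next
            assume "?f P = rev \<gamma>" "?f Q = rev \<alpha>"
            then show ?thesis
              by (intro undo fin[OF sr turn[OF rc]]) (simp_all only: fr rev_rev_ident)
          next
            assume "?f P = rev \<alpha>" "?f Q = rev \<gamma>"
            then show ?thesis
              by (intro undo fin[OF sr rc]) (simp_all only: fr rev_rev_ident)
          qed
        qed
      qed
    qed
  qed
qed

subsection \<open>Chord diagrams of joins\<close>

lemma chord_diagram_iff: "chord_diagram n ds \<longleftrightarrow> dow ds \<and> set ds = {0..<n}"
proof -
  have c: "card {i. i < length ds \<and> ds ! i = a} = count_list ds a" for a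
    by (simp add: count_list_eq_length_filter length_filter_conv_card eq_commute[of a])
  show ?thesis
  proof
    assume d: "chord_diagram n ds"
    have mem: "a \<in> set ds" if "a < n" for a
    proof (rule ccontr)
      assume "a \<notin> set ds"
      then have "count_list ds a = 0" by (rule count_notin)
      moreover have "count_list ds a = 2"
        using d that unfolding chord_diagram_def c by blast
      ultimately show False by simp
    qed
    show "dow ds \<and> set ds = {0..<n}"
      using d mem unfolding chord_diagram_def c dow_def by auto
  next
    assume d: "dow ds \<and> set ds = {0..<n}"
    have "length ds = (\<Sum>a\<in>{0..<n}. count_list ds a)"
      by (rule sum_count_set[symmetric]) (use d in auto)
    also have "\<dots> = 2 * n"
      using d by (simp add: dow_def)
    finally show "chord_diagram n ds"
      using d unfolding chord_diagram_def c dow_def by auto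
  qed
qed

text \<open>The four given positions already exhaust the occurrences of both letters, so the pieces
  between them vanish under the filter.\<close>

lemma alternating_filter:
  assumes dow: "dow ds" and ij: "i < j" "j < k" "k < l" "l < length ds"
    and v: "ds ! i = a" "ds ! j = b" "ds ! k = a" "ds ! l = b" "a \<noteq> b"
  shows "filter (\<lambda>z. z = a \<or> z = b) ds = [a, b, a, b]"
proof -
  have pick: "\<exists>p. drop n ds = p @ ds ! t # drop (Suc t) ds" if "n \<le> t" "t < length ds" for n t
    using id_take_nth_drop[of "t - n" "drop n ds"] that
    by (intro exI[of _ "take (t - n) (drop n ds)"]) simp
  have len: "k < length ds" "j < length ds" "i < length ds"
    using ij by linarith+
  obtain p0 where 0: "ds = p0 @ a # drop (Suc i) ds"
    using pick[of 0 i, OF _ len(3)] unfolding v(1) drop_0 by blast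
  obtain p1 where 1: "drop (Suc i) ds = p1 @ b # drop (Suc j) ds"
    using pick[of "Suc i" j, OF _ len(2)] ij(1) unfolding v(2) Suc_le_eq by blast
  obtain p2 where 2: "drop (Suc j) ds = p2 @ a # drop (Suc k) ds"
    using pick[of "Suc j" k, OF _ len(1)] ij(2) unfolding v(3) Suc_le_eq by blast
  obtain p3 where 3: "drop (Suc k) ds = p3 @ b # drop (Suc l) ds"
    using pick[of "Suc k" l, OF _ ij(4)] ij(3) unfolding v(4) Suc_le_eq by blast
  obtain p4 where ds: "ds = p0 @ a # p1 @ b # p2 @ a # p3 @ b # p4"
    using 0[unfolded 1 2 3] by blast
  have "a \<in> set ds" "b \<in> set ds"
    by (subst ds, simp)+
  then have "count_list ds a = 2" "count_list ds b = 2"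
    by (simp_all only: dowD[OF dow])
  then have c: "count_list (p0 @ p1 @ p2 @ p3 @ p4) a = 0" "count_list (p0 @ p1 @ p2 @ p3 @ p4) b = 0"
    using v(5) unfolding ds by simp_all
  have "a \<notin> set (p0 @ p1 @ p2 @ p3 @ p4)" "b \<notin> set (p0 @ p1 @ p2 @ p3 @ p4)"
    using c unfolding count_list_0_iff .
  then have f: "filter (\<lambda>z. z = a \<or> z = b) p = []" if "set p \<subseteq> set (p0 @ p1 @ p2 @ p3 @ p4)" for p
    using that unfolding filter_empty_conv by blast
  have "filter (\<lambda>z. z = a \<or> z = b) p0 = []" "filter (\<lambda>z. z = a \<or> z = b) p1 = []"
    "filter (\<lambda>z. z = a \<or> z = b) p2 = []" "filter (\<lambda>z. z = a \<or> z = b) p3 = []"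
    "filter (\<lambda>z. z = a \<or> z = b) p4 = []"
    by (rule f, unfold set_append, blast)+
  then show ?thesis
    unfolding ds by simp
qed

lemma alternating_indices:
  assumes "filter (\<lambda>z. z = a \<or> z = b) ds = [x, y, x, y]"
  shows "\<exists>i j k l. i < j \<and> j < k \<and> k < l \<and> l < length ds \<and> ds ! i = x \<and> ds ! j = y \<and> ds ! k = x \<and> ds ! l = y"
proof -
  let ?P = "\<lambda>z. z = a \<or> z = b"
  obtain p0 q0 where 0: "ds = p0 @ x # q0" "filter ?P q0 = [y, x, y]"
    using filter_eq_ConsD[OF assms] by auto
  obtain p1 q1 where 1: "q0 = p1 @ y # q1" "filter ?P q1 = [x, y]"
    using filter_eq_ConsD[OF 0(2)] by auto
  obtain p2 q2 where 2: "q1 = p2 @ x # q2" "filter ?P q2 = [y]"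
    using filter_eq_ConsD[OF 1(2)] by auto
  obtain p3 q3 where 3: "q2 = p3 @ y # q3"
    using filter_eq_ConsD[OF 2(2)] by auto
  have n: "(u @ z # w) ! length u = z" for u w and z :: 'a by simp
  have ds: "ds = p0 @ x # p1 @ y # p2 @ x # p3 @ y # q3"
    unfolding 0(1) 1(1) 2(1) 3 ..
  have "ds ! length p0 = x" "ds ! length (p0 @ x # p1) = y" "ds ! length (p0 @ x # p1 @ y # p2) = x"
    "ds ! length (p0 @ x # p1 @ y # p2 @ x # p3) = y"
    using n[of p0 x] n[of "p0 @ x # p1" y] n[of "p0 @ x # p1 @ y # p2" x] n[of "p0 @ x # p1 @ y # p2 @ x # p3" y]
    unfolding ds by (simp_all del: length_append nth_append_length)
  then show ?thesis
    by (intro exI[of _ "length p0"] exI[of _ "length (p0 @ x # p1)"] exI[of _ "length (p0 @ x # p1 @ y # p2)"]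
        exI[of _ "length (p0 @ x # p1 @ y # p2 @ x # p3)"]) (simp add: ds)
qed

lemma chords_intersect_cr:
  assumes "dow ds"
  shows "chords_intersect ds a b \<longleftrightarrow> cr ds a b"
proof
  assume "chords_intersect ds a b"
  then obtain i j k l where n: "a \<noteq> b" and ij: "i < j" "j < k" "k < l" "l < length ds"
    and v: "(ds ! i = a \<and> ds ! j = b \<and> ds ! k = a \<and> ds ! l = b) \<or> (ds ! i = b \<and> ds ! j = a \<and> ds ! k = b \<and> ds ! l = a)"
    unfolding chords_intersect_def by blast
  from v show "cr ds a b"
  proof (elim disjE conjE)
    assume "ds ! i = a" "ds ! j = b" "ds ! k = a" "ds ! l = b"
    from alternating_filter[OF assms ij this n] show ?thesis
      using n by (simp add: cr_def)
  next
    assume "ds ! i = b" "ds ! j = a" "ds ! k = b" "ds ! l = a"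
    from alternating_filter[OF assms ij this n[symmetric]] show ?thesis
      using n by (simp add: cr_def disj_commute)
  qed
next
  assume "cr ds a b"
  then have n: "a \<noteq> b" and "filter (\<lambda>z. z = a \<or> z = b) ds = [a, b, a, b] \<or> filter (\<lambda>z. z = a \<or> z = b) ds = [b, a, b, a]"
    unfolding cr_def by auto
  from this(2) show "chords_intersect ds a b"
  proof
    assume "filter (\<lambda>z. z = a \<or> z = b) ds = [a, b, a, b]"
    from alternating_indices[OF this] n show ?thesis
      unfolding chords_intersect_def by blast
  next
    assume "filter (\<lambda>z. z = a \<or> z = b) ds = [b, a, b, a]"
    from alternating_indices[OF this] n show ?thesis
      unfolding chords_intersect_def by blast
  qed
qed

section \<open>Words representing labelled graphs\<close>

definition represents :: "nat list \<Rightarrow> nat \<Rightarrow> (nat \<Rightarrow> nat \<Rightarrow> bool) \<Rightarrow> bool" where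
  "represents D n F \<longleftrightarrow> dow D \<and> set D = {0..<n} \<and> (\<forall>u<n. \<forall>v<n. cr D u v \<longleftrightarrow> F u v)"

lemma represents_same_graph:
  assumes D: "represents D n F" and D': "represents D' n F"
  shows "same_graph D D'"
proof -
  have s: "set D = {0..<n}" "set D' = {0..<n}" and dow: "dow D" "dow D'"
    using D D' by (simp_all add: represents_def)
  have "cr D x y \<longleftrightarrow> cr D' x y" for x y
  proof (cases "x < n \<and> y < n")
    case True
    then show ?thesis using D D' by (simp add: represents_def)
  next
    case False
    then have "x \<notin> {0..<n} \<or> y \<notin> {0..<n}" by simp
    then have "\<not> cr D x y" "\<not> cr D' x y"
      using cr_in_set[of D x y] cr_in_set[of D' x y] unfolding s by blast+
    then show ?thesis by simp
  qed
  then show ?thesis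
    using dow unfolding same_graph_def s by simp
qed

lemma diagram_relabel:
  assumes "chord_diagram n ds" "graph_iso n F (chords_intersect ds)"
  shows "\<exists>D. represents D n F \<and> W D = W ds"
proof -
  have ds: "dow ds" "set ds = {0..<n}"
    using assms(1) by (simp_all add: chord_diagram_iff)
  obtain f where f: "bij_betw f {0..<n} {0..<n}" and F: "\<And>u v. u < n \<Longrightarrow> v < n \<Longrightarrow> F u v \<longleftrightarrow> cr ds (f u) (f v)"
    using assms(2) unfolding graph_iso_def chords_intersect_cr[OF ds(1)] by blast
  \<comment> \<open>The isomorphism is extended by the identity to an injection of all naturals,
    under which words can be pulled back.\<close>
  define h where "h u = (if u < n then f u else u)" for u
  have fr: "f u < n" if "u < n" for u
    using bij_betw_apply[OF f, of u] that by simp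
  have inj: "inj h"
  proof (rule injI)
    fix u v assume "h u = h v"
    then show "u = v"
      using fr[of u] fr[of v] inj_onD[OF bij_betw_imp_inj_on[OF f], of u v]
      by (cases "u < n"; cases "v < n") (simp_all add: h_def)
  qed
  have "f ` {0..<n} = {0..<n}"
    using f by (simp add: bij_betw_def)
  moreover have "h ` {0..<n} = f ` {0..<n}"
    by (rule image_cong) (simp_all add: h_def)
  ultimately have him: "h ` {0..<n} = {0..<n}" by simp
  then have "\<exists>D. ds = map h D"
    unfolding ex_map_conv ds(2) by (intro ballI) (use him in blast)
  then obtain D where D: "ds = map h D" by blast
  have "h ` set D = h ` {0..<n}"
    using ds(2) him unfolding D by simp
  then have sD: "set D = {0..<n}"
    by (simp only: inj_image_eq_iff[OF inj])
  have "dow D"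
    unfolding dow_def
  proof
    fix x assume "x \<in> set D"
    then have "h x \<in> set ds" unfolding D by simp
    then have "count_list (map h D) (h x) = 2"
      using dowD[OF ds(1)] unfolding D by blast
    then show "count_list D x = 2"
      by (simp add: count_map_inj[OF inj])
  qed
  moreover have "cr D u v \<longleftrightarrow> F u v" if "u < n" "v < n" for u v
    using F[OF that] cr_map_inj[OF inj, of D u v] that unfolding D by (simp add: h_def)
  moreover have "W ds = W D"
    unfolding D by (rule W_map) (rule inj_on_subset[OF inj], simp)
  ultimately have "represents D n F" "W D = W ds"
    using sD unfolding represents_def by simp_all
  then show ?thesis by blast
qed

lemma represents_diagram:
  assumes "represents D n F"
  shows "chord_diagram n D \<and> graph_iso n F (chords_intersect D)"
proof -
  have D: "dow D" using assms by (simp add: represents_def)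
  have "graph_iso n F (chords_intersect D)"
    unfolding graph_iso_def chords_intersect_cr[OF D]
    by (rule exI[of _ id]) (use assms in \<open>simp add: represents_def\<close>)
  then show ?thesis
    using assms by (simp add: represents_def chord_diagram_iff)
qed

text \<open>The diagram selected by \<open>SOME\<close> is relabelled to represent the same labelled
  graph as \<open>D\<close>; by \<open>mut_complete\<close> the two are mutants, so the choice does
  not affect the weight.\<close>

lemma w_sl2_graph_eq:
  assumes D: "represents D n F" and P: "W D = evC P"
  shows "w_sl2_graph n F = P"
proof -
  define ds where "ds = (SOME ds. chord_diagram n ds \<and> graph_iso n F (chords_intersect ds))"
  have "chord_diagram n ds \<and> graph_iso n F (chords_intersect ds)"
    unfolding ds_def by (rule someI[of _ D]) (rule represents_diagram[OF D])
  then have ds: "chord_diagram n ds" "graph_iso n F (chords_intersect ds)"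
    by simp_all
  obtain D' where D': "represents D' n F" "W D' = W ds"
    using diagram_relabel[OF ds] by blast
  have "mut D D'"
    by (rule mut_complete[OF represents_same_graph[OF D D'(1)]])
  then have "W D = W D'"
    by (rule mut_W) (use D in \<open>simp add: represents_def\<close>)
  then have "W ds = evC P"
    using P D'(2) by simp
  then show ?thesis
    unfolding w_sl2_graph_def ds_def[symmetric]
    by (rule w_sl2_poly_eq[rotated]) (use ds(1) in \<open>simp add: chord_diagram_iff\<close>)
qed

lemma filter_distinct: "distinct l \<Longrightarrow> x \<in> set l \<Longrightarrow> filter (\<lambda>z. z = x) l = [x]"
  by (induction l) (auto simp: filter_empty_conv)

text \<open>The added chords are nested, hence do not cross each other, and among the old letters
  exactly the block \<open>A\<close> lies between their ends, where each old letter occurs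
  once.\<close>

lemma represents_join:
  assumes A: "distinct A" "set A = {0..<m}" and B: "distinct B" "set B = {0..<m}"
    and F: "\<And>u v. u < m \<Longrightarrow> v < m \<Longrightarrow> cr (A @ B) u v \<longleftrightarrow> F u v"
  shows "represents ([m..<m + n] @ A @ rev [m..<m + n] @ B) (m + n) (join_indep m F n)"
proof -
  let ?us = "[m..<m + n]"
  let ?D = "?us @ A @ rev ?us @ B"
  have sD: "set ?D = {0..<m + n}"
    using A(2) B(2) by auto
  have "count_list ?D x = 2" if "x < m + n" for x
    using that A B by (simp add: distinct_count_list)
  then have dow: "dow ?D"
    unfolding dow_def sD by simp
  have low: "cr ?D u v \<longleftrightarrow> F u v" if "u < m" "v < m" for u v
  proof -
    have "filter (\<lambda>z. z < m) A = A" "filter (\<lambda>z. z < m) B = B"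
      using A(2) B(2) by (auto intro!: filter_True)
    moreover have "filter (\<lambda>z. z < m) ?us = []" by (simp add: filter_empty_conv)
    ultimately have "filter (\<lambda>z. z < m) ?D = A @ B"
      by (simp add: rev_filter[symmetric])
    then show ?thesis
      using cr_filter[of "\<lambda>z. z < m" u v ?D] F that by simp
  qed
  have mix: "cr ?D u v" if "m \<le> u" "u < m + n" "v < m" for u v
  proof -
    have f: "filter (\<lambda>z. z = u \<or> z = v) ?us = [u]" "filter (\<lambda>z. z = u \<or> z = v) A = [v]"
      "filter (\<lambda>z. z = u \<or> z = v) B = [v]"
    proof -
      have "filter (\<lambda>z. z = u \<or> z = v) ?us = filter (\<lambda>z. z = u) ?us"
        by (rule filter_cong) (use that in auto)
      then show "filter (\<lambda>z. z = u \<or> z = v) ?us = [u]"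
        using filter_distinct[of ?us u] that by simp
      have "filter (\<lambda>z. z = u \<or> z = v) A = filter (\<lambda>z. z = v) A" "filter (\<lambda>z. z = u \<or> z = v) B = filter (\<lambda>z. z = v) B"
        by (rule filter_cong, use that A(2) B(2) in auto)+
      then show "filter (\<lambda>z. z = u \<or> z = v) A = [v]" "filter (\<lambda>z. z = u \<or> z = v) B = [v]"
        using filter_distinct[OF A(1), of v] filter_distinct[OF B(1), of v] that A(2) B(2) by simp_all
    qed
    have "u \<noteq> v" using that by simp
    then show ?thesis
      unfolding cr_def filter_append rev_filter[symmetric] f by simp
  qed
  \<comment> \<open>Restricted to two added chords the word is a palindrome, which an alternating
    pattern is not.\<close>
  have high: "\<not> cr ?D u v" if "m \<le> u" "m \<le> v" for u v
  proof
    assume c: "cr ?D u v"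
    let ?l = "filter (\<lambda>z. z = u \<or> z = v) ?us"
    have "filter (\<lambda>z. z = u \<or> z = v) A = []" "filter (\<lambda>z. z = u \<or> z = v) B = []"
      using A(2) B(2) that by (auto simp: filter_empty_conv)
    then have "filter (\<lambda>z. z = u \<or> z = v) ?D = ?l @ rev ?l"
      by (simp add: rev_filter)
    then have "u \<noteq> v" "?l @ rev ?l \<in> {[u, v, u, v], [v, u, v, u]}"
      using c unfolding cr_def by simp_all
    moreover have False if "w \<in> {[u, v, u, v], [v, u, v, u]}" "rev w = w" "u \<noteq> v" for w
      using that by auto
    moreover have "rev (?l @ rev ?l) = ?l @ rev ?l" by simp
    ultimately show False by blast
  qed
  have "cr ?D u v \<longleftrightarrow> join_indep m F n u v" if "u < m + n" "v < m + n" for u v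
  proof -
    consider "u < m" "v < m" | "u < m" "m \<le> v" | "m \<le> u" "v < m" | "m \<le> u" "m \<le> v"
      by linarith
    then show ?thesis
    proof cases
      case 1
      then show ?thesis using low by (simp add: join_indep_def)
    next
      case 2
      then show ?thesis using mix[of v u] that cr_sym[of ?D u v] by (simp add: join_indep_def)
    next
      case 3
      then show ?thesis using mix[of u v] that by (simp add: join_indep_def)
    next
      case 4
      then show ?thesis using high by (simp add: join_indep_def)
    qed
  qed
  then show ?thesis
    using dow sD unfolding represents_def by simp
qed

text \<open>Every letter has exactly one occurrence in \<open>A\<close>, so reversing
  \<open>A\<close> toggles all pairs by \<open>alt_toggle\<close>; this is where the complement
  graph arises.\<close>

lemma cr_rev_first:
  assumes A: "distinct A" "set A = S" and B: "distinct B" "set B = S" and xy: "x \<in> S" "y \<in> S" "x \<noteq> y"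
  shows "cr (rev A @ B) x y \<longleftrightarrow> \<not> cr (A @ B) x y"
proof -
  define f where "f = filter (\<lambda>z. z = x \<or> z = y)"
  have c: "count_list (f A) z = 1" "count_list (f B) z = 1" if "z \<in> {x, y}" for z
    using that xy A B by (auto simp: f_def count_list_filter distinct_count_list)
  have s: "set (f A @ f B) \<subseteq> {x, y}" by (auto simp: f_def)
  have "rev (f A) @ f B \<in> {[x, y, x, y], [y, x, y, x]} \<longleftrightarrow>
      (f A @ f B \<in> {[x, y, x, y], [y, x, y, x]}) \<noteq> (count_list (f A) x = 1 \<and> count_list (f A) y = 1)"
    by (rule alt_toggle[OF s _ _ xy(3)]) (simp_all add: c)
  moreover have "f (rev A @ B) = rev (f A) @ f B" "f (A @ B) = f A @ f B"
    by (simp_all add: f_def rev_filter)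
  ultimately show ?thesis
    using xy(3) c unfolding cr_def f_def[symmetric] by simp
qed

theorem theorem1:
  fixes m :: nat and E :: "nat \<Rightarrow> nat \<Rightarrow> bool" and k :: nat
  assumes "simple_graph m E"
    and "is_intersection_graph (m + 1) (join_indep m E 1)"
    and "k \<le> m"
  shows "r_coeff m (compl_graph m E) k = (-1) ^ (m - k) * r_coeff m E k"
proof -
  obtain D where D: "represents D (m + 1) (join_indep m E 1)"
    using assms(2) diagram_relabel unfolding is_intersection_graph_def by blast
  have dow: "dow D" and sD: "set D = {0..<m + 1}"
    and crD: "\<And>u v. u < m + 1 \<Longrightarrow> v < m + 1 \<Longrightarrow> cr D u v \<longleftrightarrow> join_indep m E 1 u v"
    using D by (auto simp: represents_def)
  have "m \<in> set D" using sD by simp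
  then obtain A B where AB: "cyc D (m # A @ m # B)" "m \<notin> set A" "m \<notin> set B"
    by (rule dow_split[OF dow])
  have dAB: "dow (m # A @ m # B)"
    using dow dow_cyc[OF AB(1)] by simp
  have sAB: "set (A @ B) = {0..<m}"
  proof -
    have "insert m (set (A @ B)) = insert m {0..<m}"
      using cyc_set[OF AB(1)] sD by (auto simp: atLeast0_lessThan_Suc)
    moreover have "m \<notin> set (A @ B)" using AB(2,3) by simp
    ultimately show ?thesis by (metis Diff_insert_absorb atLeastLessThan_iff less_irrefl)
  qed
  \<comment> \<open>The chord \<open>m\<close> crosses all the others, so each of its arcs contains
    every other letter exactly once and is a permutation of the vertices.\<close>
  have cA: "count_list A x = 1" "count_list B x = 1" if x: "x < m" for x
  proof -
    have "cr D m x" using crD[of m x] x by (simp add: join_indep_def)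
    then show 1: "count_list A x = 1"
      using cr_head[OF dAB, of x] cr_cyc[OF AB(1)] by simp
    have "x \<in> set (m # A @ m # B)" using x sAB by auto
    from dowD[OF dAB this] show "count_list B x = 1"
      using 1 x by simp
  qed
  have perm: "distinct L \<and> set L = {0..<m}" if L: "set L \<subseteq> {0..<m}" "\<And>x. x < m \<Longrightarrow> count_list L x = 1" for L
  proof -
    have "{0..<m} \<subseteq> set L"
      using L(2) by (metis atLeastLessThan_iff count_notin subsetI zero_neq_one)
    moreover have "count_list L x \<le> 1" for x
      using L count_notin[of x L] by (cases "x \<in> set L") auto
    then have "distinct L"
      by (induction L) (force simp: count_list_0_iff split: if_splits)+
    ultimately show ?thesis using L(1) by auto
  qed
  have A: "distinct A" "set A = {0..<m}" and B: "distinct B" "set B = {0..<m}"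
    using perm[of A] perm[of B] sAB cA by auto
  have E: "cr (A @ B) u v \<longleftrightarrow> E u v" if "u < m" "v < m" for u v
  proof -
    have "filter (\<lambda>z. z \<noteq> m) A = A" "filter (\<lambda>z. z \<noteq> m) B = B"
      using AB(2,3) by (auto intro!: filter_True)
    then have c: "cyc (filter (\<lambda>z. z \<noteq> m) D) (A @ B)"
      using cyc_filter[OF AB(1), of "\<lambda>z. z \<noteq> m"] by simp
    have "cr (A @ B) u v \<longleftrightarrow> cr (filter (\<lambda>z. z \<noteq> m) D) u v"
      by (simp only: cr_cyc[OF c])
    also have "\<dots> \<longleftrightarrow> cr D u v"
      using that by (simp add: cr_filter)
    also have "\<dots> \<longleftrightarrow> E u v"
      using crD[of u v] that by (simp add: join_indep_def)
    finally show ?thesis .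
  qed
  have EC: "cr (rev A @ B) u v \<longleftrightarrow> compl_graph m E u v" if "u < m" "v < m" for u v
    using cr_rev_first[OF A B, of u v] E[OF that] that by (cases "u = v") (simp_all add: compl_graph_def)
  have lenA: "length A = m"
    using distinct_card[OF A(1)] A(2) by simp
  obtain r where r: "\<forall>us. distinct us \<longrightarrow> set us \<inter> {0..<m} = {} \<longrightarrow>
      W (us @ A @ rev us @ B) = evC (\<Sum>k\<le>m. r k * [:- kap k, 1:] ^ length us)"
    "\<forall>us. distinct us \<longrightarrow> set us \<inter> {0..<m} = {} \<longrightarrow>
      W (us @ rev A @ rev us @ B) = evC (\<Sum>k\<le>m. ((-1) ^ (m - k) * r k) * [:- kap k, 1:] ^ length us)"
    by (rule join_formula[OF A B lenA])
  have us: "distinct [m..<m + n]" "set [m..<m + n] \<inter> {0..<m} = {}" "length [m..<m + n] = n" for n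
    by auto
  have A': "distinct (rev A)" "set (rev A) = {0..<m}" using A by simp_all
  have "w_sl2_graph (m + n) (join_indep m E n) = (\<Sum>k\<le>m. r k * [:- kap k, 1:] ^ n)" for n
    using w_sl2_graph_eq[OF represents_join[OF A B E] r(1)[rule_format, OF us(1,2)]] us(3) by simp
  then have 1: "r_coeff m E k = r k"
    using assms(3) by (rule r_coeff_eq)
  have "w_sl2_graph (m + n) (join_indep m (compl_graph m E) n)
      = (\<Sum>k\<le>m. ((-1) ^ (m - k) * r k) * [:- kap k, 1:] ^ n)" for n
    using w_sl2_graph_eq[OF represents_join[OF A' B EC] r(2)[rule_format, OF us(1,2)]] us(3) by simp
  then have "r_coeff m (compl_graph m E) k = (-1) ^ (m - k) * r k"
    using assms(3) by (rule r_coeff_eq)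
  then show ?thesis using 1 by simp
qed

end
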